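(* Let $Z_1\subset\mathbb{C}^{n_1}$ and $Z_2\subset\mathbb{C}^{n_2}$ be reduced equidimensional complex analytic varieties with conormal spaces $c_i\colon C(Z_i)\to Z_i$, $i=1,2$. Suppose $z_1\in Z_1$ and $z_2\in Z_2$ are two points such that there exists an analytic isomorphism $\phi\colon(Z_1,z_1)\to(Z_2,z_2)$. Then for a positive integer $l$, $\mathrm{codim}(c_1^{-1}z_1,C(Z_1))=l$ if and only if $\mathrm{codim}(c_2^{-1}z_2,C(Z_2))=l$. In particular, $Z_1$ is deficient conormal (dc) at $z_1$ if and only if $Z_2$ is dc at $z_2$.
   Context: For a reduced complex analytic variety $Z\subset\mathbb{C}^N$ with irreducible components of positive dimension, the conormal space $C(Z)$ is the closure in $Z\times\check{\mathbb{P}}^{N-1}$ of the set of pairs $(z,H)$ with $z$ a smooth point of $Z$ and $H$ a hyperplane containing $T_zZ$; $c\colon C(Z)\to Z$ is the projection. $Z$ is dc at $z_0$ if $\mathrm{codim}(c^{-1}z_0,C(Z))\ge2$.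
   Formalization: The formal statement also assumes that each Z_i has dimension less than n_i; if Z_i is open in C^{n_i}, its conormal space is empty, the codimension is undefined, and the claim fails (compare C in C with C×0 in C^2). *)

theory Defs
  imports "HOL-Analysis.Analysis"
begin

text \<open>The complex bilinear \<^const>\<open>scalar_product\<close> is used as the pairing of covectors with vectors
  (\<open>inner\<close> on \<^typ>\<open>complex^'n\<close> is the real inner product). Thus \<open>f\<close> is holomorphic iff it is
  Frechet differentiable with complex linear derivative.\<close>

definition holomorphic_fun :: "(complex^'n) set \<Rightarrow> (complex^'n \<Rightarrow> complex) \<Rightarrow> bool" where
  "holomorphic_fun U f \<longleftrightarrow> open U \<and> (\<forall>x\<in>U. \<exists>a. (f has_derivative scalar_product a) (at x))"

definition holomorphic_map :: "(complex^'n) set \<Rightarrow> (complex^'n \<Rightarrow> complex^'m) \<Rightarrow> bool" where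
  "holomorphic_map U f \<longleftrightarrow> (\<forall>i. holomorphic_fun U (\<lambda>x. f x $ i))"

definition biholomorphic ::
  "(complex^'n) set \<Rightarrow> (complex^'n) set \<Rightarrow> (complex^'n \<Rightarrow> complex^'n) \<Rightarrow> bool" where
  "biholomorphic U V f \<longleftrightarrow> bij_betw f U V \<and> holomorphic_map U f \<and>
     (\<exists>g. holomorphic_map V g \<and> (\<forall>x\<in>U. g (f x) = x))"

text \<open>A reduced complex analytic variety is given by its underlying set: a subset that is, near
  each of its points, the common zero set of finitely many holomorphic functions (so it is a
  closed analytic subset of some open set).\<close>

definition analytic_variety :: "(complex^'n) set \<Rightarrow> bool" where
  "analytic_variety Z \<longleftrightarrow> (\<forall>z\<in>Z. \<exists>U F. open U \<and> z \<in> U \<and> finite F \<and>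
     (\<forall>f\<in>F. holomorphic_fun U f) \<and> Z \<inter> U = {x\<in>U. \<forall>f\<in>F. f x = 0})"

text \<open>Near \<open>p\<close> the set \<open>A\<close> is a complex submanifold of dimension \<open>d\<close>.\<close>

definition smooth_point :: "(complex^'n) set \<Rightarrow> complex^'n \<Rightarrow> nat \<Rightarrow> bool" where
  "smooth_point A p d \<longleftrightarrow> p \<in> A \<and> (\<exists>U V f L. p \<in> U \<and> biholomorphic U V f \<and>
     vec.subspace L \<and> vec.dim L = d \<and> f ` (A \<inter> U) = L \<inter> V)"

text \<open>The local dimension is the upper limit, at \<open>z\<close>, of the dimensions of \<open>Z\<close> at its smooth
  points. The set under the supremum is bounded by the ambient dimension, and is nonempty for an
  analytic variety \<open>Z\<close> and \<open>z \<in> Z\<close>.\<close>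

definition local_dim :: "(complex^'n) set \<Rightarrow> complex^'n \<Rightarrow> nat" where
  "local_dim Z z = Sup {d. \<forall>U. open U \<and> z \<in> U \<longrightarrow> (\<exists>p\<in>U. smooth_point Z p d)}"

definition equidimensional :: "(complex^'n) set \<Rightarrow> nat \<Rightarrow> bool" where
  "equidimensional Z d \<longleftrightarrow> (\<forall>z\<in>Z. local_dim Z z = d)"

text \<open>The common kernel of the differentials at \<open>z\<close> of the holomorphic germs vanishing on \<open>Z\<close>; at
  a smooth point this is the tangent space of the submanifold.\<close>

definition tangent_space :: "(complex^'n) set \<Rightarrow> complex^'n \<Rightarrow> (complex^'n) set" where
  "tangent_space Z z = {v. \<forall>U f a. z \<in> U \<and> holomorphic_fun U f \<and> (\<forall>x\<in>Z \<inter> U. f x = 0) \<and>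
     (f has_derivative scalar_product a) (at z) \<longrightarrow> scalar_product a v = 0}"


text \<open>The dual projective space: linear hyperplanes of \<open>\<complex>\<^sup>n\<close>, with the quotient topology of the
  nonzero covectors.\<close>

typedef (overloaded) 'n hyperplane =
  "{H :: (complex^'n) set. \<exists>a. a \<noteq> 0 \<and> H = {v. scalar_product a v = 0}}"
  morphisms points_of Abs_hyperplane
proof -
  have "(axis undefined 1 :: complex^'n) \<noteq> 0"
    by (simp add: axis_eq_0_iff)
  then show ?thesis by blast
qed

definition hyp :: "complex^'n \<Rightarrow> 'n hyperplane" where
  "hyp a = Abs_hyperplane {v. scalar_product a v = 0}"

lemma points_of_hyp: "a \<noteq> 0 \<Longrightarrow> points_of (hyp a) = {v. scalar_product a v = 0}"
  unfolding hyp_def by (rule Abs_hyperplane_inverse) blast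

lemma hyp_surj: "\<exists>a. a \<noteq> 0 \<and> H = hyp a"
proof -
  obtain a where "a \<noteq> 0" "points_of H = {v. scalar_product a v = 0}"
    using points_of[of H] by blast
  then show ?thesis
    unfolding hyp_def by (metis points_of_inverse)
qed

instantiation hyperplane :: (finite) topological_space
begin

definition open_hyperplane :: "'a hyperplane set \<Rightarrow> bool" where
  "open_hyperplane U \<longleftrightarrow> open {a. a \<noteq> 0 \<and> hyp a \<in> U}"

instance
proof
  show "open (UNIV :: 'a hyperplane set)"
    using open_delete[OF open_UNIV, of "0 :: complex^'a"]
    by (simp add: open_hyperplane_def Compl_eq_Diff_UNIV[symmetric] Compl_eq)
next
  fix S T :: "'a hyperplane set"
  assume "open S" "open T"
  then have "open ({a. a \<noteq> 0 \<and> hyp a \<in> S} \<inter> {a. a \<noteq> 0 \<and> hyp a \<in> T})"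
    unfolding open_hyperplane_def by (rule open_Int)
  then show "open (S \<inter> T)"
    unfolding open_hyperplane_def by (rule back_subst[where P = "open"]) auto
next
  fix K :: "'a hyperplane set set"
  assume "\<forall>S\<in>K. open S"
  then have "open (\<Union>S\<in>K. {a. a \<noteq> 0 \<and> hyp a \<in> S})"
    unfolding open_hyperplane_def by blast
  then show "open (\<Union>K)"
    unfolding open_hyperplane_def by (rule back_subst[where P = "open"]) auto
qed

end


text \<open>The complex manifold \<open>\<complex>\<^sup>n \<times> \<check>P\<close> has the affine charts in which the \<open>i\<close>-th coordinate of the
  covector is normalised to 1. The chart is viewed in \<open>\<complex>\<^sup>n\<^sup>+\<^sup>n\<close>, inside the affine hyperplane
  \<open>a $ i = 1\<close>.\<close>

definition join :: "complex^'n \<Rightarrow> complex^'m \<Rightarrow> complex^('n + 'm)" where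
  "join z a = (\<chi> k. case k of Inl i \<Rightarrow> z $ i | Inr j \<Rightarrow> a $ j)"

definition chart_image ::
  "'n \<Rightarrow> ((complex^'n) \<times> 'n hyperplane) set \<Rightarrow> (complex^('n + 'n)) set" where
  "chart_image i A = {join z a | z a. a $ i = 1 \<and> (z, hyp a) \<in> A}"

definition smooth_point_proj ::
  "((complex^'n) \<times> 'n hyperplane) set \<Rightarrow> (complex^'n) \<times> 'n hyperplane \<Rightarrow> nat \<Rightarrow> bool" where
  "smooth_point_proj A p d \<longleftrightarrow> (\<exists>z a i. p = (z, hyp a) \<and> a $ i = 1 \<and>
     smooth_point (chart_image i A) (join z a) d)"

definition dim_proj :: "((complex^'n) \<times> 'n hyperplane) set \<Rightarrow> nat" where
  "dim_proj A = Sup {d. \<exists>p. smooth_point_proj A p d}"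

text \<open>Used only for nonempty \<open>A\<close> inside \<open>X = C(Z)\<close>; that space is of pure dimension, so the
  codimension is the difference of the dimensions.\<close>

definition codim_proj ::
  "((complex^'n) \<times> 'n hyperplane) set \<Rightarrow> ((complex^'n) \<times> 'n hyperplane) set \<Rightarrow> int" where
  "codim_proj A X = int (dim_proj X) - int (dim_proj A)"


definition conormal_space :: "(complex^'n) set \<Rightarrow> ((complex^'n) \<times> 'n hyperplane) set" where
  "conormal_space Z =
     closure {(z, H). (\<exists>d. smooth_point Z z d) \<and> tangent_space Z z \<subseteq> points_of H} \<inter> (Z \<times> UNIV)"

definition conormal_fibre ::
  "(complex^'n) set \<Rightarrow> complex^'n \<Rightarrow> ((complex^'n) \<times> 'n hyperplane) set" where
  "conormal_fibre Z z = {p \<in> conormal_space Z. fst p = z}"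

definition deficient_conormal_at :: "(complex^'n) set \<Rightarrow> complex^'n \<Rightarrow> bool" where
  "deficient_conormal_at Z z \<longleftrightarrow> codim_proj (conormal_fibre Z z) (conormal_space Z) \<ge> 2"


text \<open>Holomorphic maps on a subset are those that extend locally to the ambient space.\<close>

definition holomorphic_map_on_set ::
  "(complex^'n) set \<Rightarrow> (complex^'n \<Rightarrow> complex^'m) \<Rightarrow> bool" where
  "holomorphic_map_on_set S f \<longleftrightarrow> (\<forall>x\<in>S. \<exists>U F. x \<in> U \<and> holomorphic_map U F \<and>
     (\<forall>y\<in>S \<inter> U. f y = F y))"

text \<open>\<open>f\<close> represents an isomorphism of germs \<open>(Z, z) \<rightarrow> (W, w)\<close>.\<close>

definition analytic_germ_iso ::
  "(complex^'n \<Rightarrow> complex^'m) \<Rightarrow> (complex^'n) set \<Rightarrow> complex^'n \<Rightarrow>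
   (complex^'m) set \<Rightarrow> complex^'m \<Rightarrow> bool" where
  "analytic_germ_iso f Z z W w \<longleftrightarrow> f z = w \<and>
     (\<exists>U V g. open U \<and> z \<in> U \<and> open V \<and> w \<in> V \<and> bij_betw f (Z \<inter> U) (W \<inter> V) \<and>
       holomorphic_map_on_set (Z \<inter> U) f \<and> holomorphic_map_on_set (W \<inter> V) g \<and>
       (\<forall>x\<in>Z \<inter> U. g (f x) = x))"

end

theory Submission
  imports Defs "HOL-Complex_Analysis.Residue_Theorem"
begin

text \<open>Let \<open>K(Z, z)\<close> be the set of all limits of conormal covectors of \<open>Z\<close> at points tending to \<open>z\<close>.
  In an affine chart the conormal space is a slice of the closure of the cone of pairs (smooth point,
  conormal covector), which is smooth of dimension \<open>n\<close> over the smooth points of \<open>Z\<close>; so \<open>C(Z)\<close> has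
  dimension \<open>n - 1\<close>, and the fibre over \<open>z\<close> has dimension one less than \<open>K(Z, z)\<close>. If \<open>\<Phi>\<close> embeds \<open>Z\<close> into
  \<open>\<complex>\<^sup>k\<close> with a linear left inverse, then the limits for the image are exactly the covectors whose
  pullback under the derivative of \<open>\<Phi>\<close> lies in \<open>K(Z, z)\<close>, so the dimension grows by \<open>k - n\<close>. The graph of a
  germ isomorphism is such an image of both germs, and comparing the two yields equal codimensions.

  The comparison needs that \<open>K(Z, z)\<close> has smooth points at all, which follows once the closure of
  the cone is analytic. Over the complement of a discriminant, an analytic set \<open>T\<close> of pure dimension
  minus a hypersurface is a union of finitely many sheets over a linear projection; the products of
  \<open>l \<bullet> (x - y)\<close> over the points \<open>y\<close> of the closure of \<open>T\<close> above \<open>x\<close> extend over the discriminant by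
  Riemann's theorem, and their common zeros are the closure of \<open>T\<close>. The same products give, by
  differentiation, equations for the conormal covectors. An analytic set has smooth points where the
  dimension of the common kernel of the differentials is minimal.\<close>

section \<open>Holomorphic maps and their derivatives\<close>

text \<open>Dimensions are suprema over smooth points, and the supremum of no numbers is 0. If
  \<open>K(Z, z)\<close> had no smooth points, the shift by \<open>k - n\<close> would say nothing
  and codimensions in different ambient spaces could not be compared; this is why so much analytic
  geometry precedes the comparison. Smoothness is handled by holomorphic retractions instead of
  charts: the derivative of a retraction is a projection, its trace is the dimension, and dimension
  counts become identities between traces, in which \<open>trace (A ** B) = trace (B ** A)\<close>
  does the work. Projections of analytic sets stay in the same space: \<open>\<L>\<close> is an
  idempotent matrix and functions on its base are functions on the whole space that are constant
  along its kernel, so lowering the dimension of the base does not change the type. The graph serves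
  as intermediary because the ambient extensions of a germ isomorphism need not be invertible, and
  their source and target may have different dimensions.\<close>

lemma scalar_product_add_right: "scalar_product a (u + v) = scalar_product a u + scalar_product a v"
 and scalar_product_diff_right: "scalar_product a (u - v) = scalar_product a u - scalar_product a v"
 and scalar_product_scale_right: "scalar_product a (c *s v) = c * scalar_product a v"
 for a u v :: "complex^'n"
 by (simp_all add: scalar_product_def algebra_simps sum.distrib sum_subtractf sum_distrib_left)

lemma scalar_product_add_left: "scalar_product (a + b) v = scalar_product a v + scalar_product b v"
 and scalar_product_diff_left: "scalar_product (a - b) v = scalar_product a v - scalar_product b v"
 and scalar_product_scale_left: "scalar_product (c *s a) v = c * scalar_product a v"
 and scalar_product_minus_left: "scalar_product (- a) v = - scalar_product a v"
 and scalar_product_zero_left [simp]: "scalar_product 0 v = 0"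
 and scalar_product_zero_right [simp]: "scalar_product v 0 = 0"
 for a b v :: "complex^'n"
 by (simp_all add: scalar_product_def algebra_simps sum.distrib sum_subtractf sum_distrib_left sum_negf)

lemma scalar_product_axis [simp]:
 "scalar_product a (axis i 1) = a $ i" "scalar_product (axis i 1) a = a $ i" for a :: "complex^'n"
proof -
 have "(\<Sum>j\<in>UNIV. a $ j * (if j = i then 1 else 0)) = a $ i"
  by (subst sum.remove[of _ i]) auto
 then show "scalar_product a (axis i 1) = a $ i" "scalar_product (axis i 1) a = a $ i"
  by (auto simp: scalar_product_def axis_def mult.commute)
qed

lemma scalar_product_matrix_vector:
 "scalar_product a (M *v v) = scalar_product (a v* M) v" for a :: "complex^'m"
 by (simp add: scalar_product_def matrix_vector_mult_def vector_matrix_mult_def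
   sum_distrib_left sum_distrib_right mult_ac) (rule sum.swap)

lemma matrix_vector_nth: "(M *v v) $ i = scalar_product (M $ i) v" for M :: "complex^'n^'m"
 by (simp add: scalar_product_def matrix_vector_mult_def)

lemma bounded_linear_scalar_product: "bounded_linear (scalar_product a)" for a :: "complex^'n"
 unfolding scalar_product_def
 by (intro bounded_linear_sum bounded_linear_const_mult bounded_linear_vec_nth)

lemma bounded_linear_matrix_vector: "bounded_linear ((*v) M)" for M :: "complex^'n^'m"
proof (intro linear_conv_bounded_linear[THEN iffD1] linearI)
 show "M *v (x + y) = M *v x + M *v y" for x y
  by (simp add: matrix_vector_right_distrib)
 show "M *v (r *\<^sub>R x) = r *\<^sub>R (M *v x)" for r x
  by (simp add: vec_eq_iff matrix_vector_mult_def scaleR_sum_right)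
qed

lemma continuous_on_matrix_vector [continuous_intros]:
 "continuous_on S f ==> continuous_on S (\<lambda>x. M *v f x)" for M :: "complex^'n^'m"
 using bounded_linear.continuous_on[OF bounded_linear_matrix_vector] .

lemma tendsto_matrix_vector [tendsto_intros]:
 "(f \<longlongrightarrow> l) F ==> ((\<lambda>x. M *v f x) \<longlongrightarrow> M *v l) F" for M :: "complex^'n^'m"
 using bounded_linear.tendsto[OF bounded_linear_matrix_vector] .

lemma tendsto_scalar_product [tendsto_intros]:
 "(f \<longlongrightarrow> a) F ==> (g \<longlongrightarrow> b) F ==>
  ((\<lambda>x. scalar_product (f x) (g x)) \<longlongrightarrow> scalar_product a b) F" for a b :: "complex^'n"
 unfolding scalar_product_def by (intro tendsto_intros)

lemma continuous_on_scalar_product [continuous_intros]: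
 "continuous_on S f ==> continuous_on S g ==>
  continuous_on S (\<lambda>x. scalar_product (f x) (g x))" for f g :: "_ => complex^'n"
 unfolding scalar_product_def by (intro continuous_intros)

lemma scalar_product_eqI: "(\<And>v. scalar_product a v = scalar_product b v) ==> a = b"
 for a b :: "complex^'n"
 by (metis scalar_product_axis(1) vec_eq_iff)

lemma matrix_eqI: "(\<And>v. M *v v = N *v v) ==> M = N" for M N :: "complex^'n^'m"
 using matrix_eq by blast

lemma complex_linear_eq_scalar_product:
 fixes D :: "complex^'n => complex"
 assumes "linear D" "\<And>c v. D (c *s v) = c * D v"
 shows "\<exists>a. D = scalar_product a"
proof
 show "D = scalar_product (\<chi> i. D (axis i 1))"
 proof
  fix v :: "complex^'n"
  have "v = (\<Sum>i\<in>UNIV. v $ i *s axis i 1)"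
   by (simp add: basis_expansion)
  then have "D v = (\<Sum>i\<in>UNIV. v $ i * D (axis i 1))"
   using linear_sum[OF assms(1), of "\<lambda>i. v $ i *s axis i 1" UNIV] assms(2) by simp
  then show "D v = scalar_product (\<chi> i. D (axis i 1)) v"
   by (simp add: scalar_product_def mult.commute)
 qed
qed

section \<open>Complex gradients and Jacobian matrices\<close>

definition grad :: "(complex^'n => complex) => complex^'n => complex^'n" where
 "grad f x = (SOME a. (f has_derivative scalar_product a) (at x))"

definition jac :: "(complex^'n => complex^'m) => complex^'n => complex^'n^'m" where
 "jac f x = (\<chi> i. grad (\<lambda>x. f x $ i) x)"

lemma grad_eqI: "(f has_derivative scalar_product a) (at x) ==> grad f x = a"
 unfolding grad_def
 by (rule some1_equality)
   (auto intro!: ex1I[of _ a] scalar_product_eqI dest: has_derivative_unique)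

lemma has_derivative_grad:
 "holomorphic_fun U f ==> x \<in> U ==> (f has_derivative scalar_product (grad f x)) (at x)"
 unfolding holomorphic_fun_def using grad_eqI by metis

lemma holomorphic_fun_open: "holomorphic_fun U f ==> open U"
 by (simp add: holomorphic_fun_def)

lemma holomorphic_map_open: "holomorphic_map U f ==> open U"
 by (simp add: holomorphic_map_def holomorphic_fun_def)

lemma has_derivative_matrix_iff:
 fixes f :: "complex^'n => complex^'m"
 shows "(f has_derivative (*v) M) (at x) \<longleftrightarrow>
  (\<forall>i. ((\<lambda>x. f x $ i) has_derivative scalar_product (M $ i)) (at x))"
proof
 assume "(f has_derivative (*v) M) (at x)"
 then show "\<forall>i. ((\<lambda>x. f x $ i) has_derivative scalar_product (M $ i)) (at x)"
  using bounded_linear.has_derivative[OF bounded_linear_vec_nth, of f "(*v) M"]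
  by (simp add: matrix_vector_nth)
next
 assume *: "\<forall>i. ((\<lambda>x. f x $ i) has_derivative scalar_product (M $ i)) (at x)"
 have "((\<lambda>x. \<chi> i. f x $ i) has_derivative (\<lambda>v. \<chi> i. (M *v v) $ i)) (at x)"
 proof (subst has_derivative_componentwise_within, safe)
  fix b :: "complex^'m" assume "b \<in> Basis"
  then obtain i e where b: "b = axis i e" "e \<in> Basis"
   by (auto simp: Basis_vec_def)
  have "((\<lambda>x. f x $ i \<bullet> e) has_derivative (\<lambda>v. (M *v v) $ i \<bullet> e)) (at x)"
   using * by (auto intro!: derivative_eq_intros simp: matrix_vector_nth)
  then show "((\<lambda>x. (\<chi> i. f x $ i) \<bullet> b) has_derivative (\<lambda>v. (\<chi> i. (M *v v) $ i) \<bullet> b)) (at x)"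
   by (simp add: b inner_axis)
 qed
 then show "(f has_derivative (*v) M) (at x)"
  by (simp add: vec_lambda_eta)
qed

lemma jac_eqI: "(f has_derivative (*v) M) (at x) ==> jac f x = M"
 unfolding jac_def has_derivative_matrix_iff by (subst vec_eq_iff) (auto dest: grad_eqI)

lemma has_derivative_jac:
 "holomorphic_map U f ==> x \<in> U ==> (f has_derivative (*v) (jac f x)) (at x)"
 unfolding has_derivative_matrix_iff holomorphic_map_def jac_def
 by (auto intro: has_derivative_grad)

lemma holomorphic_map_iff:
 "holomorphic_map U f \<longleftrightarrow> open U \<and> (\<forall>x\<in>U. \<exists>M. (f has_derivative (*v) M) (at x))"
proof
 assume "holomorphic_map U f" then show "open U \<and> (\<forall>x\<in>U. \<exists>M. (f has_derivative (*v) M) (at x))"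
  using has_derivative_jac holomorphic_map_open by blast
next
 assume *: "open U \<and> (\<forall>x\<in>U. \<exists>M. (f has_derivative (*v) M) (at x))"
 then show "holomorphic_map U f"
  unfolding holomorphic_map_def holomorphic_fun_def has_derivative_matrix_iff by blast
qed

lemma holomorphic_fun_subset: "holomorphic_fun U f ==> open V ==> V \<subseteq> U ==> holomorphic_fun V f"
 unfolding holomorphic_fun_def by blast

lemma holomorphic_map_subset: "holomorphic_map U f ==> open V ==> V \<subseteq> U ==> holomorphic_map V f"
 unfolding holomorphic_map_def using holomorphic_fun_subset by blast

lemma holomorphic_fun_cong:
 assumes "holomorphic_fun U f" "\<And>x. x \<in> U ==> f x = g x"
 shows "holomorphic_fun U g"
 unfolding holomorphic_fun_def
proof safe
 show U: "open U" using assms(1) by (rule holomorphic_fun_open)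
 fix x assume "x \<in> U"
 then have "(g has_derivative scalar_product (grad f x)) (at x)"
  using has_derivative_transform_within_open[OF has_derivative_grad[OF assms(1)] U] assms(2) by blast
 then show "\<exists>a. (g has_derivative scalar_product a) (at x)" ..
qed

lemma holomorphic_fun_local:
 assumes "\<And>x. x \<in> U ==> \<exists>V. x \<in> V \<and> V \<subseteq> U \<and> holomorphic_fun V f"
 shows "holomorphic_fun U f"
 unfolding holomorphic_fun_def
proof safe
 have "\<exists>V. open V \<and> x \<in> V \<and> V \<subseteq> U" if "x \<in> U" for x
  using assms[OF that] holomorphic_fun_open by auto
 then show "open U"
  by (subst open_subopen) auto
 fix x assume "x \<in> U"
 then obtain V where "x \<in> V" "holomorphic_fun V f"
  using assms by auto
 then show "\<exists>a. (f has_derivative scalar_product a) (at x)"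
  by (auto simp: holomorphic_fun_def)
qed

lemma holomorphic_fun_continuous_on: "holomorphic_fun U f ==> continuous_on U f"
 by (meson continuous_at_imp_continuous_on has_derivative_continuous has_derivative_grad)

lemma holomorphic_map_continuous_on: "holomorphic_map U f ==> continuous_on U f"
 by (meson continuous_at_imp_continuous_on has_derivative_continuous has_derivative_jac)

named_theorems hol_intros

lemma holomorphic_fun_const [hol_intros]: "open (U :: (complex^'n) set) ==> holomorphic_fun U (\<lambda>x. c)"
proof -
 have "scalar_product (0 :: complex^'n) = (\<lambda>v. 0)"
  by auto
 then show "open U ==> holomorphic_fun U (\<lambda>x. c)"
  unfolding holomorphic_fun_def by (metis has_derivative_const)
qed

lemma holomorphic_fun_nth [hol_intros]: "holomorphic_map U f ==> holomorphic_fun U (\<lambda>x. f x $ i)"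
 by (simp add: holomorphic_map_def)

lemma holomorphic_map_id [hol_intros]: "open (U :: (complex^'n) set) ==> holomorphic_map U (\<lambda>x. x)"
proof -
 have "(*v) (mat 1 :: complex^'n^'n) = (\<lambda>v. v)"
  by auto
 then show "open U ==> holomorphic_map U (\<lambda>x. x)"
  unfolding holomorphic_map_iff by (metis has_derivative_ident)
qed

lemma holomorphic_fun_add [hol_intros]:
 assumes "holomorphic_fun U f" "holomorphic_fun U g"
 shows "holomorphic_fun U (\<lambda>x. f x + g x)"
 unfolding holomorphic_fun_def
proof safe
 show "open U" using assms(1) by (rule holomorphic_fun_open)
 fix x assume x: "x \<in> U"
 have "((\<lambda>x. f x + g x) has_derivative scalar_product (grad f x + grad g x)) (at x)"
  using has_derivative_add[OF has_derivative_grad[OF assms(1) x] has_derivative_grad[OF assms(2) x]]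
  by (rule has_derivative_eq_rhs) (auto simp: scalar_product_add_left)
 then show "\<exists>a. ((\<lambda>x. f x + g x) has_derivative scalar_product a) (at x)" ..
qed

lemma has_derivative_mult_scalar_product:
 fixes f g :: "complex^'n => complex"
 assumes "(f has_derivative scalar_product a) (at x)" "(g has_derivative scalar_product b) (at x)"
 shows "((\<lambda>x. f x * g x) has_derivative scalar_product (f x *s b + g x *s a)) (at x)"
 using has_derivative_mult[OF assms]
 by (rule has_derivative_eq_rhs) (auto simp: scalar_product_add_left scalar_product_scale_left)

lemma holomorphic_fun_mult [hol_intros]:
 "holomorphic_fun U f ==> holomorphic_fun U g ==> holomorphic_fun U (\<lambda>x. f x * g x)"
 unfolding holomorphic_fun_def using has_derivative_mult_scalar_product by blast

lemma holomorphic_fun_uminus [hol_intros]: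
 assumes "holomorphic_fun U f" shows "holomorphic_fun U (\<lambda>x. - f x)"
 using holomorphic_fun_mult[OF holomorphic_fun_const[OF holomorphic_fun_open[OF assms]] assms, of "-1"]
 by simp

lemma holomorphic_fun_diff [hol_intros]:
 "holomorphic_fun U f ==> holomorphic_fun U g ==> holomorphic_fun U (\<lambda>x. f x - g x)"
 using holomorphic_fun_add[OF _ holomorphic_fun_uminus] by fastforce

lemma holomorphic_fun_sum [hol_intros]:
 "open U ==> (\<And>i. i \<in> I ==> holomorphic_fun U (f i)) ==> holomorphic_fun U (\<lambda>x. \<Sum>i\<in>I. f i x)"
 by (induction I rule: infinite_finite_induct) (auto intro: hol_intros)

lemma holomorphic_fun_prod [hol_intros]:
 "open U ==> (\<And>i. i \<in> I ==> holomorphic_fun U (f i)) ==> holomorphic_fun U (\<lambda>x. \<Prod>i\<in>I. f i x)"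
 by (induction I rule: infinite_finite_induct) (auto intro: hol_intros)

lemma holomorphic_fun_power [hol_intros]:
 "holomorphic_fun U f ==> holomorphic_fun U (\<lambda>x. f x ^ k)"
 by (induction k) (auto intro: hol_intros dest: holomorphic_fun_open)

lemma holomorphic_fun_inverse [hol_intros]:
 assumes "holomorphic_fun U f" "\<And>x. x \<in> U ==> f x ~= 0"
 shows "holomorphic_fun U (\<lambda>x. inverse (f x))"
 unfolding holomorphic_fun_def
proof safe
 show "open U" using assms(1) by (rule holomorphic_fun_open)
 fix x assume x: "x \<in> U"
 have "((\<lambda>x. inverse (f x)) has_derivative
   scalar_product ((- (inverse (f x) * inverse (f x))) *s grad f x)) (at x)"
  using Deriv.has_derivative_inverse[OF assms(2)[OF x] has_derivative_grad[OF assms(1) x]]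
  by (rule has_derivative_eq_rhs) (auto simp: fun_eq_iff scalar_product_scale_left scalar_product_minus_left)
 then show "\<exists>a. ((\<lambda>x. inverse (f x)) has_derivative scalar_product a) (at x)" ..
qed

lemma holomorphic_fun_divide [hol_intros]:
 "holomorphic_fun U f ==> holomorphic_fun U g ==> (\<And>x. x \<in> U ==> g x ~= 0) ==>
  holomorphic_fun U (\<lambda>x. f x / g x)"
 unfolding divide_inverse by (intro hol_intros)

lemma holomorphic_map_const [hol_intros]: "open U ==> holomorphic_map U (\<lambda>x. c)"
 unfolding holomorphic_map_def by (auto intro: hol_intros)

lemma holomorphic_map_add [hol_intros]:
 "holomorphic_map U f ==> holomorphic_map U g ==> holomorphic_map U (\<lambda>x. f x + g x)"
 unfolding holomorphic_map_def by (auto intro: hol_intros)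

lemma holomorphic_map_diff [hol_intros]:
 "holomorphic_map U f ==> holomorphic_map U g ==> holomorphic_map U (\<lambda>x. f x - g x)"
 unfolding holomorphic_map_def by (auto intro: hol_intros)

lemma holomorphic_map_scale [hol_intros]:
 "holomorphic_fun U f ==> holomorphic_map U g ==> holomorphic_map U (\<lambda>x. f x *s g x)"
 unfolding holomorphic_map_def by (auto intro: hol_intros)

lemma holomorphic_fun_scalar_product [hol_intros]:
 "holomorphic_map U f ==> holomorphic_map U g ==> holomorphic_fun U (\<lambda>x. scalar_product (f x) (g x))"
 unfolding scalar_product_def by (intro hol_intros) (auto intro: holomorphic_map_open)

lemma holomorphic_map_matrix [hol_intros]:
 "holomorphic_map U g ==> holomorphic_map U (\<lambda>x. M *v g x)"
 unfolding holomorphic_map_def[of U "\<lambda>x. M *v g x"] matrix_vector_nth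
 by (intro allI holomorphic_fun_scalar_product holomorphic_map_const) (auto dest: holomorphic_map_open)

lemma holomorphic_map_lambda [hol_intros]:
 "(\<And>i. holomorphic_fun U (\<lambda>x. f i x)) ==> holomorphic_map U (\<lambda>x. \<chi> i. f i x)"
 unfolding holomorphic_map_def by simp

section \<open>Chain rule and restriction to complex lines\<close>

lemma has_derivative_compose_scalar_product:
 fixes g :: "complex^'n => complex^'m"
 assumes "(g has_derivative (*v) M) (at x)" "(f has_derivative scalar_product a) (at (g x))"
 shows "((\<lambda>x. f (g x)) has_derivative scalar_product (a v* M)) (at x)"
 using has_derivative_compose[OF assms] by (simp add: scalar_product_matrix_vector)

lemma has_derivative_compose_matrix:
 fixes g :: "complex^'n => complex^'m" and f :: "complex^'m => complex^'k"
 assumes "(g has_derivative (*v) M) (at x)" "(f has_derivative (*v) N) (at (g x))"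
 shows "((\<lambda>x. f (g x)) has_derivative (*v) (N ** M)) (at x)"
 using has_derivative_compose[OF assms] by (simp add: matrix_vector_mul_assoc)

lemma holomorphic_fun_compose:
 assumes "holomorphic_map U g" "holomorphic_fun V f" "\<And>x. x \<in> U ==> g x \<in> V"
 shows "holomorphic_fun U (\<lambda>x. f (g x))"
 unfolding holomorphic_fun_def
 using has_derivative_compose_scalar_product[OF has_derivative_jac[OF assms(1)]
   has_derivative_grad[OF assms(2) assms(3)]] holomorphic_map_open[OF assms(1)] by blast

lemma holomorphic_map_compose:
 "holomorphic_map U g ==> holomorphic_map V f ==> (\<And>x. x \<in> U ==> g x \<in> V) ==>
  holomorphic_map U (\<lambda>x. f (g x))"
 unfolding holomorphic_map_def[of V] holomorphic_map_def[of U "\<lambda>x. f (g x)"]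
 using holomorphic_fun_compose by blast

text \<open>Passage to one variable: Cauchy's inequality, isolated zeros and the identity theorem in
  the plane are applied to \<open>f\<close> along complex lines.\<close>

lemma has_field_derivative_line:
 fixes f :: "complex^'n => complex"
 assumes "(f has_derivative scalar_product a) (at (x + t *s v))"
 shows "((\<lambda>t. f (x + t *s v)) has_field_derivative scalar_product a v) (at t)"
proof -
 have "((\<lambda>t. x + t *s v) has_derivative (\<lambda>s. s *s v)) (at t)"
 proof -
  have "bounded_linear (\<lambda>s::complex. s *s v)"
   by (intro linear_conv_bounded_linear[THEN iffD1] linearI) (auto simp: vec_eq_iff algebra_simps)
  from bounded_linear_imp_has_derivative[OF this] show ?thesis
   using has_derivative_add[OF has_derivative_const] by fastforce
 qed
 from has_derivative_compose[OF this assms] show ?thesis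
  unfolding has_field_derivative_def
  by (rule has_derivative_eq_rhs) (auto simp: scalar_product_scale_right mult.commute)
qed

lemma continuous_on_line: "continuous_on S (\<lambda>t. x + t *s v)" for x v :: "complex^'n"
proof -
 have "continuous_on S (\<lambda>t. \<chi> i. x $ i + t * v $ i)"
  by (intro continuous_intros)
 then show ?thesis
  by (rule continuous_on_cong[THEN iffD1, rotated 2]) (auto simp: vec_eq_iff)
qed

lemma norm_vector_scale: "norm (c *s v) = norm c * norm v" for v :: "complex^'n"
 by (simp add: norm_vec_def norm_mult L2_set_right_distrib)

lemma norm_axis_complex [simp]: "norm (axis i (1::complex) :: complex^'n) = 1"
 by (simp add: norm_eq_1 inner_axis_axis)

text \<open>The index type \<open>'n option\<close> supplies one additional coordinate
  \<open>None\<close>. A function of a base point and one complex parameter thereby becomes a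
  function on a space \<open>complex^_\<close>, and \<open>holomorphic_fun\<close> expresses joint
  holomorphy in both.\<close>

definition vcons :: "complex^'n => complex => complex^('n option)" where
 "vcons x t = (\<chi> k. case k of None => t | Some i => x $ i)"

definition vtl :: "complex^('n option) => complex^'n" where
 "vtl w = (\<chi> i. w $ Some i)"

lemma vcons_nth [simp]: "vcons x t $ None = t" "vcons x t $ Some i = x $ i"
 by (simp_all add: vcons_def)

lemma vtl_nth [simp]: "vtl w $ i = w $ Some i"
 by (simp add: vtl_def)

lemma vtl_vcons [simp]: "vtl (vcons x t) = x"
 by (simp add: vec_eq_iff)

lemma vcons_vtl [simp]: "vcons (vtl w) (w $ None) = w"
 by (auto simp: vec_eq_iff vcons_def split: option.split)

lemma sum_UNIV_option: "(\<Sum>k\<in>UNIV. f k) = f None + (\<Sum>i\<in>(UNIV::'n::finite set). f (Some i))"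
 for f :: "_ => 'a::comm_monoid_add"
 unfolding UNIV_option_conv by (subst sum.insert) (auto simp: sum.reindex)

lemma norm_vcons: "norm (vcons x t) = sqrt ((norm t)\<^sup>2 + (norm x)\<^sup>2)"
 by (simp add: norm_vec_def L2_set_def sum_UNIV_option sum_nonneg)

lemma vcons_diff: "vcons x s - vcons y t = vcons (x - y) (s - t)"
 by (auto simp: vec_eq_iff vcons_def split: option.split)

lemma dist_vcons_same [simp]: "dist (vcons x t) (vcons y t) = dist x y"
 by (simp add: dist_norm vcons_diff norm_vcons)

lemma dist_vcons_le: "dist (vcons x s) (vcons y t) \<le> dist x y + dist s t"
 using sqrt_sum_squares_le_sum[of "norm (s - t)" "norm (x - y)"]
 by (simp add: dist_norm vcons_diff norm_vcons)

lemma vcons_line: "vcons x t = vcons x 0 + t *s axis None 1"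
 by (auto simp: vec_eq_iff vcons_def axis_def split: option.split)

lemma holomorphic_map_vcons [hol_intros]:
 assumes "holomorphic_map U g" "holomorphic_fun U f"
 shows "holomorphic_map U (\<lambda>x. vcons (g x) (f x))"
 unfolding holomorphic_map_def
proof
 fix k show "holomorphic_fun U (\<lambda>x. vcons (g x) (f x) $ k)"
  using assms by (cases k) (auto intro: hol_intros)
qed

lemma holomorphic_map_vtl [hol_intros]:
 "holomorphic_map U g ==> holomorphic_map U (\<lambda>x. vtl (g x))"
 unfolding holomorphic_map_def by simp

lemma continuous_on_vcons [continuous_intros]:
 assumes "continuous_on S g" "continuous_on S f"
 shows "continuous_on S (\<lambda>x. vcons (g x) (f x))"
 unfolding vcons_def
proof (intro continuous_on_vec_lambda)
 fix k show "continuous_on S (\<lambda>x. case k of None => f x | Some i => g x $ i)"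
  using assms by (cases k) (auto intro!: continuous_intros)
qed

lemma continuous_on_vtl [continuous_intros]:
 "continuous_on S g ==> continuous_on S (\<lambda>x. vtl (g x))"
 unfolding vtl_def by (intro continuous_intros)

lemma tendsto_vcons [tendsto_intros]:
 assumes "(g \<longlongrightarrow> x) F" "(f \<longlongrightarrow> t) F"
 shows "((\<lambda>y. vcons (g y) (f y)) \<longlongrightarrow> vcons x t) F"
 unfolding vcons_def
proof (intro tendsto_intros)
 fix k show "((\<lambda>y. case k of None => f y | Some i => g y $ i) \<longlongrightarrow> (case k of None => t | Some i => x $ i)) F"
  using assms by (cases k) (auto intro!: tendsto_intros)
qed

lemma has_derivative_vcons:
 fixes x :: "complex^'n"
 shows "((\<lambda>x. vcons x t) has_derivative (*v) (\<chi> k j. case k of None => 0 | Some i => if i = j then 1 else 0)) (at x)"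
 unfolding has_derivative_matrix_iff
proof
 fix k
 show "((\<lambda>x. vcons x t $ k) has_derivative
   scalar_product ((\<chi> k j. case k of None => 0 | Some i => if i = j then 1 else 0) $ k)) (at x)"
 proof (cases k)
  case None
  have "(\<lambda>v. 0) = scalar_product (\<chi> j. 0)"
   by (auto simp: scalar_product_def)
  then show ?thesis using None has_derivative_eq_rhs[OF has_derivative_const[of t]] by simp
 next
  case (Some i)
  have "(\<chi> j. if i = j then 1 else 0) = (axis i 1 :: complex^'n)"
   by (auto simp: axis_def vec_eq_iff)
  then have "scalar_product (\<chi> j. if i = j then 1 else 0) = (\<lambda>v::complex^'n. v $ i)"
   by (auto simp: fun_eq_iff)
  then show ?thesis using Some
   by (simp add: bounded_linear_imp_has_derivative bounded_linear_vec_nth)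
 qed
qed

lemma has_derivative_vcons_fst:
 assumes "(\<Phi> has_derivative scalar_product b) (at (vcons x t))"
 shows "((\<lambda>x. \<Phi> (vcons x t)) has_derivative scalar_product (vtl b)) (at x)"
proof -
 have "b v* (\<chi> k j. case k of None => 0 | Some i => if i = j then 1 else 0) = vtl b"
  by (simp add: vector_matrix_mult_def vec_eq_iff sum_UNIV_option if_distrib sum.delta
    cong: if_cong)
 with has_derivative_compose_scalar_product[OF has_derivative_vcons assms] show ?thesis
  by simp
qed

lemma has_field_derivative_vcons_snd:
 assumes "(\<Phi> has_derivative scalar_product b) (at (vcons x t))"
 shows "((\<lambda>t. \<Phi> (vcons x t)) has_field_derivative b $ None) (at t)"
proof -
 have "((\<lambda>t. \<Phi> (vcons x 0 + t *s axis None 1)) has_field_derivative scalar_product b (axis None 1)) (at t)"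
  by (rule has_field_derivative_line) (use assms in \<open>simp flip: vcons_line\<close>)
 then show ?thesis by (simp flip: vcons_line)
qed

section \<open>Cauchy estimates, parameter integrals and holomorphy of the gradient\<close>

lemma holomorphic_on_line:
 assumes "holomorphic_fun U f" "\<And>t. t \<in> S ==> x + t *s v \<in> U"
 shows "(\<lambda>t. f (x + t *s v)) holomorphic_on S"
 by (rule holomorphic_on_subset[of _ S], unfold holomorphic_on_def field_differentiable_def)
   (use has_field_derivative_line[OF has_derivative_grad[OF assms(1) assms(2)]]
   has_field_derivative_at_within in blast)+

text \<open>Holomorphy as defined asserts a derivative at each point but no continuity of it. The
  difference of a partial derivative at \<open>x\<close> and at \<open>x0\<close> is the derivative
  at 0 of \<open>f (x + t *s v) - f (x0 + t *s v)\<close>, which Cauchy's inequality bounds by the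
  values on a circle; uniform continuity of \<open>f\<close> makes these small.\<close>

lemma continuous_on_grad:
 assumes f: "holomorphic_fun U f"
 shows "continuous_on U (grad f)"
proof -
 have U: "open U" using f by (rule holomorphic_fun_open)
 have "continuous_on U (\<lambda>x. grad f x $ i)" for i
  unfolding continuous_on_iff
 proof safe
  fix x0 and e :: real assume x0: "x0 \<in> U" and e: "e > 0"
  obtain \<rho> where \<rho>: "\<rho> > 0" "cball x0 \<rho> \<subseteq> U"
   using U x0 open_contains_cball by blast
  \<comment> \<open>Half of the radius: a centre displaced by less than \<open>r\<close>, followed
    by a step of length at most \<open>r\<close> along the axis, stays in
    \<open>cball x0 \<rho>\<close>.\<close>
  define r where "r = \<rho> / 2"
  have r: "r > 0" using \<rho> by (simp add: r_def)
  have "uniformly_continuous_on (cball x0 \<rho>) f"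
   by (rule compact_uniformly_continuous)
     (use \<rho> f in \<open>auto intro: continuous_on_subset holomorphic_fun_continuous_on\<close>)
  \<comment> \<open>Cauchy's inequality divides by the radius \<open>r\<close>, so the bound
    \<open>e * r / 2\<close> leaves \<open>e / 2\<close>.\<close>
  then obtain \<delta> where \<delta>: "\<delta> > 0"
    "\<And>u u'. u \<in> cball x0 \<rho> ==> u' \<in> cball x0 \<rho> ==> dist u' u < \<delta> ==> dist (f u') (f u) < e * r / 2"
   unfolding uniformly_continuous_on_def using e r by (metis half_gt_zero mult_pos_pos)
  show "\<exists>d>0. \<forall>x\<in>U. dist x x0 < d --> dist (grad f x $ i) (grad f x0 $ i) < e"
  proof (intro exI[of _ "min r \<delta>"] conjI ballI impI)
   show "min r \<delta> > 0" using r \<delta> by simp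
   fix x assume x: "x \<in> U" "dist x x0 < min r \<delta>"
   define v :: "complex^'a" where "v = axis i 1"
   define g where "g = (\<lambda>t. f (x + t *s v) - f (x0 + t *s v))"
   have in_cball: "y + t *s v \<in> cball x0 \<rho>" if "dist y x0 < r" "t \<in> cball 0 r" for y t
   proof -
    have "dist (y + t *s v) x0 \<le> dist y x0 + norm (t *s v)"
     by (metis add.commute add_diff_eq dist_norm norm_triangle_ineq)
    also have "\<dots> \<le> r + r"
     using that by (simp add: norm_vector_scale v_def)
    finally show ?thesis by (simp add: dist_commute r_def)
   qed
   have in_U: "x + t *s v \<in> cball x0 \<rho>" "x0 + t *s v \<in> cball x0 \<rho>" if "t \<in> cball 0 r" for t
    using in_cball[OF _ that] x(2) r by auto
   have "norm ((deriv ^^ 1) g 0) \<le> fact 1 * (e * r / 2) / r ^ 1"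
   proof (rule Cauchy_inequality)
    have hol: "g holomorphic_on cball 0 r"
     unfolding g_def using in_U \<rho>(2)
     by (intro holomorphic_intros holomorphic_on_line[OF f]) blast+
    then show "g holomorphic_on ball 0 r" "continuous_on (cball 0 r) g"
     by (auto intro: holomorphic_on_subset holomorphic_on_imp_continuous_on)
    show "0 < r" by fact
    fix t :: complex assume "norm (0 - t) = r"
    then have t: "t \<in> cball 0 r" by simp
    have "dist (f (x + t *s v)) (f (x0 + t *s v)) < e * r / 2"
     by (rule \<delta>(2)) (use in_U[OF t] x(2) in auto)
    then show "norm (g t) \<le> e * r / 2"
     by (simp add: g_def dist_norm)
   qed
   moreover have "deriv g 0 = grad f x $ i - grad f x0 $ i"
   proof (rule DERIV_imp_deriv)
    have "(g has_field_derivative scalar_product (grad f x) v - scalar_product (grad f x0) v) (at 0)"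
     unfolding g_def
     by (intro derivative_intros has_field_derivative_line)
       (use has_derivative_grad[OF f] x x0 in auto)
    then show "(g has_field_derivative grad f x $ i - grad f x0 $ i) (at 0)"
     by (simp add: v_def)
   qed
   ultimately show "dist (grad f x $ i) (grad f x0 $ i) < e"
    using r e by (simp add: dist_norm)
  qed
 qed
 then have "continuous_on U (\<lambda>x. \<chi> i. grad f x $ i)"
  by (rule continuous_on_vec_lambda)
 then show ?thesis by simp
qed

lemma continuous_on_jac:
 assumes "holomorphic_map U f"
 shows "continuous_on U (jac f)"
 unfolding jac_def using assms
 by (intro continuous_intros continuous_on_grad) (auto simp: holomorphic_map_def)

text \<open>The Leibniz rule delivers the derivative of a parameter integral as an integral of real
  bounded linear maps. Complex linearity passes from the integrand to the integral because a
  constant factor can be pulled out.\<close>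

lemma bounded_linear_complex_linear_integral:
 fixes F :: "real => (complex^'n) \<Rightarrow>\<^sub>L complex"
 assumes "F integrable_on S" "\<And>s. s \<in> S ==> \<exists>b. blinfun_apply (F s) = scalar_product b"
 shows "\<exists>a. blinfun_apply (integral S F) = scalar_product a"
proof (rule complex_linear_eq_scalar_product)
 show "linear (blinfun_apply (integral S F))"
  by (simp add: blinfun.bounded_linear_right bounded_linear.linear)
 fix c :: complex and v :: "complex^'n"
 have "blinfun_apply (integral S F) (c *s v) = integral S (\<lambda>s. F s (c *s v))"
  by (rule blinfun_apply_integral[OF assms(1)])
 also have "\<dots> = integral S (\<lambda>s. c * F s v)"
 proof (rule Henstock_Kurzweil_Integration.integral_cong)
  fix s assume "s \<in> S"
  then obtain b where "blinfun_apply (F s) = scalar_product b" using assms(2) by blast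
  then show "F s (c *s v) = c * F s v" by (simp add: scalar_product_scale_right)
 qed
 also have "\<dots> = c * integral S (\<lambda>s. F s v)"
  by simp
 also have "integral S (\<lambda>s. F s v) = blinfun_apply (integral S F) v"
  by (rule blinfun_apply_integral[OF assms(1), symmetric])
 finally show "blinfun_apply (integral S F) (c *s v) = c * blinfun_apply (integral S F) v" .
qed

text \<open>Differentiation under the integral sign. The Leibniz rule asks for a derivative that is
  continuous jointly in the point and the parameter, which is where
  \<open>continuous_on_grad\<close> enters.\<close>

lemma holomorphic_fun_contour_integral:
 fixes \<Phi> :: "complex^('n::finite option) => complex" and U :: "(complex^'n) set"
 assumes \<Phi>: "holomorphic_fun V \<Phi>" and U: "open U"
  and sub: "\<And>x t. x \<in> U ==> t \<in> path_image (circlepath z r) ==> vcons x t \<in> V"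
 shows "holomorphic_fun U (\<lambda>x. contour_integral (circlepath z r) (\<lambda>t. \<Phi> (vcons x t)))"
 unfolding holomorphic_fun_def
proof safe
 show "open U" by fact
 fix x0 assume x0: "x0 \<in> U"
 then obtain e where e: "e > 0" "ball x0 e \<subseteq> U"
  using U open_contains_ball by blast
 define B where "B = ball x0 e"
 define \<gamma> where "\<gamma> = circlepath z r"
 define \<gamma>' where "\<gamma>' = (\<lambda>s. 2 * pi * \<i> * r * exp (2 * of_real pi * \<i> * of_real s))"
 have \<gamma>': "vector_derivative \<gamma> (at s) = \<gamma>' s" for s
  by (simp add: \<gamma>_def \<gamma>'_def vector_derivative_circlepath)
 define b where "b = (\<lambda>x s. \<gamma>' s *s vtl (grad \<Phi> (vcons x (\<gamma> s))))"
 define F where "F = (\<lambda>x s. Blinfun (scalar_product (b x s)))"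
 have F: "blinfun_apply (F x s) = scalar_product (b x s)" for x s
  by (simp add: F_def bounded_linear_Blinfun_apply bounded_linear_scalar_product)
 define f where "f = (\<lambda>x s. \<Phi> (vcons x (\<gamma> s)) * \<gamma>' s)"
 have cont_\<gamma>: "continuous_on {0..1} \<gamma>"
  unfolding \<gamma>_def by (metis path_circlepath path_def)
 have cont_\<gamma>': "continuous_on S \<gamma>'" for S
  unfolding \<gamma>'_def by (intro continuous_intros)
 have inV: "vcons x (\<gamma> s) \<in> V" if "x \<in> B" "s \<in> {0..1}" for x s
  using sub[of x "\<gamma> s"] that e(2) by (auto simp: B_def \<gamma>_def path_image_def)
 have cont_pair: "continuous_on (B \<times> {0..1}) (\<lambda>p. vcons (fst p) (\<gamma> (snd p)))"
  by (intro continuous_intros continuous_on_compose2[OF cont_\<gamma>]) auto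
 have cont_b: "continuous_on (B \<times> {0..1}) (\<lambda>p. b (fst p) (snd p))"
 proof -
  have "continuous_on (B \<times> {0..1}) (\<lambda>p. \<chi> i. \<gamma>' (snd p) * vtl (grad \<Phi> (vcons (fst p) (\<gamma> (snd p)))) $ i)"
   by (intro continuous_intros continuous_on_compose2[OF continuous_on_grad[OF \<Phi>] cont_pair]
     continuous_on_compose2[OF cont_\<gamma>'[of UNIV]]) (use inV in auto)
  then show ?thesis
   by (simp add: b_def vector_scalar_mult_def)
 qed
 have cont_F: "continuous_on (B \<times> {0..1}) (\<lambda>p. F (fst p) (snd p))"
  by (rule continuous_on_blinfun_componentwise) (auto simp: F intro!: continuous_intros cont_b)
 have int_eq: "contour_integral \<gamma> (\<lambda>t. \<Phi> (vcons x t)) = integral (cbox 0 1) (f x)" for x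
  unfolding contour_integral_integral \<gamma>' f_def by simp
 have "((\<lambda>x. integral (cbox 0 1) (f x)) has_derivative integral (cbox 0 1) (F x0)) (at x0 within B)"
 proof (rule leibniz_rule)
  fix x and s :: real assume x: "x \<in> B" "s \<in> cbox 0 1"
  have "((\<lambda>x. \<Phi> (vcons x (\<gamma> s)) * \<gamma>' s) has_derivative
    (\<lambda>v. scalar_product (vtl (grad \<Phi> (vcons x (\<gamma> s)))) v * \<gamma>' s)) (at x)"
   by (intro has_derivative_mult_left has_derivative_vcons_fst has_derivative_grad[OF \<Phi>])
     (use inV x in auto)
  then show "((\<lambda>x. f x s) has_derivative blinfun_apply (F x s)) (at x within B)"
   unfolding f_def F b_def
   by (rule has_derivative_at_withinI[OF has_derivative_eq_rhs])
     (auto simp: scalar_product_scale_left mult.commute)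
 next
  fix x assume x: "x \<in> B"
  have "continuous_on (cbox 0 1) (\<lambda>s. \<Phi> (vcons x (\<gamma> s)) * \<gamma>' s)"
   by (intro continuous_intros cont_\<gamma>' continuous_on_compose2[OF holomorphic_fun_continuous_on[OF \<Phi>]])
     (use inV x cont_\<gamma> in auto)
  then show "f x integrable_on cbox 0 1"
   unfolding f_def by (rule integrable_continuous)
 next
  show "continuous_on (B \<times> cbox 0 1) (\<lambda>(x, t). F x t)"
   using cont_F by (simp add: case_prod_beta)
 qed (use e in \<open>auto simp: B_def\<close>)
 note deriv_B = this
 have "open B" "x0 \<in> B" using e by (simp_all add: B_def)
 with deriv_B have deriv: "((\<lambda>x. integral (cbox 0 1) (f x)) has_derivative integral (cbox 0 1) (F x0)) (at x0)"
  by (simp only: at_within_open)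
 have "F x0 integrable_on cbox 0 1"
 proof (rule integrable_continuous)
  have "continuous_on (cbox 0 1) (\<lambda>s. F (fst (x0, s)) (snd (x0, s)))"
   by (rule continuous_on_compose2[OF cont_F]) (use \<open>x0 \<in> B\<close> in \<open>auto intro!: continuous_intros\<close>)
  then show "continuous_on (cbox 0 1) (F x0)" by simp
 qed
 then obtain a where "blinfun_apply (integral (cbox 0 1) (F x0)) = scalar_product a"
  using bounded_linear_complex_linear_integral[of "F x0" "cbox 0 1"] F by blast
 with deriv show "\<exists>a. ((\<lambda>x. contour_integral (circlepath z r) (\<lambda>t. \<Phi> (vcons x t))) has_derivative scalar_product a) (at x0)"
  unfolding \<gamma>_def[symmetric] int_eq by auto
qed

text \<open>Cauchy's formula for the derivative along the \<open>i\<close>-th axis writes the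
  partial derivative as an integral over a circle of fixed radius, with \<open>x\<close> only as a
  parameter.\<close>

lemma holomorphic_map_grad [hol_intros]:
 assumes f: "holomorphic_fun U f"
 shows "holomorphic_map U (grad f)"
 unfolding holomorphic_map_def
proof
 fix i
 define v :: "complex^'a" where "v = axis i 1"
 show "holomorphic_fun U (\<lambda>x. grad f x $ i)"
 proof (rule holomorphic_fun_local)
  fix x0 assume "x0 \<in> U"
  then obtain \<rho> where \<rho>: "\<rho> > 0" "cball x0 \<rho> \<subseteq> U"
   using holomorphic_fun_open[OF f] open_contains_cball by blast
  define r where "r = \<rho> / 2"
  have r: "r > 0" using \<rho> by (simp add: r_def)
  have in_U: "x + t *s v \<in> U" if "x \<in> ball x0 r" "t \<in> cball 0 r" for x t
  proof -
   have "dist (x + t *s v) x0 \<le> dist x x0 + norm (t *s v)"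
    by (metis add.commute add_diff_eq dist_norm norm_triangle_ineq)
   also have "\<dots> \<le> r + r"
    using that by (simp add: norm_vector_scale v_def dist_commute)
   finally show ?thesis using \<rho>(2) by (auto simp: dist_commute r_def)
  qed
  \<comment> \<open>The hyperplane \<open>w $ None = 0\<close> is removed to make division by the
    square of the parameter holomorphic; the circle of integration avoids it.\<close>
  define W where "W = (\<lambda>w. vtl w + w $ None *s v) -` U \<inter> (\<lambda>w. w $ None) -` (- {0})"
  have aff: "holomorphic_map UNIV (\<lambda>w. vtl w + w $ None *s v)"
   by (intro hol_intros open_UNIV)
  have W: "open W"
   unfolding W_def
   by (intro open_Int open_vimage holomorphic_map_continuous_on[OF aff] holomorphic_fun_open[OF f]
     continuous_intros) simp?
  have \<Phi>: "holomorphic_fun W (\<lambda>w. f (vtl w + w $ None *s v) / (w $ None)^2)"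
   by (intro hol_intros holomorphic_fun_compose[OF holomorphic_map_subset[OF aff W] f] W)
     (auto simp: W_def)
  have "holomorphic_fun (ball x0 r) (\<lambda>x. contour_integral (circlepath 0 r)
    (\<lambda>t. f (vtl (vcons x t) + vcons x t $ None *s v) / (vcons x t $ None)^2))"
   by (rule holomorphic_fun_contour_integral[OF \<Phi>])
     (use in_U r in \<open>auto simp: W_def\<close>)
  then have *: "holomorphic_fun (ball x0 r) (\<lambda>x. 1 / (2 * of_real pi * \<i>) * contour_integral (circlepath 0 r)
    (\<lambda>t. f (x + t *s v) / t^2))"
   by (auto intro!: hol_intros)
  have "holomorphic_fun (ball x0 r) (\<lambda>x. grad f x $ i)"
  proof (rule holomorphic_fun_cong[OF *])
   fix x assume x: "x \<in> ball x0 r"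
   have hol: "(\<lambda>t. f (x + t *s v)) holomorphic_on cball 0 r"
    by (rule holomorphic_on_line[OF f]) (use in_U[OF x] in auto)
   have "((\<lambda>t. f (x + t *s v)) has_field_derivative (1 / (2 * of_real pi * \<i>) *
     contour_integral (circlepath 0 r) (\<lambda>u. f (x + u *s v) / (u - 0)^2))) (at 0)"
    by (rule Cauchy_derivative_integral_circlepath)
      (use hol r in \<open>auto intro: holomorphic_on_subset holomorphic_on_imp_continuous_on\<close>)
   moreover have "((\<lambda>t. f (x + t *s v)) has_field_derivative scalar_product (grad f x) v) (at 0)"
    by (rule has_field_derivative_line) (use has_derivative_grad[OF f] in_U[OF x, of 0] r in auto)
   ultimately show "1 / (2 * of_real pi * \<i>) * contour_integral (circlepath 0 r)
    (\<lambda>t. f (x + t *s v) / t^2) = grad f x $ i"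
    using DERIV_unique by (fastforce simp: v_def)
  qed
  moreover have "ball x0 r \<subseteq> U" using in_U[of _ 0] r by auto
  ultimately show "\<exists>V. x0 \<in> V \<and> V \<subseteq> U \<and> holomorphic_fun V (\<lambda>x. grad f x $ i)"
   using r by (metis centre_in_ball)
 qed
qed

section \<open>Riemann extension and the inverse function theorem\<close>

lemma line_preimage:
 fixes x v :: "complex^'n"
 shows open_line_preimage: "open U ==> open {t. x + t *s v \<in> U}"
  and convex_line_preimage: "convex U ==> convex {t. x + t *s v \<in> U}"
proof -
 show "open {t. x + t *s v \<in> U}" if "open U"
  using open_vimage[OF that continuous_on_line[of UNIV x v]] by (simp add: vimage_def)
 have "x + ((1 - u) *\<^sub>R s + u *\<^sub>R t) *s v = (1 - u) *\<^sub>R (x + s *s v) + u *\<^sub>R (x + t *s v)"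
  for u :: real and s t
  by (auto simp: vec_eq_iff algebra_simps scaleR_conv_of_real[where 'a = complex])
 then show "convex {t. x + t *s v \<in> U}" if "convex U"
  using that unfolding convex_alt by auto
qed

text \<open>On the complex line through a point of \<open>V\<close> and \<open>x\<close> the
  one-variable identity theorem applies; convexity of \<open>U\<close> makes the part of the line
  inside \<open>U\<close> connected.\<close>

lemma holomorphic_fun_eq_zero:
 fixes f :: "complex^'n => complex"
 assumes f: "holomorphic_fun U f" and "convex U"
  and V: "open V" "V \<subseteq> U" "V ~= {}" "\<And>x. x \<in> V ==> f x = 0" and x: "x \<in> U"
 shows "f x = 0"
proof -
 obtain x0 where x0: "x0 \<in> V" using V by blast
 define v where "v = x - x0"
 have "f (x0 + 1 *s v) = 0"
 proof (rule analytic_continuation_open[of "{t. x0 + t *s v \<in> V}" "{t. x0 + t *s v \<in> U}"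
    "\<lambda>t. f (x0 + t *s v)" "\<lambda>t. 0" 1])
  show "open {t. x0 + t *s v \<in> V}" "open {t. x0 + t *s v \<in> U}"
   using V(1) holomorphic_fun_open[OF f] by (auto intro: open_line_preimage)
  show "connected {t. x0 + t *s v \<in> U}"
   by (intro convex_connected convex_line_preimage \<open>convex U\<close>)
  have "0 \<in> {t. x0 + t *s v \<in> V}" using x0 by simp
  then show "{t. x0 + t *s v \<in> V} ~= {}" by blast
  show "(\<lambda>t. f (x0 + t *s v)) holomorphic_on {t. x0 + t *s v \<in> U}"
   by (rule holomorphic_on_line[OF f]) auto
 qed (use V x in \<open>auto simp: v_def\<close>)
 then show ?thesis by (simp add: v_def)
qed

lemma holomorphic_fun_nonzero_dense:
 fixes f :: "complex^'n => complex"
 assumes "holomorphic_fun U f" "convex U" "x1 \<in> U" "f x1 ~= 0" "open V" "V \<inter> U ~= {}"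
 obtains y where "y \<in> V" "y \<in> U" "f y ~= 0"
proof -
 have "\<not> (\<forall>y\<in>V \<inter> U. f y = 0)"
  using holomorphic_fun_eq_zero[OF assms(1,2), of "V \<inter> U" x1] assms holomorphic_fun_open[OF assms(1)]
  by auto
 then show ?thesis using that by blast
qed

lemma open_nonzero:
 assumes "holomorphic_fun U h" shows "open {x\<in>U. h x ~= 0}"
proof -
 have "open (U \<inter> h -` (- {0}))"
  by (intro continuous_open_preimage holomorphic_fun_continuous_on holomorphic_fun_open[OF assms] assms) auto
 moreover have "U \<inter> h -` (- {0}) = {x\<in>U. h x ~= 0}" by auto
 ultimately show ?thesis by simp
qed

lemma holomorphic_fun_nonzero_finite:
 fixes f :: "'i => complex^'n => complex"
 assumes "finite I" "\<And>i. i \<in> I ==> holomorphic_fun U (f i)" "convex U"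
  and "\<And>i. i \<in> I ==> \<exists>x\<in>U. f i x ~= 0" and V: "open V" "V \<inter> U ~= {}" and U: "open U"
 shows "\<exists>x\<in>V \<inter> U. \<forall>i\<in>I. f i x ~= 0"
 using assms(1,2,4)
proof (induction I rule: finite_induct)
 case empty
 then show ?case using V by auto
next
 case (insert j I)
 have "\<exists>x\<in>V \<inter> U. \<forall>i\<in>I. f i x ~= 0"
  by (rule insert.IH) (use insert.prems in auto)
 then obtain x0 where x0: "x0 \<in> V" "x0 \<in> U" "\<forall>i\<in>I. f i x0 ~= 0" by blast
 define W where "W = V \<inter> U \<inter> (\<Inter>i\<in>I. {x\<in>U. f i x ~= 0})"
 have "open {x\<in>U. f i x ~= 0}" if "i \<in> I" for i
  using that insert.prems(1) by (intro open_nonzero) auto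
 then have W: "open W"
  unfolding W_def using insert.hyps V U by (intro open_Int open_INT) auto
 obtain x1 where "x1 \<in> U" "f j x1 ~= 0" using insert.prems by auto
 moreover have "W \<inter> U ~= {}" using x0 by (auto simp: W_def)
 ultimately obtain y where "y \<in> W" "f j y ~= 0"
  using holomorphic_fun_nonzero_dense[OF insert.prems(1) \<open>convex U\<close> _ _ W, of j x1] by blast
 then show ?case by (auto simp: W_def)
qed

text \<open>The tube lemma, by compactness of the image of \<open>K\<close>: an open condition known
  on a whole disc or circle above \<open>x0\<close> persists over all nearby base points.\<close>

lemma tube_vcons:
 assumes "open W" "compact K" "\<And>t. t \<in> K ==> vcons x0 t \<in> W"
 obtains e where "e > 0" "\<And>x t. dist x x0 < e ==> t \<in> K ==> vcons x t \<in> W"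
proof -
 have "compact ((\<lambda>t. vcons x0 t) ` K)"
  by (intro compact_continuous_image continuous_intros assms)
 then obtain e where e: "e > 0" "(\<Union>w\<in>(\<lambda>t. vcons x0 t) ` K. cball w e) \<subseteq> W"
  using compact_subset_open_imp_cball_epsilon_subset[OF _ assms(1)] assms(3) by (metis image_subsetI)
 show ?thesis
 proof
  show "e > 0" by fact
  fix x t assume "dist x x0 < e" "t \<in> K"
  then have "vcons x t \<in> cball (vcons x0 t) e" by (simp add: dist_commute)
  then show "vcons x t \<in> W" using e(2) \<open>t \<in> K\<close> by blast
 qed
qed

lemma nonzero_circle:
 fixes g :: "complex => complex"
 assumes "g holomorphic_on S" "open S" "connected S" "z \<in> S" "w \<in> S" "g w ~= 0" "e > 0"
 obtains \<rho> where "0 < \<rho>" "\<rho> < e" "cball z \<rho> \<subseteq> S" "\<And>t. t \<in> cball z \<rho> - {z} ==> g t ~= 0"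
proof -
 have "\<exists>r>0. ball z r \<subseteq> S \<and> (\<forall>t\<in>ball z r - {z}. g t ~= 0)"
 proof (cases "g z = 0")
  case True
  then show ?thesis using isolated_zeros[OF assms(1-4) _ assms(5,6)] by metis
 next
  case False
  have "open (S \<inter> g -` (- {0}))"
   using assms(1,2) by (intro continuous_open_preimage holomorphic_on_imp_continuous_on) auto
  moreover have "z \<in> S \<inter> g -` (- {0})" using False assms by auto
  ultimately obtain r where "r > 0" "ball z r \<subseteq> S \<inter> g -` (- {0})"
   using open_contains_ball by blast
  then show ?thesis by (intro exI[of _ r]) auto
 qed
 then obtain r where r: "r > 0" "ball z r \<subseteq> S" "\<forall>t\<in>ball z r - {z}. g t ~= 0" by blast
 have sub: "cball z (min r e / 2) \<subseteq> ball z r"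
  using r(1) assms(7) by (auto simp: mem_ball)
 show ?thesis
 proof (rule that[of "min r e / 2"])
  show "cball z (min r e / 2) \<subseteq> S" using sub r by blast
  show "\<And>t. t \<in> cball z (min r e / 2) - {z} ==> g t ~= 0" using sub r by blast
 qed (use r assms(7) in auto)
qed

text \<open>The zeros of \<open>k\<close> in the closed disc are finitely many, and at them the
  bounded function \<open>g\<close> has removable singularities. Neither the circle nor 0 is such a
  zero, so Cauchy's formula for the extended function only involves values of
  \<open>g\<close>.\<close>

lemma Cauchy_formula_bounded_off_zeros:
 fixes g k :: "complex => complex"
 assumes k: "k holomorphic_on S" and S: "open S" "connected S" and \<rho>: "\<rho> > 0" "cball 0 \<rho> \<subseteq> S"
  and k0: "\<And>t. norm t = \<rho> ==> k t ~= 0"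
  and g: "g holomorphic_on {t\<in>S. k t ~= 0}"
  and B: "\<And>t. t \<in> S ==> k t ~= 0 ==> norm (g t) \<le> B" and "k 0 ~= 0"
 shows "g 0 = 1 / (2 * of_real pi * \<i>) * contour_integral (circlepath 0 \<rho>) (\<lambda>t. g t / t)"
proof -
 define Z where "Z = {t\<in>cball 0 \<rho>. k t = 0}"
 have "0 \<in> S" using \<rho> by auto
 have finite: "finite Z"
 proof (cases "k constant_on S")
  case True
  then have "Z = {}" using \<open>k 0 ~= 0\<close> \<open>0 \<in> S\<close> \<rho>(2) unfolding Z_def constant_on_def by auto
  then show ?thesis by simp
 next
  case False
  then show ?thesis unfolding Z_def
   by (intro holomorphic_compact_finite_zeros[OF k S]) (use \<rho> in auto)
 qed
 define S' where "S' = {t\<in>S. k t ~= 0} \<union> ball 0 \<rho>"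
 have Zsub: "Z \<subseteq> ball 0 \<rho>" using k0 by (auto simp: Z_def less_le)
 have "open (S \<inter> k -` (- {0}))"
  by (intro continuous_open_preimage holomorphic_on_imp_continuous_on k S) auto
 moreover have "S \<inter> k -` (- {0}) = {t\<in>S. k t ~= 0}" by auto
 ultimately have openk: "open {t\<in>S. k t ~= 0}" by simp
 then have S': "open S'" unfolding S'_def by auto
 have eq: "S' - Z = {t\<in>S. k t ~= 0}"
  using \<rho> by (auto simp: S'_def Z_def)
 have "\<exists>g'. g' holomorphic_on S' \<and> (\<forall>z\<in>S' - Z. g' z = g z)"
 proof (rule removable_singularities[OF finite])
  show "Z \<subseteq> interior S'" using Zsub S' by (auto simp: S'_def interior_open)
  show "g holomorphic_on (S' - Z)" using g eq by simp
  fix z assume z: "z \<in> Z"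
  have "open (S' - (Z - {z}))"
   using S' finite by (intro open_Diff finite_imp_closed) auto
  then have "eventually (\<lambda>t. t \<in> S' - (Z - {z}) - {z}) (at z)"
   using z Zsub by (intro eventually_at_in_open) (auto simp: S'_def)
  then have "eventually (\<lambda>t. norm (g t) \<le> B * norm (1::complex)) (at z)"
   by eventually_elim (use B eq in auto)
  then show "g \<in> O[at z](\<lambda>_. 1)" by (rule bigoI)
 qed
 then obtain g' where g': "g' holomorphic_on S'" "\<And>z. z \<in> S' - Z ==> g' z = g z" by blast
 have cb: "cball 0 \<rho> \<subseteq> S'"
  using k0 \<rho>(2) by (auto simp: S'_def)
 have "((\<lambda>u. g' u / (u - 0)) has_contour_integral (2 * of_real pi * \<i> * g' 0)) (circlepath 0 \<rho>)"
 proof (rule Cauchy_integral_circlepath)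
  have "g' holomorphic_on cball 0 \<rho>" by (rule holomorphic_on_subset[OF g'(1) cb])
  then show "continuous_on (cball 0 \<rho>) g'" "g' holomorphic_on ball 0 \<rho>"
   using holomorphic_on_imp_continuous_on holomorphic_on_subset ball_subset_cball by blast+
 qed (use \<rho> in auto)
 then have *: "((\<lambda>u. g u / u) has_contour_integral (2 * of_real pi * \<i> * g' 0)) (circlepath 0 \<rho>)"
  by (rule has_contour_integral_eq) (use g'(2) eq k0 \<rho> in auto)
 have "g' 0 = g 0" using g'(2)[of 0] eq \<open>k 0 ~= 0\<close> \<open>0 \<in> S\<close> by auto
 then show ?thesis using contour_integral_unique[OF *] by simp
qed

text \<open>The direction \<open>v\<close> points from \<open>x0\<close> to a nearby point where
  \<open>h\<close> is nonzero, so \<open>h\<close> has an isolated zero at most at 0 on the line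
  through \<open>x0\<close> and is nonzero on a small circle. For base points near \<open>x0\<close>
  the circle still avoids the zeros of \<open>h\<close>, and Cauchy's integral over it defines the
  extension.\<close>

lemma Riemann_extension_local:
 fixes f h :: "complex^'n => complex"
 assumes h: "holomorphic_fun U h" and "convex U" and x1: "x1 \<in> U" "h x1 ~= 0"
  and f: "holomorphic_fun {x\<in>U. h x ~= 0} f"
  and x0: "x0 \<in> U" and e: "e > 0" "\<And>y. y \<in> U ==> dist y x0 < e ==> h y ~= 0 ==> norm (f y) \<le> B"
 obtains V F where "x0 \<in> V" "V \<subseteq> U" "holomorphic_fun V F" "\<And>x. x \<in> V ==> h x ~= 0 ==> F x = f x"
proof -
 have U: "open U" using h by (rule holomorphic_fun_open)
 define W where "W = ball x0 e \<inter> U"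
 have W: "open W" "convex W" "x0 \<in> W" "W \<subseteq> U"
  using U \<open>convex U\<close> x0 e by (auto simp: W_def convex_Int)
 obtain y where y: "y \<in> W" "h y ~= 0"
  using holomorphic_fun_nonzero_dense[OF h \<open>convex U\<close> x1 W(1)] W x0 by blast
 define v where "v = y - x0"
 define S where "S = (\<lambda>x. {t. x + t *s v \<in> W})"
 have S: "open (S x)" "connected (S x)" for x
  unfolding S_def using W by (auto intro: open_line_preimage convex_connected convex_line_preimage)
 have hol_line: "(\<lambda>t. h (x + t *s v)) holomorphic_on S x" for x
  by (rule holomorphic_on_line[OF h]) (use W in \<open>auto simp: S_def\<close>)
 have hv: "h (x0 + 1 *s v) ~= 0" using y by (simp add: v_def)
 have "0 \<in> S x0" "1 \<in> S x0" using W y by (auto simp: S_def v_def)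
 then obtain \<rho> where \<rho>: "0 < \<rho>" "cball 0 \<rho> \<subseteq> S x0" "\<And>t. t \<in> cball 0 \<rho> - {0} ==> h (x0 + t *s v) ~= 0"
  using nonzero_circle[OF hol_line[of x0] S _ _ hv zero_less_one] by blast
 have aff: "holomorphic_map UNIV (\<lambda>w. vtl w + w $ None *s v)"
  by (intro hol_intros open_UNIV)
 note cont_aff = holomorphic_map_continuous_on[OF aff]
 \<comment> \<open>\<open>W1\<close> keeps the whole disc inside \<open>W\<close>, where
   \<open>f\<close> is bounded off the zeros of \<open>h\<close>; \<open>W2\<close> keeps the circle
   off these zeros. Both are open conditions, so they hold over a common ball around
   \<open>x0\<close>.\<close>
 define W1 where "W1 = (\<lambda>w. vtl w + w $ None *s v) -` W"
 define W2 where "W2 = (\<lambda>w. vtl w + w $ None *s v) -` {x\<in>U. h x ~= 0} \<inter> (\<lambda>w. w $ None) -` (- {0})"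
 have W12: "open W1" "open W2"
  unfolding W1_def W2_def by (intro open_Int open_vimage cont_aff W open_nonzero[OF h] continuous_intros; simp)+
 obtain e1 where e1: "e1 > 0" "\<And>x t. dist x x0 < e1 ==> t \<in> cball 0 \<rho> ==> vcons x t \<in> W1"
  by (rule tube_vcons[OF W12(1) compact_cball, of 0 \<rho> x0]) (use \<rho>(2) in \<open>auto simp: W1_def S_def\<close>)
 have "vcons x0 t \<in> W2" if t: "t \<in> sphere 0 \<rho>" for t
 proof -
  have "t \<in> cball 0 \<rho> - {0}" using \<rho>(1) t by auto
  then have "h (x0 + t *s v) ~= 0" "x0 + t *s v \<in> U" "t ~= 0"
   using \<rho> W(4) by (auto simp: S_def)
  then show ?thesis by (simp add: W2_def)
 qed
 then obtain e2 where e2: "e2 > 0" "\<And>x t. dist x x0 < e2 ==> t \<in> sphere 0 \<rho> ==> vcons x t \<in> W2"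
  using tube_vcons[OF W12(2) compact_sphere, of 0 \<rho> x0] by blast
 define V where "V = ball x0 (min e1 e2)"
 have V1: "cball 0 \<rho> \<subseteq> S x" if "x \<in> V" for x
  using e1(2)[of x] that by (auto simp: V_def S_def W1_def dist_commute)
 have V2: "x + t *s v \<in> U \<and> h (x + t *s v) ~= 0 \<and> t ~= 0" if "x \<in> V" "norm t = \<rho>" for x t
  using e2(2)[of x t] that by (auto simp: V_def W2_def dist_commute)
 have \<Phi>: "holomorphic_fun W2 (\<lambda>w. f (vtl w + w $ None *s v) / w $ None)"
  by (intro hol_intros holomorphic_fun_compose[OF holomorphic_map_subset[OF aff W12(2)] f] W12(2))
    (auto simp: W2_def)
 have "holomorphic_fun V (\<lambda>x. contour_integral (circlepath 0 \<rho>)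
   (\<lambda>t. f (vtl (vcons x t) + vcons x t $ None *s v) / vcons x t $ None))"
  by (rule holomorphic_fun_contour_integral[OF \<Phi>])
    (use V2 \<rho>(1) in \<open>auto simp: V_def W2_def\<close>)
 then have F: "holomorphic_fun V (\<lambda>x. 1 / (2 * of_real pi * \<i>) * contour_integral (circlepath 0 \<rho>)
   (\<lambda>t. f (x + t *s v) / t))"
  by (auto intro!: hol_intros simp: V_def)
 show ?thesis
 proof (rule that[OF _ _ F])
  show "x0 \<in> V" using e1 e2 by (simp add: V_def)
  show "V \<subseteq> U"
  proof
   fix x assume "x \<in> V"
   then have "0 \<in> S x" using V1 \<rho>(1) by fastforce
   then show "x \<in> U" using W(4) by (auto simp: S_def)
  qed
  fix x assume x: "x \<in> V" "h x ~= 0"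
  have "(\<lambda>t. f (x + t *s v)) 0 = 1 / (2 * of_real pi * \<i>) *
    contour_integral (circlepath 0 \<rho>) (\<lambda>t. (\<lambda>t. f (x + t *s v)) t / t)"
  proof (rule Cauchy_formula_bounded_off_zeros[OF hol_line S \<rho>(1) V1[OF x(1)]])
   show "(\<lambda>t. f (x + t *s v)) holomorphic_on {t \<in> S x. h (x + t *s v) ~= 0}"
    by (rule holomorphic_on_line[OF f]) (use W(4) in \<open>auto simp: S_def\<close>)
   show "norm (f (x + t *s v)) \<le> B" if "t \<in> S x" "h (x + t *s v) ~= 0" for t
    by (rule e(2)) (use that in \<open>auto simp: S_def W_def dist_commute\<close>)
  qed (use V2 x in auto)
  then show "1 / (2 * of_real pi * \<i>) * contour_integral (circlepath 0 \<rho>) (\<lambda>t. f (x + t *s v) / t) = f x"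
   by simp
 qed
qed

text \<open>Each local extension is the limit of \<open>f\<close> along the dense set
  \<open>D\<close> where \<open>h\<close> is nonzero. Defining \<open>F\<close> as this limit makes
  all local extensions agree with \<open>F\<close> without any gluing.\<close>

theorem Riemann_extension:
 fixes f h :: "complex^'n => complex"
 assumes h: "holomorphic_fun U h" and cvx: "convex U" and x1: "x1 \<in> U" "h x1 ~= 0"
  and f: "holomorphic_fun {x\<in>U. h x ~= 0} f"
  and bdd: "\<And>x. x \<in> U ==> \<exists>e>0. \<exists>B. \<forall>y\<in>U. dist y x < e --> h y ~= 0 --> norm (f y) \<le> B"
 obtains F where "holomorphic_fun U F" "\<And>x. x \<in> U ==> h x ~= 0 ==> F x = f x"
proof -
 define D where "D = {x\<in>U. h x ~= 0}"
 define F where "F = (\<lambda>x. Lim (at x within D) f)"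
 have loc: "\<exists>V. x0 \<in> V \<and> V \<subseteq> U \<and> holomorphic_fun V F \<and> (\<forall>x\<in>V. h x ~= 0 --> F x = f x)"
  if x0: "x0 \<in> U" for x0
 proof -
  obtain e B where e: "e > 0" "\<And>y. y \<in> U ==> dist y x0 < e ==> h y ~= 0 ==> norm (f y) \<le> B"
   using bdd[OF x0] by blast
  obtain V G where V: "x0 \<in> V" "V \<subseteq> U" "holomorphic_fun V G" "\<And>x. x \<in> V ==> h x ~= 0 ==> G x = f x"
   using Riemann_extension_local[OF h cvx x1 f x0 e(1), of B] e(2) by metis
  have openV: "open V" using V(3) by (rule holomorphic_fun_open)
  have FG: "F x = G x" if x: "x \<in> V" for x
  proof -
   have "x islimpt D"
    unfolding islimpt_def
   proof safe
    fix T assume T: "x \<in> T" "open T"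
    have "\<exists>z\<in>T \<inter> V - {x}. True"
    proof -
     have "x islimpt (T \<inter> V)"
      by (rule interior_limit_point) (use T x openV in \<open>auto simp: interior_open\<close>)
     then show ?thesis using islimptE[of x "T \<inter> V" UNIV] by auto
    qed
    then have "(T \<inter> V - {x}) \<inter> U ~= {}" using V(2) by blast
    moreover have "open (T \<inter> V - {x})" using T openV by auto
    ultimately obtain y where "y \<in> T \<inter> V - {x}" "y \<in> U" "h y ~= 0"
     using holomorphic_fun_nonzero_dense[OF h cvx x1] by metis
    then show "\<exists>y\<in>D. y \<in> T \<and> y ~= x" by (auto simp: D_def)
   qed
   then have nt: "\<not> trivial_limit (at x within D)" by (simp add: trivial_limit_within)
   have "(G \<longlongrightarrow> G x) (at x)"
    using holomorphic_fun_continuous_on[OF V(3)] openV x continuous_on_eq_continuous_at isCont_def by blast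
   then have "(G \<longlongrightarrow> G x) (at x within D)" by (rule tendsto_within_subset) simp
   moreover have "eventually (\<lambda>y. y \<in> V) (at x within D)"
    by (rule eventually_at_topological[THEN iffD2]) (use openV x in blast)
   then have "eventually (\<lambda>y. f y = G y) (at x within D)"
    using eventually_at_topological[of "\<lambda>y. y \<in> D" x D] by (auto simp: eventually_at_filter D_def V(4) elim!: eventually_mono)
   ultimately have "(f \<longlongrightarrow> G x) (at x within D)" using tendsto_cong by blast
   then show ?thesis unfolding F_def by (rule tendsto_Lim[OF nt])
  qed
  show ?thesis
   using V holomorphic_fun_cong[OF V(3), of F] FG by metis
 qed
 show ?thesis
 proof
  show "holomorphic_fun U F"
   by (rule holomorphic_fun_local) (use loc in blast)
  show "\<And>x. x \<in> U ==> h x ~= 0 ==> F x = f x" using loc by blast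
 qed
qed

text \<open>The inverse function theorem over the reals supplies \<open>g\<close>; its derivative is
  the inverse of a complex matrix, hence complex linear. The maps to which this is applied are
  arranged to have the identity as derivative at the base point.\<close>

lemma holomorphic_inverse_function:
 fixes f :: "complex^'n => complex^'n"
 assumes f: "holomorphic_map U f" and x0: "x0 \<in> U" and j: "jac f x0 = mat 1"
 obtains U' V g where "open U'" "x0 \<in> U'" "U' \<subseteq> U" "open V" "bij_betw f U' V" "holomorphic_map V g"
  "\<And>x. x \<in> U' ==> g (f x) = x" "\<And>y. y \<in> V ==> g y \<in> U' \<and> f (g y) = y"
proof -
 define f' where "f' = (\<lambda>x. Blinfun ((*v) (jac f x)))"
 have f': "blinfun_apply (f' x) = (*v) (jac f x)" for x
  unfolding f'_def by (simp add: bounded_linear_Blinfun_apply bounded_linear_matrix_vector)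
 have cont: "continuous_on U f'"
 proof (rule continuous_on_blinfun_componentwise)
  fix b :: "complex^'n"
  have "continuous_on U (\<lambda>x. \<chi> i. scalar_product (jac f x $ i) b)"
   by (intro continuous_intros continuous_on_jac[OF f])
  then show "continuous_on U (\<lambda>x. blinfun_apply (f' x) b)"
   by (simp add: f' flip: matrix_vector_nth)
 qed
 have inv1: "id_blinfun o\<^sub>L f' x0 = id_blinfun"
  by (rule blinfun_eqI) (simp add: f' j)
 have der: "(f has_derivative blinfun_apply (f' x)) (at x)" if "x \<in> U" for x
  using has_derivative_jac[OF f that] by (simp add: f')
 obtain U' V g g' where *: "open U'" "U' \<subseteq> U" "x0 \<in> U'" "open V" "f x0 \<in> V" "homeomorphism U' V f g"
  "\<And>y. y \<in> V ==> (g has_derivative (g' y)) (at y)"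
  "\<And>y. y \<in> V ==> g' y = inv (blinfun_apply (f'(g y)))"
  "\<And>y. y \<in> V ==> bij (blinfun_apply (f'(g y)))"
  using inverse_function_theorem[OF holomorphic_map_open[OF f] der cont x0 inv1] by metis
 have hom: "\<And>x. x \<in> U' ==> g (f x) = x" "\<And>y. y \<in> V ==> f (g y) = y" "f ` U' = V" "g ` V = U'"
  using *(6) by (auto simp: homeomorphism_def)
 show ?thesis
 proof (rule that[of U' V g])
  show "bij_betw f U' V"
   unfolding bij_betw_def using hom by (metis inj_on_inverseI)
  show "holomorphic_map V g"
   unfolding holomorphic_map_iff
  proof (intro conjI ballI)
   show "open V" by fact
   fix y assume y: "y \<in> V"
   define A where "A = jac f (g y)"
   have bij: "bij ((*v) A)" using *(9)[OF y] by (simp add: f' A_def)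
   then obtain B where B: "B ** A = mat 1"
    using matrix_left_invertible_injective[of A] bij_is_inj by blast
   have "inv ((*v) A) w = B *v w" for w
   proof (rule inv_f_eq)
    show "inj ((*v) A)" using bij by (rule bij_is_inj)
    show "A *v (B *v w) = w"
     by (metis B bij bij_is_surj matrix_vector_mul_assoc matrix_vector_mul_lid surjE)
   qed
   then have "inv ((*v) A) = (*v) B" by auto
   then show "\<exists>M. (g has_derivative (*v) M) (at y)"
    using *(7,8)[OF y] by (auto simp: f' A_def)
  qed
  show "\<And>y. y \<in> V ==> g y \<in> U' \<and> f (g y) = y" using hom by blast
 qed (use * hom in auto)
qed

section \<open>Smooth points and local retractions\<close>

text \<open>In a basis \<open>B\<close> of the image, on which \<open>P\<close> is the identity,
  each basis vector contributes 1 to the trace. This converts dimensions of subspaces into traces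
  and back.\<close>

lemma trace_idempotent:
 fixes P :: "complex^'n^'n"
 assumes P: "P ** P = P"
 shows "trace P = of_nat (vec.dim (range ((*v) P)))"
proof -
 define L where "L = range ((*v) P)"
 have L: "vec.subspace L" unfolding L_def
  by (intro vec.subspace_UNIV vec.linear_subspace_image matrix_vector_mul_linear_gen)
 obtain B where B: "B \<subseteq> L" "vec.independent B" "L \<subseteq> vec.span B" "card B = vec.dim L"
  using vec.basis_exists[of L] by blast
 have span: "vec.span B = L" using B L by (metis subset_antisym vec.span_minimal)
 have finB: "finite B" using B(2) by (rule vec.finiteI_independent)
 have PL: "P *v b = b" if "b \<in> L" for b
  using that P by (auto simp: L_def matrix_vector_mul_assoc)
 have inL: "P *v v \<in> L" for v by (simp add: L_def)
 define \<phi> where "\<phi> = (\<lambda>b v. vec.representation B (P *v v) b)"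
 have \<phi>: "\<exists>a. \<phi> b = scalar_product a" for b
 proof (rule complex_linear_eq_scalar_product)
  show scale: "\<phi> b (c *s v) = c * \<phi> b v" for c v
   unfolding \<phi>_def
   by (simp add: B(2) inL span vec.representation_scale vec.scale matrix_vector_mult_scaleR
     vector_scalar_commute)
  show "linear (\<phi> b)"
  proof (rule linearI)
   show "\<phi> b (x + y) = \<phi> b x + \<phi> b y" for x y
    by (simp add: \<phi>_def matrix_vector_right_distrib B(2) inL span vec.representation_add)
   have "r *\<^sub>R x = of_real r *s x" for r and x :: "complex^'n"
    by (simp add: vec_eq_iff scaleR_conv_of_real[where 'a = complex])
   then show "\<phi> b (r *\<^sub>R x) = r *\<^sub>R \<phi> b x" for r x
    by (simp add: scale scaleR_conv_of_real[where 'a = complex])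
  qed
 qed
 have "(P *v axis i 1) $ i = (\<Sum>b\<in>B. \<phi> b (axis i 1) * b $ i)" for i
 proof -
  have "P *v axis i 1 = (\<Sum>b\<in>B. \<phi> b (axis i 1) *s b)"
   unfolding \<phi>_def using vec.sum_representation_eq[OF B(2), of "P *v axis i 1" B] inL span finB by simp
  then show ?thesis by (simp add: sum_component)
 qed
 moreover have "P $ i $ i = (P *v axis i 1) $ i" for i
  by (simp add: matrix_vector_nth)
 ultimately have "trace P = (\<Sum>i\<in>UNIV. \<Sum>b\<in>B. \<phi> b (axis i 1) * b $ i)"
  by (simp add: trace_def)
 also have "\<dots> = (\<Sum>b\<in>B. \<Sum>i\<in>UNIV. \<phi> b (axis i 1) * b $ i)"
  by (rule sum.swap)
 also have "\<dots> = (\<Sum>b\<in>B. \<phi> b b)"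
 proof (rule sum.cong)
  fix b
  obtain a where a: "\<phi> b = scalar_product a" using \<phi> by blast
  show "(\<Sum>i\<in>UNIV. \<phi> b (axis i 1) * b $ i) = \<phi> b b"
   unfolding a by (simp add: scalar_product_def[of a b])
 qed simp
 also have "\<dots> = (\<Sum>b\<in>B. 1)"
 proof (rule sum.cong)
  fix b assume "b \<in> B"
  then show "\<phi> b b = 1"
   using B PL by (auto simp: \<phi>_def vec.representation_basis)
 qed simp
 finally show ?thesis using B(4) by (simp add: L_def)
qed

lemma projection_exists:
 fixes L :: "(complex^'n) set"
 assumes "vec.subspace L"
 obtains P :: "complex^'n^'n" where "P ** P = P" "range ((*v) P) = L"
proof -
 have lin: "Vector_Spaces.linear (*s) (*s) (\<lambda>x::complex^'n. x)"
  using vec.linear_id by (simp add: id_def)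
 obtain g where g: "g ` UNIV \<subseteq> L" "Vector_Spaces.linear (*s) (*s) g" "\<forall>v\<in>L. g v = v"
  using vec.linear_exists_left_inverse_on[OF lin assms] by auto
 have M: "matrix g *v v = g v" for v
  using g(2) by (rule matrix_works)
 show ?thesis
 proof (rule that[of "matrix g"])
  show "matrix g ** matrix g = matrix g"
   by (rule matrix_eqI) (use g in \<open>auto simp: M simp flip: matrix_vector_mul_assoc\<close>)
  show "range ((*v) (matrix g)) = L"
   unfolding M using g by (auto simp: image_iff) metis
 qed
qed

lemma has_derivative_near_matrix:
 assumes "(f has_derivative (*v) M) (at p)" "open W" "p \<in> W" "\<And>x. x \<in> W ==> f x = g x"
 shows "(g has_derivative (*v) M) (at p)"
 using has_derivative_transform_within_open[OF assms(1-3)] assms(4) by blast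

lemma holomorphic_map_vimage_open:
 assumes "holomorphic_map U f" "open V" shows "open {x\<in>U. f x \<in> V}"
proof -
 have "open (U \<inter> f -` V)"
  by (intro continuous_open_preimage holomorphic_map_continuous_on[OF assms(1)]
    holomorphic_map_open[OF assms(1)] assms(2))
 moreover have "U \<inter> f -` V = {x\<in>U. f x \<in> V}" by auto
 ultimately show ?thesis by simp
qed

text \<open>Describes a submanifold near \<open>p\<close> by a retraction instead of a chart: the
  derivative at \<open>p\<close> projects onto the tangent space, and retractions are transported by
  composition. The image of \<open>U\<close> is required to lie in \<open>A\<close> but may leave
  \<open>U\<close>, which is why later constructions shrink to points \<open>x\<close> with
  \<open>\<sigma> x \<in> U\<close>.\<close>

definition local_retraction ::
 "(complex^'n) set => complex^'n => (complex^'n) set => (complex^'n => complex^'n) => bool" where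
 "local_retraction A p U \<sigma> \<longleftrightarrow> holomorphic_map U \<sigma> \<and> p \<in> U \<and> p \<in> A \<and> \<sigma> ` U \<subseteq> A \<and> (\<forall>x\<in>A \<inter> U. \<sigma> x = x)"

lemma local_retractionD:
 assumes "local_retraction A p U \<sigma>"
 shows "holomorphic_map U \<sigma>" "open U" "p \<in> U" "p \<in> A" "\<And>x. x \<in> U ==> \<sigma> x \<in> A"
  "\<And>x. x \<in> A ==> x \<in> U ==> \<sigma> x = x" "\<sigma> p = p"
  "(\<sigma> has_derivative (*v) (jac \<sigma> p)) (at p)"
 using assms by (auto simp: local_retraction_def intro: has_derivative_jac dest: holomorphic_map_open)

text \<open>Differentiate the identity between \<open>\<tau>\<close> and \<open>\<tau>\<close>
  followed by \<open>\<sigma>\<close>, valid near \<open>q\<close> because \<open>\<tau>\<close>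
  takes values in \<open>A\<close>.\<close>

lemma local_retraction_jac_absorb:
 assumes "local_retraction A p U \<sigma>" "(\<tau> has_derivative (*v) N) (at q)" "\<tau> q = p"
  "open W" "q \<in> W" "\<And>x. x \<in> W ==> \<tau> x \<in> A" "continuous_on W \<tau>"
 shows "jac \<sigma> p ** N = N"
proof -
 note r = local_retractionD[OF assms(1)]
 have "open (W \<inter> \<tau> -` U)" using assms r by (intro continuous_open_preimage)
 then have "((\<lambda>x. \<sigma> (\<tau> x)) has_derivative (*v) N) (at q)"
  by (rule has_derivative_near_matrix[OF assms(2)]) (use assms r in auto)
 moreover have "((\<lambda>x. \<sigma> (\<tau> x)) has_derivative (*v) (jac \<sigma> p ** N)) (at q)"
  using has_derivative_compose_matrix[OF assms(2)] r(8) assms(3) by simp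
 ultimately show ?thesis using jac_eqI by metis
qed

lemma local_retraction_idempotent:
 assumes "local_retraction A p U \<sigma>"
 shows "jac \<sigma> p ** jac \<sigma> p = jac \<sigma> p"
 using local_retraction_jac_absorb[OF assms local_retractionD(8)[OF assms] local_retractionD(7,2,3)[OF assms]]
  local_retractionD[OF assms] holomorphic_map_continuous_on by blast

text \<open>In the chart, retract by a linear projection onto \<open>L\<close>. The derivative of
  the resulting map is conjugate to this projection, so the traces agree.\<close>

lemma smooth_point_imp_retraction:
 fixes A :: "(complex^'n) set"
 assumes "smooth_point A p d"
 obtains U \<sigma> where "local_retraction A p U \<sigma>" "trace (jac \<sigma> p) = of_nat d"
proof -
 obtain U V f L where *: "p \<in> A" "p \<in> U" "biholomorphic U V f" "vec.subspace L" "vec.dim L = d"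
   "f ` (A \<inter> U) = L \<inter> V"
  using assms unfolding smooth_point_def by blast
 obtain g where f: "bij_betw f U V" "holomorphic_map U f" and g: "holomorphic_map V g" "\<And>x. x \<in> U ==> g (f x) = x"
  using *(3) unfolding biholomorphic_def by blast
 obtain P :: "complex^'n^'n" where P: "P ** P = P" "range ((*v) P) = L"
  using projection_exists[OF *(4)] .
 have PL: "P *v b = b" if "b \<in> L" for b
  using that P by (auto simp: matrix_vector_mul_assoc)
 define U' where "U' = {x\<in>U. P *v f x \<in> V}"
 have holPf: "holomorphic_map U (\<lambda>x. P *v f x)" by (intro hol_intros f)
 have U': "open U'"
  unfolding U'_def by (rule holomorphic_map_vimage_open[OF holPf holomorphic_map_open[OF g(1)]])
 define \<sigma> where "\<sigma> = (\<lambda>x. g (P *v f x))"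
 have fp: "f p \<in> L \<inter> V" using * by blast
 have ret: "local_retraction A p U' \<sigma>"
  unfolding local_retraction_def
 proof (intro conjI)
  show "holomorphic_map U' \<sigma>" unfolding \<sigma>_def
   by (rule holomorphic_map_compose[OF holomorphic_map_subset[OF holPf U'] g(1)]) (auto simp: U'_def)
  show "p \<in> U'" using fp PL * by (auto simp: U'_def)
  show "\<sigma> ` U' \<subseteq> A"
  proof safe
   fix x assume "x \<in> U'"
   then have "P *v f x \<in> f ` (A \<inter> U)" using *(6) P by (auto simp: U'_def)
   then show "\<sigma> x \<in> A" using g by (auto simp: \<sigma>_def)
  qed
  show "\<forall>x\<in>A \<inter> U'. \<sigma> x = x"
  proof
   fix x assume x: "x \<in> A \<inter> U'"
   then have "x \<in> U" by (simp add: U'_def)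
   then have "f x \<in> L" using *(6) x by blast
   then show "\<sigma> x = x" using PL g(2)[OF \<open>x \<in> U\<close>] by (simp add: \<sigma>_def)
  qed
 qed fact
 have df: "(f has_derivative (*v) (jac f p)) (at p)" using has_derivative_jac[OF f(2) *(2)] .
 have dg: "(g has_derivative (*v) (jac g (f p))) (at (f p))" using has_derivative_jac[OF g(1)] fp by blast
 have "((\<lambda>x. g (f x)) has_derivative (*v) (jac g (f p) ** jac f p)) (at p)"
  by (rule has_derivative_compose_matrix[OF df dg])
 moreover have "((\<lambda>x. g (f x)) has_derivative (*v) (mat 1)) (at p)"
 proof -
  have "((\<lambda>x. x) has_derivative (*v) (mat 1 :: complex^'n^'n)) (at p)"
   by (rule has_derivative_eq_rhs[OF has_derivative_ident]) auto
  then show ?thesis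
   by (rule has_derivative_near_matrix) (use holomorphic_map_open[OF f(2)] *(2) g(2) in auto)
 qed
 ultimately have inv: "jac g (f p) ** jac f p = mat 1" using jac_eqI by metis
 have "((\<lambda>x. P *v f x) has_derivative (*v) (P ** jac f p)) (at p)"
  using has_derivative_compose[OF df bounded_linear_imp_has_derivative[OF bounded_linear_matrix_vector]]
  by (simp add: matrix_vector_mul_assoc)
 then have "(\<sigma> has_derivative (*v) (jac g (f p) ** (P ** jac f p))) (at p)"
  unfolding \<sigma>_def by (rule has_derivative_compose_matrix) (use dg fp PL in auto)
 then have "trace (jac \<sigma> p) = trace (jac g (f p) ** (P ** jac f p))"
  by (simp add: jac_eqI)
 also have "\<dots> = trace (P ** (jac f p ** jac g (f p)))"
  by (subst trace_mul_sym) (simp add: matrix_mul_assoc)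
 also have "\<dots> = of_nat d"
  using inv trace_idempotent[OF P(1)] P(2) *(5) by (simp add: matrix_left_right_inverse)
 finally show ?thesis using that ret by blast
qed

text \<open>The fixed points of a holomorphic retraction form a submanifold: the map
  \<open>\<Theta>\<close> straightens them, having \<open>P *v (x - p)\<close> as its value at a
  fixed point \<open>x\<close>.\<close>

lemma retraction_imp_smooth_point:
 fixes A :: "(complex^'n) set"
 assumes "local_retraction A p U \<sigma>"
 shows "smooth_point A p (vec.dim (range ((*v) (jac \<sigma> p))))"
proof -
 note r = local_retractionD[OF assms]
 define P where "P = jac \<sigma> p"
 have P: "P ** P = P" unfolding P_def by (rule local_retraction_idempotent[OF assms])
 have PP: "P *v (P *v v) = P *v v" for v by (simp add: matrix_vector_mul_assoc P)
 \<comment> \<open>The sum of \<open>P\<close> applied to \<open>\<sigma> x - p\<close> and of the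
   complementary projection applied to \<open>x - \<sigma> x\<close>. Its derivative at
   \<open>p\<close> is \<open>P\<close> squared plus the square of the complementary projection,
   hence the identity.\<close>
 define \<Theta> where "\<Theta> = (\<lambda>x. P *v (\<sigma> x - p) + (x - \<sigma> x) - P *v (x - \<sigma> x))"
 define U0 where "U0 = {x\<in>U. \<sigma> x \<in> U}"
 have U0: "open U0" unfolding U0_def by (rule holomorphic_map_vimage_open[OF r(1,2)])
 have hol: "holomorphic_map U \<Theta>"
  unfolding \<Theta>_def by (intro hol_intros r)
 have "(\<Theta> has_derivative (*v) (mat 1)) (at p)"
  unfolding \<Theta>_def
  by (rule derivative_eq_intros r(8) bounded_linear.has_derivative[OF bounded_linear_matrix_vector] refl)+
    (auto simp: fun_eq_iff P_def[symmetric] matrix_vector_mult_diff_distrib PP)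
 then have "jac \<Theta> p = mat 1" by (rule jac_eqI)
 moreover have "p \<in> U0" using r by (simp add: U0_def)
 moreover have "holomorphic_map U0 \<Theta>"
  by (rule holomorphic_map_subset[OF hol U0]) (auto simp: U0_def)
 ultimately obtain U1 V1 g where IFT: "open U1" "p \<in> U1" "U1 \<subseteq> U0" "open V1" "bij_betw \<Theta> U1 V1"
  "holomorphic_map V1 g" "\<And>x. x \<in> U1 ==> g (\<Theta> x) = x" "\<And>y. y \<in> V1 ==> g y \<in> U1 \<and> \<Theta> (g y) = y"
  using holomorphic_inverse_function[of U0 \<Theta> p] by metis
 have hol1: "holomorphic_map U1 \<sigma>"
  by (rule holomorphic_map_subset[OF r(1) IFT(1)]) (use IFT(3) in \<open>auto simp: U0_def\<close>)
 define U2 where "U2 = {x\<in>U1. \<sigma> x \<in> U1}"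
 have U2: "open U2" unfolding U2_def by (rule holomorphic_map_vimage_open[OF hol1 IFT(1)])
 define V2 where "V2 = {y\<in>V1. g y \<in> U2}"
 have V2: "open V2" unfolding V2_def by (rule holomorphic_map_vimage_open[OF IFT(6) U2])
 define L where "L = range ((*v) P)"
 have bij2: "bij_betw \<Theta> U2 V2"
 proof (rule bij_betwI[where g = g])
  show "\<Theta> \<in> U2 \<rightarrow> V2"
   using IFT(5,7) by (auto simp: U2_def V2_def bij_betw_def)
  show "g \<in> V2 \<rightarrow> U2" by (auto simp: V2_def)
 qed (use IFT in \<open>auto simp: U2_def V2_def\<close>)
 have "biholomorphic U2 V2 \<Theta>"
  unfolding biholomorphic_def
 proof (intro conjI exI[of _ g] bij2)
  show "holomorphic_map U2 \<Theta>"
   by (rule holomorphic_map_subset[OF hol U2]) (use IFT(3) in \<open>auto simp: U0_def U2_def\<close>)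
  show "holomorphic_map V2 g"
   by (rule holomorphic_map_subset[OF IFT(6) V2]) (auto simp: V2_def)
  show "\<forall>x\<in>U2. g (\<Theta> x) = x" using IFT(7) by (auto simp: U2_def)
 qed
 moreover have "vec.subspace L" unfolding L_def
  by (intro vec.subspace_UNIV vec.linear_subspace_image matrix_vector_mul_linear_gen)
 moreover have "\<Theta> ` (A \<inter> U2) = L \<inter> V2"
 proof safe
  fix x assume x: "x \<in> A" "x \<in> U2"
  then have "\<sigma> x = x" using r(6) IFT(3) by (auto simp: U2_def U0_def)
  then have "\<Theta> x = P *v (x - p)" by (simp add: \<Theta>_def)
  then show "\<Theta> x \<in> L" by (simp add: L_def)
  show "\<Theta> x \<in> V2" using x bij2 by (auto simp: bij_betw_def)
 next
  fix y assume y: "y \<in> L" "y \<in> V2"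
  define x where "x = g y"
  have x: "x \<in> U2" "\<Theta> x = y" using y IFT by (auto simp: V2_def x_def)
  then have xU: "x \<in> U1" "\<sigma> x \<in> U1" "\<sigma> x \<in> U" "\<sigma> x \<in> A" using IFT(3) r(5) by (auto simp: U2_def U0_def)
  \<comment> \<open>If \<open>\<Theta> x\<close> lies in the range of \<open>P\<close>, its
    component from \<open>x - \<sigma> x\<close> is zero and \<open>\<Theta>\<close> takes the same
    value at \<open>\<sigma> x\<close>; injectivity of \<open>\<Theta>\<close> then gives
    \<open>\<sigma> x = x\<close>.\<close>
  have "y = P *v y" using y(1) PP by (auto simp: L_def)
  also have "\<dots> = P *v (\<sigma> x - p)"
  proof -
   have "P *v (P *v u + w - P *v w) = P *v u" for u w
    by (simp add: matrix_vector_mult_diff_distrib matrix_vector_right_distrib PP)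
   then show ?thesis unfolding x(2)[symmetric] \<Theta>_def by blast
  qed
  also have "\<dots> = \<Theta> (\<sigma> x)"
   using r(6)[OF xU(4,3)] by (simp add: \<Theta>_def)
  finally have "\<sigma> x = x" using IFT(7) xU(1,2) x(2) by metis
  then show "y \<in> \<Theta> ` (A \<inter> U2)" using x xU by force
 qed
 moreover have "p \<in> U2" using IFT(2) r(7) by (simp add: U2_def)
 ultimately show ?thesis
  unfolding smooth_point_def using r(4) by (auto simp: L_def P_def)
qed

theorem smooth_point_iff_retraction:
 "smooth_point A p d \<longleftrightarrow> (\<exists>U \<sigma>. local_retraction A p U \<sigma> \<and> trace (jac \<sigma> p) = of_nat d)"
proof
 assume "smooth_point A p d"
 then show "\<exists>U \<sigma>. local_retraction A p U \<sigma> \<and> trace (jac \<sigma> p) = of_nat d"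
  using smooth_point_imp_retraction by metis
next
 assume "\<exists>U \<sigma>. local_retraction A p U \<sigma> \<and> trace (jac \<sigma> p) = of_nat d"
 then obtain U \<sigma> where *: "local_retraction A p U \<sigma>" "trace (jac \<sigma> p) = of_nat d" by blast
 have "of_nat d = (of_nat (vec.dim (range ((*v) (jac \<sigma> p)))) :: complex)"
  using trace_idempotent[OF local_retraction_idempotent[OF *(1)]] *(2) by simp
 then have "d = vec.dim (range ((*v) (jac \<sigma> p)))" by (simp only: of_nat_eq_iff)
 then show "smooth_point A p d" using retraction_imp_smooth_point[OF *(1)] by simp
qed

lemma smooth_pointI_retraction:
 assumes "holomorphic_map U \<sigma>" "p \<in> U" "p \<in> A" "\<And>x. x \<in> U ==> \<sigma> x \<in> A"
  "\<And>x. x \<in> A ==> x \<in> U ==> \<sigma> x = x" "(\<sigma> has_derivative (*v) M) (at p)" "trace M = of_nat d"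
 shows "smooth_point A p d"
 unfolding smooth_point_iff_retraction local_retraction_def using assms jac_eqI[OF assms(6)] by blast

lemma smooth_point_in: "smooth_point A p d ==> p \<in> A"
 by (simp add: smooth_point_def)

text \<open>Two retractions onto the same set absorb each other: the projections satisfy
  \<open>P ** Q = Q\<close> and \<open>Q ** P = P\<close>, and the traces of the two products are
  equal.\<close>

lemma smooth_point_unique:
 assumes "smooth_point A p d" "smooth_point A p e"
 shows "d = e"
proof -
 obtain U \<sigma> where \<sigma>: "local_retraction A p U \<sigma>" "trace (jac \<sigma> p) = of_nat d"
  using smooth_point_imp_retraction[OF assms(1)] .
 obtain V \<tau> where \<tau>: "local_retraction A p V \<tau>" "trace (jac \<tau> p) = of_nat e"
  using smooth_point_imp_retraction[OF assms(2)] .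
 note r = local_retractionD[OF \<sigma>(1)] and s = local_retractionD[OF \<tau>(1)]
 have "jac \<sigma> p ** jac \<tau> p = jac \<tau> p"
  by (rule local_retraction_jac_absorb[OF \<sigma>(1) s(8,7,2,3)])
    (use s holomorphic_map_continuous_on in auto)
 moreover have "jac \<tau> p ** jac \<sigma> p = jac \<sigma> p"
  by (rule local_retraction_jac_absorb[OF \<tau>(1) r(8,7,2,3)])
    (use r holomorphic_map_continuous_on in auto)
 ultimately have "trace (jac \<sigma> p) = trace (jac \<tau> p)" by (metis trace_mul_sym)
 then show ?thesis using \<sigma> \<tau> by simp
qed

lemma smooth_point_nearby:
 assumes "smooth_point A p d"
 obtains U where "open U" "p \<in> U" "\<And>q. q \<in> A ==> q \<in> U ==> smooth_point A q d"
proof -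
 obtain U V f L where *: "p \<in> A" "p \<in> U" "biholomorphic U V f" "vec.subspace L" "vec.dim L = d"
   "f ` (A \<inter> U) = L \<inter> V"
  using assms unfolding smooth_point_def by blast
 show ?thesis
 proof (rule that[of U])
  show "open U" using *(3) by (auto simp: biholomorphic_def dest: holomorphic_map_open)
 qed (use * in \<open>auto simp: smooth_point_def\<close>)
qed

text \<open>The maps are inverse to each other only along the two sets, and the ambient dimensions
  may differ. The retraction onto \<open>B\<close> is \<open>G\<close> followed by
  \<open>\<sigma>\<close> and \<open>F\<close>; cyclic invariance of the trace shows that the
  dimension is kept.\<close>

lemma smooth_point_transfer:
 fixes A :: "(complex^'n) set" and B :: "(complex^'m) set"
 assumes A: "smooth_point A p d" and F: "holomorphic_map U F" "p \<in> U" and G: "holomorphic_map V G" "F p \<in> V"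
  and FB: "\<And>x. x \<in> A ==> x \<in> U ==> F x \<in> B" and GA: "\<And>y. y \<in> B ==> y \<in> V ==> G y \<in> A"
  and GF: "\<And>x. x \<in> A ==> x \<in> U ==> F x \<in> V ==> G (F x) = x"
  and FG: "\<And>y. y \<in> B ==> y \<in> V ==> G y \<in> U ==> F (G y) = y"
 shows "smooth_point B (F p) d"
proof -
 obtain W \<sigma> where \<sigma>: "local_retraction A p W \<sigma>" "trace (jac \<sigma> p) = of_nat d"
  using smooth_point_imp_retraction[OF A] .
 note r = local_retractionD[OF \<sigma>(1)]
 have Gp: "G (F p) = p" using GF r F G by auto
 define W1 where "W1 = {x\<in>W. \<sigma> x \<in> U}"
 have W1: "open W1" unfolding W1_def
  by (rule holomorphic_map_vimage_open[OF r(1) holomorphic_map_open[OF F(1)]])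
 have hol1: "holomorphic_map W1 (\<lambda>x. F (\<sigma> x))"
  by (rule holomorphic_map_compose[OF holomorphic_map_subset[OF r(1) W1] F(1)]) (auto simp: W1_def)
 define W2 where "W2 = {y\<in>V. G y \<in> W1}"
 have W2: "open W2" unfolding W2_def by (rule holomorphic_map_vimage_open[OF G(1) W1])
 have hol2: "holomorphic_map W2 (\<lambda>y. F (\<sigma> (G y)))"
  by (rule holomorphic_map_compose[OF holomorphic_map_subset[OF G(1) W2] hol1]) (auto simp: W2_def)
 have dG: "(G has_derivative (*v) (jac G (F p))) (at (F p))"
  using has_derivative_jac[OF G] .
 have dF: "(F has_derivative (*v) (jac F p)) (at p)"
  using has_derivative_jac[OF F] .
 have dFs: "((\<lambda>x. F (\<sigma> x)) has_derivative (*v) (jac F p ** jac \<sigma> p)) (at p)"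
  by (rule has_derivative_compose_matrix[OF r(8)]) (use dF r in simp)
 have "smooth_point B (F p) d"
 proof (rule smooth_pointI_retraction[OF hol2])
  show "((\<lambda>y. F (\<sigma> (G y))) has_derivative (*v) ((jac F p ** jac \<sigma> p) ** jac G (F p))) (at (F p))"
   by (rule has_derivative_compose_matrix[OF dG]) (use dFs Gp in simp)
  define W3 where "W3 = {x\<in>W1. F (\<sigma> x) \<in> V}"
  have W3: "open W3" unfolding W3_def
   by (rule holomorphic_map_vimage_open[OF hol1 holomorphic_map_open[OF G(1)]])
  have "((\<lambda>x. G (F (\<sigma> x))) has_derivative (*v) (jac G (F p) ** (jac F p ** jac \<sigma> p))) (at p)"
   by (rule has_derivative_compose_matrix[OF dFs]) (use dG r in simp)
  moreover have "((\<lambda>x. G (F (\<sigma> x))) has_derivative (*v) (jac \<sigma> p)) (at p)"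
   by (rule has_derivative_near_matrix[OF r(8) W3])
     (use r GF F G in \<open>auto simp: W3_def W1_def\<close>)
  ultimately have "jac G (F p) ** (jac F p ** jac \<sigma> p) = jac \<sigma> p" using jac_eqI by metis
  then show "trace ((jac F p ** jac \<sigma> p) ** jac G (F p)) = of_nat d"
   using \<sigma>(2) by (subst trace_mul_sym) simp
 qed (use r F G Gp FB GA FG in \<open>auto simp: W2_def W1_def\<close>)
 then show ?thesis .
qed

lemma smooth_point_local:
 assumes "smooth_point A p d" "open W" "p \<in> W" "A \<inter> W = B \<inter> W"
 shows "smooth_point B p d"
 using smooth_point_transfer[OF assms(1), of W "\<lambda>x. x" W "\<lambda>x. x" B] assms(2-4)
 by (auto intro!: hol_intros)

lemma smooth_point_bounded:
 fixes A :: "(complex^'n) set"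
 assumes "smooth_point A p d" shows "d \<le> CARD('n)"
proof -
 obtain L :: "(complex^'n) set" where "vec.dim L = d"
  using assms unfolding smooth_point_def by blast
 then show ?thesis using vec.dim_subset_UNIV[of L] by (simp add: vec.dimension_def card_cart_basis)
qed

text \<open>The components of \<open>x - \<sigma> x\<close> vanish on \<open>A\<close>, so a tangent
  vector is fixed by the derivative of \<open>\<sigma>\<close>. Conversely, a function vanishing on
  \<open>A\<close> becomes locally zero after composition with \<open>\<sigma>\<close>.\<close>

lemma tangent_space_retraction:
 fixes A :: "(complex^'n) set"
 assumes "local_retraction A p U \<sigma>"
 shows "tangent_space A p = range ((*v) (jac \<sigma> p))"
proof
 note r = local_retractionD[OF assms]
 show "tangent_space A p \<subseteq> range ((*v) (jac \<sigma> p))"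
 proof
  fix v assume v: "v \<in> tangent_space A p"
  have "(jac \<sigma> p *v v) $ i = v $ i" for i
  proof -
   have hol: "holomorphic_fun U (\<lambda>x. x $ i - \<sigma> x $ i)"
    by (intro hol_intros r)
   have "((\<lambda>x. x $ i - \<sigma> x $ i) has_derivative (\<lambda>v. v $ i - (jac \<sigma> p *v v) $ i)) (at p)"
    by (intro has_derivative_diff bounded_linear.has_derivative[OF bounded_linear_vec_nth] r(8)
      has_derivative_ident)
   then have "((\<lambda>x. x $ i - \<sigma> x $ i) has_derivative scalar_product (axis i 1 - jac \<sigma> p $ i)) (at p)"
    by (rule has_derivative_eq_rhs) (auto simp: scalar_product_diff_left matrix_vector_nth)
   moreover have van: "\<forall>x\<in>A \<inter> U. x $ i - \<sigma> x $ i = 0" using r(6) by auto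
   ultimately have "scalar_product (axis i 1 - jac \<sigma> p $ i) v = 0"
    using v hol r(3) van unfolding tangent_space_def by blast
   then show ?thesis by (simp add: scalar_product_diff_left matrix_vector_nth)
  qed
  then have "v = jac \<sigma> p *v v" by (simp add: vec_eq_iff)
  then show "v \<in> range ((*v) (jac \<sigma> p))" by blast
 qed
 show "range ((*v) (jac \<sigma> p)) \<subseteq> tangent_space A p"
 proof safe
  fix v
  show "jac \<sigma> p *v v \<in> tangent_space A p"
   unfolding tangent_space_def
  proof safe
   fix V f a
   assume V: "p \<in> V" "holomorphic_fun V f" "\<forall>x\<in>A \<inter> V. f x = 0"
    and f: "(f has_derivative scalar_product a) (at p)"
   define W where "W = {x\<in>U. \<sigma> x \<in> V}"
   have W: "open W" unfolding W_def
    by (rule holomorphic_map_vimage_open[OF r(1) holomorphic_fun_open[OF V(2)]])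
   have "((\<lambda>x. f (\<sigma> x)) has_derivative (\<lambda>v. 0)) (at p)"
    by (rule has_derivative_transform_within_open[OF has_derivative_const W])
      (use r V in \<open>auto simp: W_def\<close>)
   moreover have "((\<lambda>x. f (\<sigma> x)) has_derivative scalar_product (a v* jac \<sigma> p)) (at p)"
    by (rule has_derivative_compose_scalar_product[OF r(8)]) (use f r(7) in simp)
   ultimately have "scalar_product (a v* jac \<sigma> p) = (\<lambda>v. 0)"
    using has_derivative_unique by blast
   then show "scalar_product a (jac \<sigma> p *v v) = 0"
    by (simp add: scalar_product_matrix_vector)
  qed
 qed
qed

text \<open>With a projection \<open>R\<close> onto \<open>D\<close>, some coordinate of
  \<open>w - R *v w\<close> is nonzero. Taking this coordinate of \<open>a - R *v a\<close> is a
  linear form in \<open>a\<close> that kills \<open>D\<close>; since the pairing is symmetric, its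
  coefficients form \<open>v\<close>.\<close>

lemma subspace_separation:
 fixes D :: "(complex^'n) set"
 assumes "vec.subspace D" "w \<notin> D"
 obtains v where "\<And>a. a \<in> D ==> scalar_product a v = 0" "scalar_product w v ~= 0"
proof -
 obtain R :: "complex^'n^'n" where R: "R ** R = R" "range ((*v) R) = D"
  using projection_exists[OF assms(1)] .
 have RD: "R *v a = a" if "a \<in> D" for a
  using that R by (auto simp: matrix_vector_mul_assoc)
 have "w ~= R *v w" using assms(2) R(2) by blast
 then obtain i where i: "w $ i ~= (R *v w) $ i" by (auto simp: vec_eq_iff)
 define v where "v = axis i 1 - R $ i"
 have comm: "scalar_product a v = scalar_product v a" for a
  by (simp add: scalar_product_def mult.commute)
 have v: "scalar_product a v = a $ i - (R *v a) $ i" for a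
  unfolding comm by (simp add: v_def scalar_product_diff_left matrix_vector_nth)
 show ?thesis
  by (rule that[of v]) (use v i RD in auto)
qed

lemma tangent_space_subspace: "vec.subspace (tangent_space A p)"
 by (rule vec.subspaceI)
   (auto simp: tangent_space_def scalar_product_add_right scalar_product_scale_right)

lemma tangent_spaceD:
 assumes "v \<in> tangent_space A p" "holomorphic_fun U f" "p \<in> U" "\<And>x. x \<in> A ==> x \<in> U ==> f x = 0"
 shows "scalar_product (grad f p) v = 0"
 using assms has_derivative_grad[OF assms(2,3)] unfolding tangent_space_def by blast

text \<open>The differentials of vanishing germs form a subspace \<open>D\<close>, and the tangent
  space is its annihilator; in finite dimension the double annihilator of \<open>D\<close> is
  \<open>D\<close>.\<close>

lemma tangent_space_annihilator:
 fixes w :: "complex^'n"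
 assumes w: "\<And>v. v \<in> tangent_space A p ==> scalar_product w v = 0"
 shows "\<exists>U g. p \<in> U \<and> holomorphic_fun U g \<and> (\<forall>x\<in>A \<inter> U. g x = 0) \<and>
  (g has_derivative scalar_product w) (at p)"
proof -
 define D where "D = {a. \<exists>U g. p \<in> U \<and> holomorphic_fun U g \<and> (\<forall>x\<in>A \<inter> U. g x = 0) \<and>
   (g has_derivative scalar_product a) (at p)}"
 have "vec.subspace D"
 proof (rule vec.subspaceI)
  have "scalar_product 0 = (\<lambda>v::complex^'n. 0)" by auto
  then show "0 \<in> D"
   unfolding D_def by (intro CollectI exI[of _ UNIV] exI[of _ "\<lambda>x. 0"]) (auto intro!: hol_intros)
 next
  fix a b assume "a \<in> D" "b \<in> D"
  then obtain U f V g where *: "p \<in> U" "holomorphic_fun U f" "\<forall>x\<in>A \<inter> U. f x = 0"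
    "(f has_derivative scalar_product a) (at p)"
    "p \<in> V" "holomorphic_fun V g" "\<forall>x\<in>A \<inter> V. g x = 0" "(g has_derivative scalar_product b) (at p)"
   unfolding D_def by blast
  have UV: "open (U \<inter> V)" using * holomorphic_fun_open by blast
  have "((\<lambda>x. f x + g x) has_derivative scalar_product (a + b)) (at p)"
   using has_derivative_add[OF *(4,8)] by (rule has_derivative_eq_rhs) (auto simp: scalar_product_add_left)
  moreover have "holomorphic_fun (U \<inter> V) (\<lambda>x. f x + g x)"
   by (intro hol_intros holomorphic_fun_subset[OF *(2) UV] holomorphic_fun_subset[OF *(6) UV]) auto
  ultimately show "a + b \<in> D" unfolding D_def using *
   by (intro CollectI exI[of _ "U \<inter> V"] exI[of _ "\<lambda>x. f x + g x"]) auto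
 next
  fix c a assume "a \<in> D"
  then obtain U f where *: "p \<in> U" "holomorphic_fun U f" "\<forall>x\<in>A \<inter> U. f x = 0"
    "(f has_derivative scalar_product a) (at p)"
   unfolding D_def by blast
  have "((\<lambda>x. c * f x) has_derivative scalar_product (c *s a)) (at p)"
   using has_derivative_mult_right[OF *(4)] by (rule has_derivative_eq_rhs) (auto simp: scalar_product_scale_left)
  moreover have "holomorphic_fun U (\<lambda>x. c * f x)"
   using * by (intro hol_intros holomorphic_fun_open[OF *(2)])
  ultimately show "c *s a \<in> D" unfolding D_def using *
   by (intro CollectI exI[of _ U] exI[of _ "\<lambda>x. c * f x"]) auto
 qed
 have "w \<in> D"
 proof (rule ccontr)
  assume "w \<notin> D"
  then obtain v where v: "\<And>a. a \<in> D ==> scalar_product a v = 0" "scalar_product w v ~= 0"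
   using subspace_separation[OF \<open>vec.subspace D\<close>] by blast
  have "v \<in> tangent_space A p"
   unfolding tangent_space_def using v(1) unfolding D_def by blast
  then show False using w v(2) by blast
 qed
 then show ?thesis unfolding D_def by (rule CollectD)
qed

lemma dim_eq_imp_surj:
 fixes J :: "complex^'n^'n"
 assumes J: "N ** J = mat 1" and S: "vec.subspace S" and T: "vec.subspace T"
  and sub: "(*v) J ` S \<subseteq> T" and dim: "vec.dim T \<le> vec.dim S" and v: "v \<in> T"
 shows "\<exists>w\<in>S. J *v w = v"
proof -
 have lin: "Vector_Spaces.linear (*s) (*s) ((*v) J)" by (rule matrix_vector_mul_linear_gen)
 have inj: "inj ((*v) J)" using J matrix_left_invertible_injective by blast
 have "vec.dim ((*v) J ` S) = vec.dim S"
  by (rule vec.dim_image_eq[OF lin]) (use inj in \<open>auto intro: inj_on_subset\<close>)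
 moreover have "vec.subspace ((*v) J ` S)"
  by (rule vec.linear_subspace_image[OF lin S])
 ultimately have "(*v) J ` S = T"
  using vec.subspace_dim_equal[of "(*v) J ` S" T] sub dim T by simp
 then show ?thesis using v by auto
qed

text \<open>At a point where the tangent space has minimal dimension, functions vanishing on \<open>A\<close> have,
 in suitable coordinates, all their derivatives along the tangent space vanishing again on \<open>A\<close>;
 the identity theorem then shows that \<open>A\<close> fills the tangent space.\<close>

theorem analytic_set_has_smooth_point:
 fixes \<Omega> :: "(complex^'n) set"
 assumes \<Omega>: "open \<Omega>" and F: "\<And>f. f \<in> F ==> holomorphic_fun \<Omega> f"
  and A: "A = {x\<in>\<Omega>. \<forall>f\<in>F. f x = 0}" and "A ~= {}"
 shows "\<exists>p d. smooth_point A p d"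
proof -
 define Tg where "Tg = tangent_space A"
 obtain p where p: "p \<in> A" "\<And>q. q \<in> A ==> vec.dim (Tg p) \<le> vec.dim (Tg q)"
  using ex_has_least_nat[of "\<lambda>p. p \<in> A" _ "\<lambda>p. vec.dim (Tg p)"] \<open>A ~= {}\<close> by blast
 define T where "T = Tg p"
 have subT: "vec.subspace T" by (simp add: T_def Tg_def tangent_space_subspace)
 obtain P :: "complex^'n^'n" where P: "P ** P = P" "range ((*v) P) = T"
  using projection_exists[OF subT] .
 have PP: "P *v (P *v v) = P *v v" for v by (simp add: matrix_vector_mul_assoc P)
 \<comment> \<open>The rows of the complementary projection annihilate the tangent space at
   \<open>p\<close>, so each of them is the differential of a germ vanishing on
   \<open>A\<close>.\<close>
 define Q where "Q = mat 1 - P"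
 have Q: "Q *v v = v - P *v v" for v by (simp add: Q_def matrix_vector_mult_diff_rdistrib)
 have PT: "P *v v = v" if "v \<in> T" for v using that P PP by auto
 have "\<exists>U g. p \<in> U \<and> holomorphic_fun U g \<and> (\<forall>x\<in>A \<inter> U. g x = 0) \<and> (g has_derivative scalar_product (Q $ i)) (at p)" for i
 proof -
  have "scalar_product (Q $ i) v = 0" if "v \<in> tangent_space A p" for v
  proof -
   have "Q *v v = 0" using that PT Q by (simp add: T_def Tg_def)
   then show ?thesis by (metis matrix_vector_nth zero_index)
  qed
  then show ?thesis by (rule tangent_space_annihilator)
 qed
 then obtain U g where Ug: "\<And>i. p \<in> U i" "\<And>i. holomorphic_fun (U i) (g i)"
   "\<And>i x. x \<in> A ==> x \<in> U i ==> g i x = 0" "\<And>i. (g i has_derivative scalar_product (Q $ i)) (at p)"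
  by (metis IntI)
 define U0 where "U0 = (\<Inter>i. U i) \<inter> \<Omega>"
 have U0: "open U0"
  unfolding U0_def using Ug(2) holomorphic_fun_open \<Omega> by (intro open_Int open_INT) auto
 define ft where "ft = (\<lambda>x. \<chi> i. g i x)"
 have ft: "holomorphic_map U0 ft"
  unfolding ft_def by (intro hol_intros holomorphic_fun_subset[OF Ug(2) U0]) (auto simp: U0_def)
 have dft: "(ft has_derivative (*v) Q) (at p)"
  unfolding has_derivative_matrix_iff ft_def using Ug(4) by simp
 have ft0: "ft x = 0" if "x \<in> A" "x \<in> U0" for x
  using Ug(3) that by (simp add: ft_def vec_eq_iff U0_def)
 have pU0: "p \<in> U0" using Ug(1) p A by (auto simp: U0_def)
 \<comment> \<open>New coordinates at \<open>p\<close>: along \<open>T\<close> the linear ones,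
   transversally to \<open>T\<close> functions vanishing on \<open>A\<close>. In them
   \<open>A\<close> lies in \<open>T\<close>, and it remains to show that it fills
   \<open>T\<close>.\<close>
 define \<Theta> where "\<Theta> = (\<lambda>x. Q *v ft x + P *v (x - p))"
 have hol: "holomorphic_map U0 \<Theta>"
  unfolding \<Theta>_def by (intro hol_intros ft U0)
 have "(\<Theta> has_derivative (*v) (mat 1)) (at p)"
  unfolding \<Theta>_def
  by (rule derivative_eq_intros dft bounded_linear.has_derivative[OF bounded_linear_matrix_vector] refl)+
    (auto simp: fun_eq_iff Q matrix_vector_mult_diff_distrib PP)
 then have "jac \<Theta> p = mat 1" by (rule jac_eqI)
 then obtain U1 V1 gi where IFT: "open U1" "p \<in> U1" "U1 \<subseteq> U0" "open V1" "bij_betw \<Theta> U1 V1"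
  "holomorphic_map V1 gi" "\<And>x. x \<in> U1 ==> gi (\<Theta> x) = x" "\<And>y. y \<in> V1 ==> gi y \<in> U1 \<and> \<Theta> (gi y) = y"
  using holomorphic_inverse_function[OF hol pU0] by metis
 have \<Theta>p: "\<Theta> p = 0" using ft0 p pU0 by (simp add: \<Theta>_def)
 then have "0 \<in> V1" using IFT(2,5) by (metis bij_betwE)
 then obtain e where e: "e > 0" "ball 0 e \<subseteq> V1" using IFT(4) open_contains_ball by blast
 define B where "B = (ball 0 e :: (complex^'n) set)"
 have B: "open B" "convex B" "0 \<in> B" "B \<subseteq> V1" using e by (auto simp: B_def)
 define W where "W = {x\<in>U1. \<Theta> x \<in> B}"
 have hol1: "holomorphic_map U1 \<Theta>" by (rule holomorphic_map_subset[OF hol IFT(1,3)])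
 have W: "open W" unfolding W_def by (rule holomorphic_map_vimage_open[OF hol1 B(1)])
 have giW: "gi y \<in> W" if "y \<in> B" for y using that B IFT(8) by (auto simp: W_def)
 have \<Theta>A: "\<Theta> x \<in> T" if "x \<in> A" "x \<in> W" for x
  using that ft0 IFT(3) P by (auto simp: \<Theta>_def W_def)
 \<comment> \<open>Here the choice of \<open>p\<close> is used. At \<open>q\<close> the invertible
   matrix \<open>jac \<Theta> q\<close> maps the tangent space of \<open>A\<close> into
   \<open>T\<close>, and this tangent space has at least the dimension of \<open>T\<close>; hence
   the image is all of \<open>T\<close>.\<close>
 have tangent: "\<exists>v'\<in>tangent_space A q. jac \<Theta> q *v v' = v" if q: "q \<in> A" "q \<in> W" and v: "v \<in> T" for q v
 proof -
  have q1: "q \<in> U1" "q \<in> U0" "\<Theta> q \<in> V1" using q IFT(3) B(4) by (auto simp: W_def)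
  have d\<Theta>: "(\<Theta> has_derivative (*v) (jac \<Theta> q)) (at q)" using has_derivative_jac[OF hol q1(2)] .
  have "((\<lambda>x. gi (\<Theta> x)) has_derivative (*v) (jac gi (\<Theta> q) ** jac \<Theta> q)) (at q)"
   by (rule has_derivative_compose_matrix[OF d\<Theta> has_derivative_jac[OF IFT(6) q1(3)]])
  moreover have "((\<lambda>x. gi (\<Theta> x)) has_derivative (*v) (mat 1)) (at q)"
  proof -
   have "((\<lambda>x. x) has_derivative (*v) (mat 1 :: complex^'n^'n)) (at q)"
    by (rule has_derivative_eq_rhs[OF has_derivative_ident]) auto
   then show ?thesis by (rule has_derivative_near_matrix[OF _ IFT(1) q1(1)]) (use IFT(7) in simp)
  qed
  ultimately have inv: "jac gi (\<Theta> q) ** jac \<Theta> q = mat 1" using jac_eqI by metis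
  have "jac \<Theta> q *v v' \<in> T" if v': "v' \<in> tangent_space A q" for v'
  proof -
   have "scalar_product (grad (\<lambda>x. \<Theta> x $ i - (P *v (x - p)) $ i) q) v' = 0" for i
   proof (rule tangent_spaceD[OF v' _ q1(2)])
    show "holomorphic_fun U0 (\<lambda>x. \<Theta> x $ i - (P *v (x - p)) $ i)"
     by (intro hol_intros hol U0)
   qed (simp add: \<Theta>_def ft0)
   moreover have "grad (\<lambda>x. \<Theta> x $ i - (P *v (x - p)) $ i) q = jac \<Theta> q $ i - P $ i" for i
   proof (rule grad_eqI)
    have "((\<lambda>x. \<Theta> x $ i - (P *v (x - p)) $ i) has_derivative (\<lambda>v. (jac \<Theta> q *v v) $ i - (P *v (v - 0)) $ i)) (at q)"
     by (intro has_derivative_diff bounded_linear.has_derivative[OF bounded_linear_vec_nth] d\<Theta>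
       bounded_linear.has_derivative[OF bounded_linear_matrix_vector] has_derivative_ident has_derivative_const)
    then show "((\<lambda>x. \<Theta> x $ i - (P *v (x - p)) $ i) has_derivative scalar_product (jac \<Theta> q $ i - P $ i)) (at q)"
     by (rule has_derivative_eq_rhs) (auto simp: matrix_vector_nth scalar_product_diff_left)
   qed
   ultimately have "(jac \<Theta> q *v v') $ i = (P *v v') $ i" for i
    by (simp add: scalar_product_diff_left matrix_vector_nth)
   then have "jac \<Theta> q *v v' = P *v v'" by (simp add: vec_eq_iff)
   then show ?thesis using P(2) by auto
  qed
  then show ?thesis
   using p(2)[OF q(1)]
   by (intro dim_eq_imp_surj[OF inv tangent_space_subspace subT _ _ v]) (auto simp: T_def[unfolded Tg_def] Tg_def)
 qed
 \<comment> \<open>The functions vanishing on \<open>A\<close>, written in the new coordinates. This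
   family is closed under differentiation along \<open>T\<close>, so every member has vanishing
   Taylor coefficients at 0 on each line in \<open>T\<close>.\<close>
 define \<G> where "\<G> = {G. holomorphic_fun B G \<and> (\<forall>y\<in>B. gi y \<in> A --> G y = 0)}"
 have step: "(\<lambda>y. scalar_product (grad G y) v) \<in> \<G>" if G: "G \<in> \<G>" and v: "v \<in> T" for G v
 proof -
  have hG: "holomorphic_fun B G" using G by (simp add: \<G>_def)
  have "scalar_product (grad G y) v = 0" if y: "y \<in> B" "gi y \<in> A" for y
  proof -
   define q where "q = gi y"
   have q: "q \<in> A" "q \<in> W" "\<Theta> q = y" using y giW IFT(8) B by (auto simp: q_def)
   obtain v' where v': "v' \<in> tangent_space A q" "jac \<Theta> q *v v' = v" using tangent[OF q(1,2) v] by blast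
   have hol\<Theta>W: "holomorphic_map W \<Theta>" by (rule holomorphic_map_subset[OF hol1 W]) (auto simp: W_def)
   have hGW: "holomorphic_fun W (\<lambda>x. G (\<Theta> x))"
    by (rule holomorphic_fun_compose[OF hol\<Theta>W hG]) (auto simp: W_def)
   have "scalar_product (grad (\<lambda>x. G (\<Theta> x)) q) v' = 0"
    by (rule tangent_spaceD[OF v'(1) hGW q(2)])
      (use G IFT(7) in \<open>auto simp: \<G>_def W_def\<close>)
   moreover have "grad (\<lambda>x. G (\<Theta> x)) q = grad G y v* jac \<Theta> q"
    by (rule grad_eqI, rule has_derivative_compose_scalar_product[OF has_derivative_jac[OF hol\<Theta>W q(2)]])
      (use has_derivative_grad[OF hG y(1)] q(3) in simp)
   ultimately show ?thesis using v'(2) by (simp flip: scalar_product_matrix_vector)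
  qed
  then show ?thesis using hG by (auto simp: \<G>_def intro!: hol_intros B(1))
 qed
 have zero: "G v = 0" if G: "G \<in> \<G>" and v: "v \<in> T" "v \<in> B" for G v
 proof -
  define S where "S = {t. 0 + t *s v \<in> B}"
  have S: "open S" "connected S"
   unfolding S_def using B by (auto intro: open_line_preimage[of B 0 v, simplified]
     convex_connected convex_line_preimage[of B 0 v, simplified])
  have "0 \<in> S" "1 \<in> S" using B v by (auto simp: S_def)
  have hol_line: "(\<lambda>t. G (0 + t *s v)) holomorphic_on S" if "G \<in> \<G>" for G
   by (rule holomorphic_on_line[of B]) (use that in \<open>auto simp: \<G>_def S_def\<close>)
  have "(deriv ^^ k) (\<lambda>t. G (0 + t *s v)) 0 = 0" if "G \<in> \<G>" for k G
   using that
  proof (induction k arbitrary: G)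
   case 0
   then show ?case using B(3) IFT(7)[OF IFT(2)] \<Theta>p p(1) by (auto simp: \<G>_def)
  next
   case (Suc k)
   define G' where "G' = (\<lambda>y. scalar_product (grad G y) v)"
   have G': "G' \<in> \<G>" unfolding G'_def by (rule step[OF Suc.prems v(1)])
   have der: "deriv (\<lambda>t. G (0 + t *s v)) t = G' (0 + t *s v)" if "t \<in> S" for t
    unfolding G'_def
    by (rule DERIV_imp_deriv, rule has_field_derivative_line, rule has_derivative_grad[of B])
      (use Suc.prems that in \<open>auto simp: \<G>_def S_def\<close>)
   have "(deriv ^^ Suc k) (\<lambda>t. G (0 + t *s v)) 0 = (deriv ^^ k) (deriv (\<lambda>t. G (0 + t *s v))) 0"
    by (simp only: funpow_Suc_right o_def)
   also have "\<dots> = (deriv ^^ k) (\<lambda>t. G' (0 + t *s v)) 0"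
    by (rule higher_deriv_transform_within_open[OF _ hol_line[OF G'] S(1) \<open>0 \<in> S\<close>])
      (use der hol_line[OF Suc.prems] S(1) in \<open>auto intro: holomorphic_deriv\<close>)
   also have "\<dots> = 0" by (rule Suc.IH[OF G'])
   finally show ?case .
  qed
  then have "(deriv ^^ k) (\<lambda>t. G (0 + t *s v)) 0 = 0" for k using G by blast
  from holomorphic_fun_eq_0_on_connected[OF hol_line[OF G] S this \<open>0 \<in> S\<close> \<open>1 \<in> S\<close>]
  show ?thesis by simp
 qed
 have "p \<in> W" using IFT(2) \<Theta>p B by (simp add: W_def)
 moreover have "biholomorphic W B \<Theta>"
   unfolding biholomorphic_def
  proof (intro conjI exI[of _ gi])
   show "bij_betw \<Theta> W B"
    by (rule bij_betwI[where g = gi]) (use giW IFT B in \<open>auto simp: W_def\<close>)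
   show "holomorphic_map W \<Theta>" by (rule holomorphic_map_subset[OF hol1 W]) (auto simp: W_def)
   show "holomorphic_map B gi" by (rule holomorphic_map_subset[OF IFT(6) B(1,4)])
   show "\<forall>x\<in>W. gi (\<Theta> x) = x" using IFT(7) by (auto simp: W_def)
  qed
 moreover have "\<Theta> ` (A \<inter> W) = T \<inter> B"
  proof safe
   fix y assume y: "y \<in> T" "y \<in> B"
   have "f (gi y) = 0" if f: "f \<in> F" for f
   proof -
    have "(\<lambda>y. f (gi y)) \<in> \<G>"
     unfolding \<G>_def
    proof safe
     show "holomorphic_fun B (\<lambda>y. f (gi y))"
      by (rule holomorphic_fun_compose[OF holomorphic_map_subset[OF IFT(6) B(1,4)] F[OF f]])
        (use giW IFT(3) in \<open>auto simp: W_def U0_def\<close>)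
    qed (use A f in auto)
    then show ?thesis using zero y by blast
   qed
   moreover have "gi y \<in> \<Omega>" using giW[OF y(2)] IFT(3) by (auto simp: W_def U0_def)
   ultimately have "gi y \<in> A" by (simp add: A)
   then show "y \<in> \<Theta> ` (A \<inter> W)" using giW[OF y(2)] IFT(8)[of y] y(2) B(4) by force
  qed (use \<Theta>A in \<open>auto simp: W_def\<close>)
 ultimately have "p \<in> W \<and> biholomorphic W B \<Theta> \<and> vec.subspace T \<and> vec.dim T = vec.dim T \<and>
   \<Theta> ` (A \<inter> W) = T \<inter> B"
  using subT by simp
 then have "smooth_point A p (vec.dim T)"
  unfolding smooth_point_def by - (rule conjI[OF p(1)], (rule exI)+, assumption)
 then show ?thesis by blast
qed

section \<open>Rank-one matrices and smooth points under linear surjections\<close>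

definition outer :: "complex^'m => complex^'n => complex^'n^'m" where
 "outer u a = (\<chi> i j. u $ i * a $ j)"

lemma outer_mult [simp]: "outer u a *v v = scalar_product a v *s u"
 by (simp add: outer_def matrix_vector_mult_def scalar_product_def vec_eq_iff sum_distrib_left sum_distrib_right mult_ac)

lemma trace_outer: "trace (outer u a) = scalar_product a u"
 by (simp add: trace_def outer_def scalar_product_def mult.commute)

lemma bounded_bilinear_vector_scale: "bounded_bilinear (\<lambda>c (v :: complex^'n). c *s v)"
proof
 fix a b c and u v :: "complex^'n" and r :: real
 show "(a + b) *s u = a *s u + b *s u" "a *s (u + v) = a *s u + a *s v"
  by (simp_all add: vec_eq_iff algebra_simps)
 show "(r *\<^sub>R a) *s u = r *\<^sub>R (a *s u)" "a *s (r *\<^sub>R u) = r *\<^sub>R (a *s u)"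
  by (simp_all add: vec_eq_iff)
 show "\<exists>K. \<forall>a (b::complex^'n). norm (a *s b) \<le> norm a * norm b * K"
  by (intro exI[of _ 1]) (simp add: norm_vector_scale)
qed

lemmas has_derivative_vector_scale = bounded_bilinear.FDERIV[OF bounded_bilinear_vector_scale]
lemmas tendsto_vector_scale [tendsto_intros] = bounded_bilinear.tendsto[OF bounded_bilinear_vector_scale]
lemmas continuous_on_vector_scale [continuous_intros] =
 bounded_bilinear.continuous_on[OF bounded_bilinear_vector_scale]

lemma smooth_pointI_retraction':
 assumes "holomorphic_map U \<sigma>" "p \<in> U" "p \<in> A" "\<And>x. x \<in> U ==> \<sigma> x \<in> A"
  "\<And>x. x \<in> A ==> x \<in> U ==> \<sigma> x = x" "(\<sigma> has_derivative (*v) M) (at p)"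
 shows "\<exists>d. smooth_point A p d \<and> trace M = of_nat d"
proof -
 have "local_retraction A p U \<sigma>" unfolding local_retraction_def using assms by blast
 from retraction_imp_smooth_point[OF this] trace_idempotent[OF local_retraction_idempotent[OF this]]
 show ?thesis using jac_eqI[OF assms(6)] by auto
qed

text \<open>The retraction onto the preimage corrects \<open>c\<close> by lifting the displacement
  of \<open>S *v c\<close> under \<open>\<sigma>\<close> through the right inverse \<open>R\<close>.
  Its derivative differs from the identity by \<open>R ** (M ** S - S)\<close>, whose trace is that
  of \<open>M - mat 1\<close>; this gives the shift by the dimension of the kernel of
  \<open>S\<close>.\<close>

lemma smooth_point_linear_preimage:
 fixes S :: "complex^'k^'n" and R :: "complex^'n^'k"
 assumes SR: "S ** R = mat 1" and K: "smooth_point K (S *v c) d"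
 obtains e where "smooth_point {c. S *v c \<in> K} c e" "e + CARD('n) = d + CARD('k)"
proof -
 have SRv: "S *v (R *v v) = v" for v using SR by (simp add: matrix_vector_mul_assoc)
 obtain U \<sigma> where \<sigma>: "local_retraction K (S *v c) U \<sigma>" "trace (jac \<sigma> (S *v c)) = of_nat d"
  using smooth_point_imp_retraction[OF K] .
 note r = local_retractionD[OF \<sigma>(1)]
 define M where "M = jac \<sigma> (S *v c)"
 define W where "W = {c. S *v c \<in> U}"
 have holS: "holomorphic_map UNIV (\<lambda>c. S *v c)" by (intro hol_intros open_UNIV)
 have W: "open W" using holomorphic_map_vimage_open[OF holS r(2)] by (simp add: W_def)
 define \<tau> where "\<tau> = (\<lambda>c. c + R *v (\<sigma> (S *v c) - S *v c))"
 have hol: "holomorphic_map W \<tau>"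
  unfolding \<tau>_def by (intro hol_intros holomorphic_map_compose[OF holomorphic_map_subset[OF holS W] r(1)] W)
   (auto simp: W_def)
 have dS: "((*v) S has_derivative (*v) S) (at c)"
  by (rule bounded_linear_imp_has_derivative[OF bounded_linear_matrix_vector])
 have "((\<lambda>c. \<sigma> (S *v c)) has_derivative (*v) (M ** S)) (at c)"
  by (rule has_derivative_compose_matrix[OF dS]) (use r in \<open>simp add: M_def\<close>)
 then have "(\<tau> has_derivative (\<lambda>v. v + R *v ((M ** S) *v v - S *v v))) (at c)"
  unfolding \<tau>_def
  by (intro has_derivative_add has_derivative_diff has_derivative_ident dS
    bounded_linear.has_derivative[OF bounded_linear_matrix_vector])
 then have d\<tau>: "(\<tau> has_derivative (*v) (mat 1 + R ** (M ** S - S))) (at c)"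
  by (rule has_derivative_eq_rhs)
    (auto simp: fun_eq_iff matrix_vector_mult_add_rdistrib matrix_vector_mult_diff_rdistrib
     simp flip: matrix_vector_mul_assoc)
 have S\<tau>: "S *v \<tau> c' = \<sigma> (S *v c')" for c'
  by (simp add: \<tau>_def matrix_vector_right_distrib SRv)
 have "c \<in> W" "c \<in> {c. S *v c \<in> K}" using r by (auto simp: W_def)
 moreover have "\<tau> x \<in> {c. S *v c \<in> K}" if "x \<in> W" for x using that r by (simp add: S\<tau> W_def)
 moreover have "\<tau> x = x" if "x \<in> {c. S *v c \<in> K}" "x \<in> W" for x
  using that r by (simp add: \<tau>_def W_def)
 ultimately obtain e where e: "smooth_point {c. S *v c \<in> K} c e" "trace (mat 1 + R ** (M ** S - S)) = of_nat e"
  using smooth_pointI_retraction'[OF hol, of c "{c. S *v c \<in> K}", OF _ _ _ _ d\<tau>] by auto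
 have "trace (R ** (M ** S - S)) = trace ((M ** S - S) ** R)" by (rule trace_mul_sym)
 also have "(M ** S - S) ** R = M - mat 1"
  by (rule matrix_eqI) (simp add: matrix_vector_mult_diff_rdistrib SRv flip: matrix_vector_mul_assoc)
 finally have tr: "trace (R ** (M ** S - S)) = of_nat d - of_nat CARD('n)"
  using \<sigma>(2) by (simp add: trace_sub trace_I M_def)
 have "(of_nat e :: complex) = of_nat CARD('k) + (of_nat d - of_nat CARD('n))"
  unfolding e(2)[symmetric] trace_add tr trace_I ..
 then have "of_nat e + of_nat CARD('n) = (of_nat d + of_nat CARD('k) :: complex)"
  by simp
 then have "e + CARD('n) = d + CARD('k)" by (simp only: of_nat_eq_iff flip: of_nat_add)
 then show ?thesis using e(1) that by blast
qed

lemma matrix_diff_ldistrib: "A ** (B - C) = A ** B - A ** C" for A :: "complex^'n^'m"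
 by (rule matrix_eqI) (simp add: matrix_vector_mult_diff_rdistrib matrix_vector_mult_diff_distrib
   flip: matrix_vector_mul_assoc)

text \<open>The retraction onto \<open>K\<close> lifts a point affinely, retracts upstairs and maps
  down by \<open>S\<close>. The preimage is invariant under translations by the kernel of
  \<open>S\<close>, so the derivative \<open>M\<close> upstairs fixes the range of
  \<open>Z = mat 1 - R ** S\<close>. These kernel directions account for the difference of the two
  traces.\<close>

lemma smooth_point_linear_image:
 fixes S :: "complex^'k^'n" and R :: "complex^'n^'k"
 assumes SR: "S ** R = mat 1" and K: "smooth_point {c. S *v c \<in> K} c e"
 obtains d where "smooth_point K (S *v c) d" "e + CARD('n) = d + CARD('k)"
proof -
 have SRv: "S *v (R *v v) = v" for v using SR by (simp add: matrix_vector_mul_assoc)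
 obtain U \<tau> where \<tau>: "local_retraction {c. S *v c \<in> K} c U \<tau>" "trace (jac \<tau> c) = of_nat e"
  using smooth_point_imp_retraction[OF K] .
 note r = local_retractionD[OF \<tau>(1)]
 define M where "M = jac \<tau> c"
 define a where "a = S *v c"
 define lft where "lft = (\<lambda>y. c + R *v (y - a))"
 have hl: "holomorphic_map UNIV lft" unfolding lft_def by (intro hol_intros open_UNIV)
 have lfta: "lft a = c" by (simp add: lft_def)
 have Slft: "S *v lft y = y" for y by (simp add: lft_def matrix_vector_right_distrib SRv a_def)
 define W where "W = {y. lft y \<in> U}"
 have W: "open W" using holomorphic_map_vimage_open[OF hl r(2)] by (simp add: W_def)
 define \<sigma> where "\<sigma> = (\<lambda>y. S *v \<tau> (lft y))"
 have hol: "holomorphic_map W \<sigma>"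
  unfolding \<sigma>_def by (intro hol_intros holomorphic_map_compose[OF holomorphic_map_subset[OF hl W] r(1)])
   (auto simp: W_def)
 have dl: "(lft has_derivative (*v) R) (at a)"
 proof -
  have "(lft has_derivative (\<lambda>v. 0 + R *v (v - 0))) (at a)"
   unfolding lft_def
   by (intro has_derivative_add has_derivative_diff has_derivative_ident has_derivative_const
    bounded_linear.has_derivative[OF bounded_linear_matrix_vector])
  then show ?thesis by (rule has_derivative_eq_rhs) auto
 qed
 have "((\<lambda>y. \<tau> (lft y)) has_derivative (*v) (M ** R)) (at a)"
  by (rule has_derivative_compose_matrix[OF dl]) (use r lfta in \<open>simp add: M_def\<close>)
 then have d\<sigma>: "(\<sigma> has_derivative (*v) (S ** (M ** R))) (at a)"
  unfolding \<sigma>_def matrix_vector_mul_assoc[symmetric]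
  by (rule bounded_linear.has_derivative[OF bounded_linear_matrix_vector])
 have "a \<in> W" "a \<in> K" using r lfta by (auto simp: W_def a_def)
 moreover have "\<sigma> x \<in> K" if "x \<in> W" for x using that r(5) by (simp add: \<sigma>_def W_def)
 moreover have "\<sigma> x = x" if "x \<in> K" "x \<in> W" for x
  using that r(6)[of "lft x"] by (simp add: \<sigma>_def W_def Slft)
 ultimately obtain d where d: "smooth_point K a d" "trace (S ** (M ** R)) = of_nat d"
  using smooth_pointI_retraction'[OF hol, of a K, OF _ _ _ _ d\<sigma>] by auto
 define Z where "Z = mat 1 - R ** S"
 have "M ** Z = Z"
 proof (rule local_retraction_jac_absorb[OF \<tau>(1), folded M_def])
  have "((\<lambda>y. c + Z *v (y - c)) has_derivative (\<lambda>v. 0 + Z *v (v - 0))) (at c)"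
   by (intro has_derivative_add has_derivative_diff has_derivative_ident has_derivative_const
    bounded_linear.has_derivative[OF bounded_linear_matrix_vector])
  then show "((\<lambda>y. c + Z *v (y - c)) has_derivative (*v) Z) (at c)"
   by (rule has_derivative_eq_rhs) auto
  have "S *v (Z *v v) = 0" for v
   by (simp add: Z_def matrix_vector_mult_diff_rdistrib matrix_vector_mult_diff_distrib SRv flip: matrix_vector_mul_assoc)
  then show "c + Z *v (y - c) \<in> {c. S *v c \<in> K}" for y
   using r(4) by (simp add: matrix_vector_right_distrib)
  show "open (UNIV :: (complex^'k) set)" "c \<in> UNIV" "c + Z *v (c - c) = c" by auto
 qed (intro continuous_intros)
 then have "M - M ** (R ** S) = Z"
  unfolding Z_def by (simp add: matrix_diff_ldistrib)
 then have "trace M - trace (M ** (R ** S)) = trace Z" by (metis trace_sub)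
 moreover have "trace (M ** (R ** S)) = trace (S ** (M ** R))"
  by (metis matrix_mul_assoc trace_mul_sym)
 moreover have "trace (R ** S) = of_nat CARD('n)"
  by (metis SR trace_I trace_mul_sym)
 ultimately have "of_nat e + of_nat CARD('n) = (of_nat d + of_nat CARD('k) :: complex)"
  using d(2) \<tau>(2) by (simp add: Z_def trace_sub trace_I M_def algebra_simps)
 then have "e + CARD('n) = d + CARD('k)" by (simp only: of_nat_eq_iff flip: of_nat_add)
 then show ?thesis using d(1) that a_def by blast
qed

section \<open>Roots of holomorphic families\<close>

definition zeros_in :: "(complex^('a option) => complex) => complex => real => complex^'a => complex set" where
 "zeros_in \<Phi> z r x = {t\<in>ball z r. \<Phi> (vcons x t) = 0}"

text \<open>\<open>zorder\<close> is integer-valued because it also measures poles. At the roots of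
  a \<open>root_family\<close> it is at least 1, so \<open>nat\<close> loses nothing there.\<close>

definition zero_mult :: "(complex^('a option) => complex) => complex^'a => complex => nat" where
 "zero_mult \<Phi> x t = nat (zorder (\<lambda>s. \<Phi> (vcons x s)) t)"

text \<open>The setting of Weierstrass preparation: above each point of \<open>U\<close> the
  function has no zero on the bounding circle, so zeros in the disc cannot escape as the point
  moves.\<close>

locale root_family =
 fixes U :: "(complex^'a) set" and V :: "(complex^('a option)) set" and \<Phi> z r
 assumes open_U: "open U" and convex_U: "convex U" and hol_\<Phi>: "holomorphic_fun V \<Phi>" and r_pos: "r > 0"
  and in_V: "\<And>x t. x \<in> U ==> t \<in> cball z r ==> vcons x t \<in> V"
  and nonzero: "\<And>x t. x \<in> U ==> t \<in> sphere z r ==> \<Phi> (vcons x t) ~= 0"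
begin

abbreviation "Z \<equiv> zeros_in \<Phi> z r"

lemma Z_iff: "x \<in> U ==> t \<in> Z x \<longleftrightarrow> t \<in> cball z r \<and> \<Phi> (vcons x t) = 0"
 using nonzero[of x t] by (auto simp: zeros_in_def le_less)

text \<open>The argument principle needs a neighbourhood of the closed disc in which the function is
  defined and has finitely many zeros.\<close>

lemma larger_disc:
 assumes "x \<in> U"
 obtains R where "R > r" "\<And>t. t \<in> ball z R ==> vcons x t \<in> V" "finite {t\<in>ball z R. \<Phi> (vcons x t) = 0}"
proof -
 have "open {t. vcons x t \<in> V}"
  using open_vimage[OF holomorphic_fun_open[OF hol_\<Phi>], of "\<lambda>t. vcons x t"]
  by (simp add: vimage_def continuous_on_vcons continuous_on_const continuous_on_id)
 then obtain e where e: "e > 0" "(\<Union>t\<in>cball z r. cball t e) \<subseteq> {t. vcons x t \<in> V}"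
  using compact_subset_open_imp_cball_epsilon_subset[OF compact_cball, of _ z r] in_V[OF assms] by blast
 have V: "vcons x t \<in> V" if t: "t \<in> ball z (r + e)" for t
 proof (cases "t \<in> cball z r")
  case False
  \<comment> \<open>The point where the ray from \<open>z\<close> to \<open>t\<close> meets the
    circle; its distance from \<open>t\<close> is \<open>dist z t - r\<close>.\<close>
  define s where "s = z + of_real (r / dist z t) * (t - z)"
  have d: "dist z t > r" using False by simp
  then have "s \<in> cball z r" using r_pos
   by (simp add: s_def dist_norm norm_mult norm_divide norm_minus_commute)
  moreover have "dist s t \<le> e"
  proof -
   have "s - t = of_real (r / dist z t - 1) * (t - z)"
    by (simp add: s_def algebra_simps)
   then have "dist s t = \<bar>r / dist z t - 1\<bar> * dist z t"
    by (simp add: dist_norm norm_mult norm_minus_commute del: of_real_diff)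
   also have "\<dots> = dist z t - r"
   proof -
    have "r / dist z t \<le> 1" using d r_pos by (simp add: divide_le_eq)
    then have "\<bar>r / dist z t - 1\<bar> = 1 - r / dist z t" by simp
    moreover have "z ~= t" using d r_pos by auto
    ultimately show ?thesis by (simp add: left_diff_distrib)
   qed
   finally show ?thesis using t by simp
  qed
  ultimately show ?thesis using e(2) by fastforce
 qed (use in_V assms in auto)
 define g where "g = (\<lambda>t. \<Phi> (vcons x t))"
 have hol: "g holomorphic_on ball z (r + e)"
  unfolding g_def holomorphic_on_def field_differentiable_def
  using has_field_derivative_vcons_snd[OF has_derivative_grad[OF hol_\<Phi> V]] has_field_derivative_at_within by blast
 show ?thesis
 proof (rule that[of "r + e / 2"])
  have "finite {t\<in>cball z (r + e / 2). g t = 0}"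
  proof (cases "g constant_on ball z (r + e)")
   case True
   have "z + of_real r \<in> sphere z r" using r_pos by (simp add: dist_norm)
   then have "g (z + of_real r) ~= 0" "z + of_real r \<in> ball z (r + e)"
    using nonzero[OF assms] e by (auto simp: g_def)
   then have "{t\<in>cball z (r + e / 2). g t = 0} = {}"
    using True e unfolding constant_on_def by (auto simp: subset_iff)
   then show ?thesis by (simp only: finite.emptyI)
  next
   case False
   then show ?thesis
    by (intro holomorphic_compact_finite_zeros[OF hol]) (use e in auto)
  qed
  then show "finite {t\<in>ball z (r + e / 2). \<Phi> (vcons x t) = 0}"
   by (rule finite_subset[rotated]) (auto simp: g_def)
 qed (use e V in auto)
qed

lemma finite_Z: "x \<in> U ==> finite (Z x)"
proof -
 assume "x \<in> U"
 then obtain R where "R > r" "finite {t\<in>ball z R. \<Phi> (vcons x t) = 0}" using larger_disc by blast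
 then show ?thesis unfolding zeros_in_def by (elim finite_subset[rotated]) auto
qed

text \<open>The argument principle with weight \<open>H\<close>. The contour has winding number 1
  around the roots in the disc and 0 around the remaining zeros of the larger disc. The right side
  depends on \<open>x\<close> only as a parameter of the integrand.\<close>

lemma root_sum_integral:
 assumes x: "x \<in> U" and H: "holomorphic_fun V H"
 shows "(\<Sum>t\<in>Z x. of_nat (zero_mult \<Phi> x t) * H (vcons x t)) =
   1 / (2 * of_real pi * \<i>) * contour_integral (circlepath z r)
    (\<lambda>t. grad \<Phi> (vcons x t) $ None * H (vcons x t) / \<Phi> (vcons x t))"
  and "t \<in> Z x ==> zero_mult \<Phi> x t \<ge> 1"
proof -
 obtain R where R: "R > r" "\<And>t. t \<in> ball z R ==> vcons x t \<in> V"
   "finite {t\<in>ball z R. \<Phi> (vcons x t) = 0}"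
  using larger_disc[OF x] by blast
 define g where "g = (\<lambda>t. \<Phi> (vcons x t))"
 have der: "(g has_field_derivative grad \<Phi> (vcons x t) $ None) (at t)" if "t \<in> ball z R" for t
  unfolding g_def by (rule has_field_derivative_vcons_snd[OF has_derivative_grad[OF hol_\<Phi> R(2)[OF that]]])
 then have hol: "g holomorphic_on ball z R"
  unfolding holomorphic_on_def field_differentiable_def using has_field_derivative_at_within by blast
 have holH: "(\<lambda>t. H (vcons x t)) holomorphic_on ball z R"
  unfolding holomorphic_on_def field_differentiable_def
  using has_field_derivative_vcons_snd[OF has_derivative_grad[OF H R(2)]] has_field_derivative_at_within by blast
 define pz where "pz = {w\<in>ball z R. g w = 0 \<or> w \<in> {}}"
 have pz: "pz = {t\<in>ball z R. \<Phi> (vcons x t) = 0}" by (auto simp: pz_def g_def)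
 have Zpz: "Z x = {p\<in>pz. p \<in> ball z r}" using R(1) by (auto simp: zeros_in_def pz)
 have sph: "g t ~= 0" if "t \<in> sphere z r" for t using nonzero[OF x that] by (simp add: g_def)
 have pos: "zorder g t > 0" if "t \<in> pz" for t
 proof -
  have "z + of_real r \<in> sphere z r" using r_pos by (simp add: dist_norm)
  then have "\<exists>w\<in>ball z R. g w ~= 0"
   using sph R(1) by (intro bexI[of _ "z + of_real r"]) auto
  moreover have "t \<in> ball z R" "g t = 0" using that by (auto simp: pz g_def)
  ultimately show ?thesis using zorder_exist_zero[OF hol open_ball connected_ball, of t] by simp
 qed
 have "contour_integral (circlepath z r) (\<lambda>t. deriv g t * H (vcons x t) / g t) = 2 * pi * \<i> *
    (\<Sum>p\<in>pz. winding_number (circlepath z r) p * H (vcons x p) * zorder g p)"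
  unfolding pz_def
 proof (rule argument_principle[OF _ _ _ holH])
  show "path_image (circlepath z r) \<subseteq> ball z R - {w \<in> ball z R. g w = 0 \<or> w \<in> {}}"
   using r_pos R(1) sph by auto
  show "\<forall>w. w \<notin> ball z R --> winding_number (circlepath z r) w = 0"
   using r_pos R(1) by (auto intro!: winding_number_zero_outside[of _ "ball z R"])
  show "finite {w \<in> ball z R. g w = 0 \<or> w \<in> {}}" using R(3) pz pz_def by simp
 qed (use hol in auto)
 also have "(\<Sum>p\<in>pz. winding_number (circlepath z r) p * H (vcons x p) * zorder g p) =
   (\<Sum>p\<in>Z x. of_nat (zero_mult \<Phi> x p) * H (vcons x p))"
 proof (rule sum.mono_neutral_cong_right)
  show "finite pz" using R(3) pz by simp
  show "Z x \<subseteq> pz" using Zpz by auto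
  show "\<forall>i\<in>pz - Z x. winding_number (circlepath z r) i * H (vcons x i) * of_int (zorder g i) = 0"
  proof
   fix i assume i: "i \<in> pz - Z x"
   then have "i \<notin> cball z r" using Zpz sph by (auto simp: pz g_def le_less)
   then have "winding_number (circlepath z r) i = 0"
    using r_pos by (auto intro!: winding_number_zero_outside[of _ "cball z r"])
   then show "winding_number (circlepath z r) i * H (vcons x i) * of_int (zorder g i) = 0" by simp
  qed
  fix p assume p: "p \<in> Z x"
  then have "winding_number (circlepath z r) p = 1"
   using Zpz by (intro winding_number_circlepath) (auto simp: dist_norm norm_minus_commute)
  moreover have "of_nat (zero_mult \<Phi> x p) = (of_int (zorder g p) :: complex)"
   using pos[of p] p Zpz by (simp add: zero_mult_def g_def)
  ultimately show "winding_number (circlepath z r) p * H (vcons x p) * of_int (zorder g p) =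
    of_nat (zero_mult \<Phi> x p) * H (vcons x p)" by simp
 qed
 finally have "contour_integral (circlepath z r) (\<lambda>t. deriv g t * H (vcons x t) / g t) =
   2 * pi * \<i> * (\<Sum>p\<in>Z x. of_nat (zero_mult \<Phi> x p) * H (vcons x p))" .
 moreover have "contour_integral (circlepath z r) (\<lambda>t. deriv g t * H (vcons x t) / g t) =
   contour_integral (circlepath z r) (\<lambda>t. grad \<Phi> (vcons x t) $ None * H (vcons x t) / \<Phi> (vcons x t))"
 proof (rule contour_integral_eq)
  fix t assume "t \<in> path_image (circlepath z r)"
  then have "t \<in> ball z R" using r_pos R(1) by auto
  then have "deriv g t = grad \<Phi> (vcons x t) $ None" using der DERIV_imp_deriv by blast
  then show "deriv g t * H (vcons x t) / g t = grad \<Phi> (vcons x t) $ None * H (vcons x t) / \<Phi> (vcons x t)"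
   by (simp add: g_def)
 qed
 ultimately show "(\<Sum>t\<in>Z x. of_nat (zero_mult \<Phi> x t) * H (vcons x t)) =
   1 / (2 * of_real pi * \<i>) * contour_integral (circlepath z r)
    (\<lambda>t. grad \<Phi> (vcons x t) $ None * H (vcons x t) / \<Phi> (vcons x t))"
  by simp
 show "t \<in> Z x ==> zero_mult \<Phi> x t \<ge> 1"
  using pos[of t] Zpz by (auto simp: zero_mult_def g_def)
qed

lemma holomorphic_root_sum:
 assumes H: "holomorphic_fun V H"
 shows "holomorphic_fun U (\<lambda>x. \<Sum>t\<in>Z x. of_nat (zero_mult \<Phi> x t) * H (vcons x t))"
proof -
 define W where "W = {w\<in>V. \<Phi> w ~= 0}"
 have W: "open W" unfolding W_def by (rule open_nonzero[OF hol_\<Phi>])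
 have WV: "W \<subseteq> V" by (auto simp: W_def)
 have "holomorphic_fun W (\<lambda>w. grad \<Phi> w $ None * H w / \<Phi> w)"
  by (intro hol_intros holomorphic_fun_subset[OF hol_\<Phi> W WV] holomorphic_fun_subset[OF H W WV])
    (auto simp: W_def)
 then have "holomorphic_fun U (\<lambda>x. contour_integral (circlepath z r)
   (\<lambda>t. grad \<Phi> (vcons x t) $ None * H (vcons x t) / \<Phi> (vcons x t)))"
  by (rule holomorphic_fun_contour_integral[OF _ open_U])
    (use in_V nonzero r_pos in \<open>auto simp: W_def\<close>)
 then have "holomorphic_fun U (\<lambda>x. 1 / (2 * of_real pi * \<i>) * contour_integral (circlepath z r)
   (\<lambda>t. grad \<Phi> (vcons x t) $ None * H (vcons x t) / \<Phi> (vcons x t)))"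
  by (intro hol_intros open_U)
 then show ?thesis
  by (rule holomorphic_fun_cong) (rule root_sum_integral(1)[OF _ H, symmetric])
qed

lemma zero_mult_ge_1: "x \<in> U ==> t \<in> Z x ==> zero_mult \<Phi> x t \<ge> 1"
 using root_sum_integral(2)[OF _ holomorphic_fun_const] holomorphic_fun_open[OF hol_\<Phi>] by blast

text \<open>The case \<open>H = 1\<close> of the weighted sums: the number of roots with
  multiplicity is holomorphic and integral, hence constant on the convex set
  \<open>U\<close>.\<close>

lemma count_constant:
 "\<exists>k. \<forall>x\<in>U. (\<Sum>t\<in>Z x. zero_mult \<Phi> x t) = k"
proof -
 define N where "N = (\<lambda>x. \<Sum>t\<in>Z x. zero_mult \<Phi> x t)"
 have "holomorphic_fun V (\<lambda>w. 1)" by (intro hol_intros holomorphic_fun_open[OF hol_\<Phi>])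
 from holomorphic_root_sum[OF this] have "holomorphic_fun U (\<lambda>x. of_nat (N x))"
  by (simp add: N_def)
 then have "continuous_on U (\<lambda>x. of_nat (N x) :: complex)" by (rule holomorphic_fun_continuous_on)
 then have "(\<lambda>x. of_nat (N x) :: complex) constant_on U"
 proof (rule continuous_discrete_range_constant[OF convex_connected[OF convex_U]])
  fix x
  have "1 \<le> norm (of_nat (N y) - of_nat (N x) :: complex)" if "N y ~= N x" for y
  proof -
   have "norm (of_nat (N y) - of_nat (N x) :: complex) = \<bar>real_of_int (int (N y) - int (N x))\<bar>"
    by (metis norm_of_int of_int_diff of_int_of_nat_eq)
   also have "\<dots> \<ge> 1" using that by linarith
   finally show ?thesis .
  qed
  then show "\<exists>e>0. \<forall>y. y \<in> U \<and> of_nat (N y) ~= (of_nat (N x) :: complex) -->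
    e \<le> norm (of_nat (N y) - of_nat (N x) :: complex)"
   by (intro exI[of _ 1]) auto
 qed
 then obtain c where "\<And>x. x \<in> U ==> (of_nat (N x) :: complex) = c"
  unfolding constant_on_def by blast
 then have "N x = N y" if "x \<in> U" "y \<in> U" for x y
  using that by (metis of_nat_eq_iff)
 then show ?thesis unfolding N_def by (metis (no_types, lifting))
qed

lemma card_Z_bound: "\<exists>k. \<forall>x\<in>U. card (Z x) \<le> k"
proof -
 obtain k where k: "\<And>x. x \<in> U ==> (\<Sum>t\<in>Z x. zero_mult \<Phi> x t) = k"
  using count_constant by auto
 have "card (Z x) \<le> k" if "x \<in> U" for x
 proof -
  have "card (Z x) = (\<Sum>t\<in>Z x. 1)" by simp
  also have "\<dots> \<le> (\<Sum>t\<in>Z x. zero_mult \<Phi> x t)"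
   by (rule sum_mono) (use zero_mult_ge_1[OF that] in simp)
  finally show ?thesis using k[OF that] by simp
 qed
 then show ?thesis by blast
qed

lemma restrict:
 assumes "x0 \<in> U" "ball t \<rho> \<subseteq> ball z r" "\<rho> > 0" "\<And>s. s \<in> sphere t \<rho> ==> \<Phi> (vcons x0 s) ~= 0"
 shows "\<exists>e>0. ball x0 e \<subseteq> U \<and> (\<forall>e'. 0 < e' \<and> e' \<le> e --> root_family (ball x0 e') V \<Phi> t \<rho>)"
proof -
 have sub: "cball t \<rho> \<subseteq> cball z r"
  using assms(2,3) by (metis ball_subset_cball closure_ball closure_minimal closed_cball dual_order.trans)
 obtain e1 where e1: "e1 > 0" "ball x0 e1 \<subseteq> U" using open_U assms(1) open_contains_ball by blast
 define W where "W = {w\<in>V. \<Phi> w ~= 0}"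
 have W: "open W" unfolding W_def by (rule open_nonzero[OF hol_\<Phi>])
 have "vcons x0 s \<in> W" if "s \<in> sphere t \<rho>" for s
  using in_V[OF assms(1)] sub assms(4)[OF that] that by (auto simp: W_def)
 then obtain e2 where e2: "e2 > 0" "\<And>x s. dist x x0 < e2 ==> s \<in> sphere t \<rho> ==> vcons x s \<in> W"
  using tube_vcons[OF W compact_sphere, of t \<rho> x0] by blast
 show ?thesis
 proof (intro exI[of _ "min e1 e2"] conjI allI impI)
  fix e' assume e': "0 < e' \<and> e' \<le> min e1 e2"
  show "root_family (ball x0 e') V \<Phi> t \<rho>"
  proof
   fix x s assume x: "x \<in> ball x0 e'"
   then have "x \<in> U" using e' e1(2) by auto
   then show "s \<in> cball t \<rho> ==> vcons x s \<in> V" using in_V sub by blast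
   show "s \<in> sphere t \<rho> ==> \<Phi> (vcons x s) ~= 0"
    using e2(2)[of x s] x e' by (auto simp: dist_commute W_def)
  qed (use hol_\<Phi> assms in auto)
 qed (use e1 e2 in auto)
qed

lemma Z_isolate:
 assumes x: "x \<in> U" and "d > 0"
 shows "\<exists>\<rho>>0. \<rho> < d \<and> (\<forall>t\<in>Z x. ball t \<rho> \<subseteq> ball z r \<and> (\<forall>s\<in>sphere t \<rho>. \<Phi> (vcons x s) ~= 0) \<and>
  (\<forall>s\<in>Z x. s ~= t --> cball t \<rho> \<inter> cball s \<rho> = {}))"
proof -
 have fin: "finite (Z x)" by (rule finite_Z[OF x])
 \<comment> \<open>A third of the mutual distances separates the closed discs around the roots, and
   half of the distance to the bounding circle keeps them inside the large disc.\<close>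
 define Q where "Q = (\<lambda>t. (\<lambda>s. dist t s / 3) ` (Z x - {t}) \<union> {(r - dist z t) / 2})"
 define \<rho> where "\<rho> = Min ({d / 2} \<union> (\<Union>t\<in>Z x. Q t))"
 have finQ: "finite ({d / 2} \<union> (\<Union>t\<in>Z x. Q t))" using fin by (simp add: Q_def)
 have pos: "\<rho> > 0"
  unfolding \<rho>_def using finQ \<open>d > 0\<close> by (subst Min_gr_iff) (auto simp: Q_def zeros_in_def)
 have le: "\<rho> \<le> q" if "t \<in> Z x" "q \<in> Q t" for t q
  unfolding \<rho>_def by (rule Min_le[OF finQ]) (use that in blast)
 have led: "\<rho> \<le> d / 2" unfolding \<rho>_def by (rule Min_le[OF finQ]) blast
 have b: "cball t \<rho> \<subseteq> ball z r" if "t \<in> Z x" for t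
 proof
  fix s assume "s \<in> cball t \<rho>"
  moreover have "\<rho> \<le> (r - dist z t) / 2" by (rule le[OF that]) (simp add: Q_def)
  moreover have "dist z t < r" using that by (simp add: zeros_in_def)
  ultimately have "dist z t + dist t s < r" by (simp add: field_simps)
  then show "s \<in> ball z r" using dist_triangle[of z s t] by simp
 qed
 have sep: "dist t s \<ge> 3 * \<rho>" if "t \<in> Z x" "s \<in> Z x" "s ~= t" for t s
  using le[of t "dist t s / 3"] that by (simp add: Q_def)
 show ?thesis
 proof (intro exI[of _ \<rho>] conjI ballI impI)
  show "\<rho> < d" using led \<open>d > 0\<close> by simp
  show "ball t \<rho> \<subseteq> ball z r" if "t \<in> Z x" for t using b[OF that] ball_subset_cball by blast
  show "cball t \<rho> \<inter> cball s \<rho> = {}" if "t \<in> Z x" "s \<in> Z x" "s ~= t" for t s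
  proof -
   have "\<not> (dist t u \<le> \<rho> \<and> dist s u \<le> \<rho>)" for u
    using sep[OF that] dist_triangle[of t s u] pos by (auto simp: dist_commute)
   then show ?thesis by auto
  qed
  show "\<Phi> (vcons x s) ~= 0" if "t \<in> Z x" "s \<in> sphere t \<rho>" for t s
  proof
   assume "\<Phi> (vcons x s) = 0"
   then have "s \<in> Z x" using b[OF that(1)] that(2) by (auto simp: zeros_in_def)
   moreover have "s ~= t" using that(2) pos by auto
   ultimately show False using sep[of t s] that pos by auto
  qed
 qed (use pos in simp)
qed

text \<open>On a small disc around \<open>t\<close> the family is again a
  \<open>root_family\<close>; its root count is constant and positive at \<open>x\<close>, so every
  nearby fibre has a root in this disc.\<close>

lemma Z_lower:
 assumes x: "x \<in> U" and t: "t \<in> Z x" and "d > 0"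
 shows "\<exists>e>0. \<forall>y. dist y x < e --> (\<exists>s\<in>Z y. dist s t < d)"
proof -
 obtain \<rho> where \<rho>: "\<rho> > 0" "\<rho> < d" "ball t \<rho> \<subseteq> ball z r" "\<And>s. s \<in> sphere t \<rho> ==> \<Phi> (vcons x s) ~= 0"
  using Z_isolate[OF x \<open>d > 0\<close>] t by auto
 obtain e where e: "e > 0" "ball x e \<subseteq> U" "root_family (ball x e) V \<Phi> t \<rho>"
  using restrict[OF x \<rho>(3,1,4)] by auto
 interpret small: root_family "ball x e" V \<Phi> t \<rho> by (rule e(3))
 obtain k where k: "\<And>y. y \<in> ball x e ==> (\<Sum>s\<in>small.Z y. zero_mult \<Phi> y s) = k"
  using small.count_constant by auto
 have "t \<in> small.Z x" using t \<rho>(1) by (simp add: zeros_in_def)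
 then have "zero_mult \<Phi> x t \<le> (\<Sum>s\<in>small.Z x. zero_mult \<Phi> x s)"
  using small.finite_Z e by (intro member_le_sum) auto
 then have "k \<ge> 1" using k[of x] e zero_mult_ge_1[OF x t] by simp
 show ?thesis
 proof (intro exI[of _ e] conjI allI impI e(1))
  fix y assume "dist y x < e"
  then have y: "y \<in> ball x e" by (simp add: dist_commute)
  have "small.Z y ~= {}"
  proof
   assume "small.Z y = {}" then show False using k[OF y] \<open>k \<ge> 1\<close> by simp
  qed
  then obtain s where s: "s \<in> small.Z y" by blast
  then have "s \<in> ball t \<rho>" "\<Phi> (vcons y s) = 0" by (auto simp: zeros_in_def)
  then have "s \<in> Z y" "dist s t < d"
   using \<rho>(2,3) by (auto simp: zeros_in_def dist_commute[of s] simp del: mem_ball intro: less_trans) (auto simp: mem_ball)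
  then show "\<exists>s\<in>Z y. dist s t < d" by blast
 qed
qed

lemma Z_closed:
 assumes "x \<in> U" "\<And>n. y n \<in> U" "y \<longlonglongrightarrow> x" "s \<longlonglongrightarrow> t" "\<And>n. s n \<in> Z (y n)"
 shows "t \<in> Z x"
proof -
 have "t \<in> cball z r"
  by (rule closed_sequentially[OF closed_cball _ assms(4)]) (use assms(5) in \<open>auto simp: zeros_in_def less_imp_le\<close>)
 moreover have "\<Phi> (vcons x t) = 0"
 proof -
  have "vcons x t \<in> V" using in_V assms(1) calculation by blast
  then have "isCont \<Phi> (vcons x t)"
   using holomorphic_fun_continuous_on[OF hol_\<Phi>] holomorphic_fun_open[OF hol_\<Phi>] continuous_on_eq_continuous_at by blast
  then have "(\<lambda>n. \<Phi> (vcons (y n) (s n))) \<longlonglongrightarrow> \<Phi> (vcons x t)"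
   by (rule isCont_tendsto_compose) (intro tendsto_intros assms)
  moreover have "(\<lambda>n. \<Phi> (vcons (y n) (s n))) = (\<lambda>n. 0)"
   using assms(5) by (auto simp: zeros_in_def)
  ultimately show ?thesis by (simp add: LIMSEQ_const_iff)
 qed
 ultimately show ?thesis using Z_iff[OF assms(1)] by blast
qed

end

section \<open>Power sums, discriminant and elimination\<close>

context root_family
begin

lemma holomorphic_power_sum:
 "holomorphic_fun U (\<lambda>x. \<Sum>t\<in>Z x. of_nat (zero_mult \<Phi> x t) * t ^ j)"
proof -
 have "holomorphic_fun V (\<lambda>w. (w $ None) ^ j)"
  by (intro hol_intros holomorphic_fun_open[OF hol_\<Phi>])
 from holomorphic_root_sum[OF this] show ?thesis by simp
qed

text \<open>The exponents \<open>\<alpha>\<close> collect the powers that arise when the factors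
  belonging to \<open>P\<close> are multiplied out one at a time; without such factors the sum
  splits into a product of power sums.\<close>

definition tuple_sum :: "nat => (nat => nat) => (nat \<times> nat) set => complex^'a => complex" where
 "tuple_sum n \<alpha> P x = (\<Sum>\<tau>\<in>PiE {..<n} (\<lambda>_. Z x).
   (\<Prod>i<n. of_nat (zero_mult \<Phi> x (\<tau> i)) * \<tau> i ^ \<alpha> i) * (\<Prod>(i,j)\<in>P. \<tau> i - \<tau> j))"

text \<open>Expanding the factor of one pair \<open>(a, b)\<close> gives the difference of two sums
  over a smaller set of pairs, with the exponent at \<open>a\<close> or at \<open>b\<close> raised
  by one.\<close>

lemma holomorphic_tuple_sum:
 assumes "finite P" "P \<subseteq> {..<n} \<times> {..<n}"
 shows "holomorphic_fun U (tuple_sum n \<alpha> P)"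
 using assms
proof (induction P arbitrary: \<alpha> rule: finite_induct)
 case empty
 have "holomorphic_fun U (\<lambda>x. \<Prod>i<n. \<Sum>t\<in>Z x. of_nat (zero_mult \<Phi> x t) * t ^ \<alpha> i)"
  by (intro hol_intros holomorphic_power_sum open_U)
 then show ?case
  by (rule holomorphic_fun_cong) (simp add: tuple_sum_def prod_sum_PiE finite_Z)
next
 case (insert p P)
 obtain a b where p: "p = (a, b)" by force
 then have ab: "a < n" "b < n" using insert.prems by auto
 have shift: "(\<Prod>i<n. of_nat (m i) * \<tau> i ^ (\<alpha>(c := Suc (\<alpha> c))) i) = \<tau> c * (\<Prod>i<n. of_nat (m i) * \<tau> i ^ \<alpha> i)"
  if "c < n" for c and \<tau> :: "nat => complex" and m
 proof -
  have "(\<Prod>i<n. of_nat (m i) * \<tau> i ^ (\<alpha>(c := Suc (\<alpha> c))) i) =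
    (of_nat (m c) * \<tau> c ^ Suc (\<alpha> c)) * (\<Prod>i\<in>{..<n} - {c}. of_nat (m i) * \<tau> i ^ \<alpha> i)"
   using that by (subst prod.remove[of _ c]) (auto intro!: prod.cong)
  also have "\<dots> = \<tau> c * (\<Prod>i<n. of_nat (m i) * \<tau> i ^ \<alpha> i)"
   using that by (subst (2) prod.remove[of _ c]) auto
  finally show ?thesis .
 qed
 have "tuple_sum n \<alpha> (insert p P) = (\<lambda>x. tuple_sum n (\<alpha>(a := Suc (\<alpha> a))) P x - tuple_sum n (\<alpha>(b := Suc (\<alpha> b))) P x)"
 proof
  fix x
  have ins: "(\<Prod>(i,j)\<in>insert p P. \<tau> i - \<tau> j) = (\<tau> a - \<tau> b) * (\<Prod>(i,j)\<in>P. \<tau> i - \<tau> j)"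
   for \<tau> :: "nat => complex"
   using insert.hyps by (simp add: p)
  show "tuple_sum n \<alpha> (insert p P) x =
    tuple_sum n (\<alpha>(a := Suc (\<alpha> a))) P x - tuple_sum n (\<alpha>(b := Suc (\<alpha> b))) P x"
   unfolding tuple_sum_def ins shift[OF ab(1)] shift[OF ab(2)] sum_subtractf[symmetric]
   by (rule sum.cong[OF refl]) (simp add: algebra_simps)
 qed
 moreover have "holomorphic_fun U (\<lambda>x. tuple_sum n (\<alpha>(a := Suc (\<alpha> a))) P x - tuple_sum n (\<alpha>(b := Suc (\<alpha> b))) P x)"
  using insert.IH insert.prems by (intro hol_intros) auto
 ultimately show ?case by simp
qed

text \<open>A generalised discriminant: with \<open>n\<close> the largest number of distinct roots, the sum over
 \<open>n\<close>-tuples of roots of the product of all differences is nonzero iff there are \<open>n\<close> distinct roots.\<close>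

lemma discriminant:
 assumes "U ~= {}"
 shows "\<exists>h n. holomorphic_fun U h \<and> (\<exists>x\<in>U. h x ~= 0) \<and> (\<forall>x\<in>U. card (Z x) \<le> n) \<and>
  (\<forall>x\<in>U. h x ~= 0 \<longleftrightarrow> card (Z x) = n)"
proof -
 obtain k where k: "\<forall>x\<in>U. card (Z x) \<le> k" using card_Z_bound by blast
 obtain x0 where "x0 \<in> U" using assms by blast
 have "\<exists>x1. x1 \<in> U \<and> (\<forall>y. y \<in> U --> card (Z y) \<le> card (Z x1))"
  by (rule ex_has_greatest_nat[of "\<lambda>x. x \<in> U" x0 _ "Suc k"]) (use k \<open>x0 \<in> U\<close> in \<open>auto simp: less_Suc_eq_le\<close>)
 then obtain x1 where x1: "x1 \<in> U" "\<And>y. y \<in> U ==> card (Z y) \<le> card (Z x1)" by blast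
 define n where "n = card (Z x1)"
 \<comment> \<open>Ordered pairs, so each difference occurs with both signs and the product is
   invariant under permutations of the tuple. All injective tuples then contribute the same nonzero
   value and nothing cancels.\<close>
 define P where "P = {(i, j). i < n \<and> j < n \<and> i ~= j}"
 have P1: "P \<subseteq> {..<n} \<times> {..<n}"
  by (auto simp: P_def)
 then have P2: "finite P"
  by (rule finite_subset) simp
 note P = P1 P2
 define h where "h = tuple_sum n (\<lambda>_. 0) P"
 have noninj: "(\<Prod>(i,j)\<in>P. \<tau> i - \<tau> j) = 0" if ni: "\<not> inj_on \<tau> {..<n}" for \<tau> :: "nat => complex"
 proof -
  obtain i j where "i < n" "j < n" "i ~= j" "\<tau> i = \<tau> j" using ni unfolding inj_on_def by blast
  then show ?thesis using P(2) by (intro prod_zero) (auto simp: P_def intro!: bexI[of _ "(i, j)"])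
 qed
 have "h x ~= 0 \<longleftrightarrow> card (Z x) = n" if x: "x \<in> U" for x
 proof
  assume "h x ~= 0"
  have "card (Z x) \<ge> n"
  proof (rule ccontr)
   assume "\<not> card (Z x) \<ge> n"
   have "\<not> inj_on \<tau> {..<n}" if "\<tau> \<in> PiE {..<n} (\<lambda>_. Z x)" for \<tau>
   proof
    assume "inj_on \<tau> {..<n}"
    then have "card {..<n} \<le> card (Z x)"
     using that finite_Z[OF x] by (intro card_inj_on_le[of \<tau>]) auto
    then show False using \<open>\<not> card (Z x) \<ge> n\<close> by simp
   qed
   then have "h x = 0" unfolding h_def tuple_sum_def using noninj by (intro sum.neutral) auto
   then show False using \<open>h x ~= 0\<close> by simp
  qed
  then show "card (Z x) = n" using x1(2)[OF x] by (simp add: n_def)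
 next
  assume card: "card (Z x) = n"
  define I where "I = {\<tau>\<in>PiE {..<n} (\<lambda>_. Z x). inj_on \<tau> {..<n}}"
  define c where "c = (\<Prod>t\<in>Z x. of_nat (zero_mult \<Phi> x t)) * (\<Prod>(s, t)\<in>{(s, t). s \<in> Z x \<and> t \<in> Z x \<and> s ~= t}. s - t)"
  have fin: "finite (PiE {..<n} (\<lambda>_. Z x))" by (intro finite_PiE finite_Z x) auto
  have "h x = (\<Sum>\<tau>\<in>I. c)"
   unfolding h_def tuple_sum_def I_def
  proof (rule sum.mono_neutral_cong_right[OF fin])
   fix \<tau> assume \<tau>: "\<tau> \<in> {\<tau>\<in>PiE {..<n} (\<lambda>_. Z x). inj_on \<tau> {..<n}}"
   then have sub: "\<tau> ` {..<n} \<subseteq> Z x" by auto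
   have "card (\<tau> ` {..<n}) = n" using \<tau> by (simp add: card_image)
   then have "\<tau> ` {..<n} = Z x" using card_subset_eq[OF finite_Z[OF x] sub] card by simp
   then have bij: "bij_betw \<tau> {..<n} (Z x)" using \<tau> by (simp add: bij_betw_def)
   have "(\<Prod>i<n. of_nat (zero_mult \<Phi> x (\<tau> i)) * \<tau> i ^ 0) = (\<Prod>t\<in>Z x. (of_nat (zero_mult \<Phi> x t) :: complex))"
    using prod.reindex_bij_betw[OF bij, of "\<lambda>t. of_nat (zero_mult \<Phi> x t) :: complex"] by simp
   moreover have "bij_betw (map_prod \<tau> \<tau>) P {(s, t). s \<in> Z x \<and> t \<in> Z x \<and> s ~= t}"
    unfolding bij_betw_def
   proof
    show "inj_on (map_prod \<tau> \<tau>) P"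
     using \<tau> by (auto simp: inj_on_def P_def)
    show "map_prod \<tau> \<tau> ` P = {(s, t). s \<in> Z x \<and> t \<in> Z x \<and> s ~= t}"
    proof
     show "map_prod \<tau> \<tau> ` P \<subseteq> {(s, t). s \<in> Z x \<and> t \<in> Z x \<and> s ~= t}"
      using \<tau> sub by (auto simp: P_def inj_on_def)
     show "{(s, t). s \<in> Z x \<and> t \<in> Z x \<and> s ~= t} \<subseteq> map_prod \<tau> \<tau> ` P"
     proof safe
      fix s t assume "s \<in> Z x" "t \<in> Z x" "s ~= t"
      then obtain i j where "i < n" "j < n" "s = \<tau> i" "t = \<tau> j"
       using \<open>\<tau> ` {..<n} = Z x\<close> by (metis imageE lessThan_iff)
      then show "(s, t) \<in> map_prod \<tau> \<tau> ` P"
       using \<open>s ~= t\<close> by (intro image_eqI[of _ _ "(i, j)"]) (auto simp: P_def)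
     qed
    qed
   qed
   then have "(\<Prod>(i,j)\<in>P. \<tau> i - \<tau> j) = (\<Prod>(s, t)\<in>{(s, t). s \<in> Z x \<and> t \<in> Z x \<and> s ~= t}. s - t)"
    using prod.reindex_bij_betw[of "map_prod \<tau> \<tau>" P _ "\<lambda>(s, t). s - t"] by (simp add: case_prod_beta)
   ultimately show "(\<Prod>i<n. of_nat (zero_mult \<Phi> x (\<tau> i)) * \<tau> i ^ 0) * (\<Prod>(i,j)\<in>P. \<tau> i - \<tau> j) = c"
    by (simp add: c_def)
  qed (use noninj in auto)
  then have "h x = of_nat (card I) * c" by simp
  moreover have "I ~= {}"
  proof -
   obtain \<tau> where \<tau>: "bij_betw \<tau> {..<n} (Z x)"
    using card finite_Z[OF x] by (metis bij_betw_from_nat_into_finite ex_bij_betw_nat_finite atLeast0LessThan)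
   then have "restrict \<tau> {..<n} \<in> I"
    by (auto simp: I_def bij_betw_def inj_on_def)
   then show ?thesis by blast
  qed
  moreover have "finite I" using fin by (simp add: I_def)
  moreover have "c ~= 0"
  proof -
   have "finite {(s, t). s \<in> Z x \<and> t \<in> Z x \<and> s ~= t}"
    by (rule finite_subset[of _ "Z x \<times> Z x"]) (use finite_Z[OF x] in auto)
   moreover have "zero_mult \<Phi> x t ~= 0" if "t \<in> Z x" for t using zero_mult_ge_1[OF x that] by simp
   ultimately show ?thesis unfolding c_def using finite_Z[OF x] by (auto simp: prod_zero_iff)
  qed
  ultimately show "h x ~= 0" by (simp add: card_gt_0_iff)
 qed
 moreover have "holomorphic_fun U h" unfolding h_def by (rule holomorphic_tuple_sum[OF P(2,1)])
 ultimately show ?thesis using x1 n_def by blast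
qed

text \<open>Each of the small discs around the roots above \<open>x0\<close> keeps at least one
  root. As the number of distinct roots is \<open>n\<close> on both sides, it keeps exactly
  one.\<close>

lemma local_roots:
 assumes h: "holomorphic_fun U h" "\<And>x. x \<in> U ==> h x ~= 0 \<longleftrightarrow> card (Z x) = n"
  and x0: "x0 \<in> U" "h x0 ~= 0"
 shows "\<exists>e>0. ball x0 e \<subseteq> {x\<in>U. h x ~= 0} \<and>
  (\<exists>\<rho>. (\<forall>t\<in>Z x0. holomorphic_fun (ball x0 e) (\<rho> t) \<and> \<rho> t x0 = t) \<and>
   (\<forall>x\<in>ball x0 e. bij_betw (\<lambda>t. \<rho> t x) (Z x0) (Z x)))"
proof -
 obtain d where d: "d > 0" "\<forall>t\<in>Z x0. ball t d \<subseteq> ball z r \<and> (\<forall>s\<in>sphere t d. \<Phi> (vcons x0 s) ~= 0) \<and>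
   (\<forall>s\<in>Z x0. s ~= t --> cball t d \<inter> cball s d = {})"
  using Z_isolate[OF x0(1) zero_less_one] by auto
 have "\<exists>e>0. \<forall>e'. 0 < e' \<and> e' \<le> e --> root_family (ball x0 e') V \<Phi> t d" if "t \<in> Z x0" for t
  using restrict[OF x0(1), of t d] d that by auto
 then obtain e1 where e1: "\<forall>t\<in>Z x0. e1 t > 0 \<and> (\<forall>e'. 0 < e' \<and> e' \<le> e1 t --> root_family (ball x0 e') V \<Phi> t d)"
  by metis
 have "\<exists>e>0. \<forall>y. dist y x0 < e --> (\<exists>s\<in>Z y. dist s t < d)" if "t \<in> Z x0" for t
  by (rule Z_lower[OF x0(1) that d(1)])
 then obtain e2 where e2: "\<forall>t\<in>Z x0. e2 t > 0 \<and> (\<forall>y. dist y x0 < e2 t --> (\<exists>s\<in>Z y. dist s t < d))"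
  by metis
 have "open {x\<in>U. h x ~= 0}" by (rule open_nonzero[OF h(1)])
 then obtain e3 where e3: "e3 > 0" "ball x0 e3 \<subseteq> {x\<in>U. h x ~= 0}"
  using x0 open_contains_ball by (metis (mono_tags, lifting) mem_Collect_eq)
 have fin: "finite (Z x0)" by (rule finite_Z[OF x0(1)])
 define e where "e = Min ({e3} \<union> e1 ` Z x0 \<union> e2 ` Z x0)"
 have e: "e > 0" "e \<le> e3" "\<And>t. t \<in> Z x0 ==> e \<le> e1 t" "\<And>t. t \<in> Z x0 ==> e \<le> e2 t"
 proof -
  have fin': "finite ({e3} \<union> e1 ` Z x0 \<union> e2 ` Z x0)" using fin by simp
  show "e > 0" unfolding e_def using fin' e1 e2 e3 by (subst Min_gr_iff) auto
  show "e \<le> e3" "\<And>t. t \<in> Z x0 ==> e \<le> e1 t" "\<And>t. t \<in> Z x0 ==> e \<le> e2 t"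
   unfolding e_def by (rule Min_le[OF fin'], blast)+
 qed
 have fam: "root_family (ball x0 e) V \<Phi> t d" if "t \<in> Z x0" for t
  using e1 e that by blast
 have sub: "ball x0 e \<subseteq> {x\<in>U. h x ~= 0}" using e e3 by (meson subset_ball subset_trans)
 have ex: "\<exists>s. s \<in> Z x \<and> s \<in> ball t d" if "t \<in> Z x0" "x \<in> ball x0 e" for t x
 proof -
  have "dist x x0 < e2 t" using e(4)[OF that(1)] that(2) by (simp add: dist_commute)
  then have "\<exists>s\<in>Z x. dist s t < d" using e2[THEN bspec, OF that(1)] by simp
  then show ?thesis by (auto simp: dist_commute)
 qed
 define \<sigma> where "\<sigma> = (\<lambda>x t. SOME s. s \<in> Z x \<and> s \<in> ball t d)"
 have \<sigma>: "\<sigma> x t \<in> Z x" "\<sigma> x t \<in> ball t d" if "t \<in> Z x0" "x \<in> ball x0 e" for t x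
  using someI_ex[OF ex[OF that]] by (auto simp: \<sigma>_def)
 have disj: "s = t" if "s \<in> Z x0" "t \<in> Z x0" "u \<in> ball s d" "u \<in> ball t d" for s t u
 proof (rule ccontr)
  assume "s ~= t"
  then have "cball t d \<inter> cball s d = {}" using d(2)[THEN bspec, OF that(2)] that(1) by simp
  moreover have "u \<in> cball t d \<inter> cball s d" using that(3,4) by simp
  ultimately show False by simp
 qed
 have bij: "bij_betw (\<sigma> x) (Z x0) (Z x)" if x: "x \<in> ball x0 e" for x
 proof -
  have xU: "x \<in> U" "h x ~= 0" using sub x by auto
  have inj: "inj_on (\<sigma> x) (Z x0)"
  proof (rule inj_onI)
   fix s t assume st: "s \<in> Z x0" "t \<in> Z x0" "\<sigma> x s = \<sigma> x t"
   then show "s = t" using disj[OF st(1,2), of "\<sigma> x s"] \<sigma>(2)[OF st(1) x] \<sigma>(2)[OF st(2) x] by simp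
  qed
  have "\<sigma> x ` Z x0 = Z x"
  proof (rule card_subset_eq[OF finite_Z[OF xU(1)]])
   show "\<sigma> x ` Z x0 \<subseteq> Z x" using \<sigma>(1) x by blast
   show "card (\<sigma> x ` Z x0) = card (Z x)"
    using card_image[OF inj] h(2) xU x0 by metis
  qed
  then show ?thesis using inj by (simp add: bij_betw_def)
 qed
 have single: "zeros_in \<Phi> t d x = {\<sigma> x t}" if t: "t \<in> Z x0" and x: "x \<in> ball x0 e" for t x
 proof
  show "{\<sigma> x t} \<subseteq> zeros_in \<Phi> t d x"
   using \<sigma>[OF t x] by (auto simp: zeros_in_def)
  show "zeros_in \<Phi> t d x \<subseteq> {\<sigma> x t}"
  proof
   fix s assume s: "s \<in> zeros_in \<Phi> t d x"
   moreover have "ball t d \<subseteq> ball z r" using d(2) t by blast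
   ultimately have "s \<in> Z x" unfolding zeros_in_def by blast
   then obtain t' where t': "t' \<in> Z x0" "s = \<sigma> x t'" using bij[OF x] by (auto simp: bij_betw_def)
   then have "t' = t" using disj[OF t'(1) t, of s] \<sigma>(2)[OF t'(1) x] s by (auto simp: zeros_in_def)
   then show "s \<in> {\<sigma> x t}" using t' by simp
  qed
 qed
 have hol: "holomorphic_fun (ball x0 e) (\<lambda>x. \<sigma> x t)" if t: "t \<in> Z x0" for t
 proof -
  interpret small: root_family "ball x0 e" V \<Phi> t d by (rule fam[OF t])
  have mult: "zero_mult \<Phi> x (\<sigma> x t) ~= 0" if "x \<in> ball x0 e" for x
   using small.zero_mult_ge_1[OF that, of "\<sigma> x t"] single[OF t that] by auto
  \<comment> \<open>With a single root in the small disc, the weighted first power sum is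
    multiplicity times root and the zeroth is the multiplicity; their quotient is the root.\<close>
  have "holomorphic_fun (ball x0 e) (\<lambda>x. (\<Sum>s\<in>small.Z x. of_nat (zero_mult \<Phi> x s) * s ^ 1) /
    (\<Sum>s\<in>small.Z x. of_nat (zero_mult \<Phi> x s) * s ^ 0))"
   using single[OF t] mult
   by (intro hol_intros small.holomorphic_power_sum) simp
  then show ?thesis
   by (rule holomorphic_fun_cong) (use single[OF t] mult in simp)
 qed
 have at0: "\<sigma> x0 t = t" if "t \<in> Z x0" for t
 proof -
  have x0e: "x0 \<in> ball x0 e" using e by simp
  show ?thesis using disj[OF \<sigma>(1)[OF that x0e] that, of "\<sigma> x0 t"] \<sigma>(2)[OF that x0e] d(1) by simp
 qed
 show ?thesis
  using e(1) sub hol at0 bij by (intro exI[of _ e] conjI exI[of _ "\<lambda>t x. \<sigma> x t"]) auto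
qed

lemma isCont_in_V:
 "holomorphic_fun V A ==> x \<in> U ==> t \<in> cball z r ==> isCont A (vcons x t)"
 using holomorphic_fun_continuous_on holomorphic_fun_open continuous_on_eq_continuous_at in_V by metis

lemma locally_bounded:
 assumes A: "holomorphic_fun V A" and x: "x \<in> U"
 shows "\<exists>e>0. \<exists>B\<ge>1. cball x e \<subseteq> U \<and> (\<forall>y\<in>cball x e. \<forall>t\<in>cball z r. norm (A (vcons y t)) \<le> B)"
proof -
 obtain e where e: "e > 0" "cball x e \<subseteq> U" using open_U x open_contains_cball by blast
 have "compact ((\<lambda>p. A (vcons (fst p) (snd p))) ` (cball x e \<times> cball z r))"
 proof (intro compact_continuous_image compact_Times compact_cball)
  have "continuous_on (cball x e \<times> cball z r) (\<lambda>p. vcons (fst p) (snd p))"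
   by (intro continuous_intros)
  then show "continuous_on (cball x e \<times> cball z r) (\<lambda>p. A (vcons (fst p) (snd p)))"
   by (rule continuous_on_compose2[OF holomorphic_fun_continuous_on[OF A]]) (use in_V e in auto)
 qed
 from bounded_iff[THEN iffD1, OF compact_imp_bounded[OF this]]
 obtain B where B: "\<forall>y\<in>(\<lambda>p. A (vcons (fst p) (snd p))) ` (cball x e \<times> cball z r). norm y \<le> B"
  by (elim exE)
 have "norm (A (vcons y t)) \<le> max 1 B" if "y \<in> cball x e" "t \<in> cball z r" for y t
  using B that by (auto simp: le_max_iff_disj)
 then show ?thesis using e by (intro exI[of _ e] conjI exI[of _ "max 1 B"]) auto
qed

lemma Z_subset: "Z x \<subseteq> cball z r"
 by (auto simp: zeros_in_def)

text \<open>\<open>F\<close> plays the role of a resultant: over points with the maximal number of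
  distinct roots it is the product of the values of \<open>A\<close>, and elsewhere its Riemann
  extension. A common zero over a degenerate point is approached by roots over generic points while
  the other factors stay bounded, so \<open>F\<close> vanishes. Conversely, over generic points some
  root has \<open>A\<close> of size at most the \<open>n\<close>-th root of \<open>F\<close>, and a
  limit of such roots is a common zero.\<close>

theorem elimination:
 assumes "U ~= {}" and A: "holomorphic_fun V A"
 shows "\<exists>F n. holomorphic_fun U F \<and> (\<forall>x\<in>U. F x = 0 \<longleftrightarrow> (\<exists>t\<in>Z x. A (vcons x t) = 0)) \<and>
  (\<forall>x\<in>U. card (Z x) \<le> n) \<and> (\<exists>x\<in>U. card (Z x) = n) \<and>
  (\<forall>x\<in>U. card (Z x) = n --> F x = (\<Prod>t\<in>Z x. A (vcons x t)))"
proof -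
 obtain h where "\<exists>n. holomorphic_fun U h \<and> (\<exists>x\<in>U. h x ~= 0) \<and> (\<forall>x\<in>U. card (Z x) \<le> n) \<and>
  (\<forall>x\<in>U. h x ~= 0 \<longleftrightarrow> card (Z x) = n)"
  using discriminant[OF assms(1)] ..
 then obtain n where H: "holomorphic_fun U h \<and> (\<exists>x\<in>U. h x ~= 0) \<and> (\<forall>x\<in>U. card (Z x) \<le> n) \<and>
  (\<forall>x\<in>U. h x ~= 0 \<longleftrightarrow> card (Z x) = n)" ..
 have h': "holomorphic_fun U h" "\<exists>x\<in>U. h x ~= 0" "\<forall>x\<in>U. card (Z x) \<le> n"
  "\<forall>x\<in>U. h x ~= 0 \<longleftrightarrow> card (Z x) = n"
  using H by blast+
 note h = h'(1,2) h'(3,4)[rule_format]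
 obtain x1 where x1: "x1 \<in> U" "h x1 ~= 0" using h(2) by blast
 define f where "f = (\<lambda>x. \<Prod>t\<in>Z x. A (vcons x t))"
 have bound: "\<exists>e>0. \<exists>B\<ge>1. cball x e \<subseteq> U \<and> (\<forall>y\<in>cball x e. \<forall>t\<in>cball z r. norm (A (vcons y t)) \<le> B)"
  if "x \<in> U" for x
  by (rule locally_bounded[OF A that])
 have prod_le: "(\<Prod>t\<in>S. norm (A (vcons y t))) \<le> B ^ n"
  if "y \<in> U" "B \<ge> 1" "\<forall>t\<in>cball z r. norm (A (vcons y t)) \<le> B" "S \<subseteq> Z y" for y B S
 proof -
  have "(\<Prod>t\<in>S. norm (A (vcons y t))) \<le> (\<Prod>t\<in>S. B)"
   by (rule prod_mono) (use that Z_subset in auto)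
  also have "\<dots> = B ^ card S" by simp
  also have "\<dots> \<le> B ^ n"
   using h(3)[OF that(1)] card_mono[OF finite_Z[OF that(1)] that(4)] that(2)
   by (intro power_increasing) auto
  finally show ?thesis .
 qed
 have holf: "holomorphic_fun {x\<in>U. h x ~= 0} f"
 proof (rule holomorphic_fun_local)
  fix x0 assume x0: "x0 \<in> {x\<in>U. h x ~= 0}"
  have "x0 \<in> U" "h x0 ~= 0" using x0 by auto
  from local_roots[OF h(1,4) this]
  obtain e \<rho> where e: "e > 0" "ball x0 e \<subseteq> {x\<in>U. h x ~= 0}"
   "\<forall>t\<in>Z x0. holomorphic_fun (ball x0 e) (\<rho> t) \<and> \<rho> t x0 = t"
   "\<forall>x\<in>ball x0 e. bij_betw (\<lambda>t. \<rho> t x) (Z x0) (Z x)"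
   by auto
  have inZ: "\<rho> t x \<in> Z x" if "x \<in> ball x0 e" "t \<in> Z x0" for x t
   using bij_betwE[OF e(4)[rule_format, OF that(1)]] that(2) by blast
  have "holomorphic_fun (ball x0 e) (\<lambda>x. \<Prod>t\<in>Z x0. A (vcons x (\<rho> t x)))"
  proof (intro hol_intros open_ball)
   fix t assume t: "t \<in> Z x0"
   show "holomorphic_fun (ball x0 e) (\<lambda>x. A (vcons x (\<rho> t x)))"
   proof (rule holomorphic_fun_compose[OF _ A])
    show "holomorphic_map (ball x0 e) (\<lambda>x. vcons x (\<rho> t x))"
     using e(3) t by (intro hol_intros open_ball) auto
    fix x assume x: "x \<in> ball x0 e"
    then have "x \<in> U" using e(2) by blast
    then show "vcons x (\<rho> t x) \<in> V" using in_V inZ[OF x t] Z_subset by blast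
   qed
  qed
  then have "holomorphic_fun (ball x0 e) f"
  proof (rule holomorphic_fun_cong)
   fix x assume "x \<in> ball x0 e"
   then have "bij_betw (\<lambda>t. \<rho> t x) (Z x0) (Z x)" using e(4) by blast
   then show "(\<Prod>t\<in>Z x0. A (vcons x (\<rho> t x))) = f x"
    unfolding f_def by (rule prod.reindex_bij_betw)
  qed
  then show "\<exists>W. x0 \<in> W \<and> W \<subseteq> {x\<in>U. h x ~= 0} \<and> holomorphic_fun W f"
   using e(1,2) by (intro exI[of _ "ball x0 e"]) simp
 qed
 have bddf: "\<exists>e>0. \<exists>B. \<forall>y\<in>U. dist y x < e --> h y ~= 0 --> norm (f y) \<le> B" if x: "x \<in> U" for x
 proof -
  obtain e B where e: "e > 0" "B \<ge> 1" "\<forall>y\<in>cball x e. \<forall>t\<in>cball z r. norm (A (vcons y t)) \<le> B"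
   using bound[OF x] by auto
  have "norm (f y) \<le> B ^ n" if "y \<in> U" "dist y x < e" for y
   unfolding f_def prod_norm[symmetric]
   by (rule prod_le) (use that e in \<open>auto simp: dist_commute\<close>)
  then show ?thesis using e(1) by blast
 qed
 obtain F where F: "holomorphic_fun U F" "\<And>x. x \<in> U ==> h x ~= 0 ==> F x = f x"
  using Riemann_extension[OF h(1) convex_U x1 holf bddf] by metis
 have contF: "isCont F x" if "x \<in> U" for x
  using holomorphic_fun_continuous_on[OF F(1)] open_U that continuous_on_eq_continuous_at by blast
 have dense: "\<exists>y. y \<in> U \<and> h y ~= 0 \<and> dist y x < d" if "x \<in> U" "d > 0" for x d
  using holomorphic_fun_nonzero_dense[OF h(1) convex_U x1, of "ball x d"] that
  by (metis IntI centre_in_ball dist_commute empty_iff mem_ball open_ball)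
 have zero: "F x = 0" if x: "x \<in> U" and t: "t \<in> Z x" "A (vcons x t) = 0" for x t
 proof -
  obtain e B where e: "e > 0" "B \<ge> 1" "\<forall>y\<in>cball x e. \<forall>t\<in>cball z r. norm (A (vcons y t)) \<le> B"
   using bound[OF x] by auto
  have "\<exists>y s. y \<in> U \<and> h y ~= 0 \<and> dist y x < min e (1 / real (Suc k)) \<and> s \<in> Z y \<and> dist s t < 1 / real (Suc k)" for k
  proof -
   obtain d where d: "d > 0" "\<forall>y. dist y x < d --> (\<exists>s\<in>Z y. dist s t < 1 / real (Suc k))"
    using Z_lower[OF x t(1), of "1 / real (Suc k)"] by auto
   obtain y where "y \<in> U" "h y ~= 0" "dist y x < min d (min e (1 / real (Suc k)))"
    using dense[OF x, of "min d (min e (1 / real (Suc k)))"] d(1) e(1) by auto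
   then show ?thesis using d(2) by (metis min_less_iff_conj)
  qed
  then obtain y s where ys: "\<And>k. y k \<in> U" "\<And>k. h (y k) ~= 0" "\<And>k. dist (y k) x < min e (1 / real (Suc k))"
    "\<And>k. s k \<in> Z (y k)" "\<And>k. dist (s k) t < 1 / real (Suc k)"
   by metis
  have lim: "y \<longlonglongrightarrow> x" "s \<longlonglongrightarrow> t"
   using LIMSEQ_norm_0[of "\<lambda>k. y k - x"] LIMSEQ_norm_0[of "\<lambda>k. s k - t"] ys(3,5)
   by (auto simp: dist_norm LIM_zero_cancel)
  have tc: "t \<in> cball z r" using t(1) Z_subset by blast
  have A0: "(\<lambda>k. norm (A (vcons (y k) (s k))) * B ^ n) \<longlonglongrightarrow> 0"
   using isCont_tendsto_compose[OF isCont_in_V[OF A x tc] tendsto_vcons[OF lim]] t(2)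
   by (intro tendsto_mult_left_zero tendsto_norm_zero) simp
  have "norm (F (y k)) \<le> norm (A (vcons (y k) (s k))) * B ^ n" for k
  proof -
   have "norm (F (y k)) = (\<Prod>t\<in>Z (y k). norm (A (vcons (y k) t)))"
    using F(2) ys by (simp add: f_def prod_norm)
   also have "\<dots> = norm (A (vcons (y k) (s k))) * (\<Prod>t\<in>Z (y k) - {s k}. norm (A (vcons (y k) t)))"
    by (rule prod.remove[OF finite_Z ys(4)]) (rule ys)
   also have "\<dots> \<le> norm (A (vcons (y k) (s k))) * B ^ n"
    using ys(3)[of k] e(2,3)
    by (intro mult_left_mono prod_le[OF ys(1)]) (auto simp: dist_commute)
   finally show ?thesis .
  qed
  then have "(\<lambda>k. F (y k)) \<longlonglongrightarrow> 0"
   by (intro Lim_null_comparison[OF _ A0] always_eventually) simp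
  moreover have "(\<lambda>k. F (y k)) \<longlonglongrightarrow> F x"
   by (rule isCont_tendsto_compose[OF contF[OF x] lim(1)])
  ultimately show ?thesis using LIMSEQ_unique by blast
 qed
 have nonz: "\<exists>t\<in>Z x. A (vcons x t) = 0" if x: "x \<in> U" and F0: "F x = 0" for x
 proof -
  have "\<exists>y. y \<in> U \<and> h y ~= 0 \<and> dist y x < 1 / real (Suc k)" for k
   using dense[OF x, of "1 / real (Suc k)"] by simp
  then obtain y where y: "\<And>k. y k \<in> U" "\<And>k. h (y k) ~= 0" "\<And>k. dist (y k) x < 1 / real (Suc k)"
   by metis
  have lim: "y \<longlonglongrightarrow> x"
   using LIMSEQ_norm_0[of "\<lambda>k. y k - x"] y(3) by (auto simp: dist_norm LIM_zero_cancel)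
  have Fy: "(\<lambda>k. F (y k)) \<longlonglongrightarrow> 0"
   using isCont_tendsto_compose[OF contF[OF x] lim] F0 by simp
  \<comment> \<open>With no roots at all the empty product gives \<open>F = 1\<close> on the generic
    points, contradicting the limit 0.\<close>
  have "n > 0"
  proof (rule ccontr)
   assume "\<not> n > 0"
   then have "Z (y k) = {}" for k using h(4)[OF y(1)[of k]] y(2) finite_Z[OF y(1)[of k]] by auto
   then have "F (y k) = 1" for k using F(2)[OF y(1,2)] by (simp add: f_def)
   then show False using Fy by (simp add: LIMSEQ_const_iff)
  qed
  have "\<exists>s. s \<in> Z (y k) \<and> norm (A (vcons (y k) s)) ^ n \<le> norm (F (y k))" for k
  proof -
   have card: "card (Z (y k)) = n" using h(4) y by blast
   then have ne: "Z (y k) ~= {}" using \<open>n > 0\<close> by auto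
   define s where "s = arg_min_on (\<lambda>t. norm (A (vcons (y k) t))) (Z (y k))"
   have s: "s \<in> Z (y k)" "\<And>t. t \<in> Z (y k) ==> norm (A (vcons (y k) s)) \<le> norm (A (vcons (y k) t))"
    unfolding s_def using arg_min_if_finite[OF finite_Z[OF y(1)] ne] arg_min_least[OF finite_Z[OF y(1)] ne] by auto
   have "norm (A (vcons (y k) s)) ^ n = (\<Prod>t\<in>Z (y k). norm (A (vcons (y k) s)))" by (simp add: card)
   also have "\<dots> \<le> (\<Prod>t\<in>Z (y k). norm (A (vcons (y k) t)))"
    by (rule prod_mono) (use s in auto)
   also have "\<dots> = norm (F (y k))" using F(2) y by (simp add: f_def prod_norm)
   finally show ?thesis using s(1) by blast
  qed
  then obtain s where s: "\<And>k. s k \<in> Z (y k)" "\<And>k. norm (A (vcons (y k) (s k))) ^ n \<le> norm (F (y k))"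
   by metis
  have "\<forall>k. s k \<in> cball z r" using s(1) Z_subset by blast
  then obtain t q where tq: "t \<in> cball z r" "strict_mono q" "(s \<circ> q) \<longlonglongrightarrow> t"
   using compact_cball[of z r] unfolding compact_def by blast
  have limq: "(y \<circ> q) \<longlonglongrightarrow> x" by (rule LIMSEQ_subseq_LIMSEQ[OF lim tq(2)])
  have "t \<in> Z x"
   by (rule Z_closed[OF x _ limq tq(3)]) (use y s in auto)
  have "(\<lambda>k. norm (A (vcons ((y \<circ> q) k) ((s \<circ> q) k))) ^ n) \<longlonglongrightarrow> norm (A (vcons x t)) ^ n"
   by (intro tendsto_intros isCont_tendsto_compose[OF isCont_in_V[OF A x tq(1)]] limq tq(3))
  moreover have "(\<lambda>k. norm (F ((y \<circ> q) k))) \<longlonglongrightarrow> 0"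
   using LIMSEQ_subseq_LIMSEQ[OF Fy tq(2)] by (auto simp: o_def intro: tendsto_norm_zero)
  ultimately have "norm (A (vcons x t)) ^ n \<le> 0"
   by (rule LIMSEQ_le) (use s(2) in auto)
  then have "A (vcons x t) = 0" using \<open>n > 0\<close> by (auto simp: power_le_zero_eq)
  then show ?thesis using \<open>t \<in> Z x\<close> by blast
 qed
 have iff: "\<forall>x\<in>U. F x = 0 \<longleftrightarrow> (\<exists>t\<in>Z x. A (vcons x t) = 0)" using zero nonz by blast
 have n: "\<forall>x\<in>U. card (Z x) \<le> n" "\<exists>x\<in>U. card (Z x) = n" using h x1 by blast+
 have "\<forall>x\<in>U. card (Z x) = n --> F x = (\<Prod>t\<in>Z x. A (vcons x t))"
  using F(2) h(4) by (simp add: f_def)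
 with F(1) iff n show ?thesis by (intro exI[of _ F] exI[of _ n]) simp
qed

end

section \<open>Finite projections\<close>

text \<open>The projection with centre \<open>p\<close> and linear part \<open>\<L>\<close>, kept as
  a map of the full space into itself.\<close>

definition aproj :: "complex^'n^'n => complex^'n => complex^'n => complex^'n" where
 "aproj \<L> p x = p + \<L> *v (x - p)"

lemma holomorphic_map_aproj [hol_intros]:
 "holomorphic_map U f ==> holomorphic_map U (\<lambda>x. aproj \<L> p (f x))"
 unfolding aproj_def by (intro hol_intros) (auto dest: holomorphic_map_open)

lemma aproj_base [simp]: "aproj \<L> p p = p"
 by (simp add: aproj_def)

lemma isCont_aproj: "isCont (aproj \<L> p) x"
 using holomorphic_map_continuous_on[OF holomorphic_map_aproj[OF holomorphic_map_id[OF open_UNIV], of \<L> p]]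
 by (simp add: continuous_on_eq_continuous_at)

text \<open>Near \<open>p\<close> every coordinate of a point of \<open>T\<close> is a root of a nontrivial holomorphic equation
 over the image of the point under the projection \<open>\<L>\<close>, as in Noether normalisation.\<close>

definition finite_over :: "(complex^'n) set => complex^'n => complex^'n^'n => bool" where
 "finite_over T p \<L> \<longleftrightarrow> \<L> ** \<L> = \<L> \<and> (\<forall>i. \<exists>V Q W. holomorphic_fun V Q \<and> vcons p (p $ i) \<in> V \<and>
   (\<forall>e>0. \<exists>\<tau>. dist \<tau> (p $ i) < e \<and> Q (vcons p \<tau>) ~= 0) \<and> open W \<and> p \<in> W \<and>
   (\<forall>x\<in>T \<inter> W. Q (vcons (aproj \<L> p x) (x $ i)) = 0))"

text \<open>Start of the descent: over the identity, the \<open>i\<close>-th coordinate is the root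
  of the linear equation \<open>w $ None - w $ Some i = 0\<close>.\<close>

lemma finite_over_id: "finite_over T p (mat 1)"
 unfolding finite_over_def
proof (intro conjI allI)
 show "mat 1 ** mat 1 = (mat 1 :: complex^'a^'a)" by simp
 fix i
 have "\<exists>\<tau>. dist \<tau> (p $ i) < e \<and> \<tau> - p $ i ~= 0" if "e > 0" for e
  using that by (intro exI[of _ "p $ i + of_real (e / 2)"]) (auto simp: dist_norm)
 then show "\<exists>V Q W. holomorphic_fun V Q \<and> vcons p (p $ i) \<in> V \<and>
   (\<forall>e>0. \<exists>\<tau>. dist \<tau> (p $ i) < e \<and> Q (vcons p \<tau>) ~= 0) \<and> open W \<and> p \<in> W \<and>
   (\<forall>x\<in>T \<inter> W. Q (vcons (aproj (mat 1) p x) (x $ i)) = 0)"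
  by (intro exI[of _ UNIV] exI[of _ "\<lambda>w. w $ None - w $ Some i"]) (auto simp: aproj_def intro!: hol_intros)
qed

lemma open_ball_mult_imp: "open W ==> x \<in> W ==> \<exists>e>0. ball x e \<subseteq> W"
 by (simp add: open_contains_ball)

lemma nonzero_circle_ex:
 fixes g :: "complex => complex"
 assumes "g holomorphic_on S" "open S" "connected S" "z \<in> S" "w \<in> S" "g w ~= 0" "e > 0"
 shows "\<exists>\<rho>. 0 < \<rho> \<and> \<rho> < e \<and> cball z \<rho> \<subseteq> S \<and> (\<forall>t\<in>cball z \<rho> - {z}. g t ~= 0)"
 by (rule nonzero_circle[OF assms]) (intro exI conjI ballI; assumption)

text \<open>One step of Noether normalisation. Choose \<open>v\<close> in the range of
  \<open>\<L>\<close> such that \<open>g\<close> is not identically zero on the line from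
  \<open>p\<close> in direction \<open>v\<close>, and project along \<open>v\<close> in addition.
  The lost coordinate \<open>t\<close> along \<open>v\<close> is a root of \<open>g\<close>, and
  eliminating it from the old equation of the \<open>i\<close>-th coordinate gives the new
  equation.\<close>

theorem finite_over_project:
 fixes T :: "(complex^'n) set"
 assumes fin: "finite_over T p \<L>" and p: "p \<in> closure T" and g: "holomorphic_fun G g" "p \<in> G"
  and W: "open W" "p \<in> W" "\<And>x. x \<in> T ==> x \<in> W ==> g (aproj \<L> p x) = 0"
  and nz: "\<And>e. e > 0 ==> \<exists>x. dist x p < e \<and> g (aproj \<L> p x) ~= 0"
 shows "\<exists>\<L>'. finite_over T p \<L>' \<and> trace \<L>' = trace \<L> - 1"
proof -
 have idem: "\<L> ** \<L> = \<L>" using fin by (simp add: finite_over_def)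
 then have LL: "\<L> *v (\<L> *v w) = \<L> *v w" for w by (simp add: matrix_vector_mul_assoc)
 have gp: "g p = 0"
 proof -
  obtain s where s: "\<And>n. s n \<in> T" "s \<longlonglongrightarrow> p" using p closure_sequential by blast
  have "(\<lambda>n. aproj \<L> p (s n)) \<longlonglongrightarrow> p"
   using isCont_tendsto_compose[OF isCont_aproj s(2), of \<L> p] by simp
  moreover have "isCont g p"
   using holomorphic_fun_continuous_on[OF g(1)] holomorphic_fun_open[OF g(1)] g(2) continuous_on_eq_continuous_at by blast
  ultimately have lim: "(\<lambda>n. g (aproj \<L> p (s n))) \<longlonglongrightarrow> g p"
   by (rule isCont_tendsto_compose[rotated])
  have "eventually (\<lambda>n. s n \<in> W) sequentially" using s(2) W topological_tendstoD by blast
  then have "eventually (\<lambda>n. g (aproj \<L> p (s n)) = 0) sequentially"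
   by eventually_elim (use s W in auto)
  then have "(\<lambda>n. g (aproj \<L> p (s n))) \<longlonglongrightarrow> 0" by (rule tendsto_eventually)
  then show ?thesis using lim LIMSEQ_unique by blast
 qed
 obtain e0 where e0: "e0 > 0" "ball p e0 \<subseteq> G"
  using open_ball_mult_imp[OF holomorphic_fun_open[OF g(1)] g(2)] by auto
 have "open (aproj \<L> p -` ball p e0)"
  by (rule open_vimage) (auto simp: continuous_on_eq_continuous_at isCont_aproj)
 then obtain e1 where e1: "e1 > 0" "ball p e1 \<subseteq> aproj \<L> p -` ball p e0"
  using open_ball_mult_imp[of "aproj \<L> p -` ball p e0" p] e0 by auto
 obtain x0 where x0: "dist x0 p < e1" "g (aproj \<L> p x0) ~= 0" using nz[OF e1(1)] by auto
 define v where "v = \<L> *v (x0 - p)"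
 have pv: "p + v \<in> ball p e0" "g (p + v) ~= 0"
  using x0 e1(2) by (auto simp: v_def aproj_def dist_commute subset_iff)
 have \<L>v: "\<L> *v v = v" by (simp add: v_def LL)
 have "v ~= 0" using pv gp by auto
 then obtain k where k: "v $ k ~= 0" by (auto simp: vec_eq_iff)
 \<comment> \<open>A covector with value 1 on \<open>v\<close> that factors through
   \<open>\<L>\<close>. Subtracting the rank-one projection \<open>outer v \<psi>\<close> from
   \<open>\<L>\<close> therefore leaves an idempotent of trace one less.\<close>
 define \<psi> where "\<psi> = (inverse (v $ k) *s axis k 1) v* \<L>"
 have \<psi>v: "scalar_product \<psi> v = 1"
  using k by (simp add: \<psi>_def \<L>v scalar_product_scale_left flip: scalar_product_matrix_vector)
 have \<psi>\<L>: "scalar_product \<psi> (\<L> *v w) = scalar_product \<psi> w" for w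
  by (simp add: \<psi>_def LL flip: scalar_product_matrix_vector)
 define \<L>' where "\<L>' = \<L> - outer v \<psi>"
 have \<L>': "\<L>' *v w = \<L> *v w - scalar_product \<psi> w *s v" for w
  by (simp add: \<L>'_def matrix_vector_mult_diff_rdistrib)
 have idem': "\<L>' ** \<L>' = \<L>'"
  by (rule matrix_eqI)
    (simp add: \<L>' matrix_vector_mult_diff_distrib LL \<psi>\<L> scalar_product_diff_right vector_scalar_commute
     \<L>v scalar_product_scale_right \<psi>v flip: matrix_vector_mul_assoc)
 have LL': "\<L>' *v (\<L>' *v w) = \<L>' *v w" for w by (simp add: matrix_vector_mul_assoc idem')
 have trace: "trace \<L>' = trace \<L> - 1"
  by (simp add: \<L>'_def trace_sub trace_outer \<psi>v)
 have "\<exists>V Q W. holomorphic_fun V Q \<and> vcons p (p $ i) \<in> V \<and>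
   (\<forall>e>0. \<exists>\<tau>. dist \<tau> (p $ i) < e \<and> Q (vcons p \<tau>) ~= 0) \<and> open W \<and> p \<in> W \<and>
   (\<forall>x\<in>T \<inter> W. Q (vcons (aproj \<L>' p x) (x $ i)) = 0)" for i
 proof -
  obtain Vi Q Wi where Q: "holomorphic_fun Vi Q" "vcons p (p $ i) \<in> Vi"
   "\<forall>e>0. \<exists>\<tau>. dist \<tau> (p $ i) < e \<and> Q (vcons p \<tau>) ~= 0" "open Wi" "p \<in> Wi"
   "\<forall>x\<in>T \<inter> Wi. Q (vcons (aproj \<L> p x) (x $ i)) = 0"
   using fin unfolding finite_over_def by metis
  define S where "S = {t. p + t *s v \<in> ball p e0 \<and> vcons (p + t *s v) (p $ i) \<in> Vi}"
  have contS: "continuous_on UNIV (\<lambda>t. vcons (p + t *s v) (p $ i))"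
   by (intro continuous_intros continuous_on_line)
  have openS: "open S"
  proof -
   have "open ({t. p + t *s v \<in> ball p e0} \<inter> (\<lambda>t. vcons (p + t *s v) (p $ i)) -` Vi)"
    using contS holomorphic_fun_open[OF Q(1)] by (intro open_Int open_line_preimage open_vimage) auto
   then show ?thesis by (simp add: S_def vimage_def Int_def)
  qed
  have "0 \<in> S" using e0 Q(2) by (simp add: S_def)
  then obtain d where d: "d > 0" "ball 0 d \<subseteq> S" using open_ball_mult_imp[OF openS] by auto
  define S0 where "S0 = {t. p + t *s v \<in> ball p e0}"
  have S0: "open S0" "connected S0" "0 \<in> S0" "1 \<in> S0"
  proof -
   show "open S0" unfolding S0_def by (rule open_line_preimage[OF open_ball])
   show "connected S0" unfolding S0_def by (intro convex_connected convex_line_preimage convex_ball)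
  qed (use pv(1) e0 in \<open>auto simp: S0_def\<close>)
  have holS0: "(\<lambda>t. g (p + t *s v)) holomorphic_on S0"
   by (rule holomorphic_on_line[OF g(1)]) (use e0 in \<open>auto simp: S0_def\<close>)
  have hv: "g (p + 1 *s v) ~= 0" using pv(2) by simp
  from nonzero_circle_ex[OF holS0 S0 hv d(1)]
  obtain \<rho> where \<rho>0: "0 < \<rho> \<and> \<rho> < d \<and> cball 0 \<rho> \<subseteq> S0 \<and> (\<forall>t\<in>cball 0 \<rho> - {0}. g (p + t *s v) ~= 0)" ..
  have \<rho>: "0 < \<rho>" "\<rho> < d" "\<And>t. t \<in> cball 0 \<rho> - {0} ==> g (p + t *s v) ~= 0"
   using \<rho>0 by (blast+)
  have \<rho>S: "t \<in> S" if "t \<in> cball 0 \<rho>" for t using that \<rho>(2) d(2) by auto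
  \<comment> \<open>The argument carries two additional coordinates: the outer \<open>None\<close>
    is the position \<open>t\<close> along \<open>v\<close>, to be eliminated, and the inner one is
    the value of the \<open>i\<close>-th coordinate. \<open>l\<close> recovers the old projection
    from the new one and \<open>t\<close>; \<open>m\<close> attaches the coordinate again.\<close>
  define l where "l = (\<lambda>u :: complex^'n option option. p + \<L>' *v (vtl (vtl u) - p) + u $ None *s v)"
  have holl: "holomorphic_map UNIV l" unfolding l_def by (intro hol_intros open_UNIV)
  define m where "m = (\<lambda>u. vcons (l u) (vtl u $ None))"
  have holm: "holomorphic_map UNIV m" unfolding m_def
   by (intro hol_intros holl holomorphic_fun_nth holomorphic_map_vtl open_UNIV)
  define VV where "VV = {u. l u \<in> ball p e0} \<inter> {u. m u \<in> Vi}"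
  have VV: "open VV" unfolding VV_def
   using holomorphic_map_vimage_open[OF holl open_ball] holomorphic_map_vimage_open[OF holm holomorphic_fun_open[OF Q(1)]]
   by (intro open_Int) auto
  define \<Phi> where "\<Phi> = (\<lambda>u. g (l u))"
  define A where "A = (\<lambda>u. Q (m u))"
  have hol\<Phi>: "holomorphic_fun VV \<Phi>" unfolding \<Phi>_def
   by (rule holomorphic_fun_compose[OF holomorphic_map_subset[OF holl VV] g(1)]) (use e0 in \<open>auto simp: VV_def\<close>)
  have holA: "holomorphic_fun VV A" unfolding A_def
   by (rule holomorphic_fun_compose[OF holomorphic_map_subset[OF holm VV] Q(1)]) (auto simp: VV_def)
  define w0 where "w0 = vcons p (p $ i)"
  have lw: "l (vcons w t) = p + \<L>' *v (vtl w - p) + t *s v" and mw: "m (vcons w t) = vcons (l (vcons w t)) (w $ None)" for w t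
   by (simp_all add: l_def m_def)
  have "vcons w0 t \<in> VV" if "t \<in> cball 0 \<rho>" for t
   using \<rho>S[OF that] by (simp add: VV_def lw mw w0_def S_def)
  then obtain \<epsilon>1 where \<epsilon>1: "\<epsilon>1 > 0" "\<And>w t. dist w w0 < \<epsilon>1 ==> t \<in> cball 0 \<rho> ==> vcons w t \<in> VV"
   using tube_vcons[OF VV compact_cball, of 0 \<rho> w0] by blast
  define VN where "VN = {u\<in>VV. \<Phi> u ~= 0}"
  have VN: "open VN" unfolding VN_def by (rule open_nonzero[OF hol\<Phi>])
  have "vcons w0 t \<in> VN" if t: "t \<in> sphere 0 \<rho>" for t
  proof -
   have "t \<in> cball 0 \<rho>" "t \<in> cball 0 \<rho> - {0}" using t \<rho>(1) by auto
   then show ?thesis using \<rho>S[of t] \<rho>(3)[of t] by (simp add: VN_def VV_def lw mw w0_def S_def \<Phi>_def)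
  qed
  then obtain \<epsilon>2 where \<epsilon>2: "\<epsilon>2 > 0" "\<And>w t. dist w w0 < \<epsilon>2 ==> t \<in> sphere 0 \<rho> ==> vcons w t \<in> VN"
   using tube_vcons[OF VN compact_sphere, of 0 \<rho> w0] by blast
  define U where "U = ball w0 (min \<epsilon>1 \<epsilon>2)"
  interpret root_family U VV \<Phi> 0 \<rho>
  proof
   show "holomorphic_fun VV \<Phi>" by (rule hol\<Phi>)
   show "vcons w t \<in> VV" if "w \<in> U" "t \<in> cball 0 \<rho>" for w t
    using \<epsilon>1(2) that by (auto simp: U_def dist_commute)
   show "\<Phi> (vcons w t) ~= 0" if "w \<in> U" "t \<in> sphere 0 \<rho>" for w t
    using \<epsilon>2(2)[of w t] that by (auto simp: U_def dist_commute VN_def)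
  qed (use \<rho> in \<open>auto simp: U_def\<close>)
  have w0U: "w0 \<in> U" using \<epsilon>1 \<epsilon>2 by (simp add: U_def)
  then have "U ~= {}" by blast
  from elimination[OF this holA]
  obtain F where "\<exists>n. holomorphic_fun U F \<and> (\<forall>x\<in>U. F x = 0 \<longleftrightarrow> (\<exists>t\<in>Z x. A (vcons x t) = 0)) \<and>
   (\<forall>x\<in>U. card (Z x) \<le> n) \<and> (\<exists>x\<in>U. card (Z x) = n) \<and>
   (\<forall>x\<in>U. card (Z x) = n --> F x = (\<Prod>t\<in>Z x. A (vcons x t)))" ..
  then have F: "holomorphic_fun U F" "\<And>x. x \<in> U ==> F x = 0 \<longleftrightarrow> (\<exists>t\<in>Z x. A (vcons x t) = 0)" by blast+
  \<comment> \<open>Above \<open>p\<close> the only zero of \<open>g\<close> in the disc is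
    \<open>t = 0\<close>, where the eliminated function is the old \<open>Q\<close>; hence
    \<open>F\<close> inherits nonvanishing near \<open>p $ i\<close> from \<open>Q\<close>.\<close>
  have reg: "\<exists>\<tau>. dist \<tau> (p $ i) < e \<and> F (vcons p \<tau>) ~= 0" if "e > 0" for e
  proof -
   have "min e (min \<epsilon>1 \<epsilon>2) > 0" using that \<epsilon>1 \<epsilon>2 by simp
   then obtain \<tau> where \<tau>: "dist \<tau> (p $ i) < min e (min \<epsilon>1 \<epsilon>2)" "Q (vcons p \<tau>) ~= 0" using Q(3) by blast
   have U: "vcons p \<tau> \<in> U"
    using dist_vcons_le[of p \<tau> p "p $ i"] \<tau>(1) by (simp add: U_def w0_def dist_commute)
   have "t = 0" if "t \<in> Z (vcons p \<tau>)" for t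
    using \<rho>(3)[of t] that by (auto simp: zeros_in_def \<Phi>_def lw)
   note t0 = this
   have "F (vcons p \<tau>) ~= 0"
   proof
    assume "F (vcons p \<tau>) = 0"
    then obtain t where t: "t \<in> Z (vcons p \<tau>)" "A (vcons (vcons p \<tau>) t) = 0"
     using F(2)[OF U] by blast
    have "A (vcons (vcons p \<tau>) 0) = 0" using t(2) t0[OF t(1)] by simp
    then show False using \<tau>(2) by (simp add: A_def mw lw)
   qed
   then show ?thesis using \<tau>(1) by auto
  qed
  define N where "N = {x. vcons (aproj \<L>' p x) (x $ i) \<in> U} \<inter> {x. scalar_product \<psi> (x - p) \<in> ball 0 \<rho>} \<inter> W \<inter> Wi"
  have N: "open N"
  proof -
   have "holomorphic_map UNIV (\<lambda>x :: complex^'n. vcons (aproj \<L>' p x) (x $ i))"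
    by (intro hol_intros holomorphic_fun_nth holomorphic_map_id open_UNIV)
   from holomorphic_map_vimage_open[OF this open_U] have 1: "open {x. vcons (aproj \<L>' p x) (x $ i) \<in> U}" by simp
   have "continuous_on UNIV (\<lambda>x. scalar_product \<psi> (x - p))" by (intro continuous_intros)
   from open_vimage[OF open_ball this, of 0 \<rho>] have 2: "open {x. scalar_product \<psi> (x - p) \<in> ball 0 \<rho>}"
    by (simp add: vimage_def)
   show ?thesis unfolding N_def using 1 2 W Q by (intro open_Int) auto
  qed
  have pN: "p \<in> N" using w0U \<rho>(1) W Q by (simp add: N_def w0_def)
  have "F (vcons (aproj \<L>' p x) (x $ i)) = 0" if x: "x \<in> T" "x \<in> N" for x
  proof -
   define t where "t = scalar_product \<psi> (x - p)"
   define w where "w = vcons (aproj \<L>' p x) (x $ i)"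
   have w: "w \<in> U" "t \<in> ball 0 \<rho>" using x(2) by (auto simp: N_def w_def t_def)
   have l: "l (vcons w t) = aproj \<L> p x"
    by (simp add: lw w_def aproj_def LL') (simp add: \<L>' t_def)
   have "t \<in> Z w" using w(2) W(3)[of x] x by (simp add: zeros_in_def \<Phi>_def l N_def)
   moreover have "A (vcons w t) = 0"
   proof -
    have "x \<in> T \<inter> Wi" using x by (simp add: N_def)
    then have "Q (vcons (aproj \<L> p x) (x $ i)) = 0" using Q(6) by blast
    then show ?thesis by (simp add: A_def mw l) (simp add: w_def)
   qed
   ultimately show ?thesis using F(2)[OF w(1)] by (auto simp: w_def)
  qed
  then show ?thesis
   using F(1) w0U reg N pN by (intro exI[of _ U] exI[of _ F] exI[of _ N]) (auto simp: w0_def)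
 qed
 then have "finite_over T p \<L>'" unfolding finite_over_def using idem' by simp
 then show ?thesis using trace by blast
qed

section \<open>Sheets over the complement of a discriminant\<close>

text \<open>One equation \<open>Q i\<close> for every coordinate, over a common tube around
  \<open>p\<close> that is invariant along the kernel of \<open>\<L>\<close>. The trace of
  \<open>\<L>\<close> is left free because the rank is lowered step by step until it matches the
  dimension of \<open>T\<close>.\<close>

locale local_cover =
 fixes T :: "(complex^'n) set" and p :: "complex^'n" and \<L> :: "complex^'n^'n"
  and V Q r \<epsilon>
 assumes idem: "\<L> ** \<L> = \<L>" and eps_pos: "\<epsilon> > 0"
  and family: "\<And>i. root_family {x. norm (\<L> *v (x - p)) < \<epsilon>} (V i) (Q i) (p $ i) (r i)"
  and invariant: "\<And>i x y t. \<L> *v x = \<L> *v y ==> Q i (vcons x t) = Q i (vcons y t)"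
  and vanish: "\<And>i x. x \<in> T ==> (\<And>i. dist (p $ i) (x $ i) < r i) ==> norm (\<L> *v (x - p)) < \<epsilon> ==>
    Q i (vcons x (x $ i)) = 0"

lemma saturated_set:
 fixes c :: "complex^'n" and \<L> :: "complex^'n^'m"
 shows open_saturated: "open {x. norm (\<L> *v (x - c)) < e}"
  and convex_saturated: "convex {x. norm (\<L> *v (x - c)) < e}"
proof -
 have "continuous_on UNIV (\<lambda>x. norm (\<L> *v (x - c)))" by (intro continuous_intros)
 from open_vimage[OF open_lessThan this, of e] show "open {x. norm (\<L> *v (x - c)) < e}"
  by (simp add: vimage_def)
 have lin: "linear (\<lambda>x. \<L> *v x)" using bounded_linear_matrix_vector bounded_linear.linear by blast
 have "{x. norm (\<L> *v (x - c)) < e} = (\<lambda>x. \<L> *v x) -` ball (\<L> *v c) e"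
  by (auto simp: dist_norm norm_minus_commute matrix_vector_mult_diff_distrib)
 then show "convex {x. norm (\<L> *v (x - c)) < e}"
  using convex_linear_vimage[OF lin convex_ball] by simp
qed

lemma tube_vcons_ex:
 assumes "open W" "compact K" "\<And>t. t \<in> K ==> vcons x0 t \<in> W"
 shows "\<exists>e>0. \<forall>x. dist x x0 < e --> (\<forall>t\<in>K. vcons x t \<in> W)"
 by (rule tube_vcons[OF assms]) auto

theorem finite_over_imp_local_cover:
 fixes T :: "(complex^'n) set"
 assumes fin: "finite_over T p \<L>" and W: "open W" "p \<in> W"
 shows "\<exists>V Q r \<epsilon>. local_cover T p \<L> V Q r \<epsilon> \<and> {y. \<forall>i. dist (p $ i) (y $ i) < r i} \<subseteq> W"
proof -
 have idem: "\<L> ** \<L> = \<L>" using fin by (simp add: finite_over_def)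
 then have LL: "\<L> *v (\<L> *v w) = \<L> *v w" for w by (simp add: matrix_vector_mul_assoc)
 have "\<forall>i. \<exists>V Q N. holomorphic_fun V Q \<and> vcons p (p $ i) \<in> V \<and>
   (\<forall>e>0. \<exists>\<tau>. dist \<tau> (p $ i) < e \<and> Q (vcons p \<tau>) ~= 0) \<and> open N \<and> p \<in> N \<and>
   (\<forall>x\<in>T \<inter> N. Q (vcons (aproj \<L> p x) (x $ i)) = 0)"
  using fin unfolding finite_over_def by blast
 then obtain V0 Q0 N where *: "\<And>i. holomorphic_fun (V0 i) (Q0 i)" "\<And>i. vcons p (p $ i) \<in> V0 i"
   "\<And>i. \<forall>e>0. \<exists>\<tau>. dist \<tau> (p $ i) < e \<and> Q0 i (vcons p \<tau>) ~= 0" "\<And>i. open (N i)" "\<And>i. p \<in> N i"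
   "\<And>i. \<forall>x\<in>T \<inter> N i. Q0 i (vcons (aproj \<L> p x) (x $ i)) = 0"
  by metis
 define W' where "W' = W \<inter> (\<Inter>i. N i)"
 have W': "open W'" unfolding W'_def by (intro open_Int open_INT W(1) ballI *(4) finite)
 have pW': "p \<in> W'" using W * by (simp add: W'_def)
 then obtain d where d: "d > 0" "ball p d \<subseteq> W'" using open_ball_mult_imp[OF W' pW'] by auto
 \<comment> \<open>The norm is at most the sum of the coordinate norms, so radii below
   \<open>d / CARD('n)\<close> place the polydisc inside the ball of radius
   \<open>d\<close>.\<close>
 have "\<exists>\<rho>>0. \<rho> < d / real CARD('n) \<and> (\<forall>t\<in>cball (p $ i) \<rho>. vcons p t \<in> V0 i) \<and>
   (\<forall>t\<in>cball (p $ i) \<rho> - {p $ i}. Q0 i (vcons p t) ~= 0)" for i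
 proof -
  have "open ((\<lambda>t. vcons p t) -` V0 i)"
   by (rule open_vimage[OF holomorphic_fun_open[OF *(1)]]) (intro continuous_intros)
  then obtain e where e: "e > 0" "ball (p $ i) e \<subseteq> (\<lambda>t. vcons p t) -` V0 i"
   using open_ball_mult_imp[of _ "p $ i"] *(2) by (metis vimageI)
  obtain \<tau> where \<tau>: "dist \<tau> (p $ i) < e" "Q0 i (vcons p \<tau>) ~= 0" using *(3) e(1) by blast
  have hol: "(\<lambda>t. Q0 i (vcons p t)) holomorphic_on ball (p $ i) e"
   unfolding holomorphic_on_def field_differentiable_def
   using has_field_derivative_vcons_snd[OF has_derivative_grad[OF *(1)]] e(2) has_field_derivative_at_within by blast
  have dn: "d / real CARD('n) > 0" using d by simp
  have "p $ i \<in> ball (p $ i) e" "\<tau> \<in> ball (p $ i) e" using e \<tau> by (auto simp: dist_commute)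
  from nonzero_circle_ex[OF hol open_ball connected_ball this \<tau>(2) dn]
  obtain \<rho> where "0 < \<rho> \<and> \<rho> < d / real CARD('n) \<and> cball (p $ i) \<rho> \<subseteq> ball (p $ i) e \<and>
   (\<forall>t\<in>cball (p $ i) \<rho> - {p $ i}. Q0 i (vcons p t) ~= 0)" ..
  then show ?thesis using e(2) by (intro exI[of _ \<rho>]) auto
 qed
 then obtain r where r: "\<And>i. r i > 0" "\<And>i. r i < d / real CARD('n)" "\<And>i t. t \<in> cball (p $ i) (r i) ==> vcons p t \<in> V0 i"
   "\<And>i t. t \<in> cball (p $ i) (r i) - {p $ i} ==> Q0 i (vcons p t) ~= 0"
  by metis
 define Pd where "Pd = {y. \<forall>i. dist (p $ i) (y $ i) < r i}"
 have Pd: "Pd \<subseteq> W'"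
 proof
  fix y assume y: "y \<in> Pd"
  have "dist p y \<le> (\<Sum>i\<in>UNIV. norm ((p - y) $ i))"
   unfolding dist_norm norm_vec_def by (rule L2_set_le_sum) simp
  also have "\<dots> < (\<Sum>i\<in>(UNIV::'n set). d / real CARD('n))"
   by (rule sum_strict_mono) (use y r(2) in \<open>auto simp: Pd_def dist_norm intro: less_trans\<close>)
  also have "\<dots> = d" by simp
  finally show "y \<in> W'" using d(2) by auto
 qed
 have "\<exists>\<epsilon>>0. \<forall>x. dist x p < \<epsilon> --> (\<forall>t\<in>cball (p $ i) (r i). vcons x t \<in> V0 i) \<and>
   (\<forall>t\<in>sphere (p $ i) (r i). Q0 i (vcons x t) ~= 0)" for i
 proof -
  obtain \<epsilon>1 where \<epsilon>1: "\<epsilon>1 > 0 \<and> (\<forall>x. dist x p < \<epsilon>1 --> (\<forall>t\<in>cball (p $ i) (r i). vcons x t \<in> V0 i))"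
   using tube_vcons_ex[OF holomorphic_fun_open[OF *(1)] compact_cball r(3)] ..
  have "vcons p t \<in> {w\<in>V0 i. Q0 i w ~= 0}" if "t \<in> sphere (p $ i) (r i)" for t
  proof -
   have "t ~= p $ i" using that r(1)[of i] by auto
   then show ?thesis using r(3)[of t i] r(4)[of t i] that by simp
  qed
  from tube_vcons_ex[OF open_nonzero[OF *(1)] compact_sphere this]
  obtain \<epsilon>2 where \<epsilon>2: "\<epsilon>2 > 0 \<and> (\<forall>x. dist x p < \<epsilon>2 -->
    (\<forall>t\<in>sphere (p $ i) (r i). vcons x t \<in> {w\<in>V0 i. Q0 i w ~= 0}))" ..
  show ?thesis using \<epsilon>1 \<epsilon>2 by (intro exI[of _ "min \<epsilon>1 \<epsilon>2"]) auto
 qed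
 then obtain \<epsilon>f where \<epsilon>f: "\<And>i. \<epsilon>f i > 0" "\<And>i. \<forall>x. dist x p < \<epsilon>f i --> (\<forall>t\<in>cball (p $ i) (r i). vcons x t \<in> V0 i) \<and>
   (\<forall>t\<in>sphere (p $ i) (r i). Q0 i (vcons x t) ~= 0)"
  by metis
 define \<epsilon> where "\<epsilon> = Min (range \<epsilon>f)"
 have \<epsilon>: "\<epsilon> > 0" "\<And>i. \<epsilon> \<le> \<epsilon>f i"
  unfolding \<epsilon>_def using \<epsilon>f(1) by (auto simp: Min_gr_iff)
 \<comment> \<open>Precomposition with the projection makes the equations depend on
   \<open>\<L> *v x\<close> alone, so they are defined over the entire tube and not only near
   \<open>p\<close>.\<close>
 define l where "l = (\<lambda>w :: complex^'n option. vcons (aproj \<L> p (vtl w)) (w $ None))"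
 have holl: "holomorphic_map UNIV l" unfolding l_def
  by (intro hol_intros holomorphic_fun_nth holomorphic_map_id open_UNIV)
 define V where "V = (\<lambda>i. {w. l w \<in> V0 i})"
 define Q where "Q = (\<lambda>i w. Q0 i (l w))"
 have V: "open (V i)" for i
  using holomorphic_map_vimage_open[OF holl holomorphic_fun_open[OF *(1)]] by (simp add: V_def)
 have lv: "l (vcons x t) = vcons (aproj \<L> p x) t" for x t by (simp add: l_def)
 have "local_cover T p \<L> V Q r \<epsilon>"
 proof (rule local_cover.intro)
  fix i
  show "root_family {x. norm (\<L> *v (x - p)) < \<epsilon>} (V i) (Q i) (p $ i) (r i)"
  proof
   show "holomorphic_fun (V i) (Q i)" unfolding Q_def
    by (rule holomorphic_fun_compose[OF holomorphic_map_subset[OF holl V] *(1)]) (auto simp: V_def)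
   have near: "dist (aproj \<L> p x) p < \<epsilon>f i" if "x \<in> {x. norm (\<L> *v (x - p)) < \<epsilon>}" for x
    using that \<epsilon>(2)[of i] by (simp add: aproj_def dist_norm)
   show "vcons x t \<in> V i" if "x \<in> {x. norm (\<L> *v (x - p)) < \<epsilon>}" "t \<in> cball (p $ i) (r i)" for x t
    using \<epsilon>f(2)[of i] near[OF that(1)] that(2) by (simp add: V_def lv)
   show "Q i (vcons x t) ~= 0" if "x \<in> {x. norm (\<L> *v (x - p)) < \<epsilon>}" "t \<in> sphere (p $ i) (r i)" for x t
    using \<epsilon>f(2)[of i] near[OF that(1)] that(2) by (simp add: Q_def lv)
  qed (auto intro: open_saturated convex_saturated r(1))
 next
  show "Q i (vcons x t) = Q i (vcons y t)" if "\<L> *v x = \<L> *v y" for i x y t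
   using that by (simp add: Q_def lv aproj_def matrix_vector_mult_diff_distrib)
  show "Q i (vcons x (x $ i)) = 0"
   if "x \<in> T" "\<And>i. dist (p $ i) (x $ i) < r i" for i x
  proof -
   have "x \<in> W'" using that(2) Pd by (auto simp: Pd_def)
   then show ?thesis using *(6)[of i] that(1) by (simp add: Q_def lv W'_def)
  qed
 qed (use idem \<epsilon> in auto)
 then show ?thesis using Pd by (intro exI) (auto simp: Pd_def W'_def)
qed

lemma PiE_vec:
 fixes S :: "'n::finite => 'a set"
 assumes "\<And>i. finite (S i)"
 shows "finite {y :: 'a^'n. \<forall>i. y $ i \<in> S i}" "card {y :: 'a^'n. \<forall>i. y $ i \<in> S i} \<le> (\<Prod>i\<in>UNIV. card (S i))"
proof -
 have eq: "{y :: 'a^'n. \<forall>i. y $ i \<in> S i} = vec_lambda ` PiE UNIV S"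
 proof safe
  fix y :: "'a^'n" assume "\<forall>i. y $ i \<in> S i"
  then show "y \<in> vec_lambda ` PiE UNIV S" by (intro image_eqI[of _ _ "vec_nth y"]) auto
 qed auto
 have fin: "finite (PiE UNIV S)" using assms by (intro finite_PiE) auto
 then show "finite {y :: 'a^'n. \<forall>i. y $ i \<in> S i}" by (simp add: eq)
 show "card {y :: 'a^'n. \<forall>i. y $ i \<in> S i} \<le> (\<Prod>i\<in>UNIV. card (S i))"
  unfolding eq using card_image_le[OF fin, of vec_lambda] by (simp add: card_PiE)
qed

section \<open>Fibres of candidate points and discriminants\<close>

context local_cover
begin

definition base :: "(complex^'n) set" where "base = {x. norm (\<L> *v (x - p)) < \<epsilon>}"

definition polydisc :: "(complex^'n) set" where "polydisc = {y. \<forall>i. dist (p $ i) (y $ i) < r i}"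

text \<open>All vectors whose coordinates are roots over \<open>x\<close>. This is a finite set that
  contains the points of \<open>T\<close> in the polydisc above \<open>x\<close>, but its other
  members need neither belong to \<open>T\<close> nor project to the same point as
  \<open>x\<close>.\<close>

definition fibre :: "complex^'n => (complex^'n) set" where
 "fibre x = {y. \<forall>i. y $ i \<in> zeros_in (Q i) (p $ i) (r i) x}"

sublocale fam: root_family base "V i" "Q i" "p $ i" "r i" for i
 using family unfolding base_def .

lemma LL: "\<L> *v (\<L> *v w) = \<L> *v w"
 by (simp add: matrix_vector_mul_assoc idem)

lemma p_base: "p \<in> base" by (simp add: base_def eps_pos)

lemma open_base: "open base" and convex_base: "convex base"
 by (auto simp: base_def intro: open_saturated convex_saturated)

lemma open_polydisc: "open polydisc" and p_polydisc: "p \<in> polydisc"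
proof -
 have "polydisc = (\<Inter>i. {y. y $ i \<in> ball (p $ i) (r i)})"
  by (auto simp: polydisc_def)
 moreover have "open {y :: complex^'n. y $ i \<in> ball (p $ i) (r i)}" for i
 proof -
  have "continuous_on UNIV (\<lambda>y :: complex^'n. y $ i)" by (intro continuous_intros)
  from open_vimage[OF open_ball this] show ?thesis by (simp add: vimage_def)
 qed
 ultimately show "open polydisc" by auto
 show "p \<in> polydisc" using fam.r_pos by (simp add: polydisc_def)
qed

lemma fibre_subset: "fibre x \<subseteq> polydisc"
 by (auto simp: fibre_def polydisc_def zeros_in_def)

lemma zeros_invariant: "\<L> *v x = \<L> *v y ==> zeros_in (Q i) (p $ i) (r i) x = zeros_in (Q i) (p $ i) (r i) y"
proof -
 assume eq: "\<L> *v x = \<L> *v y"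
 have "Q i (vcons x t) = Q i (vcons y t)" for t by (rule invariant[OF eq])
 then show ?thesis unfolding zeros_in_def by simp
qed

lemma fibre_invariant: "\<L> *v x = \<L> *v y ==> fibre x = fibre y"
 unfolding fibre_def by (simp only: zeros_invariant[of x y])

lemma base_invariant: "\<L> *v x = \<L> *v y ==> x \<in> base \<longleftrightarrow> y \<in> base"
 by (simp add: base_def matrix_vector_mult_diff_distrib)

lemma finite_fibre: "x \<in> base ==> finite (fibre x)"
 unfolding fibre_def by (intro PiE_vec fam.finite_Z)

lemma card_fibre: "\<exists>D. \<forall>x\<in>base. card (fibre x) \<le> D"
proof -
 obtain k where k: "\<And>i. \<forall>x\<in>base. card (zeros_in (Q i) (p $ i) (r i) x) \<le> k i"
  using fam.card_Z_bound by metis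
 have "card (fibre x) \<le> (\<Prod>i\<in>UNIV. k i)" if "x \<in> base" for x
 proof -
  have "card (fibre x) \<le> (\<Prod>i\<in>UNIV. card (zeros_in (Q i) (p $ i) (r i) x))"
   unfolding fibre_def by (intro PiE_vec fam.finite_Z that)
  also have "\<dots> \<le> (\<Prod>i\<in>UNIV. k i)" by (rule prod_mono) (use k that in auto)
  finally show ?thesis .
 qed
 then show ?thesis by blast
qed

lemma fibre_closed:
 assumes "x \<in> base" "\<And>n. xs n \<in> base" "xs \<longlonglongrightarrow> x" "ys \<longlonglongrightarrow> y" "\<And>n. ys n \<in> fibre (xs n)"
 shows "y \<in> fibre x"
 unfolding fibre_def
proof safe
 fix i
 have lim: "(\<lambda>n. ys n $ i) \<longlonglongrightarrow> y $ i" by (intro tendsto_intros assms)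
 show "y $ i \<in> zeros_in (Q i) (p $ i) (r i) x"
  by (rule fam.Z_closed[OF assms(1,2,3) lim]) (use assms(5) in \<open>auto simp: fibre_def\<close>)
qed

lemma T_fibre: "x \<in> T ==> x \<in> polydisc ==> x \<in> base ==> x \<in> fibre x"
proof -
 assume x: "x \<in> T" "x \<in> polydisc" "x \<in> base"
 have "Q i (vcons x (x $ i)) = 0" for i
  by (rule vanish[OF x(1)]) (use x(2,3) in \<open>simp_all add: polydisc_def base_def\<close>)
 then show ?thesis using x(2) by (simp add: fibre_def zeros_in_def polydisc_def)
qed

lemma closure_T_fibre:
 assumes "x \<in> closure T" "x \<in> polydisc" "x \<in> base"
 shows "x \<in> fibre x"
proof -
 have "x \<in> (polydisc \<inter> base) \<inter> closure T" using assms by simp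
 then have "x \<in> closure ((polydisc \<inter> base) \<inter> T)"
  using open_Int_closure_subset[OF open_Int[OF open_polydisc open_base], of T] by (rule rev_subsetD)
 then obtain s where s: "\<And>n. s n \<in> (polydisc \<inter> base) \<inter> T" "s \<longlonglongrightarrow> x"
  unfolding closure_sequential by blast
 show ?thesis
  by (rule fibre_closed[OF assms(3) _ s(2,2)]) (use s(1) T_fibre in auto)
qed

text \<open>Besides being nonzero somewhere and constant along the kernel of \<open>\<L>\<close>,
  such a function certifies a local trivialisation: near each of its nonzeros the fibre is swept out
  by holomorphic sections \<open>R y\<close> that depend only on the projection of the
  point.\<close>

definition is_discr :: "(complex^'n => complex) => bool" where
 "is_discr h \<longleftrightarrow> holomorphic_fun base h \<and> (\<exists>x\<in>base. h x ~= 0) \<and>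
   (\<forall>x y. \<L> *v x = \<L> *v y --> h x = h y) \<and>
   (\<forall>x1\<in>base. h x1 ~= 0 --> (\<exists>e>0. \<exists>R. {x. norm (\<L> *v (x - x1)) < e} \<subseteq> {x\<in>base. h x ~= 0} \<and>
    (\<forall>y\<in>fibre x1. holomorphic_map {x. norm (\<L> *v (x - x1)) < e} (R y) \<and> R y x1 = y \<and>
      (\<forall>x x'. \<L> *v x = \<L> *v x' --> R y x = R y x')) \<and>
    (\<forall>x. norm (\<L> *v (x - x1)) < e --> bij_betw (\<lambda>y. R y x) (fibre x1) (fibre x))))"

lemma aproj_base_set: "x \<in> base ==> aproj \<L> p x \<in> base"
 by (simp add: base_def aproj_def LL)

lemma Lambda_aproj: "\<L> *v aproj \<L> p x = \<L> *v x"
 by (simp add: aproj_def matrix_vector_right_distrib matrix_vector_mult_diff_distrib LL)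

lemma is_discr_family:
 "\<exists>hf. (\<forall>i. holomorphic_fun base (hf i) \<and> (\<exists>x\<in>base. hf i x ~= 0)) \<and>
  (\<exists>nf. \<forall>i. \<forall>x\<in>base. hf i x ~= 0 \<longleftrightarrow> card (zeros_in (Q i) (p $ i) (r i) x) = nf i)"
proof -
 have "base ~= {}" using p_base by blast
 then have "\<exists>h n. holomorphic_fun base h \<and> (\<exists>x\<in>base. h x ~= 0) \<and>
  (\<forall>x\<in>base. h x ~= 0 \<longleftrightarrow> card (zeros_in (Q i) (p $ i) (r i) x) = n)" for i
  using fam.discriminant by meson
 then show ?thesis by metis
qed

text \<open>The product of the discriminants of the coordinate equations, precomposed with the
  projection. Where it is nonzero, the root functions of the single coordinates are combined to
  vector-valued sections.\<close>

theorem discr_exists: "\<exists>h. is_discr h"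
proof -
 obtain hf where hf0: "(\<forall>i. holomorphic_fun base (hf i) \<and> (\<exists>x\<in>base. hf i x ~= 0)) \<and>
  (\<exists>nf. \<forall>i. \<forall>x\<in>base. hf i x ~= 0 \<longleftrightarrow> card (zeros_in (Q i) (p $ i) (r i) x) = nf i)"
  using is_discr_family ..
 then obtain nf where hf: "\<And>i. holomorphic_fun base (hf i)" "\<And>i. \<exists>x\<in>base. hf i x ~= 0"
  "\<And>i x. x \<in> base ==> hf i x ~= 0 \<longleftrightarrow> card (zeros_in (Q i) (p $ i) (r i) x) = nf i" by blast
 define h where "h = (\<lambda>x. \<Prod>i\<in>UNIV. hf i (aproj \<L> p x))"
 have inv_a: "aproj \<L> p x = aproj \<L> p y" if "\<L> *v x = \<L> *v y" for x y
  using that by (simp add: aproj_def matrix_vector_mult_diff_distrib)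
 have hfa: "hf i (aproj \<L> p x) ~= 0 \<longleftrightarrow> hf i x ~= 0" if "x \<in> base" for i x
  using hf(3)[OF that] hf(3)[OF aproj_base_set[OF that]] zeros_invariant[OF Lambda_aproj] by simp
 have h0: "h x ~= 0 \<longleftrightarrow> (\<forall>i. hf i x ~= 0)" if "x \<in> base" for x
  using hfa[OF that] by (simp add: h_def)
 have "is_discr h"
  unfolding is_discr_def
 proof (intro conjI ballI impI allI)
  show "holomorphic_fun base h"
   unfolding h_def
   by (intro hol_intros holomorphic_fun_compose[OF holomorphic_map_aproj[OF holomorphic_map_id[OF open_base]] hf(1)]
     open_base aproj_base_set)
  have "\<exists>x\<in>UNIV \<inter> base. \<forall>i\<in>UNIV. hf i x ~= 0"
   by (rule holomorphic_fun_nonzero_finite[OF finite hf(1) convex_base hf(2)])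
     (use open_base p_base in auto)
  then show "\<exists>x\<in>base. h x ~= 0" using h0 by auto
  show "h x = h y" if "\<L> *v x = \<L> *v y" for x y using inv_a[OF that] by (simp add: h_def)
 next
  fix x1 assume x1: "x1 \<in> base" "h x1 ~= 0"
  define c where "c = aproj \<L> p x1"
  have c: "c \<in> base" "hf i c ~= 0" for i
   using aproj_base_set x1 h0[OF x1(1)] hfa[OF x1(1)] by (auto simp: c_def)
  have Zc: "zeros_in (Q i) (p $ i) (r i) c = zeros_in (Q i) (p $ i) (r i) x1" for i
   unfolding c_def by (rule zeros_invariant[OF Lambda_aproj])
  define P where "P = (\<lambda>i e \<rho>. e > 0 \<and> ball c e \<subseteq> {x\<in>base. hf i x ~= 0} \<and>
   (\<forall>t\<in>zeros_in (Q i) (p $ i) (r i) c. holomorphic_fun (ball c e) (\<rho> t) \<and> \<rho> t c = t) \<and>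
    (\<forall>x\<in>ball c e. bij_betw (\<lambda>t. \<rho> t x) (zeros_in (Q i) (p $ i) (r i) c) (zeros_in (Q i) (p $ i) (r i) x)))"
  have "\<exists>er. P i (fst er) (snd er)" for i
  proof -
   have "\<exists>e>0. ball c e \<subseteq> {x\<in>base. hf i x ~= 0} \<and>
   (\<exists>\<rho>. (\<forall>t\<in>zeros_in (Q i) (p $ i) (r i) c. holomorphic_fun (ball c e) (\<rho> t) \<and> \<rho> t c = t) \<and>
    (\<forall>x\<in>ball c e. bij_betw (\<lambda>t. \<rho> t x) (zeros_in (Q i) (p $ i) (r i) c) (zeros_in (Q i) (p $ i) (r i) x)))"
    by (rule fam.local_roots[OF hf(1,3) c])
   then obtain e where e: "e > 0 \<and> ball c e \<subseteq> {x\<in>base. hf i x ~= 0} \<and>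
   (\<exists>\<rho>. (\<forall>t\<in>zeros_in (Q i) (p $ i) (r i) c. holomorphic_fun (ball c e) (\<rho> t) \<and> \<rho> t c = t) \<and>
    (\<forall>x\<in>ball c e. bij_betw (\<lambda>t. \<rho> t x) (zeros_in (Q i) (p $ i) (r i) c) (zeros_in (Q i) (p $ i) (r i) x)))" ..
   then obtain \<rho> where "(\<forall>t\<in>zeros_in (Q i) (p $ i) (r i) c. holomorphic_fun (ball c e) (\<rho> t) \<and> \<rho> t c = t) \<and>
    (\<forall>x\<in>ball c e. bij_betw (\<lambda>t. \<rho> t x) (zeros_in (Q i) (p $ i) (r i) c) (zeros_in (Q i) (p $ i) (r i) x))"
    by (elim conjE exE) (rule that, rule conjI)
   then show ?thesis unfolding P_def using e by (intro exI[of _ "(e, \<rho>)"]) simp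
  qed
  then have "\<forall>i. \<exists>er. P i (fst er) (snd er)" by simp
  from choice[OF this] obtain er where er: "\<forall>i. P i (fst (er i)) (snd (er i))" ..
  define ef where "ef = (\<lambda>i. fst (er i))"
  define \<rho> where "\<rho> = (\<lambda>i. snd (er i))"
  have P: "P i (ef i) (\<rho> i)" for i using er by (simp add: ef_def \<rho>_def)
  have ef: "\<And>i. ef i > 0" "\<And>i. ball c (ef i) \<subseteq> {x\<in>base. hf i x ~= 0}"
   and \<rho>: "\<And>i. \<forall>t\<in>zeros_in (Q i) (p $ i) (r i) c. holomorphic_fun (ball c (ef i)) (\<rho> i t) \<and> \<rho> i t c = t"
    "\<And>i. \<forall>x\<in>ball c (ef i). bij_betw (\<lambda>t. \<rho> i t x) (zeros_in (Q i) (p $ i) (r i) c) (zeros_in (Q i) (p $ i) (r i) x)"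
   using P unfolding P_def by blast+
  define e where "e = Min (range ef)"
  have e: "e > 0" "\<And>i. e \<le> ef i" unfolding e_def using ef(1) by (auto simp: Min_gr_iff)
  define B where "B = {x. norm (\<L> *v (x - x1)) < e}"
  have B: "open B" unfolding B_def by (rule open_saturated)
  have aB: "aproj \<L> p x \<in> ball c (ef i)" if "x \<in> B" for x i
  proof -
   have "dist c (aproj \<L> p x) = norm (\<L> *v (x - x1))"
    by (simp add: c_def aproj_def dist_norm norm_minus_commute matrix_vector_mult_diff_distrib)
   then show ?thesis using that e(2)[of i] by (simp add: B_def)
  qed
  define R where "R = (\<lambda>y x. \<chi> i. \<rho> i (y $ i) (aproj \<L> p x))"
  have Bsub: "B \<subseteq> {x\<in>base. h x ~= 0}"
  proof
   fix x assume x: "x \<in> B"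
   have "aproj \<L> p x \<in> base" "hf i (aproj \<L> p x) ~= 0" for i using aB[OF x, of i] ef(2)[of i] by auto
   then show "x \<in> {x\<in>base. h x ~= 0}"
    using base_invariant[OF Lambda_aproj] by (simp add: h_def)
  qed
  show "\<exists>e>0. \<exists>R. {x. norm (\<L> *v (x - x1)) < e} \<subseteq> {x\<in>base. h x ~= 0} \<and>
    (\<forall>y\<in>fibre x1. holomorphic_map {x. norm (\<L> *v (x - x1)) < e} (R y) \<and> R y x1 = y \<and>
      (\<forall>x x'. \<L> *v x = \<L> *v x' --> R y x = R y x')) \<and>
    (\<forall>x. norm (\<L> *v (x - x1)) < e --> bij_betw (\<lambda>y. R y x) (fibre x1) (fibre x))"
  proof (intro exI[of _ e] exI[of _ R] conjI ballI allI impI)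
   show "{x. norm (\<L> *v (x - x1)) < e} \<subseteq> {x\<in>base. h x ~= 0}" using Bsub by (simp add: B_def)
   fix y assume y: "y \<in> fibre x1"
   have yi: "y $ i \<in> zeros_in (Q i) (p $ i) (r i) c" for i using y by (simp add: fibre_def Zc)
   have "holomorphic_map B (R y)"
    unfolding R_def
   proof (intro holomorphic_map_lambda)
    fix i
    show "holomorphic_fun B (\<lambda>x. \<rho> i (y $ i) (aproj \<L> p x))"
     by (rule holomorphic_fun_compose[OF holomorphic_map_aproj[OF holomorphic_map_id[OF B]], of "ball c (ef i)"])
       (use \<rho>(1) yi aB in auto)
   qed
   then show "holomorphic_map {x. norm (\<L> *v (x - x1)) < e} (R y)" by (simp add: B_def)
   show "R y x1 = y" using \<rho>(1) yi by (simp add: R_def vec_eq_iff flip: c_def)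
   show "R y x = R y x'" if "\<L> *v x = \<L> *v x'" for x x'
    using inv_a[OF that] by (simp add: R_def)
  next
   fix x assume "norm (\<L> *v (x - x1)) < e"
   then have x: "x \<in> B" by (simp add: B_def)
   have bij: "bij_betw (\<lambda>t. \<rho> i t (aproj \<L> p x)) (zeros_in (Q i) (p $ i) (r i) x1) (zeros_in (Q i) (p $ i) (r i) x)" for i
   proof -
    have "bij_betw (\<lambda>t. \<rho> i t (aproj \<L> p x)) (zeros_in (Q i) (p $ i) (r i) c)
      (zeros_in (Q i) (p $ i) (r i) (aproj \<L> p x))"
     using \<rho>(2)[of i, THEN bspec, OF aB[OF x]] .
    then show ?thesis unfolding Zc zeros_invariant[OF Lambda_aproj] .
   qed
   show "bij_betw (\<lambda>y. R y x) (fibre x1) (fibre x)"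
    unfolding bij_betw_def
   proof
    show "inj_on (\<lambda>y. R y x) (fibre x1)"
    proof (rule inj_onI)
     fix y y' assume y: "y \<in> fibre x1" "y' \<in> fibre x1" "R y x = R y' x"
     have "y $ i = y' $ i" for i
      using y bij[of i] by (auto simp: bij_betw_def inj_on_def fibre_def R_def vec_eq_iff)
     then show "y = y'" by (simp add: vec_eq_iff)
    qed
    show "(\<lambda>y. R y x) ` fibre x1 = fibre x"
    proof
     show "(\<lambda>y. R y x) ` fibre x1 \<subseteq> fibre x"
      using bij_betwE[OF bij] by (auto simp: fibre_def R_def)
     show "fibre x \<subseteq> (\<lambda>y. R y x) ` fibre x1"
     proof
      fix z assume z: "z \<in> fibre x"
      have "\<exists>t\<in>zeros_in (Q i) (p $ i) (r i) x1. z $ i = \<rho> i t (aproj \<L> p x)" for i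
       using z bij[of i] by (auto simp: bij_betw_def fibre_def)
      then obtain tf where "\<And>i. tf i \<in> zeros_in (Q i) (p $ i) (r i) x1" "\<And>i. z $ i = \<rho> i (tf i) (aproj \<L> p x)"
       by metis
      then show "z \<in> (\<lambda>y. R y x) ` fibre x1"
       by (intro image_eqI[of _ _ "\<chi> i. tf i"]) (auto simp: fibre_def R_def vec_eq_iff)
     qed
    qed
   qed
  qed (rule e(1))
 qed
 then show ?thesis by blast
qed

end

section \<open>Pure dimension and the rank of finite projections\<close>

definition pure_dim :: "(complex^'n) set => nat => bool" where
 "pure_dim T n \<longleftrightarrow> (\<forall>x\<in>T. \<forall>e>0. \<exists>y\<in>T. dist y x < e \<and> smooth_point T y n)"

lemma pure_dim_closure:
 assumes "pure_dim T n" "x \<in> closure T" "e > 0"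
 shows "\<exists>y\<in>T. dist y x < e \<and> smooth_point T y n"
proof -
 obtain t where t: "t \<in> T" "dist t x < e / 2" using assms(2,3) unfolding closure_approachable by (meson half_gt_zero)
 have "e / 2 > 0" using assms(3) by simp
 then obtain y where "y \<in> T" "dist y t < e / 2" "smooth_point T y n"
  using assms(1) t(1) unfolding pure_dim_def by blast
 moreover have "dist y x < e" using dist_triangle[of y x t] t(2) \<open>dist y t < e / 2\<close> by simp
 ultimately show ?thesis by blast
qed

lemma has_derivative_aproj: "(aproj \<L> p has_derivative (*v) \<L>) (at x)"
proof -
 have "((\<lambda>x. p + \<L> *v (x - p)) has_derivative (\<lambda>v. 0 + \<L> *v (v - 0))) (at x)"
  by (intro derivative_intros bounded_linear.has_derivative[OF bounded_linear_matrix_vector])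
 then show ?thesis by (simp add: aproj_def[abs_def])
qed

lemma dim_range_absorb:
 fixes J P \<L> :: "complex^'n^'n"
 assumes "J ** P = P" "J ** \<L> = J"
 shows "vec.dim (range ((*v) P)) \<le> vec.dim (range ((*v) \<L>))"
proof -
 have eq: "P *v v = J *v (\<L> *v (P *v v))" for v
  by (metis assms matrix_vector_mul_assoc)
 have "vec.dim (range ((*v) P)) \<le> vec.dim ((*v) J ` range ((*v) \<L>))"
  by (rule vec.dim_subset) (use eq in blast)
 also have "\<dots> \<le> vec.dim (range ((*v) \<L>))"
  by (rule vec.dim_image_le[OF matrix_vector_mul_linear_gen])
 finally show ?thesis .
qed

context local_cover
begin

abbreviation sat :: "complex^'n => real => (complex^'n) set" where
 "sat c e \<equiv> {x. norm (\<L> *v (x - c)) < e}"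

definition sheets where
 "sheets h x1 e R \<longleftrightarrow> e > 0 \<and> x1 \<in> base \<and> sat x1 e \<subseteq> {x\<in>base. h x ~= 0} \<and>
   (\<forall>y\<in>fibre x1. holomorphic_map (sat x1 e) (R y) \<and> R y x1 = y \<and>
      (\<forall>x x'. \<L> *v x = \<L> *v x' --> R y x = R y x')) \<and>
    (\<forall>x. norm (\<L> *v (x - x1)) < e --> bij_betw (\<lambda>y. R y x) (fibre x1) (fibre x))"

lemma sheets_exist:
 assumes "is_discr h" "x1 \<in> base" "h x1 ~= 0"
 shows "\<exists>e R. sheets h x1 e R"
proof -
 have "\<exists>e>0. \<exists>R. sat x1 e \<subseteq> {x\<in>base. h x ~= 0} \<and>
   (\<forall>y\<in>fibre x1. holomorphic_map (sat x1 e) (R y) \<and> R y x1 = y \<and>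
      (\<forall>x x'. \<L> *v x = \<L> *v x' --> R y x = R y x')) \<and>
    (\<forall>x. norm (\<L> *v (x - x1)) < e --> bij_betw (\<lambda>y. R y x) (fibre x1) (fibre x))"
  using assms(1)[unfolded is_discr_def, THEN conjunct2, THEN conjunct2, THEN conjunct2, THEN bspec, OF assms(2), THEN mp, OF assms(3)] .
 then show ?thesis unfolding sheets_def
  by (elim exE conjE, intro exI) (intro conjI assms(2); assumption)
qed

lemma is_discrD:
 assumes "is_discr h"
 shows "holomorphic_fun base h" "\<exists>x\<in>base. h x ~= 0" "\<L> *v x = \<L> *v y ==> h x = h y"
proof -
 note * = assms[unfolded is_discr_def]
 show "holomorphic_fun base h" by (rule *[THEN conjunct1])
 show "\<exists>x\<in>base. h x ~= 0" by (rule *[THEN conjunct2, THEN conjunct1])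
 show "\<L> *v x = \<L> *v y ==> h x = h y" by (rule *[THEN conjunct2, THEN conjunct2, THEN conjunct1, rule_format])
qed

lemma sat_invariant: "\<L> *v x = \<L> *v y ==> x \<in> sat c e \<longleftrightarrow> y \<in> sat c e"
 by (simp add: matrix_vector_mult_diff_distrib)

lemma sheets_basic:
 assumes "sheets h x1 e R"
 shows "e > 0" "x1 \<in> base" "x1 \<in> sat x1 e"
 using assms unfolding sheets_def by (simp_all del: mem_Collect_eq) simp

lemma sheets_sat:
 assumes "sheets h x1 e R" "x \<in> sat x1 e"
 shows "x \<in> base" "h x ~= 0"
proof -
 have "sat x1 e \<subseteq> {x\<in>base. h x ~= 0}" using assms(1) unfolding sheets_def by (elim conjE)
 then have "x \<in> {x\<in>base. h x ~= 0}" using assms(2) by (rule subsetD)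
 then show "x \<in> base" "h x ~= 0" by simp_all
qed

lemma sheets_sheet:
 assumes "sheets h x1 e R" "y \<in> fibre x1"
 shows "holomorphic_map (sat x1 e) (R y)" "R y x1 = y" "\<L> *v x = \<L> *v x' ==> R y x = R y x'"
proof -
 have "\<forall>y\<in>fibre x1. holomorphic_map (sat x1 e) (R y) \<and> R y x1 = y \<and>
      (\<forall>x x'. \<L> *v x = \<L> *v x' --> R y x = R y x')" using assms(1) unfolding sheets_def by (elim conjE)
 note * = this[THEN bspec, OF assms(2)]
 show "holomorphic_map (sat x1 e) (R y)" by (rule *[THEN conjunct1])
 show "R y x1 = y" by (rule *[THEN conjunct2, THEN conjunct1])
 show "\<L> *v x = \<L> *v x' ==> R y x = R y x'" by (rule *[THEN conjunct2, THEN conjunct2, rule_format])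
qed

lemma sheets_bij:
 assumes "sheets h x1 e R" "x \<in> sat x1 e"
 shows "bij_betw (\<lambda>y. R y x) (fibre x1) (fibre x)"
proof -
 have "\<forall>x. norm (\<L> *v (x - x1)) < e --> bij_betw (\<lambda>y. R y x) (fibre x1) (fibre x)"
  using assms(1) unfolding sheets_def by (elim conjE)
 then show ?thesis using assms(2) by simp
qed

lemma sheets_mem:
 assumes "sheets h x1 e R" "y \<in> fibre x1" "x \<in> sat x1 e"
 shows "R y x \<in> fibre x" "R y x \<in> polydisc"
proof -
 show "R y x \<in> fibre x" using bij_betw_apply[OF sheets_bij[OF assms(1,3)] assms(2)] .
 then show "R y x \<in> polydisc" using fibre_subset by (rule rev_subsetD)
qed

lemmas sheetsD = sheets_basic sheets_sat sheets_sheet sheets_bij sheets_mem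

text \<open>Above \<open>x\<close> the finitely many sheets are separated by some \<open>m\<close>,
  and they move by less than \<open>m / 2\<close> nearby; a fibre point close to one of them can
  then lie on no other.\<close>

lemma sheets_near:
 assumes s: "sheets h x1 e R" and x: "x \<in> sat x1 e" and y: "y \<in> fibre x1"
 shows "\<exists>d>0. \<forall>x' y'. dist x' x < d \<and> y' \<in> fibre x' \<and> dist y' (R y x) < d --> x' \<in> sat x1 e \<and> y' = R y x'"
proof -
 have fin: "finite (fibre x1)" by (rule finite_fibre[OF sheetsD(2)[OF s]])
 obtain m where m: "m > 0" "\<forall>z\<in>(\<lambda>y. R y x) ` fibre x1. z ~= R y x --> m \<le> dist (R y x) z"
  using finite_set_avoid[OF finite_imageI[OF fin]] by blast
 have o: "open (sat x1 e)" by (rule open_saturated)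
 have "\<forall>\<^sub>F x' in nhds x. dist (R \<eta> x') (R \<eta> x) < m / 2" if "\<eta> \<in> fibre x1" for \<eta>
 proof -
  have "isCont (R \<eta>) x"
   using holomorphic_map_continuous_on[OF sheetsD(6)[OF s that]] x o continuous_on_eq_continuous_at by blast
  then have "(R \<eta> \<longlongrightarrow> R \<eta> x) (nhds x)" by (simp add: isCont_def tendsto_at_iff_tendsto_nhds)
  then show ?thesis using m(1) by (intro tendstoD) auto
 qed
 then have "\<forall>\<^sub>F x' in nhds x. \<forall>\<eta>\<in>fibre x1. dist (R \<eta> x') (R \<eta> x) < m / 2"
  using fin by (intro eventually_ball_finite) auto
 then have "\<forall>\<^sub>F x' in nhds x. x' \<in> sat x1 e \<and> (\<forall>\<eta>\<in>fibre x1. dist (R \<eta> x') (R \<eta> x) < m / 2)"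
  using eventually_nhds_in_open[OF o x] by (rule eventually_conj[rotated])
 then obtain d where d: "d > 0" "\<forall>x'. dist x' x < d --> x' \<in> sat x1 e \<and> (\<forall>\<eta>\<in>fibre x1. dist (R \<eta> x') (R \<eta> x) < m / 2)"
  unfolding eventually_nhds_metric by blast
 show ?thesis
 proof (intro exI[of _ "min d (m/2)"] conjI allI impI)
  show "min d (m/2) > 0" using d m by simp
  fix x' y' assume *: "dist x' x < min d (m/2) \<and> y' \<in> fibre x' \<and> dist y' (R y x) < min d (m/2)"
  then have x': "x' \<in> sat x1 e" using d by simp
  then show "x' \<in> sat x1 e" .
  obtain \<eta> where \<eta>: "\<eta> \<in> fibre x1" "y' = R \<eta> x'"
   using sheetsD(9)[OF s x'] * by (auto simp: bij_betw_def)
  have "R \<eta> x = R y x"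
  proof (rule ccontr)
   assume "R \<eta> x ~= R y x"
   then have "m \<le> dist (R y x) (R \<eta> x)" using m \<eta>(1) by auto
   moreover have "dist (R \<eta> x') (R \<eta> x) < m / 2" using d * \<eta>(1) by simp
   moreover have "dist y' (R y x) < m / 2" using * by simp
   moreover have "dist (R y x) (R \<eta> x) \<le> dist (R y x) y' + dist y' (R \<eta> x)" by (rule dist_triangle)
   ultimately show False using \<eta>(2) by (simp add: dist_commute)
  qed
  then have "\<eta> = y" using sheetsD(9)[OF s x] \<eta>(1) y by (auto simp: bij_betw_def inj_on_def)
  then show "y' = R y x'" using \<eta> by simp
 qed
qed

text \<open>A point of \<open>T\<close> near \<open>w\<close> belongs to its own fibre and is close
  to \<open>R y w = w\<close>, so it lies on this sheet.\<close>

lemma sheet_near_T: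
 assumes s: "sheets h x1 e R" and w: "w \<in> sat x1 e" and y: "y \<in> fibre x1" and Rw: "R y w = w"
 shows "\<exists>d>0. \<forall>t. dist t w < d --> t \<in> sat x1 e \<and> t \<in> polydisc \<and> (t \<in> T --> R y t = t)"
proof -
 obtain d where d: "d > 0 \<and> (\<forall>x' y'. dist x' w < d \<and> y' \<in> fibre x' \<and> dist y' (R y w) < d --> x' \<in> sat x1 e \<and> y' = R y x')"
  using sheets_near[OF s w y] ..
 have "w \<in> polydisc" using sheetsD(11)[OF s y w] Rw by simp
 then have "w \<in> polydisc \<inter> sat x1 e" "open (polydisc \<inter> sat x1 e)"
  using w open_polydisc open_saturated by auto
 then obtain d' where d': "d' > 0" "ball w d' \<subseteq> polydisc \<inter> sat x1 e" using open_ball_mult_imp by meson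
 show ?thesis
 proof (intro exI[of _ "min d d'"] conjI allI impI)
  show "min d d' > 0" using d d' by simp
  fix t assume t: "dist t w < min d d'"
  then have "t \<in> ball w d'" by (simp add: dist_commute)
  then have t': "t \<in> polydisc \<inter> sat x1 e" using d' by blast
  then show "t \<in> sat x1 e" "t \<in> polydisc" by auto
  assume "t \<in> T"
  then have "t \<in> fibre t" using t' sheetsD(4)[OF s] by (intro T_fibre) auto
  then show "R y t = t" using d t Rw by (metis min_less_iff_conj)
 qed
qed

lemma sheet_at:
 assumes s: "sheets h x1 e R" and w: "w \<in> sat x1 e" "w \<in> polydisc" "w \<in> closure T"
 shows "\<exists>y\<in>fibre x1. R y w = w"
proof -
 have "w \<in> fibre w" using closure_T_fibre[OF w(3,2) sheetsD(4)[OF s w(1)]] .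
 then have "w \<in> (\<lambda>y. R y w) ` fibre x1" using sheetsD(9)[OF s w(1)] by (simp add: bij_betw_def)
 then show ?thesis by (metis imageE)
qed

text \<open>Differentiate the fact that the sheet is constant along the kernel of
  \<open>\<L>\<close>.\<close>

lemma sheet_jac_invariant:
 assumes s: "sheets h x1 e R" and w: "w \<in> sat x1 e" and y: "y \<in> fibre x1"
 shows "jac (R y) w ** \<L> = jac (R y) w"
proof -
 have D: "(R y has_derivative (*v) (jac (R y) w)) (at w)" by (rule has_derivative_jac[OF sheetsD(6)[OF s y] w])
 then have "((\<lambda>x. R y (aproj \<L> w x)) has_derivative (*v) (jac (R y) w ** \<L>)) (at w)"
  by (intro has_derivative_compose_matrix[OF has_derivative_aproj]) simp
 moreover have "R y (aproj \<L> w x) = R y x" for x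
  by (rule sheetsD(8)[OF s y]) (simp add: aproj_def matrix_vector_right_distrib matrix_vector_mult_diff_distrib LL)
 ultimately have "(R y has_derivative (*v) (jac (R y) w ** \<L>)) (at w)" by simp
 then show ?thesis using jac_eqI by metis
qed

text \<open>The sheet fixes the points of \<open>T\<close> near \<open>w\<close>, and
  \<open>\<sigma>\<close> has its values there; differentiate.\<close>

lemma sheet_jac_retraction:
 assumes s: "sheets h x1 e R" and w: "w \<in> sat x1 e" and y: "y \<in> fibre x1" and Rw: "R y w = w"
  and \<sigma>: "local_retraction T w U \<sigma>"
 shows "jac (R y) w ** jac \<sigma> w = jac \<sigma> w"
proof -
 obtain d where d: "d > 0 \<and> (\<forall>t. dist t w < d --> t \<in> sat x1 e \<and> t \<in> polydisc \<and> (t \<in> T --> R y t = t))"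
  using sheet_near_T[OF s w y Rw] ..
 note \<sigma>D = local_retractionD[OF \<sigma>]
 have "(R y has_derivative (*v) (jac (R y) w)) (at (\<sigma> w))"
  using has_derivative_jac[OF sheetsD(6)[OF s y] w] \<sigma>D(7) by simp
 from has_derivative_compose_matrix[OF \<sigma>D(8) this]
 have D: "((\<lambda>x. R y (\<sigma> x)) has_derivative (*v) (jac (R y) w ** jac \<sigma> w)) (at w)" .
 have "(\<sigma> has_derivative (*v) (jac (R y) w ** jac \<sigma> w)) (at w)"
 proof (rule has_derivative_near_matrix[OF D])
  show "open {u\<in>U. \<sigma> u \<in> ball w d}" by (rule holomorphic_map_vimage_open[OF \<sigma>D(1) open_ball])
  show "w \<in> {u\<in>U. \<sigma> u \<in> ball w d}" using \<sigma>D d by simp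
  show "R y (\<sigma> x) = \<sigma> x" if "x \<in> {u\<in>U. \<sigma> u \<in> ball w d}" for x
   using that \<sigma>D(5) d by (auto simp: dist_commute)
 qed
 then show ?thesis using jac_eqI by metis
qed

lemma trace_Lambda: "trace \<L> = of_nat (vec.dim (range ((*v) \<L>)))"
 by (rule trace_idempotent[OF idem])

text \<open>At a smooth point on a sheet, the tangent projection \<open>P\<close> and the derivative
  \<open>J\<close> of the sheet satisfy \<open>P = J ** P\<close> and \<open>J = J ** \<L>\<close>.
  So \<open>P\<close> factors through \<open>\<L>\<close> and its rank is at most that of
  \<open>\<L>\<close>.\<close>

lemma dim_bound_generic:
 assumes h: "is_discr h" and T: "pure_dim T n" and t: "t \<in> T" "t \<in> polydisc" "t \<in> base" "h t ~= 0"
 shows "n \<le> vec.dim (range ((*v) \<L>))"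
proof -
 obtain e R where s: "sheets h t e R" using sheets_exist[OF h t(3,4)] by blast
 have "t \<in> sat t e \<inter> polydisc" "open (sat t e \<inter> polydisc)"
  using sheetsD(3)[OF s] t open_polydisc open_saturated by auto
 then obtain d where d: "d > 0" "ball t d \<subseteq> sat t e \<inter> polydisc" using open_ball_mult_imp by meson
 obtain w where w: "w \<in> T" "dist w t < d" "smooth_point T w n" using T t(1) d(1) unfolding pure_dim_def by blast
 have "w \<in> ball t d" using w(2) by (simp add: dist_commute)
 then have w': "w \<in> sat t e" "w \<in> polydisc" using d(2) by blast+
 obtain y where y: "y \<in> fibre t" "R y w = w"
  using sheet_at[OF s w'] w(1) closure_subset by blast
 obtain U \<sigma> where \<sigma>: "local_retraction T w U \<sigma>" "trace (jac \<sigma> w) = of_nat n"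
  using smooth_point_imp_retraction[OF w(3)] by blast
 have "vec.dim (range ((*v) (jac \<sigma> w))) \<le> vec.dim (range ((*v) \<L>))"
  by (rule dim_range_absorb[OF sheet_jac_retraction[OF s w'(1) y \<sigma>(1)] sheet_jac_invariant[OF s w'(1) y(1)]])
 moreover have "of_nat n = (of_nat (vec.dim (range ((*v) (jac \<sigma> w)))) :: complex)"
  using trace_idempotent[OF local_retraction_idempotent[OF \<sigma>(1)]] \<sigma>(2) by simp
 ultimately show ?thesis by (simp only: of_nat_eq_iff)
qed

lemma invariant_nonzero_near:
 assumes g: "holomorphic_fun base g" "\<exists>x\<in>base. g x ~= 0" "\<And>x y. \<L> *v x = \<L> *v y ==> g x = g y"
  and x: "x \<in> base" and e: "e > 0"
 shows "\<exists>x'. dist x' x < e \<and> g (aproj \<L> x x') ~= 0"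
proof -
 obtain z where z: "z \<in> base" "g z ~= 0" using g(2) by blast
 have "x \<in> ball x e \<inter> base" using x e by simp
 then have "ball x e \<inter> base ~= {}" by blast
 then obtain x' where "x' \<in> ball x e" "g x' ~= 0"
  using holomorphic_fun_nonzero_dense[OF g(1) convex_base z open_ball] by blast
 moreover have "g (aproj \<L> x x') = g x'"
  by (rule g(3)) (simp add: aproj_def matrix_vector_right_distrib matrix_vector_mult_diff_distrib LL)
 ultimately show ?thesis by (intro exI[of _ x']) (auto simp: dist_commute)
qed

lemma Lambda_aproj': "\<L> *v aproj \<L> c x = \<L> *v x"
 by (simp add: aproj_def matrix_vector_right_distrib matrix_vector_mult_diff_distrib LL)

text \<open>Finiteness spreads from the centre to nearby points, which allows a further projection
  at a point other than \<open>p\<close>.\<close>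

lemma finite_over_at:
 assumes x: "x \<in> polydisc" "x \<in> base"
 shows "finite_over T x \<L>"
 unfolding finite_over_def
proof (intro conjI allI idem)
 fix i
 have xi: "x $ i \<in> ball (p $ i) (r i)" using x(1) by (simp add: polydisc_def)
 have "\<exists>\<tau>. dist \<tau> (x $ i) < e \<and> Q i (vcons x \<tau>) ~= 0" if e: "e > 0" for e
 proof -
  define S where "S = ball (x $ i) e \<inter> ball (p $ i) (r i)"
  have "open S" "x $ i \<in> S" using xi e by (auto simp: S_def)
  then have "infinite S" using finite_imp_not_open by blast
  moreover have "finite (zeros_in (Q i) (p $ i) (r i) x)" by (rule fam.finite_Z[OF x(2)])
  ultimately obtain \<tau> where "\<tau> \<in> S" "\<tau> \<notin> zeros_in (Q i) (p $ i) (r i) x"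
   by (meson finite_subset subsetI)
  then show ?thesis by (intro exI[of _ \<tau>]) (auto simp: S_def zeros_in_def dist_commute)
 qed
 moreover have "vcons x (x $ i) \<in> V i" by (rule fam.in_V[OF x(2)]) (use xi in auto)
 moreover have "Q i (vcons (aproj \<L> x t) (t $ i)) = 0" if "t \<in> T \<inter> (polydisc \<inter> base)" for t
 proof -
  have "Q i (vcons (aproj \<L> x t) (t $ i)) = Q i (vcons t (t $ i))" by (rule invariant[OF Lambda_aproj'])
  also have "\<dots> = 0" by (rule vanish) (use that in \<open>auto simp: polydisc_def base_def\<close>)
  finally show ?thesis .
 qed
 ultimately show "\<exists>V Q W. holomorphic_fun V Q \<and> vcons x (x $ i) \<in> V \<and>
   (\<forall>e>0. \<exists>\<tau>. dist \<tau> (x $ i) < e \<and> Q (vcons x \<tau>) ~= 0) \<and> open W \<and> x \<in> W \<and>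
   (\<forall>t\<in>T \<inter> W. Q (vcons (aproj \<L> x t) (t $ i)) = 0)"
  using fam.hol_\<Phi>[of i] open_polydisc open_base x
  by (intro exI[of _ "V i"] exI[of _ "Q i"] exI[of _ "polydisc \<inter> base"]) auto
qed

lemma project_vanishing:
 assumes g: "holomorphic_fun base g" "\<exists>x\<in>base. g x ~= 0" "\<And>x y. \<L> *v x = \<L> *v y ==> g x = g y"
  and x: "x \<in> base" "x \<in> polydisc" "x \<in> closure T" and W: "open W" "x \<in> W" "\<And>t. t \<in> T ==> t \<in> W ==> g t = 0"
 shows "\<exists>\<L>'. finite_over T x \<L>' \<and> trace \<L>' = trace \<L> - 1"
proof (rule finite_over_project[OF finite_over_at[OF x(2,1)] x(3) g(1) x(1) W(1,2)])
 show "g (aproj \<L> x t) = 0" if "t \<in> T" "t \<in> W" for t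
  using W(3)[OF that] g(3)[OF Lambda_aproj'] by metis
 show "\<exists>x'. dist x' x < e \<and> g (aproj \<L> x x') ~= 0" if "e > 0" for e
  by (rule invariant_nonzero_near[OF g x(1) that])
qed

end

text \<open>Induction on the rank. Either a point of \<open>T\<close> near \<open>p\<close> lies
  over a nonzero of the discriminant, and sheets bound the dimension; or the discriminant vanishes
  on \<open>T\<close> near \<open>p\<close>, and one more projection lowers the rank.\<close>

theorem finite_over_dim_bound:
 fixes T :: "(complex^'n) set"
 assumes T: "pure_dim T n" and p: "p \<in> closure T"
 shows "finite_over T p \<L> ==> trace \<L> = of_nat k ==> n \<le> k"
proof (induction k arbitrary: \<L> rule: less_induct)
 case (less k)
 obtain V Q r \<epsilon> where "local_cover T p \<L> V Q r \<epsilon> \<and> {y. \<forall>i. dist (p $ i) (y $ i) < r i} \<subseteq> UNIV"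
  using finite_over_imp_local_cover[OF less.prems(1) open_UNIV UNIV_I] by (elim exE)
 then interpret local_cover T p \<L> V Q r \<epsilon> by simp
 obtain h where h: "is_discr h" using discr_exists ..
 have tr: "vec.dim (range ((*v) \<L>)) = k" using trace_Lambda less.prems(2) by simp
 show ?case
 proof (cases "\<exists>t\<in>T. t \<in> polydisc \<and> t \<in> base \<and> h t ~= 0")
  case True
  then show ?thesis using dim_bound_generic[OF h T] tr by blast
 next
  case False
  have "\<exists>\<L>'. finite_over T p \<L>' \<and> trace \<L>' = trace \<L> - 1"
   by (rule project_vanishing[OF is_discrD[OF h] p_base p_polydisc p, of "polydisc \<inter> base"])
     (use False open_polydisc open_base p_base p_polydisc in auto)
  then obtain \<L>' where L: "finite_over T p \<L>'" "trace \<L>' = of_nat k - 1"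
   using less.prems(2) by auto
  have "trace \<L>' = of_nat (vec.dim (range ((*v) \<L>')))"
   using L(1) by (intro trace_idempotent) (simp add: finite_over_def)
  then have "of_nat k = (of_nat (Suc (vec.dim (range ((*v) \<L>')))) :: complex)" using L(2) by (simp add: algebra_simps)
  then have "k = Suc (vec.dim (range ((*v) \<L>')))" by (simp only: of_nat_eq_iff)
  then have "k - 1 < k" "trace \<L>' = of_nat (k - 1)" using L(2) by auto
  from less.IH[OF this(1) L(1) this(2)] show ?thesis by simp
 qed
qed

text \<open>If \<open>g\<close> vanished on \<open>T\<close> near \<open>x\<close>, then
  \<open>T\<close> would be finite over a projection of rank \<open>n - 1\<close>, contradicting the
  dimension bound.\<close>

lemma (in local_cover) dense_nonzero:
 assumes T: "pure_dim T n" and tr: "trace \<L> = of_nat n"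
  and g: "holomorphic_fun base g" "\<exists>x\<in>base. g x ~= 0" "\<And>x y. \<L> *v x = \<L> *v y ==> g x = g y"
  and x: "x \<in> base" "x \<in> polydisc" "x \<in> closure T" and e: "e > 0"
 shows "\<exists>t\<in>T. dist t x < e \<and> t \<in> polydisc \<and> t \<in> base \<and> g t ~= 0"
proof (rule ccontr)
 assume neg: "\<not> ?thesis"
 have "\<exists>\<L>'. finite_over T x \<L>' \<and> trace \<L>' = trace \<L> - 1"
  by (rule project_vanishing[OF g x, of "ball x e \<inter> polydisc \<inter> base"])
    (use neg open_polydisc open_base x e in \<open>auto simp: dist_commute\<close>)
 then obtain \<L>' where L: "finite_over T x \<L>'" "trace \<L>' = of_nat n - 1" using tr by auto
 have "trace \<L>' = of_nat (vec.dim (range ((*v) \<L>')))"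
  using L(1) by (intro trace_idempotent) (simp add: finite_over_def)
 then have "of_nat n = (of_nat (Suc (vec.dim (range ((*v) \<L>')))) :: complex)" using L(2) by (simp add: algebra_simps)
 then have n: "n = Suc (vec.dim (range ((*v) \<L>')))" by (simp only: of_nat_eq_iff)
 then have "trace \<L>' = of_nat (n - 1)" using L(2) by auto
 from finite_over_dim_bound[OF T x(3) L(1) this] n show False by simp
qed

section \<open>Analyticity of the closure\<close>

text \<open>The equality case of the rank estimate: \<open>\<L>\<close> maps the range of
  \<open>P\<close> isomorphically onto its own range, and \<open>J\<close> is the inverse on
  it.\<close>

lemma dim_range_absorb_eq:
 fixes J P \<L> :: "complex^'n^'n"
 assumes JP: "J ** P = P" and JL: "J ** \<L> = J" and PP: "P ** P = P"
  and dim: "vec.dim (range ((*v) \<L>)) \<le> vec.dim (range ((*v) P))"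
 shows "\<L> ** J = \<L>" "P ** J = J"
proof -
 have m: "A *v (B *v v) = (A ** B) *v v" for A B :: "complex^'n^'n" and v
  by (simp add: matrix_vector_mul_assoc)
 have JLP: "J *v (\<L> *v (P *v v)) = P *v v" for v by (simp add: m matrix_mul_assoc JL JP)
 have sub: "vec.subspace (range ((*v) M))" for M :: "complex^'n^'n"
  by (rule vec.linear_subspace_image[OF matrix_vector_mul_linear_gen vec.subspace_UNIV])
 have "vec.dim (range ((*v) P)) \<le> vec.dim ((*v) J ` range ((*v) (\<L> ** P)))"
 proof (rule vec.dim_subset, rule subsetI)
  fix z assume "z \<in> range ((*v) P)"
  then obtain v where "z = P *v v" by auto
  then have "z = J *v ((\<L> ** P) *v v)" using JLP[of v] by (simp add: m)
  then show "z \<in> (*v) J ` range ((*v) (\<L> ** P))" by blast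
 qed
 also have "\<dots> \<le> vec.dim (range ((*v) (\<L> ** P)))"
  by (rule vec.dim_image_le[OF matrix_vector_mul_linear_gen])
 finally have "vec.dim (range ((*v) \<L>)) \<le> vec.dim (range ((*v) (\<L> ** P)))" using dim by simp
 moreover have "range ((*v) (\<L> ** P)) \<subseteq> range ((*v) \<L>)" by (auto simp: m[symmetric])
 ultimately have eq: "range ((*v) (\<L> ** P)) = range ((*v) \<L>)"
  using vec.subspace_dim_equal[OF sub sub] by blast
 have ex: "\<exists>u. \<L> *v v = \<L> *v (P *v u)" for v
 proof -
  have "\<L> *v v \<in> range ((*v) (\<L> ** P))" unfolding eq by (rule rangeI)
  then show ?thesis by (auto simp: m)
 qed
 have JL': "J *v v = J *v (\<L> *v v)" for v by (simp add: m JL)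
 show "\<L> ** J = \<L>"
 proof (rule matrix_eqI)
  fix v obtain u where u: "\<L> *v v = \<L> *v (P *v u)" using ex by blast
  have "\<L> *v (J *v v) = \<L> *v (J *v (\<L> *v v))" using JL' by simp
  also have "\<dots> = \<L> *v v" by (simp add: u JLP)
  finally show "(\<L> ** J) *v v = \<L> *v v" by (simp add: m)
 qed
 show "P ** J = J"
 proof (rule matrix_eqI)
  fix v obtain u where u: "\<L> *v v = \<L> *v (P *v u)" using ex by blast
  have "J *v v = P *v u" using JL'[of v] u JLP by simp
  then show "(P ** J) *v v = J *v v" by (simp add: m[symmetric]) (simp add: m PP)
 qed
qed

lemma prod_norm_bound:
 fixes f :: "'a => complex"
 assumes "card A \<le> D" "1 \<le> B" "\<And>a. a \<in> A ==> norm (f a) \<le> B"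
 shows "norm (\<Prod>a\<in>A. f a) \<le> B ^ D"
proof -
 have "norm (\<Prod>a\<in>A. f a) \<le> (\<Prod>a\<in>A. B)"
  unfolding prod_norm[symmetric] by (rule prod_mono) (use assms in auto)
 also have "\<dots> = B ^ card A" by simp
 also have "\<dots> \<le> B ^ D" using assms by (intro power_increasing) auto
 finally show ?thesis .
qed

lemma isCont_pair_nhds:
 fixes f :: "'a::metric_space \<times> 'b::metric_space => 'c::topological_space"
 assumes "isCont f (x, y)" "open S" "f (x, y) \<in> S"
 shows "\<exists>\<rho>>0. \<forall>x' y'. dist x' x < \<rho> \<and> dist y' y < \<rho> --> f (x', y') \<in> S"
proof -
 obtain W where W: "open W" "(x, y) \<in> W" "\<forall>z\<in>W. f z \<in> S"
  using assms unfolding continuous_at_open by metis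
 obtain A B where AB: "open A" "open B" "x \<in> A" "y \<in> B" "A \<times> B \<subseteq> W"
  using open_prod_elim[OF W(1,2)] by (metis mem_Sigma_iff)
 obtain a where a: "a > 0" "\<forall>x'. dist x' x < a --> x' \<in> A" using AB unfolding open_dist by blast
 obtain b where b: "b > 0" "\<forall>y'. dist y' y < b --> y' \<in> B" using AB unfolding open_dist by blast
 show ?thesis
  by (intro exI[of _ "min a b"]) (use a b AB(5) W(3) in auto)
qed

section \<open>Sheets contained in \<open>T\<close> and uniform bounds on fibres\<close>

context local_cover
begin

text \<open>When the dimension of \<open>T\<close> equals the rank of \<open>\<L>\<close>, the
  points of \<open>T\<close> near \<open>w\<close> already project onto a full neighbourhood in the
  base. The sheet, being determined by the projection, then consists of points of \<open>T\<close>
  nearby.\<close>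

lemma sheet_smooth:
 assumes s: "sheets h x1 e R" and w: "w \<in> sat x1 e" and y: "y \<in> fibre x1" and Rw: "R y w = w"
  and sm: "smooth_point T w n" and tr: "trace \<L> = of_nat n"
 shows "\<exists>d>0. \<forall>x. dist x w < d --> R y x \<in> T \<and> \<L> *v R y x = \<L> *v x"
proof -
 obtain U \<sigma> where \<sigma>: "local_retraction T w U \<sigma>" "trace (jac \<sigma> w) = of_nat n"
  using smooth_point_imp_retraction[OF sm] by blast
 note \<sigma>D = local_retractionD[OF \<sigma>(1)]
 define J where "J = jac (R y) w"
 define P where "P = jac \<sigma> w"
 have J: "J ** P = P" "J ** \<L> = J"
  unfolding J_def P_def using sheet_jac_retraction[OF s w y Rw \<sigma>(1)] sheet_jac_invariant[OF s w y] by auto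
 have PP: "P ** P = P" unfolding P_def by (rule local_retraction_idempotent[OF \<sigma>(1)])
 have "of_nat (vec.dim (range ((*v) \<L>))) = (of_nat (vec.dim (range ((*v) P))) :: complex)"
  using trace_Lambda tr trace_idempotent[OF PP] \<sigma>(2) by (simp add: P_def)
 then have "vec.dim (range ((*v) \<L>)) \<le> vec.dim (range ((*v) P))" by (simp only: of_nat_eq_iff)
 note LJ = dim_range_absorb_eq[OF J PP this]
 obtain d where d: "d > 0 \<and> (\<forall>t. dist t w < d --> t \<in> sat x1 e \<and> t \<in> polydisc \<and> (t \<in> T --> R y t = t))"
  using sheet_near_T[OF s w y Rw] ..
 have Rh: "holomorphic_map (sat x1 e) (R y)" by (rule sheetsD(6)[OF s y])
 define U1 where "U1 = {u\<in>U. \<sigma> u \<in> ball w d}"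
 define N where "N = {u\<in>sat x1 e. R y u \<in> U1}"
 have U1: "open U1" unfolding U1_def by (rule holomorphic_map_vimage_open[OF \<sigma>D(1) open_ball])
 have N: "open N" unfolding N_def by (rule holomorphic_map_vimage_open[OF Rh U1])
 have wN: "w \<in> N" using w \<sigma>D d Rw by (simp add: N_def U1_def)
 have hR: "holomorphic_map N (R y)" by (rule holomorphic_map_subset[OF Rh N]) (auto simp: N_def)
 have hs: "holomorphic_map N (\<lambda>u. \<sigma> (R y u))"
  by (rule holomorphic_map_compose[OF hR \<sigma>D(1)]) (auto simp: N_def U1_def)
 \<comment> \<open>Replaces the \<open>\<L>\<close>-component of \<open>u\<close> by that of a point
   of \<open>T\<close>. By \<open>\<L> ** J = \<L>\<close> and \<open>P ** J = J\<close> its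
   derivative at \<open>w\<close> is the identity, so every \<open>x\<close> near \<open>w\<close>
   has the same \<open>\<L>\<close>-component as some point of \<open>T\<close> near
   \<open>w\<close>.\<close>
 define \<Theta> where "\<Theta> = (\<lambda>u. u - \<L> *v u + \<L> *v \<sigma> (R y u))"
 have h\<Theta>: "holomorphic_map N \<Theta>" unfolding \<Theta>_def by (intro hol_intros N hs)
 have D\<sigma>R: "((\<lambda>u. \<sigma> (R y u)) has_derivative (*v) (P ** J)) (at w)"
  unfolding P_def J_def
  by (rule has_derivative_compose_matrix[OF has_derivative_jac[OF Rh w]]) (use Rw \<sigma>D(8) in simp)
 have "(\<Theta> has_derivative (\<lambda>v. v - \<L> *v v + \<L> *v ((P ** J) *v v))) (at w)"
  unfolding \<Theta>_def
  by (intro derivative_intros bounded_linear.has_derivative[OF bounded_linear_matrix_vector] D\<sigma>R)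
 also have "(\<lambda>v. v - \<L> *v v + \<L> *v ((P ** J) *v v)) = (*v) (mat 1)"
  by (auto simp: LJ matrix_vector_mul_assoc)
 finally have "jac \<Theta> w = mat 1" by (rule jac_eqI)
 from holomorphic_inverse_function[OF h\<Theta> wN this]
 obtain U' V' g where g: "w \<in> U'" "U' \<subseteq> N" "open V'" "bij_betw \<Theta> U' V'" "\<And>y. y \<in> V' ==> g y \<in> U' \<and> \<Theta> (g y) = y"
  by metis
 have "\<Theta> w = w" using Rw \<sigma>D(7) by (simp add: \<Theta>_def)
 then have "w \<in> V'" using bij_betw_apply[OF g(4,1)] by simp
 then obtain d' where d': "d' > 0" "ball w d' \<subseteq> V'" using open_ball_mult_imp[OF g(3)] by blast
 have "R y x \<in> T \<and> \<L> *v R y x = \<L> *v x" if x: "dist x w < d'" for x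
 proof -
  have "x \<in> ball w d'" using x by (simp add: dist_commute)
  then have "x \<in> V'" using d'(2) by blast
  define u where "u = g x"
  have u: "u \<in> N" "\<Theta> u = x" using g(5)[OF \<open>x \<in> V'\<close>] g(2) by (auto simp: u_def)
  define t where "t = \<sigma> (R y u)"
  have t: "t \<in> T" "dist t w < d" using u(1) \<sigma>D(5) by (auto simp: N_def U1_def t_def dist_commute)
  then have Rt: "R y t = t" using d by blast
  have "\<L> *v x = \<L> *v t" using u(2)[symmetric]
   by (simp add: \<Theta>_def t_def[symmetric] matrix_vector_right_distrib matrix_vector_mult_diff_distrib LL)
  then have "R y x = t" using sheetsD(8)[OF s y] Rt by metis
  then show ?thesis using t(1) \<open>\<L> *v x = \<L> *v t\<close> by simp
 qed
 then show ?thesis using d'(1) by blast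
qed

lemma bounded_polydisc: "bounded polydisc"
proof (rule boundedI)
 fix y assume y: "y \<in> polydisc"
 have "norm (y - p) \<le> (\<Sum>i\<in>UNIV. norm ((y - p) $ i))"
  unfolding norm_vec_def by (rule L2_set_le_sum) simp
 also have "\<dots> \<le> (\<Sum>i\<in>UNIV. r i)"
  by (rule sum_mono) (use y in \<open>auto simp: polydisc_def dist_norm norm_minus_commute intro: less_imp_le\<close>)
 finally show "norm y \<le> norm p + (\<Sum>i\<in>UNIV. r i)" using norm_triangle_sub[of y p] by simp
qed

text \<open>Properness of the fibres: they lie in a bounded polydisc and form a closed relation, so
  a sequence of counterexamples would accumulate at a point of \<open>fibre x\<close>.\<close>

lemma fibre_eventually:
 assumes x: "x \<in> base" and \<phi>: "\<And>y. y \<in> fibre x ==> \<exists>\<rho>>0. \<forall>x' y'. dist x' x < \<rho> \<and> dist y' y < \<rho> --> \<phi> x' y'"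
 shows "\<exists>e>0. \<forall>x'\<in>base. dist x' x < e --> (\<forall>y'\<in>fibre x'. \<phi> x' y')"
proof (rule ccontr)
 assume neg: "\<not> ?thesis"
 have "\<forall>n. \<exists>z. fst z \<in> base \<and> dist (fst z) x < inverse (real (Suc n)) \<and> snd z \<in> fibre (fst z) \<and> \<not> \<phi> (fst z) (snd z)"
 proof
  fix n have "inverse (real (Suc n)) > 0" by simp
  then obtain x' y' where "x' \<in> base" "dist x' x < inverse (real (Suc n))" "y' \<in> fibre x'" "\<not> \<phi> x' y'"
   using neg by blast
  then show "\<exists>z. fst z \<in> base \<and> dist (fst z) x < inverse (real (Suc n)) \<and> snd z \<in> fibre (fst z) \<and> \<not> \<phi> (fst z) (snd z)"
   by (intro exI[of _ "(x', y')"]) simp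
 qed
 from choice[OF this] obtain z where zz: "\<forall>n. fst (z n) \<in> base \<and> dist (fst (z n)) x < inverse (real (Suc n)) \<and>
   snd (z n) \<in> fibre (fst (z n)) \<and> \<not> \<phi> (fst (z n)) (snd (z n))" ..
 have z: "\<And>n. fst (z n) \<in> base" "\<And>n. dist (fst (z n)) x < inverse (real (Suc n))"
  "\<And>n. snd (z n) \<in> fibre (fst (z n))" "\<And>n. \<not> \<phi> (fst (z n)) (snd (z n))" using zz by simp_all
 have lim: "(\<lambda>n. fst (z n)) \<longlonglongrightarrow> x"
  unfolding tendsto_dist_iff[of _ x]
  by (rule tendsto_sandwich[OF _ _ tendsto_const LIMSEQ_inverse_real_of_nat]) (use z(2) in \<open>auto intro!: always_eventually less_imp_le\<close>)
 have "bounded (range (\<lambda>n. snd (z n)))"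
  by (rule bounded_subset[OF bounded_polydisc]) (use z(3) fibre_subset in blast)
 then obtain y \<nu> where \<nu>: "strict_mono \<nu>" "((\<lambda>n. snd (z n)) \<circ> \<nu>) \<longlonglongrightarrow> y"
  using bounded_imp_convergent_subsequence by blast
 then have limy: "(\<lambda>n. snd (z (\<nu> n))) \<longlonglongrightarrow> y" by (simp add: o_def)
 have limx: "(\<lambda>n. fst (z (\<nu> n))) \<longlonglongrightarrow> x" using LIMSEQ_subseq_LIMSEQ[OF lim \<nu>(1)] by (simp add: o_def)
 have "y \<in> fibre x" by (rule fibre_closed[OF x z(1) limx limy z(3)])
 then obtain \<rho> where \<rho>: "\<rho> > 0" "\<forall>x' y'. dist x' x < \<rho> \<and> dist y' y < \<rho> --> \<phi> x' y'" using \<phi> by blast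
 have "\<forall>\<^sub>F n in sequentially. dist (fst (z (\<nu> n))) x < \<rho> \<and> dist (snd (z (\<nu> n))) y < \<rho>"
  using tendstoD[OF limx \<rho>(1)] tendstoD[OF limy \<rho>(1)] by (rule eventually_conj)
 then obtain n where "dist (fst (z (\<nu> n))) x < \<rho> \<and> dist (snd (z (\<nu> n))) y < \<rho>"
  using eventually_happens trivial_limit_sequentially by blast
 then show False using \<rho>(2) z(4) by blast
qed

lemma fibre_bounded:
 fixes \<psi> :: "complex^'n => complex^'n => complex"
 assumes x: "x \<in> base" and c: "\<And>y. y \<in> fibre x ==> isCont (\<lambda>z. \<psi> (fst z) (snd z)) (x, y)"
 shows "\<exists>e>0. \<exists>B\<ge>1. \<forall>x'\<in>base. dist x' x < e --> (\<forall>y'\<in>fibre x'. norm (\<psi> x' y') \<le> B)"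
proof -
 define B where "B = 1 + (\<Sum>y\<in>fibre x. norm (\<psi> x y))"
 have "\<exists>e>0. \<forall>x'\<in>base. dist x' x < e --> (\<forall>y'\<in>fibre x'. norm (\<psi> x' y') \<le> B)"
 proof (rule fibre_eventually[OF x])
  fix y assume y: "y \<in> fibre x"
  have "norm (\<psi> x y) \<le> (\<Sum>y\<in>fibre x. norm (\<psi> x y))"
   by (rule member_le_sum[OF y]) (use finite_fibre[OF x] in auto)
  then have "norm (\<psi> x y) < B" by (simp add: B_def)
  then have "\<psi> (fst (x, y)) (snd (x, y)) \<in> ball 0 B" by simp
  from isCont_pair_nhds[OF c[OF y] open_ball this]
  obtain \<rho> where "\<rho> > 0" "\<forall>x' y'. dist x' x < \<rho> \<and> dist y' y < \<rho> --> \<psi> x' y' \<in> ball 0 B" by auto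
  then show "\<exists>\<rho>>0. \<forall>x' y'. dist x' x < \<rho> \<and> dist y' y < \<rho> --> norm (\<psi> x' y') \<le> B"
   by (intro exI[of _ \<rho>]) (auto intro: less_imp_le)
 qed
 moreover have "B \<ge> 1" by (simp add: B_def sum_nonneg)
 ultimately show ?thesis by blast
qed

lemma sheetwise_extension:
 assumes h: "is_discr h" and f: "\<And>x1 e R. sheets h x1 e R ==> holomorphic_fun (sat x1 e) f"
  and b: "\<And>x. x \<in> base ==> \<exists>e>0. \<exists>B. \<forall>x'\<in>base. dist x' x < e --> norm (f x') \<le> B"
 shows "\<exists>F. holomorphic_fun base F \<and> (\<forall>x\<in>base. h x ~= 0 --> F x = f x)"
proof -
 obtain x1 where x1: "x1 \<in> base" "h x1 ~= 0" using is_discrD(2)[OF h] by blast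
 have hol: "holomorphic_fun {x\<in>base. h x ~= 0} f"
 proof (rule holomorphic_fun_local)
  fix x assume x: "x \<in> {x\<in>base. h x ~= 0}"
  then obtain e R where s: "sheets h x e R" using sheets_exist[OF h] by blast
  then have "x \<in> sat x e" "sat x e \<subseteq> {x\<in>base. h x ~= 0}" using sheetsD(3,4,5)[OF s] by blast+
  then show "\<exists>V. x \<in> V \<and> V \<subseteq> {x\<in>base. h x ~= 0} \<and> holomorphic_fun V f"
   using f[OF s] by (intro exI[of _ "sat x e"] conjI)
 qed
 have "\<exists>e>0. \<exists>B. \<forall>y\<in>base. dist y x < e --> h y ~= 0 --> norm (f y) \<le> B" if "x \<in> base" for x
  using b[OF that] by meson
 from Riemann_extension[OF is_discrD(1)[OF h] convex_base x1 hol this]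
 obtain F where "holomorphic_fun base F" "\<And>x. x \<in> base ==> h x ~= 0 ==> F x = f x" by metis
 then show ?thesis by (intro exI[of _ F]) simp
qed

lemma sheetwise_bij:
 assumes s: "sheets h x1 e R" and L: "\<And>y x. y \<in> fibre x1 ==> x \<in> sat x1 e ==> L x (R y x) \<longleftrightarrow> L x1 y"
  and x: "x \<in> sat x1 e"
 shows "bij_betw (\<lambda>y. R y x) {y\<in>fibre x1. L x1 y} {y\<in>fibre x. L x y}"
 unfolding bij_betw_def
proof
 note b = sheetsD(9)[OF s x, unfolded bij_betw_def]
 show "inj_on (\<lambda>y. R y x) {y\<in>fibre x1. L x1 y}" by (rule inj_on_subset[OF b[THEN conjunct1]]) auto
 have "(\<lambda>y. R y x) ` fibre x1 = fibre x" using b by simp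
 then show "(\<lambda>y. R y x) ` {y\<in>fibre x1. L x1 y} = {y\<in>fibre x. L x y}"
 proof (intro equalityI subsetI)
  fix z assume "z \<in> (\<lambda>y. R y x) ` {y\<in>fibre x1. L x1 y}"
  then obtain y where y: "z = R y x" "y \<in> fibre x1" "L x1 y" by auto
  then show "z \<in> {y\<in>fibre x. L x y}" using L[OF y(2) x] sheetsD(10)[OF s y(2) x] by simp
 next
  fix z assume z: "z \<in> {y\<in>fibre x. L x y}"
  then have "z \<in> (\<lambda>y. R y x) ` fibre x1" using \<open>(\<lambda>y. R y x) ` fibre x1 = fibre x\<close> by simp
  then obtain y where y: "z = R y x" "y \<in> fibre x1" by auto
  then have "L x1 y" using L[OF y(2) x] z by simp
  then show "z \<in> (\<lambda>y. R y x) ` {y\<in>fibre x1. L x1 y}" using y by simp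
 qed
qed

end

text \<open>The function \<open>\<delta>\<close> admits sets that are only locally closed. It is
  constantly 1 for the variety itself and removes the degenerate points in the application to the
  conormal cone.\<close>

locale analytic_cover = local_cover T p \<L> V Q r \<epsilon>
 for T :: "(complex^'n) set" and p \<L> V Q r \<epsilon> +
 fixes \<Omega> \<F> \<delta> n
 assumes T_eq: "T = {x\<in>\<Omega>. (\<forall>f\<in>\<F>. f x = 0) \<and> \<delta> x ~= 0}"
  and hol_F: "\<And>f. f \<in> \<F> ==> holomorphic_fun \<Omega> f" and hol_delta: "holomorphic_fun \<Omega> \<delta>"
  and polydisc_sub: "{y. \<forall>i. dist (p $ i) (y $ i) < r i} \<subseteq> \<Omega>"
  and pure: "pure_dim T n"
begin

lemma polydisc_Omega: "polydisc \<subseteq> \<Omega>" using polydisc_sub by (simp add: polydisc_def)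

lemma holomorphic_on_sheet:
 assumes s: "sheets h x1 e R" and y: "y \<in> fibre x1" and f: "holomorphic_fun \<Omega> f"
 shows "holomorphic_fun (sat x1 e) (\<lambda>x. f (R y x))"
 by (rule holomorphic_fun_compose[OF sheetsD(6)[OF s y] f]) (use sheetsD(11)[OF s y] polydisc_Omega in blast)

lemma sheet_dense:
 assumes s: "sheets h x1 e R" and y: "y \<in> fibre x1" and w: "w \<in> sat x1 e" "\<delta> (R y w) ~= 0"
  and x: "x \<in> sat x1 e" and d: "d > 0"
 shows "\<exists>x'\<in>sat x1 e. dist x' x < d \<and> dist (R y x') (R y x) < d \<and> \<delta> (R y x') ~= 0"
proof -
 define V where "V = {x'\<in>sat x1 e. R y x' \<in> ball (R y x) d} \<inter> ball x d"
 have V: "open V" unfolding V_def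
  by (intro open_Int open_ball holomorphic_map_vimage_open[OF sheetsD(6)[OF s y]])
 have "x \<in> V \<inter> sat x1 e" using x d by (simp add: V_def)
 then have ne: "V \<inter> sat x1 e ~= {}" by blast
 obtain x' where "x' \<in> V" "x' \<in> sat x1 e" "\<delta> (R y x') ~= 0"
  using holomorphic_fun_nonzero_dense[OF holomorphic_on_sheet[OF s y hol_delta] convex_saturated w V ne] by metis
 then show ?thesis by (intro bexI[of _ x']) (auto simp: V_def dist_commute)
qed

text \<open>Near a smooth point the sheet lies in \<open>T\<close> and is a section of
  \<open>\<L>\<close>. The identity theorem extends the equations of \<open>T\<close> and the
  section property to the whole sheet, and density of the nonzeros of \<open>\<delta>\<close> places
  the sheet in the closure.\<close>

lemma sheet_closure:
 assumes tr: "trace \<L> = of_nat n" and s: "sheets h x1 e R" and y: "y \<in> fibre x1"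
  and x2: "x2 \<in> sat x1 e" "R y x2 \<in> closure T" "\<L> *v R y x2 = \<L> *v x2" and x: "x \<in> sat x1 e"
 shows "\<L> *v R y x = \<L> *v x" "R y x \<in> closure T" "\<delta> (R y x) ~= 0 ==> R y x \<in> T"
proof -
 define w0 where "w0 = R y x2"
 have w0: "w0 \<in> sat x1 e" "R y w0 = w0"
  using sat_invariant[OF x2(3)] x2(1) sheetsD(8)[OF s y x2(3)] by (simp_all add: w0_def)
 obtain d where d: "d > 0 \<and> (\<forall>t. dist t w0 < d --> t \<in> sat x1 e \<and> t \<in> polydisc \<and> (t \<in> T --> R y t = t))"
  using sheet_near_T[OF s w0(1) y w0(2)] ..
 obtain w where w: "w \<in> T" "dist w w0 < d" "smooth_point T w n"
  using pure_dim_closure[OF pure] x2(2) d unfolding w0_def by blast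
 have w': "w \<in> sat x1 e" "R y w = w" using d w by blast+
 obtain d2 where d2: "d2 > 0 \<and> (\<forall>x. dist x w < d2 --> R y x \<in> T \<and> \<L> *v R y x = \<L> *v x)"
  using sheet_smooth[OF s w'(1) y w'(2) w(3) tr] ..
 define N where "N = ball w d2 \<inter> sat x1 e"
 have "w \<in> N" using w' d2 by (simp add: N_def)
 then have N: "open N" "N \<subseteq> sat x1 e" "N ~= {}"
  unfolding N_def by (blast intro: open_Int open_ball open_saturated)+
 have NT: "R y z \<in> T" "\<L> *v R y z = \<L> *v z" if "z \<in> N" for z
  using d2 that by (auto simp: N_def dist_commute)
 have f0: "f (R y z) = 0" if f: "f \<in> \<F>" and z: "z \<in> sat x1 e" for f z
  by (rule holomorphic_fun_eq_zero[OF holomorphic_on_sheet[OF s y hol_F[OF f]] convex_saturated N _ z])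
    (use NT(1) T_eq f in auto)
 show L: "\<L> *v R y x = \<L> *v x"
 proof -
  have "(\<L> *v R y x - \<L> *v x) $ i = 0" for i
  proof (rule holomorphic_fun_eq_zero[OF _ convex_saturated N _ x])
   show "holomorphic_fun (sat x1 e) (\<lambda>x. (\<L> *v R y x - \<L> *v x) $ i)"
    by (intro hol_intros sheetsD(6)[OF s y] open_saturated)
  qed (use NT(2) in auto)
  then show ?thesis by (simp add: vec_eq_iff)
 qed
 have inT: "R y z \<in> T" if "z \<in> sat x1 e" "\<delta> (R y z) ~= 0" for z
  using f0[OF _ that(1)] that sheetsD(11)[OF s y that(1)] polydisc_Omega unfolding T_eq by blast
 then show "\<delta> (R y x) ~= 0 ==> R y x \<in> T" using x by blast
 have dw: "\<delta> (R y w) ~= 0" using w' w T_eq by simp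
 show "R y x \<in> closure T"
  unfolding closure_approachable
 proof (intro allI impI)
  fix d :: real assume "d > 0"
  then obtain x' where "x' \<in> sat x1 e" "dist (R y x') (R y x) < d" "\<delta> (R y x') ~= 0"
   using sheet_dense[OF s y w'(1) dw x] by blast
  then show "\<exists>z\<in>T. dist z (R y x) < d" using inT by blast
 qed
qed

text \<open>The points of the closure of \<open>T\<close> above \<open>x\<close>, selected from the
  candidates in \<open>fibre x\<close>. Over a nonzero of the discriminant they fill whole
  sheets.\<close>

definition live :: "complex^'n => (complex^'n) set" where
 "live x = {y\<in>fibre x. y \<in> closure T \<and> \<L> *v y = \<L> *v x}"

lemma live_bij:
 assumes tr: "trace \<L> = of_nat n" and s: "sheets h x1 e R" and x: "x \<in> sat x1 e"
 shows "bij_betw (\<lambda>y. R y x) (live x1) (live x)"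
 unfolding live_def
proof (rule sheetwise_bij[OF s _ x])
 fix y z assume y: "y \<in> fibre x1" and z: "z \<in> sat x1 e"
 have x1: "R y x1 = y" "x1 \<in> sat x1 e" using sheetsD(7)[OF s y] sheetsD(3)[OF s] .
 show "(R y z \<in> closure T \<and> \<L> *v R y z = \<L> *v z) \<longleftrightarrow> (y \<in> closure T \<and> \<L> *v y = \<L> *v x1)"
 proof
  assume "R y z \<in> closure T \<and> \<L> *v R y z = \<L> *v z"
  then show "y \<in> closure T \<and> \<L> *v y = \<L> *v x1"
   using sheet_closure(1,2)[OF tr s y z _ _ x1(2)] x1(1) by simp
 next
  assume "y \<in> closure T \<and> \<L> *v y = \<L> *v x1"
  then show "R y z \<in> closure T \<and> \<L> *v R y z = \<L> *v z"
   using sheet_closure(1,2)[OF tr s y x1(2) _ _ z] x1(1) by simp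
 qed
qed

lemma finite_live: "x \<in> base ==> finite (live x)"
 unfolding live_def using finite_fibre by (rule finite_subset[rotated]) auto

lemma live_subset: "live x \<subseteq> fibre x" by (auto simp: live_def)

text \<open>Both expressions are symmetric in the live points, so the choice of sheets does not
  matter, and bounded fibre values permit Riemann extension. The second one is the elementary
  symmetric function of degree one below the number of live points.\<close>

lemma live_product:
 assumes tr: "trace \<L> = of_nat n" and h: "is_discr h"
  and \<psi>: "\<And>x1 e R y. sheets h x1 e R ==> y \<in> live x1 ==> holomorphic_fun (sat x1 e) (\<lambda>x. \<psi> x (R y x))"
  and b: "\<And>x. x \<in> base ==> \<exists>e>0. \<exists>B\<ge>1. \<forall>x'\<in>base. dist x' x < e --> (\<forall>y'\<in>live x'. norm (\<psi> x' y') \<le> B)"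
 shows "\<exists>F. holomorphic_fun base F \<and> (\<forall>x\<in>base. h x ~= 0 --> F x = (\<Prod>y\<in>live x. \<psi> x y))"
  "\<exists>F. holomorphic_fun base F \<and> (\<forall>x\<in>base. h x ~= 0 --> F x = (\<Sum>y\<in>live x. \<Prod>y'\<in>live x - {y}. \<psi> x y'))"
proof -
 obtain D where D: "\<forall>x\<in>base. card (fibre x) \<le> D" using card_fibre ..
 have cl: "card A \<le> D" if "x \<in> base" "A \<subseteq> live x" for A x
  using card_mono[OF finite_fibre[OF that(1)], of A] that live_subset[of x] D by force
 have 1: "(\<Prod>y\<in>live x. \<psi> x y) = (\<Prod>y\<in>live x1. \<psi> x (R y x))" if "sheets h x1 e R" "x \<in> sat x1 e" for x1 e R x
  using prod.reindex_bij_betw[OF live_bij[OF tr that], of "\<psi> x"] by simp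
 show "\<exists>F. holomorphic_fun base F \<and> (\<forall>x\<in>base. h x ~= 0 --> F x = (\<Prod>y\<in>live x. \<psi> x y))"
 proof (rule sheetwise_extension[OF h])
  fix x1 e R assume s: "sheets h x1 e R"
  have "holomorphic_fun (sat x1 e) (\<lambda>x. \<Prod>y\<in>live x1. \<psi> x (R y x))"
   by (intro holomorphic_fun_prod open_saturated \<psi>[OF s])
  then show "holomorphic_fun (sat x1 e) (\<lambda>x. \<Prod>y\<in>live x. \<psi> x y)"
   by (rule holomorphic_fun_cong) (simp add: 1[OF s])
 next
  fix x assume "x \<in> base"
  then obtain e B where eB: "e > 0" "B \<ge> 1" "\<forall>x'\<in>base. dist x' x < e --> (\<forall>y'\<in>live x'. norm (\<psi> x' y') \<le> B)"
   using b by blast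
  have "norm (\<Prod>y\<in>live x'. \<psi> x' y) \<le> B ^ D" if "x' \<in> base" "dist x' x < e" for x'
   by (rule prod_norm_bound[OF cl[OF that(1) order_refl] eB(2)]) (use eB that in blast)
  then show "\<exists>e>0. \<exists>B. \<forall>x'\<in>base. dist x' x < e --> norm (\<Prod>y\<in>live x'. \<psi> x' y) \<le> B" using eB(1) by blast
 qed
 have 2: "(\<Sum>y\<in>live x. \<Prod>y'\<in>live x - {y}. \<psi> x y') = (\<Sum>y\<in>live x1. \<Prod>y'\<in>live x1 - {y}. \<psi> x (R y' x))"
  if s: "sheets h x1 e R" "x \<in> sat x1 e" for x1 e R x
 proof -
  note bij = live_bij[OF tr that]
  have "(\<Sum>y\<in>live x. \<Prod>y'\<in>live x - {y}. \<psi> x y') = (\<Sum>y\<in>live x1. \<Prod>y'\<in>live x - {R y x}. \<psi> x y')"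
   using sum.reindex_bij_betw[OF bij, of "\<lambda>y. \<Prod>y'\<in>live x - {y}. \<psi> x y'"] by simp
  also have "\<dots> = (\<Sum>y\<in>live x1. \<Prod>y'\<in>live x1 - {y}. \<psi> x (R y' x))"
  proof (rule sum.cong)
   fix y assume y: "y \<in> live x1"
   have "bij_betw (\<lambda>y. R y x) (live x1 - {y}) (live x - {R y x})"
    using bij y by (intro bij_betw_DiffI) (auto simp: bij_betw_def)
   from prod.reindex_bij_betw[OF this, of "\<psi> x"]
   show "(\<Prod>y'\<in>live x - {R y x}. \<psi> x y') = (\<Prod>y'\<in>live x1 - {y}. \<psi> x (R y' x))" by simp
  qed simp
  finally show ?thesis .
 qed
 show "\<exists>F. holomorphic_fun base F \<and> (\<forall>x\<in>base. h x ~= 0 --> F x = (\<Sum>y\<in>live x. \<Prod>y'\<in>live x - {y}. \<psi> x y'))"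
 proof (rule sheetwise_extension[OF h])
  fix x1 e R assume s: "sheets h x1 e R"
  have "holomorphic_fun (sat x1 e) (\<lambda>x. \<Sum>y\<in>live x1. \<Prod>y'\<in>live x1 - {y}. \<psi> x (R y' x))"
   by (intro holomorphic_fun_sum holomorphic_fun_prod open_saturated \<psi>[OF s]) auto
  then show "holomorphic_fun (sat x1 e) (\<lambda>x. \<Sum>y\<in>live x. \<Prod>y'\<in>live x - {y}. \<psi> x y')"
   by (rule holomorphic_fun_cong) (simp add: 2[OF s])
 next
  fix x assume "x \<in> base"
  then obtain e B where eB: "e > 0" "B \<ge> 1" "\<forall>x'\<in>base. dist x' x < e --> (\<forall>y'\<in>live x'. norm (\<psi> x' y') \<le> B)"
   using b by blast
  have "norm (\<Sum>y\<in>live x'. \<Prod>y'\<in>live x' - {y}. \<psi> x' y') \<le> real D * B ^ D" if "x' \<in> base" "dist x' x < e" for x'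
  proof -
   have "norm (\<Sum>y\<in>live x'. \<Prod>y'\<in>live x' - {y}. \<psi> x' y') \<le> (\<Sum>y\<in>live x'. B ^ D)"
    by (rule sum_norm_le, rule prod_norm_bound[OF cl[OF that(1)] eB(2)]) (use eB that in auto)
   also have "\<dots> \<le> real D * B ^ D" using cl[OF that(1) order_refl] eB(2) by (simp add: mult_right_mono)
   finally show ?thesis .
  qed
  then show "\<exists>e>0. \<exists>B. \<forall>x'\<in>base. dist x' x < e --> norm (\<Sum>y\<in>live x'. \<Prod>y'\<in>live x' - {y}. \<psi> x' y') \<le> B"
   using eB(1) by blast
 qed
qed

end

text \<open>When \<open>\<psi>'\<close> is added to handle a new point, each point excludes at most
  one value of the coefficient \<open>c\<close>.\<close>

lemma finite_common_nonzero:
 fixes \<Psi> :: "('z => complex) set"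
 assumes "finite A" and ne: "\<Psi> ~= {}" and closed: "\<And>\<psi> \<psi>' c. \<psi> \<in> \<Psi> ==> \<psi>' \<in> \<Psi> ==> (\<lambda>z. \<psi> z + c * \<psi>' z) \<in> \<Psi>"
 shows "(\<forall>a\<in>A. \<exists>\<psi>\<in>\<Psi>. \<psi> a ~= 0) ==> \<exists>\<psi>\<in>\<Psi>. \<forall>a\<in>A. \<psi> a ~= 0"
 using assms(1)
proof (induction A)
 case empty
 then show ?case using ne by auto
next
 case (insert a A)
 then obtain \<psi> where \<psi>: "\<psi> \<in> \<Psi>" "\<forall>b\<in>A. \<psi> b ~= 0" by auto
 obtain \<psi>' where \<psi>': "\<psi>' \<in> \<Psi>" "\<psi>' a ~= 0" using insert.prems by auto
 have "finite ((\<lambda>b. - \<psi> b / \<psi>' b) ` insert a A)" using insert.hyps by simp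
 then obtain c where c: "c \<notin> (\<lambda>b. - \<psi> b / \<psi>' b) ` insert a A"
  using ex_new_if_finite[OF infinite_UNIV_char_0] by blast
 have "\<psi> b + c * \<psi>' b ~= 0" if b: "b \<in> insert a A" for b
 proof (cases "\<psi>' b = 0")
  case True
  then have "b \<in> A" using b \<psi>' by auto
  then show ?thesis using \<psi> True by simp
 next
  case False
  have "c ~= - \<psi> b / \<psi>' b" using c b by auto
  then show ?thesis using False by (auto simp: field_simps add_eq_0_iff)
 qed
 then show ?case using closed[OF \<psi>(1) \<psi>'(1), of c] by (intro bexI) auto
qed

lemma generic_covector:
 fixes A :: "(complex^'n) set"
 assumes "finite A" "0 \<notin> A"
 shows "\<exists>l. \<forall>v\<in>A. scalar_product l v ~= 0"
proof -
 have "\<exists>\<psi>\<in>range scalar_product. \<forall>a\<in>A. \<psi> a ~= 0"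
 proof (rule finite_common_nonzero[OF assms(1)])
  show "\<forall>a\<in>A. \<exists>\<psi>\<in>range scalar_product. \<psi> a ~= 0"
  proof
   fix a assume "a \<in> A"
   then have "a ~= 0" using assms(2) by auto
   then obtain i where "a $ i ~= 0" by (auto simp: vec_eq_iff)
   then have "scalar_product (axis i 1) a ~= 0" by simp
   then show "\<exists>\<psi>\<in>range scalar_product. \<psi> a ~= 0" by blast
  qed
  fix \<psi> \<psi>' :: "complex^'n => complex" and c assume "\<psi> \<in> range scalar_product" "\<psi>' \<in> range scalar_product"
  then obtain a b where "\<psi> = scalar_product a" "\<psi>' = scalar_product b" by blast
  then have "(\<lambda>z. \<psi> z + c * \<psi>' z) = scalar_product (a + c *s b)"
   by (auto simp: scalar_product_add_left scalar_product_scale_left)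
  then show "(\<lambda>z. \<psi> z + c * \<psi>' z) \<in> range scalar_product" by blast
 qed auto
 then show ?thesis by auto
qed

context analytic_cover
begin

lemma live_difference_bounded:
 fixes l :: "complex^'n"
 assumes "x \<in> base"
 shows "\<exists>e>0. \<exists>B\<ge>1. \<forall>x'\<in>base. dist x' x < e --> (\<forall>y'\<in>live x'. norm (scalar_product l (x' - y')) \<le> B)"
proof -
 have "\<exists>e>0. \<exists>B\<ge>1. \<forall>x'\<in>base. dist x' x < e --> (\<forall>y'\<in>fibre x'. norm (scalar_product l (x' - y')) \<le> B)"
  by (rule fibre_bounded[OF assms]) (unfold isCont_def, intro tendsto_intros)
 then obtain e B where "e > 0" "B \<ge> 1" "\<forall>x'\<in>base. dist x' x < e --> (\<forall>y'\<in>fibre x'. norm (scalar_product l (x' - y')) \<le> B)"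
  by (elim exE conjE)
 then show ?thesis using live_subset by (intro exI[of _ e] exI[of _ B] conjI) auto
qed

lemma difference_product:
 assumes tr: "trace \<L> = of_nat n" and h: "is_discr h"
 shows "\<exists>F. holomorphic_fun base F \<and> (\<forall>x\<in>base. h x ~= 0 --> F x = (\<Prod>y\<in>live x. scalar_product l (x - y)))"
  "\<exists>F. holomorphic_fun base F \<and> (\<forall>x\<in>base. h x ~= 0 -->
    F x = (\<Sum>y\<in>live x. \<Prod>y'\<in>live x - {y}. scalar_product l (x - y')))"
proof -
 have hol: "holomorphic_fun (sat x1 e) (\<lambda>x. scalar_product l (x - R y x))" if s: "sheets h x1 e R" and y: "y \<in> live x1" for x1 e R y
  using y live_subset by (intro hol_intros open_saturated sheetsD(6)[OF s]) auto
 show "\<exists>F. holomorphic_fun base F \<and> (\<forall>x\<in>base. h x ~= 0 --> F x = (\<Prod>y\<in>live x. scalar_product l (x - y)))"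
  by (rule live_product(1)[where \<psi> = "\<lambda>x y. scalar_product l (x - y)", OF tr h], erule (1) hol, erule live_difference_bounded)
 show "\<exists>F. holomorphic_fun base F \<and> (\<forall>x\<in>base. h x ~= 0 -->
    F x = (\<Sum>y\<in>live x. \<Prod>y'\<in>live x - {y}. scalar_product l (x - y')))"
  by (rule live_product(2)[where \<psi> = "\<lambda>x y. scalar_product l (x - y)", OF tr h], erule (1) hol, erule live_difference_bounded)
qed

lemma T_live:
 assumes "t \<in> T" "t \<in> polydisc" "t \<in> base"
 shows "t \<in> live t"
 using T_fibre[OF assms] closure_subset assms(1) by (auto simp: live_def)

lemma difference_product_zero:
 assumes "t \<in> T" "t \<in> polydisc" "t \<in> base"
 shows "(\<Prod>y\<in>live t. scalar_product l (t - y)) = 0"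
 by (rule prod_zero[OF finite_live[OF assms(3)]]) (rule bexI[OF _ T_live[OF assms]], simp)

text \<open>On \<open>T\<close> one factor vanishes where the product formula holds, and such points
  are dense in \<open>T\<close>. Conversely, for \<open>x\<close> outside the closure, a covector
  that is nonzero on all \<open>x - y\<close> with \<open>y\<close> another candidate keeps every
  factor away from 0 near \<open>x\<close>, hence also the extension \<open>F l\<close>.\<close>

theorem closure_zero_set:
 assumes tr: "trace \<L> = of_nat n" and h: "is_discr h"
  and F: "\<And>l. holomorphic_fun base (F l)"
  and Fp: "\<And>l x. x \<in> base ==> h x ~= 0 ==> F l x = (\<Prod>y\<in>live x. scalar_product l (x - y))"
  and x: "x \<in> polydisc" "x \<in> base"
 shows "x \<in> closure T \<longleftrightarrow> (\<forall>l. F l x = 0)"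
proof
 assume xT: "x \<in> closure T"
 show "\<forall>l. F l x = 0"
 proof (rule allI, rule ccontr)
  fix l assume "F l x ~= 0"
  then have "x \<in> {x\<in>base. F l x ~= 0}" using x by simp
  then obtain e where e: "e > 0" "ball x e \<subseteq> {x\<in>base. F l x ~= 0}" using open_ball_mult_imp[OF open_nonzero[OF F]] by meson
  obtain t where t: "t \<in> T" "dist t x < e" "t \<in> polydisc" "t \<in> base" "h t ~= 0"
   using dense_nonzero[OF pure tr is_discrD[OF h] x(2,1) xT e(1)] by blast
  have "F l t = 0" using Fp[OF t(4,5)] difference_product_zero[OF t(1,3,4)] by simp
  moreover have "t \<in> ball x e" using t(2) by (simp add: dist_commute)
  ultimately show False using e(2) by blast
 qed
next
 assume zero: "\<forall>l. F l x = 0"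
 show "x \<in> closure T"
 proof (rule ccontr)
  assume "x \<notin> closure T"
  then obtain \<eta> where \<eta>: "\<eta> > 0" "ball x \<eta> \<subseteq> - closure T" using open_ball_mult_imp[of "- closure T" x] by auto
  have fin: "finite ((\<lambda>y. x - y) ` (fibre x - {x}))" using finite_fibre[OF x(2)] by simp
  have "0 \<notin> (\<lambda>y. x - y) ` (fibre x - {x})" by auto
  then obtain l where l: "\<forall>v\<in>(\<lambda>y. x - y) ` (fibre x - {x}). scalar_product l v ~= 0"
   using generic_covector[OF fin] by blast
  obtain d where d: "d > 0" "\<forall>z\<in>scalar_product l ` (\<lambda>y. x - y) ` (fibre x - {x}). z ~= 0 --> d \<le> dist 0 z"
   using finite_set_avoid[OF finite_imageI[OF fin, of "scalar_product l"], of 0] by blast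
  have dl: "d \<le> norm (scalar_product l (x - y))" if "y \<in> fibre x" "y ~= x" for y
  proof -
   have "x - y \<in> (\<lambda>y. x - y) ` (fibre x - {x})" using that by auto
   then have "scalar_product l (x - y) ~= 0" "scalar_product l (x - y) \<in> scalar_product l ` (\<lambda>y. x - y) ` (fibre x - {x})"
    using l by blast+
   then show ?thesis using d(2) by fastforce
  qed
  \<comment> \<open>Below \<open>d\<close> to leave room for moving \<open>x\<close>, and at most 1
    so that \<open>c ^ D\<close> bounds the product from below for any number of factors up to
    \<open>D\<close>.\<close>
  define c where "c = min (d / 2) 1"
  have c: "c > 0" "c \<le> 1" "c < d" using d(1) by (auto simp: c_def)
  \<comment> \<open>The point \<open>x\<close> may itself be a candidate in its fibre. Candidates
    near it lie in \<open>ball x \<eta>\<close>, which misses the closure of \<open>T\<close>, so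
    they are not live.\<close>
  have "\<exists>e>0. \<forall>x'\<in>base. dist x' x < e --> (\<forall>y'\<in>fibre x'. y' \<in> ball x \<eta> \<or> c < norm (scalar_product l (x' - y')))"
  proof (rule fibre_eventually[OF x(2)])
   fix y assume y: "y \<in> fibre x"
   show "\<exists>\<rho>>0. \<forall>x' y'. dist x' x < \<rho> \<and> dist y' y < \<rho> --> y' \<in> ball x \<eta> \<or> c < norm (scalar_product l (x' - y'))"
   proof (cases "y = x")
    case True
    then show ?thesis using \<eta>(1) by (intro exI[of _ \<eta>]) (auto simp: dist_commute)
   next
    case False
    have cont: "isCont (\<lambda>z. norm (scalar_product l (fst z - snd z))) (x, y)"
     unfolding isCont_def by (intro tendsto_intros)
    have "norm (scalar_product l (fst (x, y) - snd (x, y))) \<in> {c<..}" using dl[OF y False] c by simp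
    from isCont_pair_nhds[OF cont open_greaterThan this]
    show ?thesis by auto
   qed
  qed
  then obtain e where e: "e > 0 \<and> (\<forall>x'\<in>base. dist x' x < e -->
    (\<forall>y'\<in>fibre x'. y' \<in> ball x \<eta> \<or> c < norm (scalar_product l (x' - y'))))" ..
  obtain D where D: "\<forall>x\<in>base. card (fibre x) \<le> D" using card_fibre ..
  have low: "c ^ D \<le> norm (F l x')" if x': "x' \<in> base" "dist x' x < e" "h x' ~= 0" for x'
  proof -
   have ge: "c \<le> norm (scalar_product l (x' - y'))" if y': "y' \<in> live x'" for y'
   proof -
    have "y' \<notin> ball x \<eta>" using y' \<eta>(2) by (auto simp: live_def)
    then show ?thesis using e x' y' live_subset by (meson less_imp_le subsetD)
   qed
   have "c ^ D \<le> c ^ card (live x')"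
    using D x'(1) card_mono[OF finite_fibre[OF x'(1)] live_subset] c
    by (intro power_decreasing) (auto intro: order_trans)
   also have "\<dots> = (\<Prod>y'\<in>live x'. c)" by simp
   also have "\<dots> \<le> (\<Prod>y'\<in>live x'. norm (scalar_product l (x' - y')))"
    by (rule prod_mono) (use ge c in auto)
   also have "\<dots> = norm (F l x')" using Fp[OF x'(1,3)] by (simp add: prod_norm)
   finally show ?thesis .
  qed
  have cD: "c ^ D > 0" using c by simp
  have "continuous_on base (F l)" by (rule holomorphic_fun_continuous_on[OF F])
  then obtain e2 where e2: "e2 > 0" "\<forall>x'\<in>base. dist x' x < e2 --> dist (F l x') (F l x) < c ^ D"
   using cD x(2) unfolding continuous_on_iff by meson
  obtain z where z: "z \<in> base" "h z ~= 0" using is_discrD(2)[OF h] by blast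
  have "x \<in> ball x (min e e2) \<inter> base" using e e2 x(2) by simp
  then have "ball x (min e e2) \<inter> base ~= {}" by blast
  then obtain x' where x': "x' \<in> ball x (min e e2)" "x' \<in> base" "h x' ~= 0"
   using holomorphic_fun_nonzero_dense[OF is_discrD(1)[OF h] convex_base z open_ball] by metis
  then have "dist x' x < e" "dist x' x < e2" by (auto simp: dist_commute)
  then have "norm (F l x') < c ^ D" "c ^ D \<le> norm (F l x')" using e2(2) x' low zero by auto
  then show False by simp
 qed
qed

text \<open>Such a sheet is a local retraction onto \<open>T\<close>, so \<open>T\<close> is smooth
  of dimension \<open>trace (jac (R y) w)\<close> at \<open>w\<close>. Since the sheet is a section
  of \<open>\<L>\<close>, this trace equals that of \<open>\<L>\<close>, and pure dimension
  identifies it with \<open>n\<close>.\<close>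

lemma sheet_in_T_trace:
 assumes s: "sheets h x1 e R" and y: "y \<in> fibre x1" and L: "\<And>x. x \<in> sat x1 e ==> \<L> *v R y x = \<L> *v x"
  and f: "\<And>x f. x \<in> sat x1 e ==> f \<in> \<F> ==> f (R y x) = 0" and x0: "x0 \<in> sat x1 e" "\<delta> (R y x0) ~= 0"
 shows "trace \<L> = of_nat n"
proof -
 define w where "w = R y x0"
 have w: "w \<in> sat x1 e" "R y w = w"
  using sat_invariant[OF L[OF x0(1)]] x0(1) sheetsD(8)[OF s y L[OF x0(1)]] by (simp_all add: w_def)
 have RT: "R y x \<in> T" if "x \<in> sat x1 e" "\<delta> (R y x) ~= 0" for x
  using f[OF that(1)] that sheetsD(11)[OF s y that(1)] polydisc_Omega unfolding T_eq by blast
 have wT: "w \<in> T" using RT[OF x0] by (simp add: w_def)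
 obtain d where d: "d > 0 \<and> (\<forall>t. dist t w < d --> t \<in> sat x1 e \<and> t \<in> polydisc \<and> (t \<in> T --> R y t = t))"
  using sheet_near_T[OF s w(1) y w(2)] ..
 have Rh: "holomorphic_map (sat x1 e) (R y)" by (rule sheetsD(6)[OF s y])
 define U where "U = {x\<in>sat x1 e. \<delta> (R y x) ~= 0} \<inter> ball w d"
 have U: "open U" unfolding U_def
  by (intro open_Int open_ball open_nonzero[OF holomorphic_on_sheet[OF s y hol_delta]])
 have "\<delta> w ~= 0" using x0(2) unfolding w_def .
 then have "\<delta> (R y w) ~= 0" using w(2) by simp
 moreover have "w \<in> ball w d" using d by simp
 ultimately have wU: "w \<in> U" using w(1) by (simp add: U_def)
 have D: "(R y has_derivative (*v) (jac (R y) w)) (at w)" by (rule has_derivative_jac[OF Rh w(1)])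
 have "\<exists>m. smooth_point T w m \<and> trace (jac (R y) w) = of_nat m"
 proof (rule smooth_pointI_retraction'[OF _ wU wT _ _ D])
  show "holomorphic_map U (R y)" by (rule holomorphic_map_subset[OF Rh U]) (auto simp: U_def)
  show "R y x \<in> T" if "x \<in> U" for x using that by (intro RT) (simp_all add: U_def)
  show "R y x = x" if x: "x \<in> T" "x \<in> U" for x
  proof -
   have "dist x w < d" using x(2) by (simp add: U_def dist_commute)
   then show ?thesis using d x(1) by blast
  qed
 qed
 then obtain m where m: "smooth_point T w m" "trace (jac (R y) w) = of_nat m" by blast
 have "((\<lambda>x. \<L> *v R y x) has_derivative (*v) (\<L> ** jac (R y) w)) (at w)"
  by (rule has_derivative_compose_matrix[OF D])
    (intro bounded_linear.has_derivative[OF bounded_linear_matrix_vector] has_derivative_ident)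
 then have "((*v) \<L> has_derivative (*v) (\<L> ** jac (R y) w)) (at w)"
 proof (rule has_derivative_near_matrix[OF _ U wU])
  show "\<L> *v R y x = \<L> *v x" if "x \<in> U" for x using that by (intro L) (simp add: U_def)
 qed
 moreover have "((*v) \<L> has_derivative (*v) \<L>) (at w)"
  by (intro bounded_linear.has_derivative[OF bounded_linear_matrix_vector] has_derivative_ident)
 ultimately have LJ: "\<L> ** jac (R y) w = \<L>" using jac_eqI[of "(*v) \<L>" \<L> w] jac_eqI[of "(*v) \<L>" "\<L> ** jac (R y) w" w] by simp
 have "trace \<L> = trace (\<L> ** jac (R y) w)" by (simp only: LJ)
 also have "\<dots> = trace (jac (R y) w ** \<L>)" by (rule trace_mul_sym)
 also have "\<dots> = of_nat m" using sheet_jac_invariant[OF s w(1) y] m(2) by simp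
 finally have tr: "trace \<L> = of_nat m" .
 obtain N where N: "open N" "w \<in> N" "\<And>q. q \<in> T ==> q \<in> N ==> smooth_point T q m"
  using smooth_point_nearby[OF m(1)] by metis
 obtain e' where e': "e' > 0" "ball w e' \<subseteq> N" using open_ball_mult_imp[OF N(1,2)] by blast
 obtain q where q: "q \<in> T" "dist q w < e'" "smooth_point T q n"
  using pure wT e'(1) unfolding pure_dim_def by blast
 have "q \<in> ball w e'" using q(2) by (simp add: dist_commute)
 then have "smooth_point T q m" using N(3) q(1) e'(2) by blast
 then show ?thesis using smooth_point_unique[OF q(3)] tr by simp
qed

text \<open>By \<open>delta_live_sheet\<close> below: \<open>\<delta>\<close> does not vanish identically on the sheet through \<open>y\<close>.\<close>

definition delta_live :: "complex^'n => complex^'n => bool" where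
 "delta_live x y \<longleftrightarrow> (\<forall>\<rho>>0. \<exists>x' y'. dist x' (aproj \<L> p x) < \<rho> \<and> dist y' y < \<rho> \<and> y' \<in> fibre x' \<and> \<delta> y' ~= 0)"

lemma aproj_sat: "x \<in> sat c e ==> aproj \<L> p x \<in> sat c e"
 using sat_invariant[OF Lambda_aproj] by blast

text \<open>By \<open>sheets_near\<close> the fibre points in the definition lie on the sheet
  itself, and nonzeros of \<open>\<delta>\<close> on a sheet are dense as soon as one exists. The
  right side does not depend on the point of the sheet.\<close>

lemma delta_live_sheet:
 assumes s: "sheets h x1 e R" and y: "y \<in> fibre x1" and x: "x \<in> sat x1 e"
 shows "delta_live x (R y x) \<longleftrightarrow> (\<exists>w\<in>sat x1 e. \<delta> (R y w) ~= 0)"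
proof -
 define a where "a = aproj \<L> p x"
 have a: "a \<in> sat x1 e" using aproj_sat[OF x] by (simp add: a_def)
 have Ra: "R y x = R y a" by (rule sheetsD(8)[OF s y]) (simp add: a_def Lambda_aproj)
 obtain d where d: "d > 0 \<and> (\<forall>x' y'. dist x' a < d \<and> y' \<in> fibre x' \<and> dist y' (R y a) < d --> x' \<in> sat x1 e \<and> y' = R y x')"
  using sheets_near[OF s a y] ..
 show ?thesis
 proof
  assume "delta_live x (R y x)"
  then obtain x' y' where "dist x' a < d" "dist y' (R y a) < d" "y' \<in> fibre x'" "\<delta> y' ~= 0"
   using d unfolding delta_live_def Ra a_def[symmetric] by blast
  then show "\<exists>w\<in>sat x1 e. \<delta> (R y w) ~= 0" using d by blast
 next
  assume "\<exists>w\<in>sat x1 e. \<delta> (R y w) ~= 0"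
  then obtain w where w: "w \<in> sat x1 e" "\<delta> (R y w) ~= 0" ..
  show "delta_live x (R y x)"
   unfolding delta_live_def Ra a_def[symmetric]
  proof (intro allI impI)
   fix \<rho> :: real assume "\<rho> > 0"
   then obtain x' where x': "x'\<in>sat x1 e" "dist x' a < \<rho>" "dist (R y x') (R y a) < \<rho>" "\<delta> (R y x') ~= 0"
    using sheet_dense[OF s y w a] by blast
   have "R y x' \<in> fibre x'" by (rule sheetsD(10)[OF s y x'(1)])
   then show "\<exists>x' y'. dist x' a < \<rho> \<and> dist y' (R y a) < \<rho> \<and> y' \<in> fibre x' \<and> \<delta> y' ~= 0"
    using x' by (intro exI[of _ x'] exI[of _ "R y x'"]) simp
  qed
 qed
qed

lemma delta_live_const:
 assumes s: "sheets h x1 e R" and y: "y \<in> fibre x1" and x: "x \<in> sat x1 e"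
 shows "delta_live x (R y x) \<longleftrightarrow> delta_live x1 y"
 using delta_live_sheet[OF s y x] delta_live_sheet[OF s y sheetsD(3)[OF s]] sheetsD(7)[OF s y] by simp

text \<open>Functions on pairs of a base point and a candidate that vanish when both are the same
  point of \<open>T\<close>. The second summand detects candidates that do not project to the same
  point as the base point.\<close>

definition test_functions :: "((complex^'n) \<times> (complex^'n) => complex) set" where
 "test_functions = {\<psi>. \<exists>f b. holomorphic_fun \<Omega> f \<and> (\<forall>t\<in>T. f t = 0) \<and>
   \<psi> = (\<lambda>z. f (snd z) + scalar_product b (\<L> *v (snd z - fst z)))}"

lemma open_Omega: "open \<Omega>" by (rule holomorphic_fun_open[OF hol_delta])

lemma test_functions_closed:
 assumes "\<psi> \<in> test_functions" "\<psi>' \<in> test_functions"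
 shows "(\<lambda>z. \<psi> z + c * \<psi>' z) \<in> test_functions"
proof -
 obtain f b f' b' where f: "holomorphic_fun \<Omega> f" "\<forall>t\<in>T. f t = 0" "holomorphic_fun \<Omega> f'" "\<forall>t\<in>T. f' t = 0"
  "\<psi> = (\<lambda>z. f (snd z) + scalar_product b (\<L> *v (snd z - fst z)))"
  "\<psi>' = (\<lambda>z. f' (snd z) + scalar_product b' (\<L> *v (snd z - fst z)))"
  using assms unfolding test_functions_def by auto
 show ?thesis
  unfolding test_functions_def
 proof (intro CollectI exI conjI)
  show "holomorphic_fun \<Omega> (\<lambda>x. f x + c * f' x)" by (intro hol_intros f open_Omega)
  show "\<forall>t\<in>T. f t + c * f' t = 0" using f by simp
  show "(\<lambda>z. \<psi> z + c * \<psi>' z) = (\<lambda>z. f (snd z) + c * f' (snd z) + scalar_product (b + c *s b') (\<L> *v (snd z - fst z)))"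
   by (auto simp: f(5,6) scalar_product_add_left scalar_product_scale_left algebra_simps)
 qed
qed

lemma test_function_on_sheet:
 assumes s: "sheets h x1 e R" and y: "y \<in> fibre x1" and \<psi>: "\<psi> \<in> test_functions"
 shows "holomorphic_fun (sat x1 e) (\<lambda>x. \<psi> (x, R y x))"
proof -
 obtain f b where f: "holomorphic_fun \<Omega> f" "\<psi> = (\<lambda>z. f (snd z) + scalar_product b (\<L> *v (snd z - fst z)))"
  using \<psi> unfolding test_functions_def by auto
 show ?thesis unfolding f(2) fst_conv snd_conv
  by (intro hol_intros holomorphic_on_sheet[OF s y f(1)] sheetsD(6)[OF s y] open_saturated)
qed

text \<open>A sheet annihilated by all test functions satisfies the equations of \<open>T\<close>
  and is a section of \<open>\<L>\<close>, so the rank would already equal \<open>n\<close>.\<close>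

lemma test_function_separates:
 assumes s: "sheets h x1 e R" and y: "y \<in> fibre x1" and dl: "delta_live x1 y" and tr: "trace \<L> ~= of_nat n"
 shows "\<exists>\<psi>\<in>test_functions. \<exists>x\<in>sat x1 e. \<psi> (x, R y x) ~= 0"
proof (rule ccontr)
 assume "\<not> ?thesis"
 then have z: "\<psi> (x, R y x) = 0" if "\<psi> \<in> test_functions" "x \<in> sat x1 e" for \<psi> x using that by blast
 obtain w where w: "w \<in> sat x1 e" "\<delta> (R y w) ~= 0"
  using dl delta_live_sheet[OF s y sheetsD(3)[OF s]] sheetsD(7)[OF s y] by auto
 have t1: "(\<lambda>z. f (snd z) + scalar_product b (\<L> *v (snd z - fst z))) \<in> test_functions"
  if "holomorphic_fun \<Omega> f" "\<forall>t\<in>T. f t = 0" for f b using that unfolding test_functions_def by blast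
 have f0: "f (R y x) = 0" if "x \<in> sat x1 e" "f \<in> \<F>" for x f
 proof -
  have "\<forall>t\<in>T. f t = 0" using that(2) T_eq by blast
  from z[OF t1[OF hol_F[OF that(2)] this, of 0] that(1)] show ?thesis by simp
 qed
 have L: "\<L> *v R y x = \<L> *v x" if x: "x \<in> sat x1 e" for x
 proof -
  have "(\<L> *v (R y x - x)) $ i = 0" for i
   using z[OF t1[of "\<lambda>_. 0" "axis i 1"] x] holomorphic_fun_const[OF open_Omega] by simp
  then show ?thesis by (simp add: vec_eq_iff matrix_vector_mult_diff_distrib)
 qed
 have "trace \<L> = of_nat n"
 proof (rule sheet_in_T_trace[OF s y _ _ w])
  show "\<L> *v R y x = \<L> *v x" if "x \<in> sat x1 e" for x using L[OF that] .
  show "f (R y x) = 0" if "x \<in> sat x1 e" "f \<in> \<F>" for x f using f0[OF that] .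
 qed
 then show False using tr by simp
qed

text \<open>If the rank of \<open>\<L>\<close> is too large, \<open>T\<close> contains no open part of a sheet, so a generic function that
 vanishes on \<open>T\<close> is nonzero on every sheet that can meet \<open>T\<close>; its product over these sheets
 descends to the base and allows a further projection.\<close>

theorem reduce_trace:
 assumes tr: "trace \<L> ~= of_nat n" and p: "p \<in> closure T"
 shows "\<exists>\<L>'. finite_over T p \<L>' \<and> trace \<L>' = trace \<L> - 1"
proof -
 obtain h where h: "is_discr h" using discr_exists ..
 obtain x1 where x1: "x1 \<in> base" "h x1 ~= 0" using is_discrD(2)[OF h] by blast
 obtain e R where s: "sheets h x1 e R" using sheets_exist[OF h x1] by blast
 define A where "A = {y\<in>fibre x1. delta_live x1 y}"
 have finA: "finite A" using finite_fibre[OF x1(1)] by (simp add: A_def)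
 have "\<forall>y\<in>A. \<exists>\<psi>. \<psi> \<in> test_functions \<and> (\<exists>x\<in>sat x1 e. \<psi> (x, R y x) ~= 0)"
  using test_function_separates[OF s _ _ tr] unfolding A_def by blast
 from bchoice[OF this] obtain \<psi>f where \<psi>f: "\<forall>y\<in>A. \<psi>f y \<in> test_functions \<and> (\<exists>x\<in>sat x1 e. \<psi>f y (x, R y x) ~= 0)" ..
 have ne: "sat x1 e \<inter> sat x1 e ~= {}" using sheetsD(3)[OF s] by blast
 have "\<exists>x\<in>sat x1 e \<inter> sat x1 e. \<forall>y\<in>A. \<psi>f y (x, R y x) ~= 0"
  by (rule holomorphic_fun_nonzero_finite[OF finA _ convex_saturated _ open_saturated ne open_saturated])
    (use \<psi>f test_function_on_sheet[OF s] in \<open>auto simp: A_def\<close>)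
 then obtain x2 where x2: "x2 \<in> sat x1 e" "\<forall>y\<in>A. \<psi>f y (x2, R y x2) ~= 0" by blast
 define Pt where "Pt = (\<lambda>y. (x2, R y x2)) ` A"
 have "test_functions ~= {}"
  using holomorphic_fun_const[OF open_Omega, of 0] unfolding test_functions_def by auto
 moreover have "\<forall>a\<in>Pt. \<exists>\<psi>\<in>test_functions. \<psi> a ~= 0" unfolding Pt_def using \<psi>f x2 by auto
 ultimately have "\<exists>\<psi>\<in>test_functions. \<forall>a\<in>Pt. \<psi> a ~= 0"
  using finA by (intro finite_common_nonzero test_functions_closed) (auto simp: Pt_def)
 then obtain \<psi> where \<psi>: "\<psi> \<in> test_functions" "\<forall>y\<in>A. \<psi> (x2, R y x2) ~= 0" by (auto simp: Pt_def)
 obtain f b where f: "holomorphic_fun \<Omega> f" "\<forall>t\<in>T. f t = 0"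
  "\<psi> = (\<lambda>z. f (snd z) + scalar_product b (\<L> *v (snd z - fst z)))"
  using \<psi>(1) unfolding test_functions_def by auto
 define LS where "LS = (\<lambda>x. {y\<in>fibre x. delta_live x y})"
 have bij: "bij_betw (\<lambda>y. R' y x) (LS x3) (LS x)" if "sheets h x3 e' R'" "x \<in> sat x3 e'" for x3 e' R' x
  unfolding LS_def using sheetwise_bij[OF that(1) delta_live_const[OF that(1)] that(2)] .
 have "\<exists>F. holomorphic_fun base F \<and> (\<forall>x\<in>base. h x ~= 0 --> F x = (\<Prod>y\<in>LS x. \<psi> (x, y)))"
 proof (rule sheetwise_extension[OF h])
  fix x3 e' R' assume s3: "sheets h x3 e' R'"
  have "holomorphic_fun (sat x3 e') (\<lambda>x. \<Prod>y\<in>LS x3. \<psi> (x, R' y x))"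
   by (intro holomorphic_fun_prod open_saturated test_function_on_sheet[OF s3 _ \<psi>(1)]) (simp add: LS_def)
  then show "holomorphic_fun (sat x3 e') (\<lambda>x. \<Prod>y\<in>LS x. \<psi> (x, y))"
  proof (rule holomorphic_fun_cong)
   fix x assume "x \<in> sat x3 e'"
   from prod.reindex_bij_betw[OF bij[OF s3 this], of "\<lambda>y. \<psi> (x, y)"]
   show "(\<Prod>y\<in>LS x3. \<psi> (x, R' y x)) = (\<Prod>y\<in>LS x. \<psi> (x, y))" .
  qed
 next
  fix x assume x: "x \<in> base"
  have "\<exists>e>0. \<exists>B\<ge>1. \<forall>x'\<in>base. dist x' x < e --> (\<forall>y'\<in>fibre x'. norm (\<psi> (x', y')) \<le> B)"
  proof (rule fibre_bounded[OF x])
   fix y assume "y \<in> fibre x"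
   then have "y \<in> \<Omega>" using fibre_subset polydisc_Omega by blast
   then have "isCont f y" using holomorphic_fun_continuous_on[OF f(1)] open_Omega continuous_on_eq_continuous_at by blast
   then have "((\<lambda>z. f (snd z)) \<longlongrightarrow> f (snd (x, y))) (at (x, y))"
    by (intro isCont_tendsto_compose[of _ f] tendsto_intros) simp
   then show "isCont (\<lambda>z. \<psi> (fst z, snd z)) (x, y)"
    unfolding isCont_def f(3) fst_conv snd_conv
    using tendsto_fst[OF tendsto_ident_at[of "(x, y)" UNIV]] tendsto_snd[OF tendsto_ident_at[of "(x, y)" UNIV]]
    by (intro tendsto_intros) simp_all
  qed
  then obtain e B where eB: "e > 0" "B \<ge> 1" "\<forall>x'\<in>base. dist x' x < e --> (\<forall>y'\<in>fibre x'. norm (\<psi> (x', y')) \<le> B)"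
   by blast
  obtain D where D: "\<forall>x\<in>base. card (fibre x) \<le> D" using card_fibre ..
  have "norm (\<Prod>y\<in>LS x'. \<psi> (x', y)) \<le> B ^ D" if "x' \<in> base" "dist x' x < e" for x'
  proof (rule prod_norm_bound[OF _ eB(2)])
   show "card (LS x') \<le> D"
    using card_mono[OF finite_fibre[OF that(1)], of "LS x'"] D that(1) by (force simp: LS_def)
   show "norm (\<psi> (x', y)) \<le> B" if "y \<in> LS x'" for y
    using eB(3) that \<open>x' \<in> base\<close> \<open>dist x' x < e\<close> by (simp add: LS_def)
  qed
  then show "\<exists>e>0. \<exists>B. \<forall>x'\<in>base. dist x' x < e --> norm (\<Prod>y\<in>LS x'. \<psi> (x', y)) \<le> B" using eB(1) by blast
 qed
 then obtain F where F: "holomorphic_fun base F" "\<And>x. x \<in> base ==> h x ~= 0 ==> F x = (\<Prod>y\<in>LS x. \<psi> (x, y))" by blast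
 define G where "G = (\<lambda>x. h (aproj \<L> p x) * F (aproj \<L> p x))"
 have aa: "aproj \<L> p x = aproj \<L> p y" if "\<L> *v x = \<L> *v y" for x y
  using that by (simp add: aproj_def matrix_vector_mult_diff_distrib)
 have ha: "h (aproj \<L> p x) = h x" for x by (rule is_discrD(3)[OF h Lambda_aproj])
 have LSa: "LS (aproj \<L> p x) = LS x" for x
  unfolding LS_def delta_live_def aa[OF Lambda_aproj] fibre_invariant[OF Lambda_aproj] by simp
 have \<psi>a: "\<psi> (aproj \<L> p x, y) = \<psi> (x, y)" for x y
  by (simp add: f(3) matrix_vector_mult_diff_distrib Lambda_aproj)
 have G: "G x = h x * (\<Prod>y\<in>LS x. \<psi> (x, y))" if "x \<in> base" "h x ~= 0" for x
  using F(2)[OF aproj_base_set[OF that(1)]] that(2) by (simp add: G_def ha LSa \<psi>a)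
 have holG: "holomorphic_fun base G"
 proof -
  have "holomorphic_map base (aproj \<L> p)" using holomorphic_map_aproj[OF holomorphic_map_id[OF open_base]] .
  then show ?thesis unfolding G_def
   by (intro holomorphic_fun_mult holomorphic_fun_compose[OF _ F(1)] holomorphic_fun_compose[OF _ is_discrD(1)[OF h]] aproj_base_set)
 qed
 have x2b: "x2 \<in> base" "h x2 ~= 0" using sheetsD(4,5)[OF s x2(1)] .
 have "LS x2 = (\<lambda>y. R y x2) ` A" using bij[OF s x2(1)] by (simp add: bij_betw_def A_def LS_def)
 then have "G x2 ~= 0" using G[OF x2b] x2b \<psi>(2) finA by auto
 then have nz: "\<exists>x\<in>base. G x ~= 0" using x2b by blast
 show ?thesis
 proof (rule project_vanishing[OF holG nz _ p_base p_polydisc p, of "polydisc \<inter> base"])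
  show "G x = G y" if "\<L> *v x = \<L> *v y" for x y using aa[OF that] by (simp add: G_def)
  show "open (polydisc \<inter> base)" "p \<in> polydisc \<inter> base" using open_polydisc open_base p_polydisc p_base by auto
  fix t assume t: "t \<in> T" "t \<in> polydisc \<inter> base"
  show "G t = 0"
  proof (cases "h t = 0")
   case True
   then show ?thesis by (simp add: G_def ha)
  next
   case False
   then obtain e' R' where s': "sheets h t e' R'" using sheets_exist[OF h] t by blast
   have tf: "t \<in> fibre t" using T_fibre t by simp
   have "\<delta> t ~= 0" using t(1) T_eq by blast
   moreover have Rt: "R' t t = t" by (rule sheetsD(7)[OF s' tf])
   ultimately have "\<exists>w\<in>sat t e'. \<delta> (R' t w) ~= 0" by (intro bexI[OF _ sheetsD(3)[OF s']]) simp
   then have "delta_live t t"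
    using delta_live_sheet[OF s' tf sheetsD(3)[OF s']] by (simp only: Rt)
   then have "t \<in> LS t" using tf by (simp add: LS_def)
   moreover have "\<psi> (t, t) = 0" using f t(1) by simp
   moreover have "finite (LS t)" using finite_fibre t by (simp add: LS_def)
   ultimately have "(\<Prod>y\<in>LS t. \<psi> (t, y)) = 0" by (intro prod_zero) auto
   then show ?thesis using G False t by simp
  qed
 qed
qed

end

text \<open>Descent on the rank: start from the identity projection and project further as long as
  the rank differs from \<open>n\<close>.\<close>

theorem analytic_cover_exists:
 fixes T :: "(complex^'n) set"
 assumes T: "T = {x\<in>\<Omega>. (\<forall>f\<in>\<F>. f x = 0) \<and> \<delta> x ~= 0}"
  and F: "\<And>f. f \<in> \<F> ==> holomorphic_fun \<Omega> f" and \<delta>: "holomorphic_fun \<Omega> \<delta>"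
  and pure: "pure_dim T n" and p: "p \<in> \<Omega>" "p \<in> closure T"
 shows "\<exists>\<L> V Q r \<epsilon>. analytic_cover T p \<L> V Q r \<epsilon> \<Omega> \<F> \<delta> n \<and> trace \<L> = of_nat n"
proof -
 have "finite_over T p \<L> ==> trace \<L> = of_nat k ==> ?thesis" for k \<L>
 proof (induction k arbitrary: \<L> rule: less_induct)
  case (less k)
  have "\<exists>V Q r \<epsilon>. local_cover T p \<L> V Q r \<epsilon> \<and> {y. \<forall>i. dist (p $ i) (y $ i) < r i} \<subseteq> \<Omega>"
   by (rule finite_over_imp_local_cover[OF less.prems(1) holomorphic_fun_open[OF \<delta>] p(1)])
  then obtain V Q r \<epsilon> where lc: "local_cover T p \<L> V Q r \<epsilon> \<and> {y. \<forall>i. dist (p $ i) (y $ i) < r i} \<subseteq> \<Omega>"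
   by (elim exE)
  have ac: "analytic_cover T p \<L> V Q r \<epsilon> \<Omega> \<F> \<delta> n"
   by (rule analytic_cover.intro[OF conjunct1[OF lc]], rule analytic_cover_axioms.intro)
     (use T F \<delta> conjunct2[OF lc] pure in auto)
  show ?case
  proof (cases "k = n")
   case True
   then show ?thesis using ac less.prems(2) by (intro exI conjI) auto
  next
   case False
   then have "trace \<L> ~= of_nat n" using less.prems(2) by simp
   from analytic_cover.reduce_trace[OF ac this p(2)]
   obtain \<L>' where L: "finite_over T p \<L>'" "trace \<L>' = of_nat k - 1" using less.prems(2) by auto
   have "trace \<L>' = of_nat (vec.dim (range ((*v) \<L>')))"
    using L(1) by (intro trace_idempotent) (simp add: finite_over_def)
   then have "of_nat k = (of_nat (Suc (vec.dim (range ((*v) \<L>')))) :: complex)" using L(2) by (simp add: algebra_simps)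
   then have "k = Suc (vec.dim (range ((*v) \<L>')))" by (simp only: of_nat_eq_iff)
   then have "k - 1 < k" "trace \<L>' = of_nat (k - 1)" using L(2) by auto
   from less.IH[OF this(1) L(1) this(2)] show ?thesis .
  qed
 qed
 from this[OF finite_over_id, of "CARD('n)"] show ?thesis by (simp add: trace_def mat_def)
qed

section \<open>Conormal cones\<close>

definition jfst :: "complex^('n::finite + 'm::finite) => complex^'n" where "jfst x = (\<chi> i. x $ Inl i)"
definition jsnd :: "complex^('n::finite + 'm::finite) => complex^'m" where "jsnd x = (\<chi> j. x $ Inr j)"

lemma join_nth [simp]: "join z a $ Inl i = z $ i" "join z a $ Inr j = a $ j"
 by (simp_all add: join_def)

lemma jfst_nth [simp]: "jfst x $ i = x $ Inl i" and jsnd_nth [simp]: "jsnd y $ j = y $ Inr j"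
 by (simp_all add: jfst_def jsnd_def)

lemma vec_eq_sum_iff: "x = y \<longleftrightarrow> (\<forall>i. x $ Inl i = y $ Inl i) \<and> (\<forall>j. x $ Inr j = y $ Inr j)"
 for x y :: "'a^('n::finite + 'm::finite)"
 unfolding vec_eq_iff by (metis sum.exhaust)

lemma jfst_join [simp]: "jfst (join z a) = z" and jsnd_join [simp]: "jsnd (join z a) = a"
 by (simp_all add: vec_eq_iff)

lemma join_jfst_jsnd [simp]: "join (jfst x) (jsnd x) = x"
 by (simp add: vec_eq_sum_iff)

lemma join_eq_iff [simp]: "join z a = join w b \<longleftrightarrow> z = w \<and> a = b"
 by (metis jfst_join jsnd_join)

lemma holomorphic_map_jfst [hol_intros]: "holomorphic_map U g ==> holomorphic_map U (\<lambda>x. jfst (g x))"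
 and holomorphic_map_jsnd [hol_intros]: "holomorphic_map U g ==> holomorphic_map U (\<lambda>x. jsnd (g x))"
 unfolding jfst_def jsnd_def by (intro holomorphic_map_lambda holomorphic_fun_nth; assumption)+

lemma holomorphic_map_join [hol_intros]:
 assumes "holomorphic_map U f" "holomorphic_map U g"
 shows "holomorphic_map U (\<lambda>x. join (f x) (g x))"
 unfolding holomorphic_map_def
proof
 fix k show "holomorphic_fun U (\<lambda>x. join (f x) (g x) $ k)"
  by (cases k) (use assms in \<open>simp_all add: holomorphic_map_def\<close>)
qed

lemma continuous_on_jfst [continuous_intros]: "continuous_on S g ==> continuous_on S (\<lambda>x. jfst (g x))"
 and continuous_on_jsnd [continuous_intros]: "continuous_on S g ==> continuous_on S (\<lambda>x. jsnd (g x))"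
 unfolding jfst_def jsnd_def by (intro continuous_intros; assumption)+

lemma tendsto_jfst [tendsto_intros]: "(g \<longlongrightarrow> l) F ==> ((\<lambda>x. jfst (g x)) \<longlongrightarrow> jfst l) F"
 and tendsto_jsnd [tendsto_intros]: "(g \<longlongrightarrow> l) F ==> ((\<lambda>x. jsnd (g x)) \<longlongrightarrow> jsnd l) F"
 unfolding jfst_def jsnd_def by (intro tendsto_intros; assumption)+

lemma tendsto_join [tendsto_intros]:
 assumes "(f \<longlongrightarrow> z) F" "(g \<longlongrightarrow> a) F"
 shows "((\<lambda>x. join (f x) (g x)) \<longlongrightarrow> join z a) F"
proof (rule vec_tendstoI)
 fix k show "((\<lambda>x. join (f x) (g x) $ k) \<longlongrightarrow> join z a $ k) F"
  by (cases k) (use assms in \<open>auto intro: tendsto_vec_nth\<close>)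
qed

lemma open_jfst_vimage: "open U ==> open {x :: complex^('n::finite + 'm::finite). jfst x \<in> U}"
proof -
 assume "open U"
 then have "open (jfst -` U :: (complex^('n::finite + 'm::finite)) set)"
  by (rule open_vimage) (intro continuous_intros)
 then show ?thesis by (simp add: vimage_def)
qed

lemma sum_UNIV_sum: "(\<Sum>k\<in>UNIV. f k) = (\<Sum>i\<in>(UNIV::'n::finite set). f (Inl i)) + (\<Sum>j\<in>(UNIV::'m::finite set). f (Inr j))"
 for f :: "_ => 'a::comm_monoid_add"
 unfolding UNIV_Plus_UNIV[symmetric] by (subst sum.Plus) auto

lemma holomorphic_map_vector_matrix [hol_intros]:
 assumes "\<And>i. holomorphic_map U (\<lambda>x. M x $ i)" "holomorphic_map U b" "open U"
 shows "holomorphic_map U (\<lambda>x. b x v* M x)"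
 unfolding vector_matrix_mult_def
 by (intro holomorphic_map_lambda holomorphic_fun_sum holomorphic_fun_mult holomorphic_fun_nth assms)

lemma holomorphic_map_jac_row: "holomorphic_map U f ==> holomorphic_map U (\<lambda>x. jac f x $ i)"
 unfolding jac_def vec_lambda_beta by (intro holomorphic_map_grad holomorphic_fun_nth)

lemma annihilates_range_iff:
 "(\<forall>v\<in>range ((*v) J). scalar_product a v = 0) \<longleftrightarrow> a v* J = 0" for J :: "complex^'n^'m"
proof
 assume "\<forall>v\<in>range ((*v) J). scalar_product a v = 0"
 then have "scalar_product (a v* J) v = scalar_product 0 v" for v
  by (simp add: scalar_product_matrix_vector[symmetric])
 then show "a v* J = 0" by (rule scalar_product_eqI)
qed (auto simp: scalar_product_matrix_vector)

lemma vector_matrix_idempotent: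
 fixes J :: "complex^'n^'n"
 assumes "J ** J = J" shows "(b - b v* J) v* J = 0"
proof (rule scalar_product_eqI)
 fix v
 have "J *v (J *v v) = J *v v" by (simp add: matrix_vector_mul_assoc assms)
 then show "scalar_product ((b - b v* J) v* J) v = scalar_product 0 v"
  by (simp add: scalar_product_matrix_vector[symmetric] scalar_product_diff_left)
qed

text \<open>The zero covector is included, so this is the conormal bundle over the smooth points,
  embedded in the doubled space.\<close>

definition conormal_cone :: "(complex^'n) set => (complex^('n + 'n)) set" where
 "conormal_cone Z = {join z a | z a. (\<exists>d. smooth_point Z z d) \<and> (\<forall>v\<in>tangent_space Z z. scalar_product a v = 0)}"

lemma join_conormal_cone:
 "join z a \<in> conormal_cone Z \<longleftrightarrow> (\<exists>d. smooth_point Z z d) \<and> (\<forall>v\<in>tangent_space Z z. scalar_product a v = 0)"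
 by (auto simp: conormal_cone_def)

lemma conormal_cone_iff:
 "x \<in> conormal_cone Z \<longleftrightarrow> (\<exists>d. smooth_point Z (jfst x) d) \<and> (\<forall>v\<in>tangent_space Z (jfst x). scalar_product (jsnd x) v = 0)"
 using join_conormal_cone[of "jfst x" "jsnd x"] by simp

lemma local_retraction_at:
 assumes "local_retraction Z z U \<sigma>" "w \<in> Z" "w \<in> U"
 shows "local_retraction Z w U \<sigma>"
 using assms by (auto simp: local_retraction_def)

lemma conormal_cone_retraction:
 assumes "local_retraction Z z U \<sigma>"
 shows "join z a \<in> conormal_cone Z \<longleftrightarrow> a v* jac \<sigma> z = 0"
 unfolding join_conormal_cone tangent_space_retraction[OF assms] annihilates_range_iff
 using retraction_imp_smooth_point[OF assms] by blast

lemma tangent_space_local: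
 assumes W: "open W" "z \<in> W"
 shows "tangent_space (Z \<inter> W) z = tangent_space Z z"
proof
 show "tangent_space Z z \<subseteq> tangent_space (Z \<inter> W) z"
 proof
  fix v assume v: "v \<in> tangent_space Z z"
  show "v \<in> tangent_space (Z \<inter> W) z"
   unfolding tangent_space_def
  proof (intro CollectI allI impI)
   fix U f a assume *: "z \<in> U \<and> holomorphic_fun U f \<and> (\<forall>x\<in>Z \<inter> W \<inter> U. f x = 0) \<and> (f has_derivative scalar_product a) (at z)"
   have "open (U \<inter> W)" using * holomorphic_fun_open W by blast
   then have "holomorphic_fun (U \<inter> W) f" using * holomorphic_fun_subset by blast
   then have "z \<in> U \<inter> W \<and> holomorphic_fun (U \<inter> W) f \<and> (\<forall>x\<in>Z \<inter> (U \<inter> W). f x = 0) \<and> (f has_derivative scalar_product a) (at z)"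
    using * W by auto
   then show "scalar_product a v = 0" using v unfolding tangent_space_def by blast
  qed
 qed
 show "tangent_space (Z \<inter> W) z \<subseteq> tangent_space Z z"
 proof
  fix v assume v: "v \<in> tangent_space (Z \<inter> W) z"
  show "v \<in> tangent_space Z z"
   unfolding tangent_space_def
  proof (intro CollectI allI impI)
   fix U f a assume *: "z \<in> U \<and> holomorphic_fun U f \<and> (\<forall>x\<in>Z \<inter> U. f x = 0) \<and> (f has_derivative scalar_product a) (at z)"
   then have "z \<in> U \<and> holomorphic_fun U f \<and> (\<forall>x\<in>(Z \<inter> W) \<inter> U. f x = 0) \<and> (f has_derivative scalar_product a) (at z)" by auto
   then show "scalar_product a v = 0" using v unfolding tangent_space_def by blast
  qed
 qed
qed

lemma conormal_cone_local:
 assumes W: "open W" shows "conormal_cone (Z \<inter> W) = conormal_cone Z \<inter> {x. jfst x \<in> W}"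
proof -
 have "smooth_point (Z \<inter> W) z d \<longleftrightarrow> smooth_point Z z d" if "z \<in> W" for z d
  using smooth_point_local[OF _ W that, of "Z \<inter> W" d Z] smooth_point_local[OF _ W that, of Z d "Z \<inter> W"] by blast
 moreover have "z \<in> W" if "smooth_point (Z \<inter> W) z d" for z d using smooth_point_in[OF that] by simp
 ultimately have "x \<in> conormal_cone (Z \<inter> W) \<longleftrightarrow> x \<in> conormal_cone Z \<and> jfst x \<in> W" for x
  unfolding conormal_cone_iff using tangent_space_local[OF W, of "jfst x" Z] by metis
 then show ?thesis by blast
qed

text \<open>Only the trace of a derivative is needed, and a diagonal entry is found by moving a
  single coordinate.\<close>

lemma jac_diagonal_eq:
 fixes \<Sigma> :: "complex^'k => complex^'k"
 assumes "(\<Sigma> has_derivative (*v) M) (at x)" "((\<lambda>t. \<Sigma> (x + t *s axis k 1) $ k) has_field_derivative m) (at 0)"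
 shows "M $ k $ k = m"
proof -
 have "((\<lambda>x. \<Sigma> x $ k) has_derivative scalar_product (M $ k)) (at (x + 0 *s axis k 1))"
  using assms(1) unfolding has_derivative_matrix_iff by simp
 from has_field_derivative_line[OF this]
 have "((\<lambda>t. \<Sigma> (x + t *s axis k 1) $ k) has_field_derivative M $ k $ k) (at 0)" by simp
 then show ?thesis using assms(2) DERIV_unique by blast
qed

lemma join_add_axis: "join z a + t *s axis (Inl i) 1 = join (z + t *s axis i 1) a"
 "join z a + t *s axis (Inr j) 1 = join z (a + t *s axis j 1)"
 by (auto simp: vec_eq_sum_iff axis_def)

text \<open>The retraction applies \<open>\<sigma>\<close> to the point and removes from the
  covector its part that is not conormal at the new point. The trace of its derivative is
  \<open>trace P\<close> from the point and \<open>CARD('n) - trace P\<close> from the covector, so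
  the dimension of \<open>Z\<close> cancels.\<close>

theorem smooth_conormal_cone:
 fixes Z :: "(complex^'n) set"
 assumes sm: "smooth_point Z z d" and a: "join z a \<in> conormal_cone Z"
 shows "smooth_point (conormal_cone Z) (join z a) CARD('n)"
proof -
 obtain U \<sigma> where \<sigma>: "local_retraction Z z U \<sigma>" using smooth_point_imp_retraction[OF sm] by blast
 note \<sigma>D = local_retractionD[OF \<sigma>]
 define P where "P = jac \<sigma> z"
 have aP: "a v* P = 0" using a conormal_cone_retraction[OF \<sigma>] by (simp add: P_def)
 define U1 where "U1 = {x\<in>U. \<sigma> x \<in> U}"
 have U1: "open U1" unfolding U1_def by (rule holomorphic_map_vimage_open[OF \<sigma>D(1,2)])
 define \<Omega> where "\<Omega> = {x :: complex^('n + 'n). jfst x \<in> U1}"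
 have \<Omega>: "open \<Omega>" unfolding \<Omega>_def by (rule open_jfst_vimage[OF U1])
 define \<Sigma> where "\<Sigma> = (\<lambda>x :: complex^('n + 'n). join (\<sigma> (jfst x)) (jsnd x - jsnd x v* jac \<sigma> (\<sigma> (jfst x))))"
 have h1: "holomorphic_map \<Omega> (\<lambda>x. \<sigma> (jfst x))"
  by (rule holomorphic_map_compose[OF holomorphic_map_jfst[OF holomorphic_map_id[OF \<Omega>]] \<sigma>D(1)]) (simp add: \<Omega>_def U1_def)
 have h2: "holomorphic_map \<Omega> (\<lambda>x. jac \<sigma> (\<sigma> (jfst x)) $ i)" for i
  by (rule holomorphic_map_compose[OF h1 holomorphic_map_jac_row[OF \<sigma>D(1)]]) (simp add: \<Omega>_def U1_def)
 have h\<Sigma>: "holomorphic_map \<Omega> \<Sigma>" unfolding \<Sigma>_def by (intro hol_intros h1 h2 \<Omega>)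
 have in\<Omega>: "join z a \<in> \<Omega>" using \<sigma>D(3,7) by (simp add: \<Omega>_def U1_def)
 define J where "J = jac \<Sigma> (join z a)"
 have D: "(\<Sigma> has_derivative (*v) J) (at (join z a))" unfolding J_def by (rule has_derivative_jac[OF h\<Sigma> in\<Omega>])
 have J1: "J $ Inl i $ Inl i = P $ i $ i" for i
 proof (rule jac_diagonal_eq[OF D])
  have "((\<lambda>x. \<sigma> x $ i) has_derivative scalar_product (P $ i)) (at (z + 0 *s axis i 1))"
   using \<sigma>D(8) unfolding has_derivative_matrix_iff P_def by simp
  from has_field_derivative_line[OF this]
  show "((\<lambda>t. \<Sigma> (join z a + t *s axis (Inl i) 1) $ Inl i) has_field_derivative P $ i $ i) (at 0)"
   by (simp add: join_add_axis \<Sigma>_def)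
 qed
 have J2: "J $ Inr j $ Inr j = 1 - P $ j $ j" for j
 proof (rule jac_diagonal_eq[OF D])
  have "((a + t *s axis j 1) v* P) $ j = t * P $ j $ j" for t
  proof -
   have "scalar_product (a + t *s axis j 1) (P *v axis j 1) = ((a + t *s axis j 1) v* P) $ j"
    by (simp only: scalar_product_matrix_vector scalar_product_axis)
   moreover have "scalar_product (a + t *s axis j 1) (P *v axis j 1) =
     scalar_product a (P *v axis j 1) + t * (P *v axis j 1) $ j"
    by (simp only: scalar_product_add_left scalar_product_scale_left scalar_product_axis)
   moreover have "scalar_product a (P *v axis j 1) = 0"
    by (simp only: scalar_product_matrix_vector aP scalar_product_zero_left)
   moreover have "(P *v axis j 1) $ j = P $ j $ j" by (simp add: matrix_vector_nth)
   ultimately show ?thesis by simp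
  qed
  then have "(\<lambda>t. \<Sigma> (join z a + t *s axis (Inr j) 1) $ Inr j) = (\<lambda>t. a $ j + t * (1 - P $ j $ j))"
   by (auto simp: join_add_axis \<Sigma>_def \<sigma>D(7) P_def[symmetric] algebra_simps)
  then show "((\<lambda>t. \<Sigma> (join z a + t *s axis (Inr j) 1) $ Inr j) has_field_derivative 1 - P $ j $ j) (at 0)"
   by (auto intro!: derivative_eq_intros)
 qed
 have tr: "trace J = of_nat CARD('n)"
  by (simp add: trace_def sum_UNIV_sum J1 J2 sum_subtractf)
 show ?thesis
 proof (rule smooth_pointI_retraction[OF h\<Sigma> in\<Omega> a _ _ D tr])
  show "\<Sigma> x \<in> conormal_cone Z" if "x \<in> \<Omega>" for x
  proof -
   have "\<sigma> (jfst x) \<in> Z" "\<sigma> (jfst x) \<in> U" using that \<sigma>D(5) by (auto simp: \<Omega>_def U1_def)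
   then have r: "local_retraction Z (\<sigma> (jfst x)) U \<sigma>" by (rule local_retraction_at[OF \<sigma>])
   show ?thesis unfolding \<Sigma>_def conormal_cone_retraction[OF r]
    by (rule vector_matrix_idempotent[OF local_retraction_idempotent[OF r]])
  qed
  show "\<Sigma> x = x" if x: "x \<in> conormal_cone Z" "x \<in> \<Omega>" for x
  proof -
   have "jfst x \<in> Z" using x(1) smooth_point_in by (auto simp: conormal_cone_iff)
   moreover have "jfst x \<in> U" using x(2) by (simp add: \<Omega>_def U1_def)
   ultimately have r: "local_retraction Z (jfst x) U \<sigma>" "\<sigma> (jfst x) = jfst x"
    using local_retraction_at[OF \<sigma>] \<sigma>D(6) by auto
   have "join (jfst x) (jsnd x) \<in> conormal_cone Z" using x(1) by simp
   then have "jsnd x v* jac \<sigma> (jfst x) = 0" unfolding conormal_cone_retraction[OF r(1)] .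
   then show ?thesis by (simp add: \<Sigma>_def r(2))
  qed
 qed
qed

section \<open>Equations for the conormal covectors\<close>

context analytic_cover
begin

text \<open>By \<open>sheet_closure\<close> the sheet through \<open>t\<close> lies in
  \<open>T\<close> where \<open>\<delta>\<close> is nonzero, and near \<open>t\<close> it fixes
  \<open>T\<close>. Tangent spaces of \<open>T\<close> can thus be read off from sheets.\<close>

lemma sheet_retraction:
 assumes tr: "trace \<L> = of_nat n" and s: "sheets h t e R" and t: "t \<in> T" "t \<in> polydisc" "t \<in> base"
 shows "\<exists>U. local_retraction T t U (R t)"
proof -
 have tf: "t \<in> fibre t" by (rule T_fibre[OF t])
 have Rt: "R t t = t" by (rule sheetsD(7)[OF s tf])
 have ts: "t \<in> sat t e" by (rule sheetsD(3)[OF s])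
 obtain d where d: "d > 0 \<and> (\<forall>x. dist x t < d --> x \<in> sat t e \<and> x \<in> polydisc \<and> (x \<in> T --> R t x = x))"
  using sheet_near_T[OF s ts tf Rt] ..
 have dt: "\<delta> t ~= 0" using t(1) T_eq by blast
 have tc: "R t t \<in> closure T" using Rt t(1) closure_subset by auto
 have Rh: "holomorphic_map (sat t e) (R t)" by (rule sheetsD(6)[OF s tf])
 define U where "U = {x\<in>sat t e. \<delta> (R t x) ~= 0} \<inter> ball t d"
 have U: "open U" unfolding U_def
  by (intro open_Int open_ball open_nonzero[OF holomorphic_on_sheet[OF s tf hol_delta]])
 have "local_retraction T t U (R t)"
  unfolding local_retraction_def
 proof (intro conjI)
  show "holomorphic_map U (R t)" by (rule holomorphic_map_subset[OF Rh U]) (auto simp: U_def)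
  have "t \<in> ball t d" using d by simp
  then show "t \<in> U" using ts dt by (simp add: U_def Rt)
  show "R t ` U \<subseteq> T"
  proof
   fix y assume "y \<in> R t ` U"
   then obtain x where x: "x \<in> U" "y = R t x" by auto
   then have "x \<in> sat t e" "\<delta> (R t x) ~= 0" by (auto simp: U_def)
   then show "y \<in> T" using sheet_closure(3)[OF tr s tf ts tc] Rt x(2) by simp
  qed
  show "\<forall>x\<in>T \<inter> U. R t x = x"
  proof
   fix x assume x: "x \<in> T \<inter> U"
   then have "dist x t < d" by (simp add: U_def dist_commute)
   then show "R t x = x" using d x by blast
  qed
 qed (rule t(1))
 then show ?thesis ..
qed

lemma live_invariant: "\<L> *v x = \<L> *v y ==> live x = live y"
 unfolding live_def using fibre_invariant[of x y] by simp

text \<open>Every summand except that of \<open>y\<close> contains the factor with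
  \<open>y' = y\<close>, which is zero. A globally defined symmetric function thereby yields the
  product over the other live points.\<close>

lemma sum_prod_live:
 assumes "y \<in> live y" "y \<in> base"
 shows "(\<Sum>z\<in>live y. \<Prod>z'\<in>live y - {z}. scalar_product l (y - z')) = (\<Prod>z'\<in>live y - {y}. scalar_product l (y - z'))"
proof -
 have fin: "finite (live y)" by (rule finite_live[OF assms(2)])
 have "(\<Prod>z'\<in>live y - {z}. scalar_product l (y - z')) = 0" if "z \<in> live y - {y}" for z
 proof (rule prod_zero)
  show "\<exists>z'\<in>live y - {z}. scalar_product l (y - z') = 0"
   by (rule bexI[of _ y]) (use that assms in auto)
 qed (use fin in simp)
 then show ?thesis using sum.remove[OF fin assms(1), of "\<lambda>z. \<Prod>z'\<in>live y - {z}. scalar_product l (y - z')"] by simp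
qed

text \<open>By the product rule only the factor of \<open>t\<close> itself is differentiated,
  because it vanishes at \<open>t\<close>. The gradient is a multiple of
  \<open>l - l v* jac (R t) t\<close>, which is conormal.\<close>

lemma grad_difference_product:
 assumes tr: "trace \<L> = of_nat n" and s: "sheets h t e R" and t: "t \<in> T" "t \<in> polydisc" "t \<in> base"
  and F: "\<And>x. x \<in> base ==> h x ~= 0 ==> F x = (\<Prod>y\<in>live x. scalar_product l (x - y))"
 shows "grad F t = (\<Prod>y\<in>live t - {t}. scalar_product l (t - y)) *s (l - l v* jac (R t) t)"
proof -
 have tf: "t \<in> fibre t" by (rule T_fibre[OF t])
 have tl: "t \<in> live t" by (rule T_live[OF t])
 have Rt: "R t t = t" by (rule sheetsD(7)[OF s tf])
 have ts: "t \<in> sat t e" by (rule sheetsD(3)[OF s])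
 define g where "g = (\<lambda>x. \<Prod>y\<in>live t - {t}. scalar_product l (x - R y x))"
 define f where "f = (\<lambda>x. scalar_product l (x - R t x))"
 have Ff: "F x = f x * g x" if x: "x \<in> sat t e" for x
 proof -
  have "F x = (\<Prod>y\<in>live x. scalar_product l (x - y))" by (rule F[OF sheetsD(4,5)[OF s x]])
  also have "\<dots> = (\<Prod>y\<in>live t. scalar_product l (x - R y x))"
   using prod.reindex_bij_betw[OF live_bij[OF tr s x], of "\<lambda>y. scalar_product l (x - y)"] by simp
  also have "\<dots> = f x * g x" unfolding f_def g_def by (rule prod.remove[OF finite_live[OF t(3)] tl])
  finally show ?thesis .
 qed
 have hg: "holomorphic_fun (sat t e) g" unfolding g_def
 proof (intro holomorphic_fun_prod open_saturated)
  fix y assume "y \<in> live t - {t}"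
  then have "y \<in> fibre t" using live_subset by blast
  then show "holomorphic_fun (sat t e) (\<lambda>x. scalar_product l (x - R y x))"
   by (intro hol_intros open_saturated sheetsD(6)[OF s])
 qed
 have Df: "(f has_derivative scalar_product (l - l v* jac (R t) t)) (at t)"
 proof -
  have "((\<lambda>x. x - R t x) has_derivative (\<lambda>v. v - jac (R t) t *v v)) (at t)"
   by (intro derivative_intros has_derivative_jac[OF sheetsD(6)[OF s tf] ts])
  then have "(f has_derivative (\<lambda>v. scalar_product l (v - jac (R t) t *v v))) (at t)"
   unfolding f_def by (rule bounded_linear.has_derivative[OF bounded_linear_scalar_product])
  then show ?thesis
   by (rule has_derivative_eq_rhs) (auto simp: scalar_product_diff_right scalar_product_diff_left scalar_product_matrix_vector)
 qed
 have f0: "f t = 0" by (simp add: f_def Rt)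
 have g0: "g t = (\<Prod>y\<in>live t - {t}. scalar_product l (t - y))" unfolding g_def
 proof (rule prod.cong[OF refl])
  fix y assume "y \<in> live t - {t}"
  then have "y \<in> fibre t" using live_subset by blast
  then show "scalar_product l (t - R y t) = scalar_product l (t - y)" using sheetsD(7)[OF s] by simp
 qed
 have "((\<lambda>x. f x * g x) has_derivative scalar_product (g t *s (l - l v* jac (R t) t))) (at t)"
  using has_derivative_mult_scalar_product[OF Df has_derivative_grad[OF hg ts]] f0 by simp
 then have "(F has_derivative scalar_product (g t *s (l - l v* jac (R t) t))) (at t)"
  by (rule has_derivative_transform_within_open[OF _ open_saturated ts]) (use Ff in simp)
 then show ?thesis using grad_eqI g0 by metis
qed

text \<open>The covectors must be generic for \<open>A\<close>, which the coordinate covectors need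
  not be. Taking \<open>l0\<close> and \<open>l0 + \<tau> *s axis i 1\<close> makes all of them
  generic while their differences still give every coordinate covector.\<close>

lemma covector_family:
 fixes A :: "(complex^'n) set"
 assumes "finite A" "0 \<notin> A"
 shows "\<exists>l \<tau>. \<tau> ~= 0 \<and> (\<forall>i. l (Some i) = l None + \<tau> *s axis i 1) \<and> (\<forall>k. \<forall>v\<in>A. scalar_product (l k) v ~= (0::complex))"
proof -
 obtain l0 where l0: "\<forall>v\<in>A. scalar_product l0 v ~= 0" using generic_covector[OF assms] ..
 have "finite (insert 0 ((\<lambda>(v, i). - scalar_product l0 v / v $ i) ` (A \<times> (UNIV :: 'n set))))" using assms(1) by simp
 then obtain \<tau> where \<tau>: "\<tau> \<notin> insert 0 ((\<lambda>(v, i). - scalar_product l0 v / v $ i) ` (A \<times> (UNIV :: 'n set)))"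
  using ex_new_if_finite[OF infinite_UNIV_char_0] by blast
 have nz: "scalar_product (l0 + \<tau> *s axis i 1) v ~= 0" if v: "v \<in> A" for i v
 proof (cases "v $ i = 0")
  case True
  then show ?thesis using l0 v by (simp add: scalar_product_add_left scalar_product_scale_left)
 next
  case False
  have "\<tau> ~= - scalar_product l0 v / v $ i" using \<tau> v by auto
  then show ?thesis using False
   by (auto simp: scalar_product_add_left scalar_product_scale_left field_simps add_eq_0_iff)
 qed
 show ?thesis
  by (intro exI[of _ "\<lambda>k. case k of None => l0 | Some i => l0 + \<tau> *s axis i 1"] exI[of _ \<tau>])
    (use \<tau> nz l0 in \<open>auto split: option.split\<close>)
qed

end

lemma vector_matrix_scale_left: "(c *s a) v* J = c *s (a v* J)" for J :: "complex^'n^'m"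
 by (rule scalar_product_eqI) (simp only: scalar_product_matrix_vector[symmetric] scalar_product_scale_left)

lemma vector_matrix_diff_left: "(a - b) v* J = a v* J - b v* J" for J :: "complex^'n^'m"
 by (rule scalar_product_eqI) (simp only: scalar_product_matrix_vector[symmetric] scalar_product_diff_left)

lemma vector_matrix_rows:
 fixes M J :: "complex^'n^'n"
 assumes "\<And>i. M $ i = c *s (axis i 1 - axis i 1 v* J)"
 shows "a v* M = c *s (a - a v* J)"
proof (rule scalar_product_eqI)
 fix v
 have "(M *v v) $ i = c * (v $ i - (J *v v) $ i)" for i
  by (simp only: matrix_vector_nth assms scalar_product_scale_left scalar_product_diff_left
    scalar_product_matrix_vector[symmetric] scalar_product_axis)
 then have "M *v v = c *s (v - J *v v)" by (simp add: vec_eq_iff algebra_simps)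
 then show "scalar_product (a v* M) v = scalar_product (c *s (a - a v* J)) v"
  by (simp only: scalar_product_matrix_vector[symmetric] scalar_product_scale_left scalar_product_scale_right
    scalar_product_diff_left scalar_product_diff_right)
qed

text \<open>\<open>D\<close> is controlled only on \<open>base\<close>, which candidates may leave.
  Those that project to the same point as \<open>x\<close> lie in \<open>base\<close>; near the
  others the condition on projections fails, so they do not matter.\<close>

lemma (in analytic_cover) live_bounded:
 assumes D: "holomorphic_fun base D" and x: "x \<in> base"
 shows "\<exists>e>0. \<exists>B\<ge>1. \<forall>x'\<in>base. dist x' x < e --> (\<forall>y'\<in>live x'. norm (D y') \<le> B)"
proof -
 define B where "B = 1 + (\<Sum>y\<in>fibre x. norm (D y))"
 have "\<exists>e>0. \<forall>x'\<in>base. dist x' x < e --> (\<forall>y'\<in>fibre x'. \<L> *v y' = \<L> *v x' --> norm (D y') \<le> B)"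
 proof (rule fibre_eventually[OF x])
  fix y assume y: "y \<in> fibre x"
  show "\<exists>\<rho>>0. \<forall>x' y'. dist x' x < \<rho> \<and> dist y' y < \<rho> --> \<L> *v y' = \<L> *v x' --> norm (D y') \<le> B"
  proof (cases "\<L> *v y = \<L> *v x")
   case True
   then have yb: "y \<in> base" using base_invariant x by blast
   have "norm (D y) \<le> (\<Sum>y\<in>fibre x. norm (D y))"
    by (rule member_le_sum[OF y]) (use finite_fibre[OF x] in auto)
   then have "norm (D y) < B" by (simp add: B_def)
   then have "0 < B - norm (D y)" by simp
   then obtain \<rho>1 where \<rho>1: "\<rho>1 > 0" "\<forall>y'\<in>base. dist y' y < \<rho>1 --> dist (D y') (D y) < B - norm (D y)"
    using holomorphic_fun_continuous_on[OF D] yb unfolding continuous_on_iff by meson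
   obtain \<rho>2 where \<rho>2: "\<rho>2 > 0" "ball y \<rho>2 \<subseteq> base" using open_ball_mult_imp[OF open_base yb] by blast
   have "norm (D y') \<le> B" if "dist y' y < min \<rho>1 \<rho>2" for y'
   proof -
    have "y' \<in> ball y \<rho>2" using that by (simp add: dist_commute)
    then have "dist (D y') (D y) < B - norm (D y)" using \<rho>1 \<rho>2 that by auto
    then show ?thesis using norm_triangle_sub[of "D y'" "D y"] by (simp add: dist_norm)
   qed
   then show ?thesis using \<rho>1 \<rho>2 by (intro exI[of _ "min \<rho>1 \<rho>2"]) auto
  next
   case False
   have c: "isCont (\<lambda>z. \<L> *v (snd z - fst z)) (x, y)"
    unfolding isCont_def by (intro tendsto_intros)
   have "\<L> *v (snd (x, y) - fst (x, y)) \<in> - {0}" using False by (simp add: matrix_vector_mult_diff_distrib)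
   from isCont_pair_nhds[OF c _ this]
   obtain \<rho> where "\<rho> > 0" "\<forall>x' y'. dist x' x < \<rho> \<and> dist y' y < \<rho> --> \<L> *v (snd (x', y') - fst (x', y')) \<in> - {0}"
    by auto
   then show ?thesis by (intro exI[of _ \<rho>]) (auto simp: matrix_vector_mult_diff_distrib)
  qed
 qed
 then obtain e where e: "e > 0 \<and> (\<forall>x'\<in>base. dist x' x < e --> (\<forall>y'\<in>fibre x'. \<L> *v y' = \<L> *v x' --> norm (D y') \<le> B))" ..
 have "B \<ge> 1" by (simp add: B_def sum_nonneg)
 then show ?thesis using e by (intro exI[of _ e] exI[of _ B]) (auto simp: live_def)
qed

text \<open>The matrix is built to satisfy \<open>M t = \<delta>' t\<close> times
  \<open>mat 1 - J\<close>, where \<open>J\<close> is the derivative of the sheet through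
  \<open>t\<close>. For nonzero \<open>\<delta>' t\<close> the equation
  \<open>\<delta>' t *s a = a v* M t\<close> then says \<open>a v* J = 0\<close>, that is,
  \<open>a\<close> is conormal.\<close>

lemma (in analytic_cover) generic_conormal:
 assumes tr: "trace \<L> = of_nat n"
 shows "\<exists>\<delta>' M. holomorphic_fun base \<delta>' \<and> (\<forall>i. holomorphic_map base (\<lambda>x. M x $ i)) \<and>
  (\<forall>t\<in>T \<inter> polydisc \<inter> base. \<delta>' t ~= 0 --> (\<exists>d. smooth_point T t d) \<and>
    (\<forall>a. join t a \<in> conormal_cone T \<longleftrightarrow> \<delta>' t *s a = a v* M t)) \<and>
  (\<forall>x\<in>closure T \<inter> polydisc \<inter> base. \<forall>e>0. \<exists>t\<in>T \<inter> polydisc \<inter> base. dist t x < e \<and> \<delta>' t ~= 0)"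
proof -
 obtain h where h: "is_discr h" using discr_exists ..
 obtain x1 where x1: "x1 \<in> base" "h x1 ~= 0" using is_discrD(2)[OF h] by blast
 \<comment> \<open>Differences of live points over one generic \<open>x1\<close>. Covectors that are
   nonzero on them make \<open>D\<close> nonzero at all live points over \<open>x1\<close>, hence
   \<open>\<delta>'\<close> not identically zero.\<close>
 define A where "A = (\<lambda>(y, y'). y - y') ` (live x1 \<times> live x1) - {0}"
 have "finite A" "0 \<notin> A" using finite_live[OF x1(1)] by (auto simp: A_def)
 from covector_family[OF this]
 obtain l \<tau> where l0: "\<tau> ~= 0 \<and> (\<forall>i. l (Some i) = l None + \<tau> *s axis i 1) \<and> (\<forall>k. \<forall>v\<in>A. scalar_product (l k) v ~= 0)"
  by (elim exE)
 then have \<tau>: "\<tau> ~= 0" and lS: "\<And>i. l (Some i) = l None + \<tau> *s axis i 1" and lA: "\<And>k v. v \<in> A ==> scalar_product (l k) v ~= 0"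
  by auto
 have "\<forall>k. \<exists>F. holomorphic_fun base F \<and> (\<forall>x\<in>base. h x ~= 0 --> F x = (\<Prod>y\<in>live x. scalar_product (l k) (x - y)))"
  using difference_product(1)[OF tr h] by blast
 from choice[OF this] obtain F where F0: "\<forall>k. holomorphic_fun base (F k) \<and> (\<forall>x\<in>base. h x ~= 0 --> F k x = (\<Prod>y\<in>live x. scalar_product (l k) (x - y)))" ..
 have hF: "holomorphic_fun base (F k)" for k using F0 by simp
 have F: "F k x = (\<Prod>y\<in>live x. scalar_product (l k) (x - y))" if "x \<in> base" "h x ~= 0" for k x using F0 that by simp
 have "\<forall>k. \<exists>F. holomorphic_fun base F \<and> (\<forall>x\<in>base. h x ~= 0 -->
    F x = (\<Sum>y\<in>live x. \<Prod>y'\<in>live x - {y}. scalar_product (l k) (x - y')))"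
  using difference_product(2)[OF tr h] by blast
 from choice[OF this] obtain C where C0: "\<forall>k. holomorphic_fun base (C k) \<and> (\<forall>x\<in>base. h x ~= 0 -->
    C k x = (\<Sum>y\<in>live x. \<Prod>y'\<in>live x - {y}. scalar_product (l k) (x - y')))" ..
 have hC: "holomorphic_fun base (C k)" for k using C0 by simp
 have C: "C k y = (\<Prod>y'\<in>live y - {y}. scalar_product (l k) (y - y'))" if "y \<in> base" "h y ~= 0" "y \<in> live y" for k y
  using C0 that sum_prod_live[OF that(3,1)] by simp
 define D where "D = (\<lambda>x. \<Prod>k\<in>UNIV. C k x)"
 have hD: "holomorphic_fun base D" unfolding D_def by (intro holomorphic_fun_prod open_base hC)
 \<comment> \<open>Each gradient carries its own factor \<open>C k\<close>. Multiplication by the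
   other factors gives all of them the common factor \<open>D\<close>; differences then isolate
   \<open>\<tau>\<close> times the coordinate covector, and division by \<open>\<tau>\<close>
   normalises.\<close>
 define M where "M = (\<lambda>x. \<chi> i. (h x / \<tau>) *s ((\<Prod>k\<in>UNIV - {Some i}. C k x) *s grad (F (Some i)) x
   - (\<Prod>k\<in>UNIV - {None}. C k x) *s grad (F None) x))"
 have hM: "holomorphic_map base (\<lambda>x. M x $ i)" for i
  unfolding M_def vec_lambda_beta
  by (intro holomorphic_map_scale holomorphic_map_diff holomorphic_fun_prod open_base hC holomorphic_map_grad hF
    holomorphic_fun_divide is_discrD(1)[OF h] holomorphic_fun_const) (rule \<tau>)
 define \<delta>' where "\<delta>' = (\<lambda>x. h x * D x)"
 have h\<delta>': "holomorphic_fun base \<delta>'" unfolding \<delta>'_def by (intro hol_intros hD is_discrD(1)[OF h])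
 have main: "(\<exists>d. smooth_point T t d) \<and> (\<forall>a. join t a \<in> conormal_cone T \<longleftrightarrow> \<delta>' t *s a = a v* M t)"
  if t: "t \<in> T" "t \<in> polydisc" "t \<in> base" and nz: "\<delta>' t ~= 0" for t
 proof -
  have ht: "h t ~= 0" using nz by (simp add: \<delta>'_def)
  obtain e R where s: "sheets h t e R" using sheets_exist[OF h t(3) ht] by blast
  obtain U where U: "local_retraction T t U (R t)" using sheet_retraction[OF tr s t] ..
  define J where "J = jac (R t) t"
  have tl: "t \<in> live t" by (rule T_live[OF t])
  have g: "grad (F k) t = C k t *s (l k - l k v* J)" for k
   unfolding J_def C[OF t(3) ht tl] by (rule grad_difference_product[OF tr s t F])
  have CD: "(\<Prod>k'\<in>UNIV - {k}. C k' t) * C k t = D t" for k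
   unfolding D_def using prod.remove[of UNIV k "\<lambda>k. C k t"] by (simp add: mult.commute)
  have scl: "(\<Prod>k'\<in>UNIV - {k}. C k' t) *s (C k t *s w) = D t *s w" for k and w :: "complex^'n"
   by (simp only: vector_smult_assoc CD)
  have row: "M t $ i = \<delta>' t *s (axis i 1 - axis i 1 v* J)" for i
  proof -
   have "M t $ i = (h t / \<tau>) *s (D t *s (l (Some i) - l (Some i) v* J) - D t *s (l None - l None v* J))"
    unfolding M_def vec_lambda_beta g scl ..
   also have "\<dots> = (h t / \<tau> * D t) *s ((l (Some i) - l None) - (l (Some i) - l None) v* J)"
    by (simp add: vector_matrix_diff_left vec_eq_iff algebra_simps)
   also have "l (Some i) - l None = \<tau> *s axis i 1" by (simp add: lS)
   also have "(h t / \<tau> * D t) *s (\<tau> *s axis i 1 - (\<tau> *s axis i 1) v* J) = \<delta>' t *s (axis i 1 - axis i 1 v* J)"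
    unfolding vector_matrix_scale_left using \<tau> by (simp add: \<delta>'_def vec_eq_iff field_simps)
   finally show ?thesis .
  qed
  have aM: "a v* M t = \<delta>' t *s (a - a v* J)" for a by (rule vector_matrix_rows[OF row])
  have "join t a \<in> conormal_cone T \<longleftrightarrow> \<delta>' t *s a = a v* M t" for a
   unfolding conormal_cone_retraction[OF U] aM J_def[symmetric] using nz by (auto simp: vec_eq_iff)
  then show ?thesis using retraction_imp_smooth_point[OF U] by blast
 qed
 have "\<exists>N. holomorphic_fun base N \<and> (\<forall>x\<in>base. h x ~= 0 --> N x = (\<Prod>y\<in>live x. D y))"
 proof (rule live_product(1)[where \<psi> = "\<lambda>x y. D y", OF tr h _ live_bounded[OF hD]])
  fix x2 e R y assume s: "sheets h x2 e R" and y: "y \<in> live x2"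
  then have yf: "y \<in> fibre x2" using live_subset by blast
  show "holomorphic_fun (sat x2 e) (\<lambda>x. D (R y x))"
  proof (rule holomorphic_fun_compose[OF sheetsD(6)[OF s yf] hD])
   fix x assume x: "x \<in> sat x2 e"
   have "\<L> *v R y x = \<L> *v x"
    using sheet_closure(1)[OF tr s yf sheetsD(3)[OF s] _ _ x] y sheetsD(7)[OF s yf] by (simp add: live_def)
   then show "R y x \<in> base" using base_invariant sheetsD(4)[OF s x] by blast
  qed
 qed
 then obtain N where N0: "holomorphic_fun base N \<and> (\<forall>x\<in>base. h x ~= 0 --> N x = (\<Prod>y\<in>live x. D y))" ..
 \<comment> \<open>\<open>D\<close> depends on the sheet, while the density result is for functions
   of the projection. \<open>G\<close> is the norm of \<open>D\<close> over the live points times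
   \<open>h\<close>; where it is nonzero on \<open>T\<close>, so are \<open>D\<close> and
   \<open>h\<close>.\<close>
 define G where "G = (\<lambda>x. h x * N (aproj \<L> p x))"
 have hp: "h (aproj \<L> p x) = h x" for x by (rule is_discrD(3)[OF h Lambda_aproj])
 have G: "G x = h x * (\<Prod>y\<in>live x. D y)" if x: "x \<in> base" "h x ~= 0" for x
 proof -
  have "h (aproj \<L> p x) ~= 0" using x hp by simp
  then show ?thesis using N0 aproj_base_set[OF x(1)] live_invariant[OF Lambda_aproj, of x] by (simp add: G_def)
 qed
 have hG: "holomorphic_fun base G" unfolding G_def
  by (rule holomorphic_fun_mult[OF is_discrD(1)[OF h]
     holomorphic_fun_compose[OF holomorphic_map_aproj[OF holomorphic_map_id[OF open_base]] conjunct1[OF N0] aproj_base_set]])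
 have "D y ~= 0" if y: "y \<in> live x1" for y
 proof -
  have L: "\<L> *v y = \<L> *v x1" using y by (simp add: live_def)
  have yb: "y \<in> base" using base_invariant[OF L] x1 by simp
  have hy: "h y ~= 0" using is_discrD(3)[OF h L] x1 by simp
  have lv: "live y = live x1" by (rule live_invariant[OF L])
  have "C k y ~= 0" for k
  proof -
   have "scalar_product (l k) (y - y') ~= 0" if "y' \<in> live x1 - {y}" for y'
   proof (rule lA)
    show "y - y' \<in> A" unfolding A_def using y that by force
   qed
   then show ?thesis using C[OF yb hy] y lv finite_live[OF x1(1)] by simp
  qed
  then show ?thesis by (simp add: D_def)
 qed
 then have "G x1 ~= 0" using G[OF x1] x1(2) finite_live[OF x1(1)] by simp
 then have nz: "\<exists>x\<in>base. G x ~= 0" using x1 by blast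
 have inv: "G x = G y" if "\<L> *v x = \<L> *v y" for x y
  using is_discrD(3)[OF h that] that by (simp add: G_def aproj_def matrix_vector_mult_diff_distrib)
 have dense: "\<exists>t\<in>T \<inter> polydisc \<inter> base. dist t x < e \<and> \<delta>' t ~= 0"
  if x: "x \<in> closure T \<inter> polydisc \<inter> base" and e: "e > 0" for x e
 proof -
  have x': "x \<in> base" "x \<in> polydisc" "x \<in> closure T" using x by auto
  obtain t where t: "t \<in> T" "dist t x < e" "t \<in> polydisc" "t \<in> base" "G t ~= 0"
   using dense_nonzero[OF pure tr hG nz inv x' e] by blast
  have ht: "h t ~= 0" using t(5) by (auto simp: G_def)
  have "D t ~= 0" using G[OF t(4) ht] t(5) T_live[OF t(1,3,4)] finite_live[OF t(4)] by auto
  then show ?thesis using t ht by (intro bexI[of _ t]) (auto simp: \<delta>'_def)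
 qed
 show ?thesis
 proof (intro exI[of _ \<delta>'] exI[of _ M] conjI)
  show "holomorphic_fun base \<delta>'" by (rule h\<delta>')
  show "\<forall>i. holomorphic_map base (\<lambda>x. M x $ i)" using hM by simp
  show "\<forall>t\<in>T \<inter> polydisc \<inter> base. \<delta>' t ~= 0 --> (\<exists>d. smooth_point T t d) \<and>
    (\<forall>a. join t a \<in> conormal_cone T \<longleftrightarrow> \<delta>' t *s a = a v* M t)"
  proof (intro ballI impI)
   fix t assume "t \<in> T \<inter> polydisc \<inter> base" and nz: "\<delta>' t ~= 0"
   then have "t \<in> T" "t \<in> polydisc" "t \<in> base" by auto
   from main[OF this nz] show "(\<exists>d. smooth_point T t d) \<and>
    (\<forall>a. join t a \<in> conormal_cone T \<longleftrightarrow> \<delta>' t *s a = a v* M t)" .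
  qed
  show "\<forall>x\<in>closure T \<inter> polydisc \<inter> base. \<forall>e>0. \<exists>t\<in>T \<inter> polydisc \<inter> base. dist t x < e \<and> \<delta>' t ~= 0"
   using dense by blast
 qed
qed

text \<open>The covector \<open>a - a v* jac \<sigma> t\<close> is conormal at \<open>t\<close> and
  varies continuously with \<open>t\<close>, with value \<open>a\<close> at
  \<open>z\<close>.\<close>

lemma conormal_cone_approx:
 assumes j: "join z a \<in> conormal_cone Z" and e: "e > 0"
 shows "\<exists>\<rho>>0. \<forall>t\<in>Z. dist t z < \<rho> --> (\<exists>b. join t b \<in> conormal_cone Z \<and> dist (join t b) (join z a) < e)"
proof -
 obtain d where sm: "smooth_point Z z d" using j by (auto simp: join_conormal_cone)
 obtain U \<sigma> where \<sigma>: "local_retraction Z z U \<sigma>" using smooth_point_imp_retraction[OF sm] by blast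
 note \<sigma>D = local_retractionD[OF \<sigma>]
 have a0: "a v* jac \<sigma> z = 0" using j conormal_cone_retraction[OF \<sigma>] by simp
 define \<beta> where "\<beta> = (\<lambda>x. join x (a - a v* jac \<sigma> x))"
 have "holomorphic_map U \<beta>" unfolding \<beta>_def
  by (intro hol_intros \<sigma>D(2) holomorphic_map_jac_row[OF \<sigma>D(1)])
 then have "continuous_on U \<beta>" by (rule holomorphic_map_continuous_on)
 then obtain \<rho>1 where \<rho>1: "\<rho>1 > 0" "\<forall>x\<in>U. dist x z < \<rho>1 --> dist (\<beta> x) (\<beta> z) < e"
  using e \<sigma>D(3) unfolding continuous_on_iff by meson
 obtain \<rho>2 where \<rho>2: "\<rho>2 > 0" "ball z \<rho>2 \<subseteq> U" using open_ball_mult_imp[OF \<sigma>D(2,3)] by blast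
 have "\<exists>b. join t b \<in> conormal_cone Z \<and> dist (join t b) (join z a) < e" if t: "t \<in> Z" "dist t z < min \<rho>1 \<rho>2" for t
 proof -
  have "t \<in> ball z \<rho>2" using t(2) by (simp add: dist_commute)
  then have tU: "t \<in> U" using \<rho>2 by blast
  have r: "local_retraction Z t U \<sigma>" by (rule local_retraction_at[OF \<sigma> t(1) tU])
  have "join t (a - a v* jac \<sigma> t) \<in> conormal_cone Z"
   unfolding conormal_cone_retraction[OF r] by (rule vector_matrix_idempotent[OF local_retraction_idempotent[OF r]])
  moreover have "dist (join t (a - a v* jac \<sigma> t)) (join z a) < e"
   using \<rho>1 tU t(2) a0 by (auto simp: \<beta>_def)
  ultimately show ?thesis by blast
 qed
 then show ?thesis using \<rho>1 \<rho>2 by (intro exI[of _ "min \<rho>1 \<rho>2"]) auto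
qed

text \<open>The closure theorem is used at two levels: the cover of \<open>T\<close> at
  \<open>z0\<close> provides equations of the cone over generic points, and the cover of the set
  \<open>W\<close> defined by them at \<open>join z0 a0\<close> provides equations of the
  closure.\<close>

theorem conormal_closure_analytic:
 fixes T :: "(complex^'n) set"
 assumes \<Omega>: "open \<Omega>" and T: "T = {x\<in>\<Omega>. \<forall>f\<in>\<F>. f x = 0}" and F: "\<And>f. f \<in> \<F> ==> holomorphic_fun \<Omega> f"
  and pure: "pure_dim T d" and z0: "z0 \<in> T" and a0: "join z0 a0 \<in> closure (conormal_cone T)"
 shows "\<exists>Y \<G>. open Y \<and> join z0 a0 \<in> Y \<and> (\<forall>g\<in>\<G>. holomorphic_fun Y g) \<and>
  (\<forall>x\<in>Y. x \<in> closure (conormal_cone T) \<longleftrightarrow> (\<forall>g\<in>\<G>. g x = 0))"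
proof -
 have T1: "T = {x\<in>\<Omega>. (\<forall>f\<in>\<F>. f x = 0) \<and> (1::complex) ~= 0}" using T by simp
 have z0': "z0 \<in> \<Omega>" "z0 \<in> closure T" using z0 T subsetD[OF closure_subset z0] by blast+
 have "\<exists>\<L> V Q r \<epsilon>. analytic_cover T z0 \<L> V Q r \<epsilon> \<Omega> \<F> (\<lambda>_. 1) d \<and> trace \<L> = of_nat d"
  by (rule analytic_cover_exists[OF T1 F holomorphic_fun_const[OF \<Omega>] pure z0'])
 then obtain \<L> V Q r \<epsilon> where ac: "analytic_cover T z0 \<L> V Q r \<epsilon> \<Omega> \<F> (\<lambda>_. 1) d \<and> trace \<L> = of_nat d"
  by (elim exE)
 interpret Z: analytic_cover T z0 \<L> V Q r \<epsilon> \<Omega> \<F> "\<lambda>_. 1" d using ac by simp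
 obtain \<delta>' M where gc: "holomorphic_fun Z.base \<delta>' \<and> (\<forall>i. holomorphic_map Z.base (\<lambda>x. M x $ i)) \<and>
  (\<forall>t\<in>T \<inter> Z.polydisc \<inter> Z.base. \<delta>' t ~= 0 --> (\<exists>d. smooth_point T t d) \<and>
    (\<forall>a. join t a \<in> conormal_cone T \<longleftrightarrow> \<delta>' t *s a = a v* M t)) \<and>
  (\<forall>x\<in>closure T \<inter> Z.polydisc \<inter> Z.base. \<forall>e>0. \<exists>t\<in>T \<inter> Z.polydisc \<inter> Z.base. dist t x < e \<and> \<delta>' t ~= 0)"
  using Z.generic_conormal[OF conjunct2[OF ac]] by (elim exE)
 define U where "U = Z.polydisc \<inter> Z.base"
 have U: "open U" "z0 \<in> U" "U \<subseteq> \<Omega>" unfolding U_def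
  using Z.open_polydisc Z.open_base Z.p_polydisc Z.p_base Z.polydisc_Omega by auto
 have h\<delta>: "holomorphic_fun U \<delta>'" using holomorphic_fun_subset[OF conjunct1[OF gc] U(1)] by (simp add: U_def)
 have hM: "holomorphic_map U (\<lambda>x. M x $ i)" for i
 proof -
  have "holomorphic_map Z.base (\<lambda>x. M x $ i)" using gc by blast
  then show ?thesis by (rule holomorphic_map_subset[OF _ U(1)]) (auto simp: U_def)
 qed
 have cone: "join t a \<in> conormal_cone T \<longleftrightarrow> \<delta>' t *s a = a v* M t" "\<exists>d. smooth_point T t d"
  if "t \<in> T" "t \<in> U" "\<delta>' t ~= 0" for t a using gc that unfolding U_def by blast+
 have dense: "\<exists>t\<in>T \<inter> U. dist t x < e \<and> \<delta>' t ~= 0" if x: "x \<in> T" "x \<in> U" and e: "e > 0" for x e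
 proof -
  have "x \<in> closure T \<inter> Z.polydisc \<inter> Z.base" using x closure_subset by (auto simp: U_def)
  then have "\<exists>t\<in>T \<inter> Z.polydisc \<inter> Z.base. dist t x < e \<and> \<delta>' t ~= 0" using gc e by blast
  then show ?thesis by (auto simp: U_def)
 qed
 define \<Omega>' where "\<Omega>' = {x :: complex^('n + 'n). jfst x \<in> U}"
 have \<Omega>': "open \<Omega>'" unfolding \<Omega>'_def by (rule open_jfst_vimage[OF U(1)])
 have hj: "holomorphic_map \<Omega>' jfst" using holomorphic_map_jfst[OF holomorphic_map_id[OF \<Omega>']] .
 have js: "holomorphic_map \<Omega>' jsnd" using holomorphic_map_jsnd[OF holomorphic_map_id[OF \<Omega>']] .
 have comp: "holomorphic_fun \<Omega>' (\<lambda>x. f (jfst x))" if "holomorphic_fun U f" for f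
  by (rule holomorphic_fun_compose[OF hj that]) (simp add: \<Omega>'_def)
 have compM: "holomorphic_map \<Omega>' (\<lambda>x. M (jfst x) $ i)" for i
  by (rule holomorphic_map_compose[OF hj hM]) (simp add: \<Omega>'_def)
 \<comment> \<open>The equations of \<open>T\<close> pulled back to pairs, together with the
   equations for the covector, which are linear in it.\<close>
 define \<F>' where "\<F>' = (\<lambda>f x. f (jfst x)) ` \<F> \<union> range (\<lambda>i x. (\<delta>' (jfst x) *s jsnd x - jsnd x v* M (jfst x)) $ i)"
 have hF': "holomorphic_fun \<Omega>' f" if f: "f \<in> \<F>'" for f
 proof -
  have "holomorphic_fun \<Omega>' (\<lambda>x. f (jfst x))" if "f \<in> \<F>" for f
   by (rule comp[OF holomorphic_fun_subset[OF F[OF that] U(1,3)]])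
  moreover have "holomorphic_fun \<Omega>' (\<lambda>x. (\<delta>' (jfst x) *s jsnd x - jsnd x v* M (jfst x)) $ i)" for i
   by (intro holomorphic_fun_nth holomorphic_map_diff holomorphic_map_scale holomorphic_map_vector_matrix comp h\<delta> js compM \<Omega>')
  ultimately show ?thesis using f unfolding \<F>'_def by blast
 qed
 define W where "W = {x\<in>\<Omega>'. (\<forall>f\<in>\<F>'. f x = 0) \<and> \<delta>' (jfst x) ~= 0}"
 have W: "x \<in> W \<longleftrightarrow> x \<in> conormal_cone T \<and> x \<in> \<Omega>' \<and> \<delta>' (jfst x) ~= 0" for x
 proof -
  have zT: "jfst x \<in> T" if "x \<in> conormal_cone T"
   using that smooth_point_in by (auto simp: conormal_cone_iff)
  have "x \<in> W \<longleftrightarrow> jfst x \<in> T \<and> jfst x \<in> U \<and> \<delta>' (jfst x) ~= 0 \<and> \<delta>' (jfst x) *s jsnd x - jsnd x v* M (jfst x) = 0"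
   unfolding W_def \<F>'_def ball_Un ball_simps(9) mem_Collect_eq
   using U(3) by (auto simp: \<Omega>'_def T vec_eq_iff)
  also have "\<dots> \<longleftrightarrow> x \<in> conormal_cone T \<and> jfst x \<in> U \<and> \<delta>' (jfst x) ~= 0"
   using cone(1)[of "jfst x" "jsnd x"] zT by auto
  finally show ?thesis by (simp add: \<Omega>'_def)
 qed
 have Wsm: "smooth_point W x CARD('n)" if x: "x \<in> W" for x
 proof -
  have c: "join (jfst x) (jsnd x) \<in> conormal_cone T" using x W by simp
  then obtain m where "smooth_point T (jfst x) m" unfolding join_conormal_cone by blast
  from smooth_conormal_cone[OF this c] have "smooth_point (conormal_cone T) x CARD('n)" by simp
  moreover have "open {x\<in>\<Omega>'. \<delta>' (jfst x) ~= 0}" by (rule open_nonzero[OF comp[OF h\<delta>]])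
  ultimately show ?thesis
   by (rule smooth_point_local) (use x W in auto)
 qed
 have pureW: "pure_dim W CARD('n)" unfolding pure_dim_def using Wsm by force
 \<comment> \<open>Every conormal covector is a limit of conormal covectors at generic points, by
   \<open>dense\<close> and \<open>conormal_cone_approx\<close>, so removing the zeros of
   \<open>\<delta>'\<close> does not change the closure.\<close>
 have clos: "x \<in> closure W \<longleftrightarrow> x \<in> closure (conormal_cone T)" if x: "x \<in> \<Omega>'" for x
 proof
  have "W \<subseteq> conormal_cone T" using W by blast
  then show "x \<in> closure W ==> x \<in> closure (conormal_cone T)" using closure_mono by blast
  assume xc: "x \<in> closure (conormal_cone T)"
  have "x \<in> \<Omega>' \<inter> closure (conormal_cone T)" using x xc by simp
  then have "x \<in> closure (\<Omega>' \<inter> conormal_cone T)" using open_Int_closure_subset[OF \<Omega>'] by blast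
  moreover have "\<Omega>' \<inter> conormal_cone T \<subseteq> closure W"
  proof
   fix y assume y: "y \<in> \<Omega>' \<inter> conormal_cone T"
   then have j: "join (jfst y) (jsnd y) \<in> conormal_cone T" "jfst y \<in> U" by (simp_all add: \<Omega>'_def)
   have yT: "jfst y \<in> T" using y smooth_point_in by (auto simp: conormal_cone_iff)
   show "y \<in> closure W"
    unfolding closure_approachable
   proof (intro allI impI)
    fix e :: real assume "e > 0"
    from conormal_cone_approx[OF j(1) this]
    obtain \<rho> where \<rho>: "\<rho> > 0 \<and> (\<forall>t\<in>T. dist t (jfst y) < \<rho> -->
      (\<exists>b. join t b \<in> conormal_cone T \<and> dist (join t b) (join (jfst y) (jsnd y)) < e))" ..
    obtain t where t: "t \<in> T \<inter> U" "dist t (jfst y) < \<rho>" "\<delta>' t ~= 0" using dense[OF yT j(2)] \<rho> by blast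
    then obtain b where b: "join t b \<in> conormal_cone T" "dist (join t b) y < e" using \<rho> by auto
    have "join t b \<in> W" using W b(1) t by (simp add: \<Omega>'_def)
    then show "\<exists>w\<in>W. dist w y < e" using b(2) by blast
   qed
  qed
  ultimately show "x \<in> closure W" using closure_minimal[OF _ closed_closure] by (metis subsetD)
 qed
 have in\<Omega>': "join z0 a0 \<in> \<Omega>'" using U(2) by (simp add: \<Omega>'_def)
 then have aW: "join z0 a0 \<in> closure W" using clos a0 by blast
 have "\<exists>\<L> V Q r \<epsilon>. analytic_cover W (join z0 a0) \<L> V Q r \<epsilon> \<Omega>' \<F>' (\<lambda>x. \<delta>' (jfst x)) CARD('n) \<and> trace \<L> = of_nat CARD('n)"
  by (rule analytic_cover_exists[OF W_def hF' comp[OF h\<delta>] pureW in\<Omega>' aW])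
 then obtain \<L>2 V2 Q2 r2 \<epsilon>2 where ac2: "analytic_cover W (join z0 a0) \<L>2 V2 Q2 r2 \<epsilon>2 \<Omega>' \<F>' (\<lambda>x. \<delta>' (jfst x)) CARD('n)
   \<and> trace \<L>2 = of_nat CARD('n)" by (elim exE)
 interpret W: analytic_cover W "join z0 a0" \<L>2 V2 Q2 r2 \<epsilon>2 \<Omega>' \<F>' "\<lambda>x. \<delta>' (jfst x)" "CARD('n)" using ac2 by simp
 note tr2 = conjunct2[OF ac2]
 obtain h where h: "W.is_discr h" using W.discr_exists ..
 have "\<forall>l. \<exists>F. holomorphic_fun W.base F \<and> (\<forall>x\<in>W.base. h x ~= 0 --> F x = (\<Prod>y\<in>W.live x. scalar_product l (x - y)))"
  using W.difference_product(1)[OF tr2 h] by blast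
 from choice[OF this] obtain G where G: "\<forall>l. holomorphic_fun W.base (G l) \<and>
   (\<forall>x\<in>W.base. h x ~= 0 --> G l x = (\<Prod>y\<in>W.live x. scalar_product l (x - y)))" ..
 have hG: "holomorphic_fun W.base (G l)" for l using G by simp
 have Gp: "G l x = (\<Prod>y\<in>W.live x. scalar_product l (x - y))" if "x \<in> W.base" "h x ~= 0" for l x using G that by simp
 define Y where "Y = W.polydisc \<inter> W.base"
 have Y: "open Y" "join z0 a0 \<in> Y" "Y \<subseteq> \<Omega>'" unfolding Y_def
  using W.open_polydisc W.open_base W.p_polydisc W.p_base W.polydisc_Omega by auto
 show ?thesis
 proof (intro exI[of _ Y] exI[of _ "range G"] conjI ballI)
  show "holomorphic_fun Y g" if "g \<in> range G" for g
   using that holomorphic_fun_subset[OF hG Y(1)] by (auto simp: Y_def)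
  show "x \<in> closure (conormal_cone T) \<longleftrightarrow> (\<forall>g\<in>range G. g x = 0)" if x: "x \<in> Y" for x
  proof -
   have "x \<in> W.polydisc" "x \<in> W.base" using x by (auto simp: Y_def)
   from W.closure_zero_set[OF tr2 h hG Gp this]
   have "x \<in> closure W \<longleftrightarrow> (\<forall>l. G l x = 0)" .
   moreover have "x \<in> \<Omega>'" using x Y(3) by blast
   ultimately show ?thesis using clos by auto
  qed
 qed (use Y in auto)
qed

section \<open>Dimensions of cones and slices\<close>

text \<open>A set that is a cone along the range of \<open>E\<close> is, near a point with \<open>i\<close>-th coordinate 1, the
 product of its slice with a line; the scaling by \<open>s\<close> is \<open>y \<mapsto> y + (s - 1) *s (E *v y)\<close>.\<close>

locale partial_cone =
 fixes A :: "(complex^'k) set" and E :: "complex^'k^'k" and i :: 'k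
 assumes idem: "E ** E = E" and row: "\<And>y. (E *v y) $ i = y $ i"
  and cone: "\<And>y s. y \<in> A ==> s ~= 0 ==> y + (s - 1) *s (E *v y) \<in> A"
begin

definition scale :: "complex => complex^'k => complex^'k" where
 "scale s y = y + (s - 1) *s (E *v y)"

lemma EE: "E *v (E *v y) = E *v y" by (simp add: matrix_vector_mul_assoc idem)

lemma E_scale: "E *v scale s y = s *s (E *v y)"
proof -
 have "E *v scale s y = E *v y + (s - 1) *s (E *v y)"
  by (simp only: scale_def matrix_vector_right_distrib vector_scalar_commute EE)
 then show ?thesis by (simp add: vec_eq_iff algebra_simps)
qed

lemma scale_nth: "scale s y $ i = s * y $ i"
 by (simp add: scale_def row algebra_simps)

lemma scale_scale: "scale s (scale t y) = scale (s * t) y"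
 unfolding scale_def[of s "scale t y"] E_scale
 by (simp add: scale_def vec_eq_iff algebra_simps)

lemma scale_1 [simp]: "scale 1 y = y" by (simp add: scale_def)

lemma scale_in: "y \<in> A ==> s ~= 0 ==> scale s y \<in> A"
 using cone by (simp add: scale_def)

lemma holomorphic_scale [hol_intros]:
 "holomorphic_fun U f ==> holomorphic_map U g ==> holomorphic_map U (\<lambda>x. scale (f x) (g x))"
 unfolding scale_def by (intro hol_intros) (auto dest: holomorphic_fun_open)

lemma has_derivative_scale:
 assumes f: "(f has_derivative scalar_product a) (at x)" "f x = 1" and g: "(g has_derivative (*v) M) (at x)"
 shows "((\<lambda>x. scale (f x) (g x)) has_derivative (*v) (M + outer (E *v g x) a)) (at x)"
proof -
 have "((\<lambda>x. g x + (f x - 1) *s (E *v g x)) has_derivative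
   (\<lambda>v. M *v v + ((f x - 1) *s (E *v (M *v v)) + (scalar_product a v - 0) *s (E *v g x)))) (at x)"
  by (intro derivative_intros has_derivative_vector_scale f g bounded_linear.has_derivative[OF bounded_linear_matrix_vector])
 then show ?thesis unfolding scale_def
  by (rule has_derivative_eq_rhs) (auto simp: f(2) matrix_vector_mult_add_rdistrib)
qed

text \<open>Normalise the \<open>i\<close>-th coordinate to 1, retract within the slice, and scale
  back. The radial direction adds exactly one to the trace.\<close>

lemma smooth_slice_imp:
 assumes sm: "smooth_point {y\<in>A. y $ i = 1} x d"
 shows "smooth_point A x (Suc d)"
proof -
 obtain U \<sigma> where \<sigma>: "local_retraction {y\<in>A. y $ i = 1} x U \<sigma>" "trace (jac \<sigma> x) = of_nat d"
  using smooth_point_imp_retraction[OF sm] by blast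
 note \<sigma>D = local_retractionD[OF \<sigma>(1)]
 have x: "x \<in> A" "x $ i = 1" using \<sigma>D(4) by auto
 define P where "P = jac \<sigma> x"
 define U0 where "U0 = {y :: complex^'k. y $ i ~= 0}"
 have hi: "holomorphic_fun UNIV (\<lambda>y :: complex^'k. y $ i)" by (intro hol_intros open_UNIV)
 have U0: "open U0" using open_nonzero[OF hi] by (simp add: U0_def)
 have hi0: "holomorphic_fun U0 (\<lambda>y. y $ i)" by (rule holomorphic_fun_subset[OF hi U0]) simp
 define \<eta> where "\<eta> = (\<lambda>y. scale (inverse (y $ i)) y)"
 have h\<eta>: "holomorphic_map U0 \<eta>" unfolding \<eta>_def
  by (intro holomorphic_scale holomorphic_fun_inverse hi0 holomorphic_map_id U0) (simp add: U0_def)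
 define U1 where "U1 = {y\<in>U0. \<eta> y \<in> U}"
 have U1: "open U1" unfolding U1_def by (rule holomorphic_map_vimage_open[OF h\<eta> \<sigma>D(2)])
 have \<eta>x: "\<eta> x = x" by (simp add: \<eta>_def x(2))
 have xU1: "x \<in> U1" using x \<sigma>D(3) \<eta>x by (simp add: U1_def U0_def)
 define \<Sigma> where "\<Sigma> = (\<lambda>y. scale (y $ i) (\<sigma> (\<eta> y)))"
 have h1: "holomorphic_map U1 (\<lambda>y. \<sigma> (\<eta> y))"
  by (rule holomorphic_map_compose[OF holomorphic_map_subset[OF h\<eta> U1] \<sigma>D(1)]) (auto simp: U1_def)
 have h\<Sigma>: "holomorphic_map U1 \<Sigma>" unfolding \<Sigma>_def
  by (intro holomorphic_scale h1 holomorphic_fun_subset[OF hi0 U1]) (auto simp: U1_def)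
 have D1: "((\<lambda>y. y $ i) has_derivative scalar_product (axis i 1)) (at x)"
  by (rule has_derivative_eq_rhs[OF bounded_linear.has_derivative[OF bounded_linear_vec_nth has_derivative_ident]]) auto
 have D2: "((\<lambda>y. inverse (y $ i)) has_derivative scalar_product (- axis i 1)) (at x)"
  by (rule has_derivative_eq_rhs[OF Deriv.has_derivative_inverse[OF _ D1]]) (auto simp: x scalar_product_minus_left)
 have Id: "((\<lambda>y. y) has_derivative (*v) (mat 1)) (at x)" by (rule has_derivative_eq_rhs[OF has_derivative_ident]) auto
 have D\<eta>: "(\<eta> has_derivative (*v) (mat 1 + outer (E *v x) (- axis i 1))) (at x)"
  unfolding \<eta>_def by (rule has_derivative_scale[OF D2 _ Id]) (simp add: x)
 have D\<sigma>\<eta>: "((\<lambda>y. \<sigma> (\<eta> y)) has_derivative (*v) (P ** (mat 1 + outer (E *v x) (- axis i 1)))) (at x)"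
  unfolding P_def by (rule has_derivative_compose_matrix[OF D\<eta>]) (simp add: \<eta>x \<sigma>D(8))
 define J where "J = P ** (mat 1 + outer (E *v x) (- axis i 1)) + outer (E *v x) (axis i 1)"
 have D: "(\<Sigma> has_derivative (*v) J) (at x)"
  using has_derivative_scale[OF D1 x(2) D\<sigma>\<eta>] unfolding \<Sigma>_def J_def by (simp add: \<eta>x \<sigma>D(7))
 \<comment> \<open>The retraction has values in the slice, so its \<open>i\<close>-th coordinate is
   constant and the corresponding row of the derivative is zero.\<close>
 have Pi: "(P *v v) $ i = 0" for v
 proof -
  have c: "((\<lambda>y. 1) has_derivative scalar_product (P $ i)) (at x)"
   unfolding P_def
  proof (rule has_derivative_transform_within_open[OF _ \<sigma>D(2,3)])
   show "((\<lambda>y. \<sigma> y $ i) has_derivative scalar_product (jac \<sigma> x $ i)) (at x)"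
    using \<sigma>D(8) unfolding has_derivative_matrix_iff by blast
   show "\<sigma> y $ i = 1" if "y \<in> U" for y using \<sigma>D(5)[OF that] by simp
  qed
  have "((\<lambda>y. 1 :: complex) has_derivative (\<lambda>v. 0)) (at x)" by (rule has_derivative_const)
  from has_derivative_unique[OF c this] have "scalar_product (P $ i) v = 0" by (rule fun_cong)
  then show ?thesis by (simp add: matrix_vector_nth)
 qed
 have "J = P + outer (P *v (E *v x)) (- axis i 1) + outer (E *v x) (axis i 1)"
 proof (rule matrix_eqI)
  fix v
  have "J *v v = P *v (v + scalar_product (- axis i 1) v *s (E *v x)) + scalar_product (axis i 1) v *s (E *v x)"
   by (simp add: J_def matrix_vector_mult_add_rdistrib matrix_vector_mul_assoc[symmetric])
  also have "\<dots> = (P + outer (P *v (E *v x)) (- axis i 1) + outer (E *v x) (axis i 1)) *v v"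
   by (simp add: matrix_vector_mult_add_rdistrib matrix_vector_right_distrib vector_scalar_commute)
  finally show "J *v v = (P + outer (P *v (E *v x)) (- axis i 1) + outer (E *v x) (axis i 1)) *v v" .
 qed
 then have "trace J = trace P + scalar_product (- axis i 1) (P *v (E *v x)) + scalar_product (axis i 1) (E *v x)"
  by (simp only: trace_add trace_outer)
 also have "\<dots> = of_nat (Suc d)" using \<sigma>(2) by (simp add: P_def[symmetric] scalar_product_minus_left Pi row x)
 finally have tr: "trace J = of_nat (Suc d)" .
 show ?thesis
 proof (rule smooth_pointI_retraction[OF h\<Sigma> xU1 x(1) _ _ D tr])
  show "\<Sigma> y \<in> A" if "y \<in> U1" for y
   unfolding \<Sigma>_def using that \<sigma>D(5) by (intro scale_in) (auto simp: U1_def U0_def)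
  show "\<Sigma> y = y" if y: "y \<in> A" "y \<in> U1" for y
  proof -
   have y0: "y $ i ~= 0" "\<eta> y \<in> U" using y(2) by (auto simp: U1_def U0_def)
   then have "\<eta> y \<in> {y\<in>A. y $ i = 1}" using y(1) scale_in by (simp add: \<eta>_def scale_nth)
   then have "\<sigma> (\<eta> y) = \<eta> y" using \<sigma>D(6) y0(2) by blast
   then show ?thesis using y0(1) by (simp add: \<Sigma>_def \<eta>_def scale_scale)
  qed
 qed
qed

text \<open>Retract onto the cone and rescale the result into the slice. The rescaling lowers the
  trace by the \<open>i\<close>-th coordinate of \<open>P *v (E *v x)\<close>, which is 1.\<close>

lemma smooth_imp_slice:
 assumes sm: "smooth_point A x m" and x1: "x $ i = 1"
 shows "\<exists>d. m = Suc d \<and> smooth_point {y\<in>A. y $ i = 1} x d"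
proof -
 obtain U \<sigma> where \<sigma>: "local_retraction A x U \<sigma>" "trace (jac \<sigma> x) = of_nat m"
  using smooth_point_imp_retraction[OF sm] by blast
 note \<sigma>D = local_retractionD[OF \<sigma>(1)]
 define P where "P = jac \<sigma> x"
 define U1 where "U1 = {y\<in>U. \<sigma> y $ i ~= 0}"
 have hs: "holomorphic_fun U (\<lambda>y. \<sigma> y $ i)" by (intro hol_intros \<sigma>D(1))
 have U1: "open U1" unfolding U1_def by (rule open_nonzero[OF hs])
 have xU1: "x \<in> U1" using \<sigma>D(3,7) x1 by (simp add: U1_def)
 have h1: "holomorphic_map U1 \<sigma>" by (rule holomorphic_map_subset[OF \<sigma>D(1) U1]) (auto simp: U1_def)
 have h2: "holomorphic_fun U1 (\<lambda>y. \<sigma> y $ i)" by (intro hol_intros h1)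
 define \<rho> where "\<rho> = (\<lambda>y. scale (inverse (\<sigma> y $ i)) (\<sigma> y))"
 have h\<rho>: "holomorphic_map U1 \<rho>" unfolding \<rho>_def
  by (intro holomorphic_scale holomorphic_fun_inverse h1 h2) (simp add: U1_def)
 have D1: "((\<lambda>y. \<sigma> y $ i) has_derivative scalar_product (P $ i)) (at x)"
  using \<sigma>D(8) unfolding has_derivative_matrix_iff P_def by blast
 have \<sigma>x: "\<sigma> x $ i = 1" using \<sigma>D(7) x1 by simp
 have D2: "((\<lambda>y. inverse (\<sigma> y $ i)) has_derivative scalar_product (- (P $ i))) (at x)"
  by (rule has_derivative_eq_rhs[OF Deriv.has_derivative_inverse[OF _ D1]]) (auto simp: \<sigma>x scalar_product_minus_left)
 have D: "(\<rho> has_derivative (*v) (P + outer (E *v x) (- (P $ i)))) (at x)"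
  using has_derivative_scale[OF D2 _ \<sigma>D(8)] \<sigma>D(7) x1 by (simp add: \<rho>_def \<sigma>x P_def)
 \<comment> \<open>The line from \<open>x\<close> in direction \<open>E *v x\<close> lies in the
   cone near \<open>x\<close>, so the retraction fixes it and the derivative fixes its
   direction.\<close>
 have PE: "P *v (E *v x) = E *v x"
 proof -
  have "scalar_product (P $ j) (E *v x) = (E *v x) $ j" for j
  proof -
   have c0: "((\<lambda>y. \<sigma> y $ j) has_derivative scalar_product (P $ j)) (at (x + 0 *s (E *v x)))"
    using \<sigma>D(8) unfolding has_derivative_matrix_iff P_def by simp
   have c: "((\<lambda>t. \<sigma> (x + t *s (E *v x)) $ j) has_field_derivative scalar_product (P $ j) (E *v x)) (at 0)"
    by (rule has_field_derivative_line[OF c0])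
   define N where "N = {t. x + t *s (E *v x) \<in> U} - {-1}"
   have N: "open N" "0 \<in> N" unfolding N_def
    using open_line_preimage[OF \<sigma>D(2), of x "E *v x"] \<sigma>D(3) by (auto intro: open_Diff)
   have "((\<lambda>t. (x + t *s (E *v x)) $ j) has_field_derivative scalar_product (P $ j) (E *v x)) (at 0)"
   proof (rule has_field_derivative_transform_within_open[OF c N])
    fix t assume t: "t \<in> N"
    have "x + ((1 + t) - 1) *s (E *v x) \<in> A"
     by (rule cone[OF \<sigma>D(4)]) (use t in \<open>auto simp: N_def add_eq_0_iff\<close>)
    then have "\<sigma> (x + t *s (E *v x)) = x + t *s (E *v x)" using t \<sigma>D(6) by (simp add: N_def)
    then show "\<sigma> (x + t *s (E *v x)) $ j = (x + t *s (E *v x)) $ j" by simp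
   qed
   moreover have "((\<lambda>t. (x + t *s (E *v x)) $ j) has_field_derivative (E *v x) $ j) (at 0)"
    by (auto intro!: derivative_eq_intros)
   ultimately show ?thesis by (rule DERIV_unique)
  qed
  then show ?thesis by (simp add: vec_eq_iff matrix_vector_nth)
 qed
 have tr: "trace (P + outer (E *v x) (- (P $ i))) = of_nat m - 1"
 proof -
  have "trace (P + outer (E *v x) (- (P $ i))) = of_nat m + scalar_product (- (P $ i)) (E *v x)"
   unfolding trace_add trace_outer using \<sigma>(2) by (simp add: P_def)
  also have "scalar_product (- (P $ i)) (E *v x) = - ((P *v (E *v x)) $ i)"
   by (simp add: scalar_product_minus_left matrix_vector_nth)
  also have "\<dots> = - 1" unfolding PE row x1 ..
  finally show ?thesis by simp
 qed
 have "\<exists>d. smooth_point {y\<in>A. y $ i = 1} x d \<and> trace (P + outer (E *v x) (- (P $ i))) = of_nat d"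
 proof (rule smooth_pointI_retraction'[OF h\<rho> xU1 _ _ _ D])
  show "x \<in> {y\<in>A. y $ i = 1}" using \<sigma>D(4) x1 by simp
  show "\<rho> y \<in> {y\<in>A. y $ i = 1}" if "y \<in> U1" for y
   using that \<sigma>D(5) by (auto simp: U1_def \<rho>_def scale_nth intro!: scale_in)
  show "\<rho> y = y" if "y \<in> {y\<in>A. y $ i = 1}" "y \<in> U1" for y
   using that \<sigma>D(6) by (auto simp: U1_def \<rho>_def)
 qed
 then obtain d where d: "smooth_point {y\<in>A. y $ i = 1} x d" "of_nat m - 1 = (of_nat d :: complex)" using tr by auto
 then have "of_nat m = (of_nat (Suc d) :: complex)" by (simp add: algebra_simps)
 then have "m = Suc d" by (simp only: of_nat_eq_iff)
 then show ?thesis using d(1) by blast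
qed

end

section \<open>Cones over subsets of the product with the dual projective space\<close>

definition snd_projection :: "complex^('n::finite + 'n)^('n + 'n)" where
 "snd_projection = (\<chi> k l. if k = l then (case k of Inl _ => 0 | Inr _ => 1) else 0)"

lemma snd_projection_mult: "snd_projection *v x = join 0 (jsnd x)"
proof -
 have "(snd_projection *v x) $ k = (case k of Inl _ => 0 | Inr _ => 1) * x $ k" for k
  unfolding snd_projection_def matrix_vector_mult_def vec_lambda_beta
  by (simp add: if_distrib[of "\<lambda>c. c * _"] cong: if_cong)
 then show ?thesis by (simp add: vec_eq_sum_iff)
qed

text \<open>All affine charts are collected in one cone with the zero covector removed; the chart
  \<open>i\<close> is its slice at height 1, and dimensions differ by one.\<close>

definition cone_over :: "((complex^'n) \<times> 'n hyperplane) set => (complex^('n + 'n)) set" where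
 "cone_over X = {join z a | z a. a ~= 0 \<and> (z, hyp a) \<in> X}"

lemma cone_over_iff: "x \<in> cone_over X \<longleftrightarrow> jsnd x ~= 0 \<and> (jfst x, hyp (jsnd x)) \<in> X"
proof
 assume "jsnd x ~= 0 \<and> (jfst x, hyp (jsnd x)) \<in> X"
 then have "join (jfst x) (jsnd x) \<in> cone_over X" unfolding cone_over_def by blast
 then show "x \<in> cone_over X" by simp
qed (auto simp: cone_over_def)

lemma hyp_scale: "s ~= 0 ==> hyp (s *s a) = hyp a"
 by (simp add: hyp_def scalar_product_scale_left)

lemma hyp_eqD:
 assumes a: "a ~= 0" and b: "b ~= 0" and eq: "hyp a = hyp b"
 shows "\<exists>s. s ~= 0 \<and> b = s *s a"
proof -
 have ker: "scalar_product a v = 0 \<longleftrightarrow> scalar_product b v = 0" for v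
  using points_of_hyp[OF a] points_of_hyp[OF b] eq by auto
 obtain i where i: "a $ i ~= 0" using a by (auto simp: vec_eq_iff)
 have bj: "b $ j = b $ i * a $ j / a $ i" for j
 proof -
  have "scalar_product a (axis j 1 - (a $ j / a $ i) *s axis i 1) = 0"
   using i by (simp add: scalar_product_diff_right scalar_product_scale_right)
  then have "scalar_product b (axis j 1 - (a $ j / a $ i) *s axis i 1) = 0" using ker by blast
  then show ?thesis by (simp add: scalar_product_diff_right scalar_product_scale_right mult.commute)
 qed
 have "b $ j = ((b $ i / a $ i) *s a) $ j" for j by (subst bj) simp
 then have "b = (b $ i / a $ i) *s a" unfolding vec_eq_iff by blast
 moreover have "b $ i / a $ i ~= 0" using b calculation by (metis vector_smult_lzero)
 ultimately show ?thesis by blast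
qed

lemma partial_cone_over:
 fixes X :: "((complex^'n) \<times> 'n hyperplane) set"
 shows "partial_cone (cone_over X) snd_projection (Inr i)"
proof
 show "snd_projection ** snd_projection = (snd_projection :: complex^('n + 'n)^('n + 'n))"
  by (rule matrix_eqI) (simp add: matrix_vector_mul_assoc[symmetric] snd_projection_mult)
 show "(snd_projection *v y) $ Inr i = y $ Inr i" for y :: "complex^('n + 'n)" by (simp add: snd_projection_mult)
 fix y :: "complex^('n + 'n)" and s :: complex assume y: "y \<in> cone_over X" and s: "s ~= 0"
 have "y + (s - 1) *s (snd_projection *v y) = join (jfst y) (s *s jsnd y)"
  by (simp add: snd_projection_mult vec_eq_sum_iff algebra_simps)
 then show "y + (s - 1) *s (snd_projection *v y) \<in> cone_over X"
  using y s by (simp add: cone_over_iff hyp_scale)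
qed

lemma (in partial_cone) smooth_scale:
 assumes sm: "smooth_point A x m" and s: "s ~= 0"
 shows "smooth_point A (scale s x) m"
proof (rule smooth_point_transfer[OF sm])
 show "holomorphic_map UNIV (scale s)" "holomorphic_map UNIV (scale (inverse s))"
  by (intro hol_intros open_UNIV)+
qed (use s in \<open>auto simp: scale_scale intro: scale_in\<close>)

lemma chart_image_slice: "chart_image i X = {x \<in> cone_over X. x $ Inr i = 1}"
proof (intro equalityI subsetI)
 fix x assume "x \<in> chart_image i X"
 then obtain z a where x: "x = join z a" "a $ i = 1" "(z, hyp a) \<in> X" unfolding chart_image_def by blast
 then have "a ~= 0" by auto
 then show "x \<in> {x \<in> cone_over X. x $ Inr i = 1}" using x by (simp add: cone_over_iff)
next
 fix x assume "x \<in> {x \<in> cone_over X. x $ Inr i = 1}"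
 then have "jsnd x $ i = 1" "(jfst x, hyp (jsnd x)) \<in> X" by (simp_all add: cone_over_iff)
 then have "join (jfst x) (jsnd x) \<in> chart_image i X" unfolding chart_image_def by blast
 then show "x \<in> chart_image i X" by simp
qed

lemma smooth_cone_over_slice:
 assumes sm: "smooth_point (cone_over X) x m"
 shows "\<exists>d p. m = Suc d \<and> smooth_point_proj X p d"
proof -
 have x: "x \<in> cone_over X" by (rule smooth_point_in[OF sm])
 then obtain i where i: "jsnd x $ i ~= 0" by (auto simp: cone_over_iff vec_eq_iff)
 interpret partial_cone "cone_over X" snd_projection "Inr i" by (rule partial_cone_over)
 define y where "y = scale (inverse (x $ Inr i)) x"
 have y1: "y $ Inr i = 1" using i by (simp add: y_def scale_nth)
 have "smooth_point (cone_over X) y m" unfolding y_def using i by (intro smooth_scale[OF sm]) simp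
 from smooth_imp_slice[OF this y1]
 obtain d where d: "m = Suc d" "smooth_point (chart_image i X) (join (jfst y) (jsnd y)) d"
  unfolding chart_image_slice by auto
 then have "smooth_point_proj X (jfst y, hyp (jsnd y)) d"
  unfolding smooth_point_proj_def using y1 by (intro exI conjI) (auto)
 then show ?thesis using d by blast
qed

lemma dim_proj_cone_over: "dim_proj X = Sup {d. \<exists>x. smooth_point (cone_over X) x (Suc d)}"
proof -
 have "(\<exists>p. smooth_point_proj X p d) \<longleftrightarrow> (\<exists>x. smooth_point (cone_over X) x (Suc d))" for d
 proof
  assume "\<exists>p. smooth_point_proj X p d"
  then obtain z a i where "a $ i = 1" "smooth_point (chart_image i X) (join z a) d"
   unfolding smooth_point_proj_def by blast
  then have "smooth_point {x \<in> cone_over X. x $ Inr i = 1} (join z a) d" by (simp add: chart_image_slice)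
  from partial_cone.smooth_slice_imp[OF partial_cone_over this]
  show "\<exists>x. smooth_point (cone_over X) x (Suc d)" ..
 next
  assume "\<exists>x. smooth_point (cone_over X) x (Suc d)"
  then show "\<exists>p. smooth_point_proj X p d" using smooth_cone_over_slice by blast
 qed
 then show ?thesis by (simp add: dim_proj_def)
qed

text \<open>Passing from nonzero covectors to hyperplanes is continuous and open, and the conormal
  cone is invariant under scaling; hence closures upstairs and downstairs correspond.\<close>

lemma closure_conormal:
 fixes Z :: "(complex^'n) set"
 assumes a: "a ~= 0"
 shows "(z, hyp a) \<in> closure {(z, H). (\<exists>d. smooth_point Z z d) \<and> tangent_space Z z \<subseteq> points_of H} \<longleftrightarrow>
  join z a \<in> closure (conormal_cone Z)" (is "_ \<in> closure ?N \<longleftrightarrow> _")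
proof -
 have N: "(w, hyp b) \<in> ?N \<longleftrightarrow> join w b \<in> conormal_cone Z" if "b ~= 0" for w b
  using points_of_hyp[OF that] by (auto simp: join_conormal_cone)
 show ?thesis
 proof
  assume L: "(z, hyp a) \<in> closure ?N"
  show "join z a \<in> closure (conormal_cone Z)"
  proof (rule ccontr)
   assume "join z a \<notin> closure (conormal_cone Z)"
   then have in1: "(z, a) \<in> {x. join (fst x) (snd x) \<in> - closure (conormal_cone Z)}" by simp
   have "continuous_on UNIV (\<lambda>x :: (complex^'n) \<times> (complex^'n). join (fst x) (snd x))"
    unfolding continuous_on_def by (intro ballI tendsto_intros)
   from open_vimage[OF _ this, of "- closure (conormal_cone Z)"]
   have "open {x. join (fst x) (snd x) \<in> - closure (conormal_cone Z)}" by (simp add: vimage_def open_Compl)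
   then obtain A B where AB0: "open A" "open B" "(z, a) \<in> A \<times> B" "A \<times> B \<subseteq> {x. join (fst x) (snd x) \<in> - closure (conormal_cone Z)}"
    using in1 by (rule open_prod_elim)
   have AB: "open A" "open B" "z \<in> A" "a \<in> B" using AB0 by auto
   have AB5: "join w b \<notin> closure (conormal_cone Z)" if "w \<in> A" "b \<in> B" for w b
    using subsetD[OF AB0(4), of "(w, b)"] that by simp
   \<comment> \<open>The image of a neighbourhood of \<open>a\<close> is open in the quotient
     because its preimage is the union of all nonzero rescalings of \<open>B - {0}\<close>.\<close>
   define H where "H = hyp ` (B - {0})"
   have "open H"
    unfolding open_hyperplane_def
   proof -
    have "{c. c ~= 0 \<and> hyp c \<in> H} = (\<Union>s\<in>-{0}. (\<lambda>c. s *s c) -` (B - {0}))"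
    proof (intro equalityI subsetI)
     fix c assume "c \<in> {c. c ~= 0 \<and> hyp c \<in> H}"
     then obtain b where b: "c ~= 0" "b \<in> B" "b ~= 0" "hyp c = hyp b" by (auto simp: H_def)
     then obtain s where "s ~= 0" "b = s *s c" using hyp_eqD by blast
     then show "c \<in> (\<Union>s\<in>-{0}. (\<lambda>c. s *s c) -` (B - {0}))" using b by auto
    next
     fix c assume "c \<in> (\<Union>s\<in>-{0}. (\<lambda>c. s *s c) -` (B - {0}))"
     then obtain s where s: "s ~= 0" "s *s c \<in> B - {0}" by auto
     then have "c ~= 0" by auto
     moreover have "hyp c \<in> H" unfolding H_def using s hyp_scale[OF s(1), of c] by (metis imageI)
     ultimately show "c \<in> {c. c ~= 0 \<and> hyp c \<in> H}" by simp
    qed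
    moreover have "open ((\<lambda>c :: complex^'n. s *s c) -` (B - {0}))" for s
     by (rule open_vimage) (intro open_Diff AB closed_singleton continuous_intros)+
    ultimately show "open {c. c ~= 0 \<and> hyp c \<in> H}" by auto
   qed
   then have o: "open (A \<times> H)" using AB(1) by (rule open_Times[rotated])
   have "(z, hyp a) \<in> A \<times> H" using AB a by (auto simp: H_def)
   then have "A \<times> H \<inter> ?N ~= {}" using L open_Int_closure_eq_empty[OF o, of ?N] by blast
   then obtain w b where "w \<in> A" "b \<in> B" "b ~= 0" "(w, hyp b) \<in> ?N" by (auto simp: H_def)
   then have "join w b \<in> conormal_cone Z" using N by blast
   then show False using AB5[OF \<open>w \<in> A\<close> \<open>b \<in> B\<close>] subsetD[OF closure_subset] by blast
  qed
 next
  assume L: "join z a \<in> closure (conormal_cone Z)"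
  show "(z, hyp a) \<in> closure ?N"
  proof (rule ccontr)
   assume "(z, hyp a) \<notin> closure ?N"
   then have "(z, hyp a) \<in> - closure ?N" "open (- closure ?N)" by auto
   from this(2,1) obtain A B where AB0: "open A" "open B" "(z, hyp a) \<in> A \<times> B" "A \<times> B \<subseteq> - closure ?N"
    by (rule open_prod_elim)
   have AB: "open A" "open B" "z \<in> A" "hyp a \<in> B" "A \<times> B \<subseteq> - closure ?N" using AB0 by auto
   define C where "C = {x :: complex^('n + 'n). jfst x \<in> A} \<inter> jsnd -` {b. b ~= 0 \<and> hyp b \<in> B}"
   have oB: "open {b. b ~= 0 \<and> hyp b \<in> B}" using AB(2) by (simp add: open_hyperplane_def)
   have cj: "continuous_on UNIV (jsnd :: complex^('n + 'n) => complex^'n)" by (rule continuous_on_jsnd[OF continuous_on_id])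
   have o: "open C" unfolding C_def
    by (rule open_Int[OF open_jfst_vimage[OF AB(1)] open_vimage[OF oB cj]])
   have "join z a \<in> C" using AB a by (simp add: C_def)
   then have "C \<inter> conormal_cone Z ~= {}" using L open_Int_closure_eq_empty[OF o, of "conormal_cone Z"] by blast
   then obtain x where x: "x \<in> C" "x \<in> conormal_cone Z" by blast
   then have "(jfst x, hyp (jsnd x)) \<in> ?N" using N[of "jsnd x" "jfst x"] by (simp add: C_def)
   then have "(jfst x, hyp (jsnd x)) \<in> closure ?N" by (rule subsetD[OF closure_subset])
   moreover have "(jfst x, hyp (jsnd x)) \<in> A \<times> B" using x(1) by (simp add: C_def)
   ultimately show False using AB(5) by blast
  qed
 qed
qed

lemma cone_over_conormal_space:
 "x \<in> cone_over (conormal_space Z) \<longleftrightarrow> x \<in> closure (conormal_cone Z) \<and> jsnd x ~= 0 \<and> jfst x \<in> Z"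
 unfolding cone_over_iff conormal_space_def using closure_conormal[of "jsnd x" "jfst x" Z] by auto

lemma cone_over_conormal_fibre:
 "z \<in> Z ==> x \<in> cone_over (conormal_fibre Z z) \<longleftrightarrow> x \<in> closure (conormal_cone Z) \<and> jsnd x ~= 0 \<and> jfst x = z"
 using cone_over_conormal_space[of x Z] unfolding cone_over_iff conormal_fibre_def by auto

text \<open>Over smooth points the cone is the zero set of the continuous map \<open>G\<close>, so
  the closure adds nothing there.\<close>

lemma closure_conormal_smooth:
 assumes x: "x \<in> closure (conormal_cone Z)" and sm: "smooth_point Z (jfst x) d"
 shows "x \<in> conormal_cone Z"
proof -
 obtain U \<sigma> where \<sigma>: "local_retraction Z (jfst x) U \<sigma>" using smooth_point_imp_retraction[OF sm] by blast
 note \<sigma>D = local_retractionD[OF \<sigma>]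
 define \<Omega> where "\<Omega> = {x :: complex^('a + 'a). jfst x \<in> U}"
 have \<Omega>: "open \<Omega>" unfolding \<Omega>_def by (rule open_jfst_vimage[OF \<sigma>D(2)])
 define G where "G = (\<lambda>x :: complex^('a + 'a). jsnd x v* jac \<sigma> (jfst x))"
 have row: "holomorphic_map \<Omega> (\<lambda>x. jac \<sigma> (jfst x) $ i)" for i
  by (rule holomorphic_map_compose[OF holomorphic_map_jfst[OF holomorphic_map_id[OF \<Omega>]] holomorphic_map_jac_row[OF \<sigma>D(1)]])
    (simp add: \<Omega>_def)
 have hG: "holomorphic_map \<Omega> G" unfolding G_def by (intro hol_intros row \<Omega>)
 have "G x = 0"
 proof (rule ccontr)
  assume "G x ~= 0"
  then have "x \<in> {x\<in>\<Omega>. G x \<in> - {0}}" using \<sigma>D(3) by (simp add: \<Omega>_def)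
  moreover have o: "open {x\<in>\<Omega>. G x \<in> - {0}}" by (rule holomorphic_map_vimage_open[OF hG]) (simp add: open_Compl)
  ultimately obtain y where y: "y \<in> conormal_cone Z" "y \<in> \<Omega>" "G y ~= 0"
   using x open_Int_closure_eq_empty[OF o, of "conormal_cone Z"] by blast
  have "jfst y \<in> Z" using y(1) smooth_point_in by (auto simp: conormal_cone_iff)
  then have r: "local_retraction Z (jfst y) U \<sigma>" using local_retraction_at[OF \<sigma>] y(2) by (simp add: \<Omega>_def)
  show False using conormal_cone_retraction[OF r, of "jsnd y"] y(1,3) by (simp add: G_def)
 qed
 then show ?thesis using conormal_cone_retraction[OF \<sigma>, of "jsnd x"] by (simp add: G_def)
qed

lemma open_jsnd_nonzero: "open {x :: complex^('n::finite + 'm::finite). jsnd x ~= 0}"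
proof -
 have "open (jsnd -` (- {0}) :: (complex^('n + 'm)) set)"
  by (rule open_vimage) (auto intro!: continuous_intros)
 then show ?thesis by (simp add: vimage_def)
qed

lemma smooth_conormal_space:
 fixes Z :: "(complex^'n) set"
 assumes y: "y \<in> conormal_cone Z" "jsnd y ~= 0"
 shows "smooth_point (cone_over (conormal_space Z)) y CARD('n)"
proof -
 obtain d where sm: "smooth_point Z (jfst y) d" using y by (auto simp: conormal_cone_iff)
 obtain U where U: "open U" "jfst y \<in> U" "\<And>q. q \<in> Z ==> q \<in> U ==> smooth_point Z q d"
  using smooth_point_nearby[OF sm] by metis
 define N where "N = {x :: complex^('n + 'n). jfst x \<in> U} \<inter> {x. jsnd x ~= 0}"
 have N: "open N" "y \<in> N" unfolding N_def
  using open_jfst_vimage[OF U(1)] open_jsnd_nonzero U(2) y(2) by auto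
 have "join (jfst y) (jsnd y) \<in> conormal_cone Z" using y by simp
 from smooth_conormal_cone[OF sm this] have "smooth_point (conormal_cone Z) y CARD('n)" by simp
 then show ?thesis
 proof (rule smooth_point_local[OF _ N])
  have "x \<in> conormal_cone Z \<longleftrightarrow> x \<in> cone_over (conormal_space Z)" if x: "x \<in> N" for x
  proof
   assume c: "x \<in> conormal_cone Z"
   then have "jfst x \<in> Z" using smooth_point_in by (auto simp: conormal_cone_iff)
   moreover have "x \<in> closure (conormal_cone Z)" using c closure_subset by (rule rev_subsetD)
   ultimately show "x \<in> cone_over (conormal_space Z)"
    using x unfolding cone_over_conormal_space N_def by blast
  next
   assume "x \<in> cone_over (conormal_space Z)"
   then show "x \<in> conormal_cone Z"
    using x U(3) closure_conormal_smooth unfolding cone_over_conormal_space N_def by blast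
  qed
  then show "conormal_cone Z \<inter> N = cone_over (conormal_space Z) \<inter> N" by blast
 qed
qed

text \<open>Near any smooth point of the closed cone there are points of the conormal bundle, where
  the dimension is \<open>CARD('n)\<close>; dimension is locally constant along smooth
  points.\<close>

lemma dim_conormal_space:
 fixes Z :: "(complex^'n) set"
 assumes "y \<in> conormal_cone Z" "jsnd y ~= 0"
 shows "dim_proj (conormal_space Z) = CARD('n) - 1"
proof -
 have eq: "m = CARD('n)" if sm: "smooth_point (cone_over (conormal_space Z)) x m" for x m
 proof -
  obtain U where U: "open U" "x \<in> U" "\<And>q. q \<in> cone_over (conormal_space Z) ==> q \<in> U ==>
    smooth_point (cone_over (conormal_space Z)) q m"
   using smooth_point_nearby[OF sm] by metis
  have x: "x \<in> closure (conormal_cone Z)" "jsnd x ~= 0" using smooth_point_in[OF sm] by (auto simp: cone_over_conormal_space)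
  have o: "open (U \<inter> {x. jsnd x ~= 0})" using U(1) open_jsnd_nonzero by (rule open_Int)
  have "x \<in> U \<inter> {x. jsnd x ~= 0}" using U x by simp
  then obtain y where y: "y \<in> conormal_cone Z" "y \<in> U" "jsnd y ~= 0"
   using x(1) open_Int_closure_eq_empty[OF o, of "conormal_cone Z"] by blast
  have s: "smooth_point (cone_over (conormal_space Z)) y CARD('n)" by (rule smooth_conormal_space[OF y(1,3)])
  show ?thesis using smooth_point_unique[OF U(3)[OF smooth_point_in[OF s] y(2)] s] .
 qed
 have "{d. \<exists>x. smooth_point (cone_over (conormal_space Z)) x (Suc d)} = {CARD('n) - 1}"
 proof (intro equalityI subsetI)
  fix d assume "d \<in> {d. \<exists>x. smooth_point (cone_over (conormal_space Z)) x (Suc d)}"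
  then have "Suc d = CARD('n)" using eq by blast
  then have "d = CARD('n) - 1" by (metis diff_Suc_1)
  then show "d \<in> {CARD('n) - 1}" by simp
 next
  fix d assume "d \<in> {CARD('n) - 1}"
  then have "Suc d = CARD('n)" using zero_less_card_finite by (simp add: Suc_pred)
  then show "d \<in> {d. \<exists>x. smooth_point (cone_over (conormal_space Z)) x (Suc d)}"
   using smooth_conormal_space[OF assms] by auto
 qed
 then show ?thesis by (simp add: dim_proj_cone_over)
qed

text \<open>Since \<open>d < CARD('n)\<close>, the tangent projection is not the identity and some
  \<open>b - b v* P\<close> is nonzero. Unit length keeps limits of such covectors away from
  0.\<close>

lemma ex_conormal:
 fixes Z :: "(complex^'n) set"
 assumes sm: "smooth_point Z z d" and d: "d < CARD('n)"
 shows "\<exists>a. norm a = 1 \<and> join z a \<in> conormal_cone Z"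
proof -
 obtain U \<sigma> where \<sigma>: "local_retraction Z z U \<sigma>" "trace (jac \<sigma> z) = of_nat d"
  using smooth_point_imp_retraction[OF sm] by blast
 define P where "P = jac \<sigma> z"
 have "\<exists>b. b - b v* P ~= 0"
 proof (rule ccontr)
  assume "\<not> ?thesis"
  then have "b v* P = b" for b by (metis eq_iff_diff_eq_0)
  then have "scalar_product b (P *v v) = scalar_product b v" for b v by (simp add: scalar_product_matrix_vector)
  from this[of "axis _ 1"] have "P *v v = v" for v by (simp add: vec_eq_iff)
  then have "P = mat 1" by (intro matrix_eqI) simp
  then have "(of_nat d :: complex) = of_nat CARD('n)" using \<sigma>(2) by (simp add: P_def[symmetric] trace_def mat_def)
  then show False using d by (simp only: of_nat_eq_iff)
 qed
 then obtain b where b: "b - b v* P ~= 0" ..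
 define u where "u = b - b v* P"
 define a where "a = (1 / of_real (norm u)) *s u"
 have "norm a = 1" using b by (simp add: a_def norm_vector_scale norm_divide u_def[symmetric])
 moreover have "a v* P = 0" unfolding a_def u_def vector_matrix_scale_left P_def
  by (simp add: vector_matrix_idempotent[OF local_retraction_idempotent[OF \<sigma>(1)]])
 then have "join z a \<in> conormal_cone Z" unfolding conormal_cone_retraction[OF \<sigma>(1)] P_def .
 ultimately show ?thesis by blast
qed

text \<open>The cone \<open>K(Z, z)\<close> of the overview. Like \<open>conormal_cone\<close> it
  admits the covector 0, which makes it stable under linear pullback.\<close>

definition conormal_limits :: "(complex^'n) set => complex^'n => (complex^'n) set" where
 "conormal_limits Z z = {a. join z a \<in> closure (conormal_cone Z)}"

lemma conormal_limits_scale: "a \<in> conormal_limits Z z ==> s *s a \<in> conormal_limits Z z"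
proof -
 assume a: "a \<in> conormal_limits Z z"
 define f where "f = (\<lambda>x :: complex^('a + 'a). join (jfst x) (s *s jsnd x))"
 have c: "continuous_on (closure (conormal_cone Z)) f" unfolding f_def continuous_on_def
  by (intro ballI tendsto_intros)
 have "f ` conormal_cone Z \<subseteq> closure (conormal_cone Z)"
 proof (rule order_trans[OF _ closure_subset], rule image_subsetI)
  fix x assume "x \<in> conormal_cone Z"
  then show "f x \<in> conormal_cone Z" by (auto simp: f_def conormal_cone_iff scalar_product_scale_left)
 qed
 from image_closure_subset[OF c closed_closure this]
 have "f (join z a) \<in> closure (conormal_cone Z)" using a by (auto simp: conormal_limits_def)
 then show "s *s a \<in> conormal_limits Z z" by (simp add: f_def conormal_limits_def)
qed

text \<open>The smooth point at hand may be the vertex, which has no image in projective space. A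
  small multiple of \<open>b\<close> is then a nonzero point in the neighbourhood where all points
  are smooth of the same dimension.\<close>

lemma conormal_limits_smooth_nonzero:
 assumes sm: "smooth_point (conormal_limits Z z) a m" and b: "b \<in> conormal_limits Z z" "b ~= 0"
 shows "\<exists>a. a ~= 0 \<and> smooth_point (conormal_limits Z z) a m"
proof (cases "a = 0")
 case True
 obtain U where U: "open U" "a \<in> U" "\<And>q. q \<in> conormal_limits Z z ==> q \<in> U ==> smooth_point (conormal_limits Z z) q m"
  using smooth_point_nearby[OF sm] by metis
 obtain e where e: "e > 0" "ball 0 e \<subseteq> U" using open_ball_mult_imp[OF U(1)] U(2) True by blast
 define s :: complex where "s = of_real (e / (2 * norm b))"
 have s: "s ~= 0" using e b by (simp add: s_def)
 have "norm (s *s b) = e / 2" using e b by (simp add: s_def norm_vector_scale norm_divide norm_mult)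
 then have "s *s b \<in> U" using e by auto
 moreover have "s *s b ~= 0" using s b by (simp add: vec_eq_iff)
 ultimately show ?thesis using U(3) conormal_limits_scale[OF b(1)] by blast
qed (use sm in blast)

lemma smooth_conormal_fibre:
 fixes Z :: "(complex^'n) set"
 assumes z: "z \<in> Z" and b: "b \<in> conormal_limits Z z" "b ~= 0"
 shows "(\<exists>x. smooth_point (cone_over (conormal_fibre Z z)) x m) \<longleftrightarrow> (\<exists>a. smooth_point (conormal_limits Z z) a m)"
proof
 assume "\<exists>x. smooth_point (cone_over (conormal_fibre Z z)) x m"
 then obtain x where sm: "smooth_point (cone_over (conormal_fibre Z z)) x m" ..
 have x: "jsnd x ~= 0" using smooth_point_in[OF sm] cone_over_conormal_fibre[OF z] by blast
 have o: "open (- {0 :: complex^'n})" by (simp add: open_Compl)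
 have "smooth_point (conormal_limits Z z) (jsnd x) m"
 proof (rule smooth_point_transfer[OF sm])
  show "holomorphic_map UNIV (jsnd :: complex^('n + 'n) => _)"
   using holomorphic_map_jsnd[OF holomorphic_map_id[OF open_UNIV]] .
  show "holomorphic_map (- {0}) (join z :: complex^'n => complex^('n + 'n))" by (intro hol_intros o)
  show "x \<in> UNIV" "jsnd x \<in> - {0}" using x by simp_all
  show "jsnd y \<in> conormal_limits Z z" if "y \<in> cone_over (conormal_fibre Z z)" for y
  proof -
   have y: "y \<in> closure (conormal_cone Z)" "jfst y = z" using that cone_over_conormal_fibre[OF z] by blast+
   have "join (jfst y) (jsnd y) \<in> closure (conormal_cone Z)" using y(1) by simp
   then show ?thesis unfolding conormal_limits_def y(2) by simp
  qed
  show "join z a \<in> cone_over (conormal_fibre Z z)" if "a \<in> conormal_limits Z z" "a \<in> - {0}" for a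
   by (rule cone_over_conormal_fibre[OF z, THEN iffD2]) (use that in \<open>simp add: conormal_limits_def\<close>)
  show "join z (jsnd y) = y" if "y \<in> cone_over (conormal_fibre Z z)" for y
  proof -
   have "jfst y = z" using that cone_over_conormal_fibre[OF z] by blast
   then show ?thesis using join_jfst_jsnd[of y] by simp
  qed
 qed simp
 then show "\<exists>a. smooth_point (conormal_limits Z z) a m" ..
next
 assume "\<exists>a. smooth_point (conormal_limits Z z) a m"
 then obtain a where a: "a ~= 0" "smooth_point (conormal_limits Z z) a m"
  using conormal_limits_smooth_nonzero[OF _ b] by blast
 have o: "open (- {0 :: complex^'n})" by (simp add: open_Compl)
 have "smooth_point (cone_over (conormal_fibre Z z)) (join z a) m"
 proof (rule smooth_point_transfer[OF a(2)])
  show "holomorphic_map UNIV (jsnd :: complex^('n + 'n) => _)"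
   using holomorphic_map_jsnd[OF holomorphic_map_id[OF open_UNIV]] .
  show "holomorphic_map (- {0}) (join z :: complex^'n => complex^('n + 'n))" by (intro hol_intros o)
  show "a \<in> - {0}" "join z a \<in> UNIV" using a by simp_all
  show "jsnd y \<in> conormal_limits Z z" if "y \<in> cone_over (conormal_fibre Z z)" for y
  proof -
   have y: "y \<in> closure (conormal_cone Z)" "jfst y = z" using that cone_over_conormal_fibre[OF z] by blast+
   have "join (jfst y) (jsnd y) \<in> closure (conormal_cone Z)" using y(1) by simp
   then show ?thesis unfolding conormal_limits_def y(2) by simp
  qed
  show "join z a \<in> cone_over (conormal_fibre Z z)" if "a \<in> conormal_limits Z z" "a \<in> - {0}" for a
   by (rule cone_over_conormal_fibre[OF z, THEN iffD2]) (use that in \<open>simp add: conormal_limits_def\<close>)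
  show "join z (jsnd y) = y" if "y \<in> cone_over (conormal_fibre Z z)" for y
  proof -
   have "jfst y = z" using that cone_over_conormal_fibre[OF z] by blast
   then show ?thesis using join_jfst_jsnd[of y] by simp
  qed
 qed simp
 then show "\<exists>x. smooth_point (cone_over (conormal_fibre Z z)) x m" ..
qed

text \<open>From the cone of limits to the projective fibre the dimension drops by one; the second
  claim ensures that this drop never starts from 0.\<close>

lemma dim_conormal_fibre:
 assumes z: "z \<in> Z" and b: "b \<in> conormal_limits Z z" "b ~= 0"
 shows "dim_proj (conormal_fibre Z z) = Sup {d. \<exists>a. smooth_point (conormal_limits Z z) a (Suc d)}"
  "smooth_point (conormal_limits Z z) a m ==> \<exists>d. m = Suc d"
proof -
 show "dim_proj (conormal_fibre Z z) = Sup {d. \<exists>a. smooth_point (conormal_limits Z z) a (Suc d)}"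
  unfolding dim_proj_cone_over smooth_conormal_fibre[OF assms] ..
 show "\<exists>d. m = Suc d" if "smooth_point (conormal_limits Z z) a m"
  using that smooth_conormal_fibre[OF assms, of m] smooth_cone_over_slice by blast
qed

section \<open>Smooth points of analytic varieties and existence of conormal limits\<close>

lemma analytic_varietyD:
 assumes "analytic_variety Z" "z \<in> Z"
 shows "\<exists>U F. open U \<and> z \<in> U \<and> finite F \<and>
   (\<forall>f\<in>F. holomorphic_fun U f) \<and> Z \<inter> U = {x\<in>U. \<forall>f\<in>F. f x = 0}"
 using assms(1)[unfolded analytic_variety_def, rule_format, OF assms(2)] .

lemma analytic_variety_smooth_dense:
 assumes Z: "analytic_variety Z" and z: "z \<in> Z" and W: "open W" "z \<in> W"
 shows "\<exists>p\<in>W. \<exists>m. smooth_point Z p m"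
proof -
 obtain U F where UF0: "open U \<and> z \<in> U \<and> finite F \<and>
   (\<forall>f\<in>F. holomorphic_fun U f) \<and> Z \<inter> U = {x\<in>U. \<forall>f\<in>F. f x = 0}"
  using analytic_varietyD[OF Z z] by (elim exE)
 note UF = UF0[THEN conjunct1] UF0[THEN conjunct2, THEN conjunct1]
  UF0[THEN conjunct2, THEN conjunct2, THEN conjunct2, THEN conjunct1]
  UF0[THEN conjunct2, THEN conjunct2, THEN conjunct2, THEN conjunct2]
 have o: "open (U \<inter> W)" using UF W by blast
 have A: "Z \<inter> (U \<inter> W) = {x\<in>U \<inter> W. \<forall>f\<in>F. f x = 0}" using UF(4) by blast
 have hf: "holomorphic_fun (U \<inter> W) f" if "f \<in> F" for f
  by (rule holomorphic_fun_subset[OF UF(3)[rule_format, OF that] o]) simp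
 have "Z \<inter> (U \<inter> W) ~= {}" using z UF W by blast
 from analytic_set_has_smooth_point[OF o hf A this]
 obtain p m where p: "smooth_point (Z \<inter> (U \<inter> W)) p m" by blast
 then have pin: "p \<in> U \<inter> W" using smooth_point_in by blast
 have "smooth_point Z p m" by (rule smooth_point_local[OF p o pin]) auto
 then show ?thesis using pin by blast
qed

text \<open>All points of \<open>Z\<close> near a smooth point are smooth of the same dimension, so
  the set defining \<open>local_dim\<close> is a singleton there.\<close>

lemma equidimensional_smooth:
 assumes eq: "equidimensional Z d" and sm: "smooth_point Z p m"
 shows "m = d"
proof -
 have "{d. \<forall>U. open U \<and> p \<in> U --> (\<exists>q\<in>U. smooth_point Z q d)} = {m}"
 proof (intro equalityI subsetI)
  fix k assume k: "k \<in> {d. \<forall>U. open U \<and> p \<in> U --> (\<exists>q\<in>U. smooth_point Z q d)}"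
  obtain U where U: "open U" "p \<in> U" "\<And>q. q \<in> Z ==> q \<in> U ==> smooth_point Z q m"
   using smooth_point_nearby[OF sm] by metis
  obtain q where q: "q \<in> U" "smooth_point Z q k" using k U by blast
  then show "k \<in> {m}" using smooth_point_unique[OF q(2) U(3)[OF smooth_point_in[OF q(2)] q(1)]] by simp
 qed (use sm in auto)
 then have "local_dim Z p = m" by (simp add: local_dim_def)
 then show ?thesis using eq smooth_point_in[OF sm] unfolding equidimensional_def by simp
qed

lemma equidimensional_pure_dim:
 assumes Z: "analytic_variety Z" and eq: "equidimensional Z d" and W: "open W"
 shows "pure_dim (Z \<inter> W) d"
 unfolding pure_dim_def
proof (intro ballI allI impI)
 fix x and e :: real assume x: "x \<in> Z \<inter> W" and e: "e > 0"
 have "open (W \<inter> ball x e)" "x \<in> W \<inter> ball x e" using W x e by auto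
 then obtain p m where p: "p \<in> W \<inter> ball x e" "smooth_point Z p m"
  using analytic_variety_smooth_dense[OF Z] x by blast
 have "smooth_point Z p d" using p equidimensional_smooth[OF eq] by blast
 then have "smooth_point (Z \<inter> W) p d" by (rule smooth_point_local[OF _ W]) (use p in auto)
 then show "\<exists>y\<in>Z \<inter> W. dist y x < e \<and> smooth_point (Z \<inter> W) y d"
  using p smooth_point_in by (intro bexI[of _ p]) (auto simp: dist_commute)
qed

text \<open>Unit conormal covectors at smooth points tending to \<open>z\<close> have a convergent
  subsequence, whose limit again has norm 1.\<close>

lemma conormal_limits_ex_nonzero:
 fixes Z :: "(complex^'n) set"
 assumes Z: "analytic_variety Z" and eq: "equidimensional Z d" and d: "d < CARD('n)" and z: "z \<in> Z"
 shows "\<exists>a. a ~= 0 \<and> a \<in> conormal_limits Z z"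
proof -
 have "\<exists>x. jfst x \<in> ball z (inverse (real (Suc k))) \<and> norm (jsnd x) = 1 \<and> x \<in> conormal_cone Z" for k
 proof -
  obtain p m where p: "p \<in> ball z (inverse (real (Suc k)))" "smooth_point Z p m"
   using analytic_variety_smooth_dense[OF Z z open_ball] by (metis centre_in_ball inverse_positive_iff_positive of_nat_0_less_iff zero_less_Suc)
  have "m < CARD('n)" using equidimensional_smooth[OF eq p(2)] d by simp
  then obtain a where "norm a = 1" "join p a \<in> conormal_cone Z" using ex_conormal[OF p(2)] by blast
  then show ?thesis using p by (intro exI[of _ "join p a"]) simp
 qed
 then obtain x where x: "\<And>k. jfst (x k) \<in> ball z (inverse (real (Suc k)))" "\<And>k. norm (jsnd (x k)) = 1" "\<And>k. x k \<in> conormal_cone Z"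
  by metis
 have lim: "(\<lambda>k. jfst (x k)) \<longlonglongrightarrow> z"
  unfolding tendsto_dist_iff[of _ z]
  by (rule tendsto_sandwich[OF _ _ tendsto_const LIMSEQ_inverse_real_of_nat])
    (use x(1) in \<open>auto intro!: always_eventually less_imp_le simp: dist_commute\<close>)
 have "bounded (range (\<lambda>k. jsnd (x k)))" using x(2) by (intro boundedI[of _ 1]) auto
 then obtain a \<nu> where \<nu>: "strict_mono \<nu>" "((\<lambda>k. jsnd (x k)) \<circ> \<nu>) \<longlonglongrightarrow> a"
  using bounded_imp_convergent_subsequence by blast
 have l2: "(\<lambda>k. jsnd (x (\<nu> k))) \<longlonglongrightarrow> a" using \<nu>(2) by (simp add: o_def)
 have l1: "(\<lambda>k. jfst (x (\<nu> k))) \<longlonglongrightarrow> z" using LIMSEQ_subseq_LIMSEQ[OF lim \<nu>(1)] by (simp add: o_def)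
 have "(\<lambda>k. x (\<nu> k)) \<longlonglongrightarrow> join z a" using tendsto_join[OF l1 l2] by simp
 then have "join z a \<in> closure (conormal_cone Z)"
  unfolding closure_sequential using x(3) by (intro exI[of _ "\<lambda>k. x (\<nu> k)"]) simp
 moreover have "norm a = 1"
 proof -
  have "(\<lambda>k. norm (jsnd (x (\<nu> k)))) \<longlonglongrightarrow> norm a" by (intro tendsto_intros l2)
  then have "(\<lambda>k. 1 :: real) \<longlonglongrightarrow> norm a" by (simp add: x(2))
  then show ?thesis using LIMSEQ_unique[OF _ tendsto_const] by blast
 qed
 then have "a ~= 0" by auto
 ultimately show ?thesis by (auto simp: conormal_limits_def)
qed

text \<open>Near a nonzero limit \<open>a0\<close> the closed cone is analytic; fixing the point
  \<open>z\<close> in its equations leaves equations for the limits over \<open>z\<close>.\<close>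

theorem conormal_limits_ex_smooth:
 fixes Z :: "(complex^'n) set"
 assumes Z: "analytic_variety Z" and eq: "equidimensional Z d" and d: "d < CARD('n)" and z: "z \<in> Z"
 shows "\<exists>a m. smooth_point (conormal_limits Z z) a m"
proof -
 obtain a0 where a0: "a0 ~= 0" "a0 \<in> conormal_limits Z z" using conormal_limits_ex_nonzero[OF assms] by blast
 obtain U F where UF0: "open U \<and> z \<in> U \<and> finite F \<and>
   (\<forall>f\<in>F. holomorphic_fun U f) \<and> Z \<inter> U = {x\<in>U. \<forall>f\<in>F. f x = 0}"
  using analytic_varietyD[OF Z z] by (elim exE)
 note UF = UF0[THEN conjunct1] UF0[THEN conjunct2, THEN conjunct1]
  UF0[THEN conjunct2, THEN conjunct2, THEN conjunct2, THEN conjunct1]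
  UF0[THEN conjunct2, THEN conjunct2, THEN conjunct2, THEN conjunct2]
 have hF: "holomorphic_fun U f" if "f \<in> F" for f using UF(3) that by blast
 have oU: "open {x :: complex^('n + 'n). jfst x \<in> U}" by (rule open_jfst_vimage[OF UF(1)])
 have loc: "x \<in> closure (conormal_cone (Z \<inter> U)) \<longleftrightarrow> x \<in> closure (conormal_cone Z)" if "jfst x \<in> U" for x
 proof
  assume "x \<in> closure (conormal_cone (Z \<inter> U))"
  moreover have "closure (conormal_cone (Z \<inter> U)) \<subseteq> closure (conormal_cone Z)"
   unfolding conormal_cone_local[OF UF(1)] by (rule closure_mono) blast
  ultimately show "x \<in> closure (conormal_cone Z)" by blast
 next
  assume "x \<in> closure (conormal_cone Z)"
  then have "x \<in> {x. jfst x \<in> U} \<inter> closure (conormal_cone Z)" using that by simp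
  then have "x \<in> closure ({x. jfst x \<in> U} \<inter> conormal_cone Z)" using open_Int_closure_subset[OF oU] by (rule subsetD[rotated])
  then show "x \<in> closure (conormal_cone (Z \<inter> U))" unfolding conormal_cone_local[OF UF(1)] by (simp add: Int_commute)
 qed
 have zU: "z \<in> Z \<inter> U" using z UF by blast
 have j0: "join z a0 \<in> closure (conormal_cone (Z \<inter> U))" using a0 loc UF(2) by (simp add: conormal_limits_def)
 have "\<exists>Y \<G>. open Y \<and> join z a0 \<in> Y \<and> (\<forall>g\<in>\<G>. holomorphic_fun Y g) \<and>
  (\<forall>x\<in>Y. x \<in> closure (conormal_cone (Z \<inter> U)) \<longleftrightarrow> (\<forall>g\<in>\<G>. g x = 0))"
  by (rule conormal_closure_analytic[OF UF(1,4) _ equidimensional_pure_dim[OF Z eq UF(1)] zU j0]) (rule hF)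
 then obtain Y \<G> where Y: "open Y \<and> join z a0 \<in> Y \<and> (\<forall>g\<in>\<G>. holomorphic_fun Y g) \<and>
  (\<forall>x\<in>Y. x \<in> closure (conormal_cone (Z \<inter> U)) \<longleftrightarrow> (\<forall>g\<in>\<G>. g x = 0))"
  by (elim exE)
 define \<Omega> where "\<Omega> = {a. join z a \<in> Y}"
 have hj: "holomorphic_map UNIV (join z :: complex^'n => _)" by (intro hol_intros open_UNIV)
 have \<Omega>: "open \<Omega>" using holomorphic_map_vimage_open[OF hj, of Y] Y by (simp add: \<Omega>_def)
 have A: "conormal_limits Z z \<inter> \<Omega> = {a\<in>\<Omega>. \<forall>g\<in>(\<lambda>g a. g (join z a)) ` \<G>. g a = 0}"
  using Y loc UF(2) by (auto simp: conormal_limits_def \<Omega>_def)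
 have hg: "holomorphic_fun \<Omega> g" if g: "g \<in> (\<lambda>g a. g (join z a)) ` \<G>" for g
 proof -
  obtain g' where g': "g = (\<lambda>a. g' (join z a))" "g' \<in> \<G>" using g by blast
  have hY: "holomorphic_fun Y g'" using Y g'(2) by blast
  show ?thesis unfolding g'(1)
   by (rule holomorphic_fun_compose[OF holomorphic_map_subset[OF hj \<Omega> subset_UNIV] hY]) (simp add: \<Omega>_def)
 qed
 have ne: "conormal_limits Z z \<inter> \<Omega> ~= {}" using a0 Y by (auto simp: \<Omega>_def)
 from analytic_set_has_smooth_point[OF \<Omega> hg A ne]
 obtain a m where sm: "smooth_point (conormal_limits Z z \<inter> \<Omega>) a m" by blast
 have "a \<in> \<Omega>" using smooth_point_in[OF sm] by blast
 then have "smooth_point (conormal_limits Z z) a m" using smooth_point_local[OF sm \<Omega>] by blast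
 then show ?thesis by blast
qed

section \<open>Embeddings and germ isomorphisms\<close>

lemma closure_map_local:
 fixes G :: "'a::topological_space => 'b::metric_space"
 assumes x: "x \<in> closure A" and N: "open N" "x \<in> N" and G: "continuous_on N G"
  and B: "\<And>y. y \<in> A ==> y \<in> N ==> G y \<in> B"
 shows "G x \<in> closure B"
 unfolding closure_approachable
proof (intro allI impI)
 fix e :: real assume e: "e > 0"
 have o: "open (G -` ball (G x) e \<inter> N)" by (rule continuous_on_open_vimage[OF N(1), THEN iffD1, rule_format, OF G open_ball])
 have "x \<in> G -` ball (G x) e \<inter> N" using e N by simp
 then obtain y where "y \<in> G -` ball (G x) e" "y \<in> N" "y \<in> A"
  using x open_Int_closure_eq_empty[OF o, of A] by blast
 then have "G y \<in> B" "dist (G y) (G x) < e" using B by (simp_all add: dist_commute)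
 then show "\<exists>y\<in>B. dist y (G x) < e" by blast
qed

lemma vector_matrix_mul_assoc: "(c v* A) v* B = c v* (A ** B)"
 for A :: "complex^'m^'k" and B :: "complex^'n^'m"
 by (rule scalar_product_eqI) (simp only: scalar_product_matrix_vector[symmetric] matrix_vector_mul_assoc)

lemma vector_matrix_add_left: "(a + b) v* J = a v* J + b v* J" for J :: "complex^'n^'m"
 by (rule scalar_product_eqI) (simp only: scalar_product_matrix_vector[symmetric] scalar_product_add_left)

lemma vector_matrix_mat_1: "c v* mat 1 = c" for c :: "complex^'n"
 by (rule scalar_product_eqI) (simp add: scalar_product_matrix_vector[symmetric])

lemma vector_matrix_zero: "0 v* J = 0" for J :: "complex^'n^'m"
 by (rule scalar_product_eqI) (simp add: scalar_product_matrix_vector[symmetric])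

text \<open>\<open>E\<close> is compared with the image of \<open>Z\<close> only inside
  \<open>W\<close>, so one set can be the target of several embeddings. The linear left inverse
  \<open>S\<close> serves as a global substitute for the inverse of \<open>\<Phi>\<close>.\<close>

locale embedding =
 fixes Z :: "(complex^'n) set" and E :: "(complex^'k) set" and U W \<Phi> and S :: "complex^'k^'n"
 assumes U: "open U" and W: "open W" and hol: "holomorphic_map U \<Phi>" and left_inv: "\<And>x. x \<in> U ==> S *v \<Phi> x = x"
  and image: "\<And>x. x \<in> Z ==> x \<in> U ==> \<Phi> x \<in> E"
  and preimage: "\<And>y. y \<in> E ==> y \<in> W ==> S *v y \<in> Z \<and> S *v y \<in> U \<and> \<Phi> (S *v y) = y"
begin

definition U1 where "U1 = {x\<in>U. \<Phi> x \<in> W}"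

lemma open_U1: "open U1" unfolding U1_def by (rule holomorphic_map_vimage_open[OF hol W])

lemma U1D: "x \<in> U1 ==> x \<in> U" "x \<in> U1 ==> \<Phi> x \<in> W" by (auto simp: U1_def)

lemma jac_left_inverse: "x \<in> U ==> S ** jac \<Phi> x = mat 1"
proof -
 assume x: "x \<in> U"
 have "((*v) S has_derivative (*v) S) (at (\<Phi> x))"
  by (intro bounded_linear.has_derivative[OF bounded_linear_matrix_vector] has_derivative_ident)
 from has_derivative_compose_matrix[OF has_derivative_jac[OF hol x] this]
 have D: "((\<lambda>x. S *v \<Phi> x) has_derivative (*v) (S ** jac \<Phi> x)) (at x)" .
 have "((\<lambda>x. x) has_derivative (*v) (S ** jac \<Phi> x)) (at x)"
  by (rule has_derivative_near_matrix[OF D U x]) (rule left_inv)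
 moreover have "((\<lambda>x. x) has_derivative (*v) (mat 1)) (at x)"
  by (rule has_derivative_eq_rhs[OF has_derivative_ident]) auto
 ultimately show ?thesis using jac_eqI[of "\<lambda>x. x" "S ** jac \<Phi> x" x] jac_eqI[of "\<lambda>x. x" "mat 1" x] by simp
qed

lemma holomorphic_S: "open V ==> holomorphic_map V ((*v) S)"
 using holomorphic_map_matrix[OF holomorphic_map_id] .

text \<open>A retraction \<open>\<sigma>\<close> onto \<open>Z\<close> induces the retraction of
  \<open>E\<close> given by \<open>S\<close>, \<open>\<sigma>\<close> and \<open>\<Phi>\<close> in
  succession. By \<open>S ** jac \<Phi> x = mat 1\<close>, a covector kills the range of its
  derivative iff its pullback kills the range of the derivative of \<open>\<sigma>\<close>.\<close>

lemma conormal_cone_embedding: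
 assumes x: "x \<in> Z" "x \<in> U1"
 shows "join (\<Phi> x) c \<in> conormal_cone E \<longleftrightarrow> join x (c v* jac \<Phi> x) \<in> conormal_cone Z"
proof -
 have SP: "S *v \<Phi> x = x" by (rule left_inv[OF U1D(1)[OF x(2)]])
 have sm: "smooth_point Z x d" if "smooth_point E (\<Phi> x) d" for d
 proof -
  have "smooth_point Z (S *v \<Phi> x) d"
  proof (rule smooth_point_transfer[OF that holomorphic_S[OF W] U1D(2)[OF x(2)] holomorphic_map_subset[OF hol open_U1]])
   show "U1 \<subseteq> U" using U1D by blast
   show "S *v \<Phi> x \<in> U1" using x SP by simp
   show "S *v y \<in> Z" "\<Phi> (S *v y) = y" if "y \<in> E" "y \<in> W" for y using preimage[OF that] by auto
   show "\<Phi> y \<in> E" "S *v \<Phi> y = y" if "y \<in> Z" "y \<in> U1" for y using that image left_inv U1D(1) by blast+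
  qed
  then show ?thesis by (simp only: SP)
 qed
 have main: "join (\<Phi> x) c \<in> conormal_cone E \<longleftrightarrow> join x (c v* jac \<Phi> x) \<in> conormal_cone Z"
  if sm0: "smooth_point Z x d" for d
 proof -
  obtain V \<sigma> where \<sigma>: "local_retraction Z x V \<sigma>" using smooth_point_imp_retraction[OF sm0] by blast
  note \<sigma>D = local_retractionD[OF \<sigma>]
  define V1 where "V1 = {u\<in>V. \<sigma> u \<in> U1}"
  have V1: "open V1" unfolding V1_def by (rule holomorphic_map_vimage_open[OF \<sigma>D(1) open_U1])
  define V2 where "V2 = {y\<in>W. S *v y \<in> V1}"
  have V2: "open V2" unfolding V2_def by (rule holomorphic_map_vimage_open[OF holomorphic_S[OF W] V1])
  define \<rho> where "\<rho> = (\<lambda>y. \<Phi> (\<sigma> (S *v y)))"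
  have h1: "holomorphic_map V2 (\<lambda>y. \<sigma> (S *v y))"
   by (rule holomorphic_map_compose[OF holomorphic_S[OF V2] \<sigma>D(1)]) (simp add: V2_def V1_def)
  have h\<rho>: "holomorphic_map V2 \<rho>" unfolding \<rho>_def
   by (rule holomorphic_map_compose[OF h1 hol]) (simp add: V2_def V1_def U1_def)
  have r: "local_retraction E (\<Phi> x) V2 \<rho>"
   unfolding local_retraction_def
  proof (intro conjI ballI)
   show "\<Phi> x \<in> V2" using x U1D(2) \<sigma>D(3,7) by (simp add: V2_def V1_def SP)
   show "\<Phi> x \<in> E" using image x U1D(1) by blast
   show "\<rho> ` V2 \<subseteq> E"
   proof
    fix w assume "w \<in> \<rho> ` V2"
    then obtain y where y: "y \<in> V2" "w = \<rho> y" by blast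
    then have "\<sigma> (S *v y) \<in> Z" "\<sigma> (S *v y) \<in> U" using \<sigma>D(5) by (auto simp: V2_def V1_def U1_def)
    then show "w \<in> E" using image y(2) by (simp add: \<rho>_def)
   qed
   fix y assume y: "y \<in> E \<inter> V2"
   then have "y \<in> W" "S *v y \<in> V" by (auto simp: V2_def V1_def)
   then have "S *v y \<in> Z" "\<Phi> (S *v y) = y" using preimage y by blast+
   moreover have "\<sigma> (S *v y) = S *v y" using \<sigma>D(6) \<open>S *v y \<in> V\<close> calculation by blast
   ultimately show "\<rho> y = y" by (simp add: \<rho>_def)
  qed (rule h\<rho>)
  have "((*v) S has_derivative (*v) S) (at (\<Phi> x))"
   by (intro bounded_linear.has_derivative[OF bounded_linear_matrix_vector] has_derivative_ident)
  then have "((\<lambda>y. \<sigma> (S *v y)) has_derivative (*v) (jac \<sigma> x ** S)) (at (\<Phi> x))"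
   by (rule has_derivative_compose_matrix) (simp only: SP \<sigma>D(8))
  then have "(\<rho> has_derivative (*v) (jac \<Phi> x ** (jac \<sigma> x ** S))) (at (\<Phi> x))"
   unfolding \<rho>_def
   by (rule has_derivative_compose_matrix) (simp only: SP \<sigma>D(7) has_derivative_jac[OF hol U1D(1)[OF x(2)]])
  then have j: "jac \<rho> (\<Phi> x) = jac \<Phi> x ** (jac \<sigma> x ** S)" by (rule jac_eqI)
  have SJ: "S ** jac \<Phi> x = mat 1" by (rule jac_left_inverse[OF U1D(1)[OF x(2)]])
  have eq: "c v* (jac \<Phi> x ** (jac \<sigma> x ** S)) = ((c v* jac \<Phi> x) v* jac \<sigma> x) v* S"
   by (simp only: vector_matrix_mul_assoc matrix_mul_assoc)
  have pull: "(b v* S) v* jac \<Phi> x = b" for b by (simp only: vector_matrix_mul_assoc SJ vector_matrix_mat_1)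
  show ?thesis
   unfolding conormal_cone_retraction[OF r] conormal_cone_retraction[OF \<sigma>] j eq
   using pull vector_matrix_zero by metis
 qed
 show ?thesis
 proof
  assume L: "join (\<Phi> x) c \<in> conormal_cone E"
  then obtain d where "smooth_point E (\<Phi> x) d" unfolding join_conormal_cone by blast
  then show "join x (c v* jac \<Phi> x) \<in> conormal_cone Z" using main[OF sm] L by blast
 next
  assume L: "join x (c v* jac \<Phi> x) \<in> conormal_cone Z"
  then obtain d where "smooth_point Z x d" unfolding join_conormal_cone by blast
  then show "join (\<Phi> x) c \<in> conormal_cone E" using main L by blast
 qed
qed

text \<open>Limits are transported by continuous maps between the cones. Pulling back covectors is
  one direction; the other has to lift covectors in such a way that the prescribed \<open>c\<close>
  appears in the limit.\<close>

theorem conormal_limits_embedding: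
 assumes z: "z \<in> U1"
 shows "conormal_limits E (\<Phi> z) = {c. c v* jac \<Phi> z \<in> conormal_limits Z z}"
proof -
 have SP: "S *v \<Phi> z = z" by (rule left_inv[OF U1D(1)[OF z]])
 have jr: "holomorphic_map U1 (\<lambda>x. jac \<Phi> x $ i)" for i
  by (rule holomorphic_map_jac_row[OF holomorphic_map_subset[OF hol open_U1]]) (auto simp: U1_def)
 have "c \<in> conormal_limits E (\<Phi> z) \<longleftrightarrow> c v* jac \<Phi> z \<in> conormal_limits Z z" for c
 proof
  assume c: "c \<in> conormal_limits E (\<Phi> z)"
  define W1 where "W1 = {y\<in>W. S *v y \<in> U1}"
  have W1: "open W1" unfolding W1_def by (rule holomorphic_map_vimage_open[OF holomorphic_S[OF W] open_U1])
  define N where "N = {y :: complex^('k + 'k). jfst y \<in> W1}"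
  have N: "open N" unfolding N_def by (rule open_jfst_vimage[OF W1])
  define G where "G = (\<lambda>y :: complex^('k + 'k). join (S *v jfst y) (jsnd y v* jac \<Phi> (S *v jfst y)))"
  have hS: "holomorphic_map N (\<lambda>y. S *v jfst y)" by (intro hol_intros N)
  have "holomorphic_map N (\<lambda>y. jac \<Phi> (S *v jfst y) $ i)" for i
   by (rule holomorphic_map_compose[OF hS jr]) (simp add: N_def W1_def)
  then have "holomorphic_map N G" unfolding G_def by (intro hol_intros hS N)
  then have cG: "continuous_on N G" by (rule holomorphic_map_continuous_on)
  have "G (join (\<Phi> z) c) \<in> closure (conormal_cone Z)"
  proof (rule closure_map_local[OF _ N _ cG])
   show "join (\<Phi> z) c \<in> closure (conormal_cone E)" using c by (simp add: conormal_limits_def)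
   show "join (\<Phi> z) c \<in> N" using z U1D(2) SP by (simp add: N_def W1_def)
   fix y assume y: "y \<in> conormal_cone E" "y \<in> N"
   then have "jfst y \<in> E" "jfst y \<in> W" "S *v jfst y \<in> U1"
    using smooth_point_in by (auto simp: conormal_cone_iff N_def W1_def)
   then have p: "S *v jfst y \<in> Z" "S *v jfst y \<in> U1" "\<Phi> (S *v jfst y) = jfst y" using preimage by blast+
   have "join (\<Phi> (S *v jfst y)) (jsnd y) \<in> conormal_cone E" using y(1) by (simp only: p(3) join_jfst_jsnd)
   then show "G y \<in> conormal_cone Z" unfolding G_def conormal_cone_embedding[OF p(1,2)] .
  qed
  then show "c v* jac \<Phi> z \<in> conormal_limits Z z" by (simp add: G_def SP conormal_limits_def)
 next
  assume c: "c v* jac \<Phi> z \<in> conormal_limits Z z"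
  define N where "N = {y :: complex^('n + 'n). jfst y \<in> U1}"
  have N: "open N" unfolding N_def by (rule open_jfst_vimage[OF open_U1])
  \<comment> \<open>The prescribed \<open>c\<close>, corrected through \<open>S\<close> by the
    difference of the given covector and the pullback of \<open>c\<close>. Its pullback is exactly
    the given covector, and the correction vanishes at the limit point.\<close>
  define H where "H = (\<lambda>u :: complex^('n + 'n). join (\<Phi> (jfst u)) (c + (jsnd u - c v* jac \<Phi> (jfst u)) v* S))"
  have hj: "holomorphic_map N jfst" "holomorphic_map N jsnd"
   using holomorphic_map_jfst[OF holomorphic_map_id[OF N]] holomorphic_map_jsnd[OF holomorphic_map_id[OF N]] .
  have h1: "holomorphic_map N (\<lambda>u. jac \<Phi> (jfst u) $ i)" for i
   by (rule holomorphic_map_compose[OF hj(1) jr]) (simp add: N_def)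
  have h2: "holomorphic_map N (\<lambda>u. \<Phi> (jfst u))"
   by (rule holomorphic_map_compose[OF hj(1) hol]) (simp add: N_def U1_def)
  have "holomorphic_map N (\<lambda>u. jsnd u - c v* jac \<Phi> (jfst u))"
   by (intro holomorphic_map_diff hj holomorphic_map_vector_matrix h1 holomorphic_map_const N)
  then have "holomorphic_map N (\<lambda>u. (jsnd u - c v* jac \<Phi> (jfst u)) v* S)"
   by (rule holomorphic_map_vector_matrix[rotated]) (intro holomorphic_map_const N)+
  then have "holomorphic_map N H" unfolding H_def
   by (intro holomorphic_map_join holomorphic_map_add holomorphic_map_const N h2)
  then have cH: "continuous_on N H" by (rule holomorphic_map_continuous_on)
  have "H (join z (c v* jac \<Phi> z)) \<in> closure (conormal_cone E)"
  proof (rule closure_map_local[OF _ N _ cH])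
   show "join z (c v* jac \<Phi> z) \<in> closure (conormal_cone Z)" using c by (simp add: conormal_limits_def)
   show "join z (c v* jac \<Phi> z) \<in> N" using z by (simp add: N_def)
   fix u assume u: "u \<in> conormal_cone Z" "u \<in> N"
   then have p: "jfst u \<in> Z" "jfst u \<in> U1" using smooth_point_in by (auto simp: conormal_cone_iff N_def)
   have "(c + (jsnd u - c v* jac \<Phi> (jfst u)) v* S) v* jac \<Phi> (jfst u) = jsnd u"
    unfolding vector_matrix_add_left vector_matrix_mul_assoc[of _ S] jac_left_inverse[OF U1D(1)[OF p(2)]] vector_matrix_mat_1
    by simp
   then show "H u \<in> conormal_cone E" unfolding H_def conormal_cone_embedding[OF p] using u(1) by simp
  qed
  then show "c \<in> conormal_limits E (\<Phi> z)" by (simp add: H_def vector_matrix_zero conormal_limits_def)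
 qed
 then show ?thesis by blast
qed

text \<open>Pullback of covectors is multiplication by the transpose of \<open>jac \<Phi> z\<close>,
  which has the transpose of \<open>S\<close> as right inverse. The limits for \<open>E\<close> are
  thus a linear preimage of those for \<open>Z\<close>.\<close>

theorem smooth_conormal_limits_embedding:
 assumes z: "z \<in> U1"
 shows "smooth_point (conormal_limits Z z) a D ==>
   \<exists>c e. smooth_point (conormal_limits E (\<Phi> z)) c e \<and> e + CARD('n) = D + CARD('k)"
  "smooth_point (conormal_limits E (\<Phi> z)) c e ==>
   \<exists>a D. smooth_point (conormal_limits Z z) a D \<and> e + CARD('n) = D + CARD('k)"
proof -
 define J where "J = jac \<Phi> z"
 have SJ: "S ** J = mat 1" unfolding J_def by (rule jac_left_inverse[OF U1D(1)[OF z]])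
 have SR: "transpose J ** transpose S = mat 1" by (simp add: matrix_transpose_mul[symmetric] SJ)
 have K: "conormal_limits E (\<Phi> z) = {c. transpose J *v c \<in> conormal_limits Z z}"
  unfolding conormal_limits_embedding[OF z] J_def by simp
 show "\<exists>c e. smooth_point (conormal_limits E (\<Phi> z)) c e \<and> e + CARD('n) = D + CARD('k)"
  if "smooth_point (conormal_limits Z z) a D"
 proof -
  have "smooth_point (conormal_limits Z z) (transpose J *v (transpose S *v a)) D"
   using that by (simp only: matrix_vector_mul_assoc SR matrix_vector_mul_lid)
  from smooth_point_linear_preimage[OF SR this] show ?thesis unfolding K by metis
 qed
 show "\<exists>a D. smooth_point (conormal_limits Z z) a D \<and> e + CARD('n) = D + CARD('k)"
  if "smooth_point (conormal_limits E (\<Phi> z)) c e"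
  using smooth_point_linear_image[OF SR that[unfolded K]] by metis
qed

end

section \<open>Graphs of germ isomorphisms and comparison of dimensions\<close>

definition jfst_matrix :: "complex^('n::finite + 'm::finite)^'n" where
 "jfst_matrix = (\<chi> i l. case l of Inl i' => if i' = i then 1 else 0 | Inr _ => 0)"

definition jsnd_matrix :: "complex^('n::finite + 'm::finite)^'m" where
 "jsnd_matrix = (\<chi> j l. case l of Inl _ => 0 | Inr j' => if j' = j then 1 else 0)"

lemma jfst_matrix_mult: "jfst_matrix *v x = jfst x" and jsnd_matrix_mult: "jsnd_matrix *v x = jsnd x"
 by (simp_all add: vec_eq_iff jfst_matrix_def jsnd_matrix_def matrix_vector_mult_def sum_UNIV_sum
   if_distrib[of "\<lambda>c. c * _"] cong: if_cong)

text \<open>The graph \<open>E\<close> is formed with \<open>\<phi>\<close> on \<open>Z1\<close>,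
  but the two embeddings use local extensions \<open>F\<close> and \<open>G\<close>, which agree
  with \<open>\<phi>\<close> and \<open>g\<close> only on the varieties. Each embedding has a
  coordinate projection as linear left inverse, and the dimension of the product space cancels
  between them.\<close>

lemma germ_iso_smooth_conormal_limits:
 fixes Z1 :: "(complex^'n1) set" and Z2 :: "(complex^'n2) set"
 assumes iso: "analytic_germ_iso \<phi> Z1 z1 Z2 z2" and z1: "z1 \<in> Z1" and z2: "z2 \<in> Z2"
 shows "smooth_point (conormal_limits Z1 z1) a1 D1 ==>
   \<exists>a2 D2. smooth_point (conormal_limits Z2 z2) a2 D2 \<and> D1 + CARD('n2) = D2 + CARD('n1)"
  "smooth_point (conormal_limits Z2 z2) a2 D2 ==>
   \<exists>a1 D1. smooth_point (conormal_limits Z1 z1) a1 D1 \<and> D2 + CARD('n1) = D1 + CARD('n2)"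
proof -
 obtain U V g where UV: "\<phi> z1 = z2 \<and> open U \<and> z1 \<in> U \<and> open V \<and> z2 \<in> V \<and> bij_betw \<phi> (Z1 \<inter> U) (Z2 \<inter> V) \<and>
    holomorphic_map_on_set (Z1 \<inter> U) \<phi> \<and> holomorphic_map_on_set (Z2 \<inter> V) g \<and> (\<forall>x\<in>Z1 \<inter> U. g (\<phi> x) = x)"
  using iso unfolding analytic_germ_iso_def by (elim conjE exE) simp
 have bij: "bij_betw \<phi> (Z1 \<inter> U) (Z2 \<inter> V)" and o: "open U" "open V" and zz: "z1 \<in> U" "z2 \<in> V" "\<phi> z1 = z2"
  and g\<phi>: "\<And>x. x \<in> Z1 ==> x \<in> U ==> g (\<phi> x) = x" using UV by simp_all
 have "\<forall>x\<in>Z1 \<inter> U. \<exists>N F. x \<in> N \<and> holomorphic_map N F \<and> (\<forall>y\<in>Z1 \<inter> U \<inter> N. \<phi> y = F y)"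
  using UV unfolding holomorphic_map_on_set_def by simp
 from this[THEN bspec, OF IntI[OF z1 zz(1)]] obtain N1 F where F: "z1 \<in> N1 \<and> holomorphic_map N1 F \<and> (\<forall>y\<in>Z1 \<inter> U \<inter> N1. \<phi> y = F y)"
  by (elim exE)
 have "\<forall>x\<in>Z2 \<inter> V. \<exists>N F. x \<in> N \<and> holomorphic_map N F \<and> (\<forall>y\<in>Z2 \<inter> V \<inter> N. g y = F y)"
  using UV unfolding holomorphic_map_on_set_def by simp
 from this[THEN bspec, OF IntI[OF z2 zz(2)]] obtain N2 G where G: "z2 \<in> N2 \<and> holomorphic_map N2 G \<and> (\<forall>y\<in>Z2 \<inter> V \<inter> N2. g y = G y)"
  by (elim exE)
 have F\<phi>: "F y = \<phi> y" if "y \<in> Z1" "y \<in> U" "y \<in> N1" for y using F that by simp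
 have Gg: "G y = g y" if "y \<in> Z2" "y \<in> V" "y \<in> N2" for y using G that by simp
 have \<phi>V: "\<phi> x \<in> Z2" "\<phi> x \<in> V" if "x \<in> Z1" "x \<in> U" for x
  using bij_betw_apply[OF bij, of x] that by simp_all
 have ex: "\<exists>x. x \<in> Z1 \<and> x \<in> U \<and> \<phi> x = y" if "y \<in> Z2" "y \<in> V" for y
 proof -
  have "y \<in> \<phi> ` (Z1 \<inter> U)" using bij that by (simp add: bij_betw_def)
  then show ?thesis by blast
 qed
 define E where "E = {join x (\<phi> x) | x. x \<in> Z1 \<and> x \<in> U}"
 define V1 where "V1 = U \<inter> N1"
 define V2 where "V2 = V \<inter> N2"
 have V1: "open V1" "z1 \<in> V1" "V1 \<subseteq> N1" using o F holomorphic_map_open zz by (auto simp: V1_def)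
 have V2: "open V2" "z2 \<in> V2" "V2 \<subseteq> N2" using o G holomorphic_map_open zz by (auto simp: V2_def)
 have o1: "open {y :: complex^('n1 + 'n2). jfst y \<in> V1}" by (rule open_jfst_vimage[OF V1(1)])
 have o2: "open {y :: complex^('n1 + 'n2). jsnd y \<in> V2}"
  using open_vimage[OF V2(1) continuous_on_jsnd[OF continuous_on_id]] by (simp add: vimage_def)
 interpret e1: embedding Z1 E V1 "{y. jfst y \<in> V1}" "\<lambda>x. join x (F x)" jfst_matrix
 proof
  show "open V1" "open {y :: complex^('n1 + 'n2). jfst y \<in> V1}" by (rule V1(1), rule o1)
  show "holomorphic_map V1 (\<lambda>x. join x (F x))"
   by (intro holomorphic_map_join holomorphic_map_id V1(1) holomorphic_map_subset[OF _ V1(1,3)]) (use F in simp)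
  show "jfst_matrix *v join x (F x) = x" for x by (simp add: jfst_matrix_mult)
  show "join x (F x) \<in> E" if "x \<in> Z1" "x \<in> V1" for x
   using that F\<phi>[of x] by (auto simp: E_def V1_def)
  fix y assume y: "y \<in> E" "y \<in> {y. jfst y \<in> V1}"
  then obtain x where x: "y = join x (\<phi> x)" "x \<in> Z1" "x \<in> V1" by (auto simp: E_def)
  then have "F x = \<phi> x" using F\<phi> by (simp add: V1_def)
  then show "jfst_matrix *v y \<in> Z1 \<and> jfst_matrix *v y \<in> V1 \<and> join (jfst_matrix *v y) (F (jfst_matrix *v y)) = y"
   using x by (simp add: jfst_matrix_mult)
 qed
 interpret e2: embedding Z2 E V2 "{y. jsnd y \<in> V2}" "\<lambda>y. join (G y) y" jsnd_matrix
 proof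
  show "open V2" "open {y :: complex^('n1 + 'n2). jsnd y \<in> V2}" by (rule V2(1), rule o2)
  show "holomorphic_map V2 (\<lambda>y. join (G y) y)"
   by (intro holomorphic_map_join holomorphic_map_id V2(1) holomorphic_map_subset[OF _ V2(1,3)]) (use G in simp)
  show "jsnd_matrix *v join (G y) y = y" for y by (simp add: jsnd_matrix_mult)
  show "join (G y) y \<in> E" if y: "y \<in> Z2" "y \<in> V2" for y
  proof -
   obtain x where x: "x \<in> Z1" "x \<in> U" "\<phi> x = y" using ex[of y] y by (auto simp: V2_def)
   have "G y = x" using Gg[of y] y g\<phi>[OF x(1,2)] x(3) by (simp add: V2_def)
   then show ?thesis using x by (auto simp: E_def)
  qed
  fix y assume y: "y \<in> E" "y \<in> {y. jsnd y \<in> V2}"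
  then obtain x where x: "y = join x (\<phi> x)" "x \<in> Z1" "x \<in> U" "\<phi> x \<in> V2" by (auto simp: E_def)
  then have "G (\<phi> x) = x" using Gg[of "\<phi> x"] g\<phi>[of x] \<phi>V[of x] by (simp add: V2_def)
  then show "jsnd_matrix *v y \<in> Z2 \<and> jsnd_matrix *v y \<in> V2 \<and> join (G (jsnd_matrix *v y)) (jsnd_matrix *v y) = y"
   using x \<phi>V[of x] by (simp add: jsnd_matrix_mult)
 qed
 have u1: "z1 \<in> e1.U1" using V1(2) by (simp add: e1.U1_def)
 have u2: "z2 \<in> e2.U1" using V2(2) by (simp add: e2.U1_def)
 have Fz: "F z1 = z2" using F\<phi>[of z1] z1 zz V1(2) by (simp add: V1_def)
 have Gz: "G z2 = z1" using Gg[of z2] z2 zz V2(2) g\<phi>[of z1] z1 by (simp add: V2_def)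
 show "\<exists>a2 D2. smooth_point (conormal_limits Z2 z2) a2 D2 \<and> D1 + CARD('n2) = D2 + CARD('n1)"
  if sm: "smooth_point (conormal_limits Z1 z1) a1 D1"
 proof -
  obtain c e where e: "smooth_point (conormal_limits E (join z1 z2)) c e" "e + CARD('n1) = D1 + CARD('n1 + 'n2)"
   using e1.smooth_conormal_limits_embedding(1)[OF u1 sm] Fz by auto
  obtain a2 D2 where "smooth_point (conormal_limits Z2 z2) a2 D2" "e + CARD('n2) = D2 + CARD('n1 + 'n2)"
   using e2.smooth_conormal_limits_embedding(2)[OF u2, of c e] e(1) Gz by auto
  then show ?thesis using e(2) by (intro exI[of _ a2] exI[of _ D2]) simp
 qed
 show "\<exists>a1 D1. smooth_point (conormal_limits Z1 z1) a1 D1 \<and> D2 + CARD('n1) = D1 + CARD('n2)"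
  if sm: "smooth_point (conormal_limits Z2 z2) a2 D2"
 proof -
  obtain c e where e: "smooth_point (conormal_limits E (join z1 z2)) c e" "e + CARD('n2) = D2 + CARD('n1 + 'n2)"
   using e2.smooth_conormal_limits_embedding(1)[OF u2 sm] Gz by auto
  obtain a1 D1 where "smooth_point (conormal_limits Z1 z1) a1 D1" "e + CARD('n1) = D1 + CARD('n1 + 'n2)"
   using e1.smooth_conormal_limits_embedding(2)[OF u1, of c e] e(1) Fz by auto
  then show ?thesis using e(2) by (intro exI[of _ a1] exI[of _ D1]) simp
 qed
qed

text \<open>The suprema range over finite sets, so the first one is attained because its set is
  nonempty; shifting the point where it is attained gives the inequality.\<close>

lemma Sup_shift_le:
 fixes P P' :: "nat => bool"
 assumes b: "\<And>D. P D ==> D \<le> N1" "\<And>D. P' D ==> D \<le> N2"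
  and suc: "\<And>D. P D ==> \<exists>d. D = Suc d" "\<And>D. P' D ==> \<exists>d. D = Suc d"
  and ne: "\<exists>D. P D" and shift: "\<And>D1. P D1 ==> \<exists>D2. P' D2 \<and> D1 + n2 = D2 + n1"
 shows "Sup {d. P (Suc d)} + n2 \<le> Sup {d. P' (Suc d)} + (n1 :: nat)"
proof -
 have f1: "finite {d. P (Suc d)}" by (rule finite_subset[of _ "{..N1}"]) (use b(1) in force)+
 have f2: "finite {d. P' (Suc d)}" by (rule finite_subset[of _ "{..N2}"]) (use b(2) in force)+
 have ne': "{d. P (Suc d)} ~= {}" using ne suc(1) by blast
 have "Sup {d. P (Suc d)} \<in> {d. P (Suc d)}" unfolding cSup_eq_Max[OF f1 ne'] by (rule Max_in[OF f1 ne'])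
 then have "P (Suc (Sup {d. P (Suc d)}))" by simp
 from shift[OF this] obtain D2 where D2: "P' D2" "Suc (Sup {d. P (Suc d)}) + n2 = D2 + n1" by blast
 obtain d2 where d2: "D2 = Suc d2" using suc(2)[OF D2(1)] by blast
 have "d2 \<le> Sup {d. P' (Suc d)}" by (rule cSup_upper) (use D2 d2 f2 in auto)
 then show ?thesis using D2(2) d2 by simp
qed

lemma dim_fibre_le:
 fixes Z1 :: "(complex^'n1) set" and Z2 :: "(complex^'n2) set"
 assumes Z1: "analytic_variety Z1" "equidimensional Z1 d1" "d1 < CARD('n1)" "z1 \<in> Z1"
  and Z2: "analytic_variety Z2" "equidimensional Z2 d2" "d2 < CARD('n2)" "z2 \<in> Z2"
  and shift: "\<And>a1 D1. smooth_point (conormal_limits Z1 z1) a1 D1 ==>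
   \<exists>a2 D2. smooth_point (conormal_limits Z2 z2) a2 D2 \<and> D1 + CARD('n2) = D2 + CARD('n1)"
 shows "dim_proj (conormal_fibre Z1 z1) + CARD('n2) \<le> dim_proj (conormal_fibre Z2 z2) + CARD('n1)"
proof -
 obtain b1 where b1: "b1 \<in> conormal_limits Z1 z1" "b1 ~= 0" using conormal_limits_ex_nonzero[OF Z1] by blast
 obtain b2 where b2: "b2 \<in> conormal_limits Z2 z2" "b2 ~= 0" using conormal_limits_ex_nonzero[OF Z2] by blast
 have ne: "\<exists>D a. smooth_point (conormal_limits Z1 z1) a D" using conormal_limits_ex_smooth[OF Z1] by blast
 show ?thesis
  unfolding dim_conormal_fibre(1)[OF Z1(4) b1] dim_conormal_fibre(1)[OF Z2(4) b2]
 proof (rule Sup_shift_le[where P = "\<lambda>D. \<exists>a. smooth_point (conormal_limits Z1 z1) a D"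
    and P' = "\<lambda>D. \<exists>a. smooth_point (conormal_limits Z2 z2) a D"])
  show "D \<le> CARD('n1)" if "\<exists>a. smooth_point (conormal_limits Z1 z1) a D" for D
   using that smooth_point_bounded by blast
  show "D \<le> CARD('n2)" if "\<exists>a. smooth_point (conormal_limits Z2 z2) a D" for D
   using that smooth_point_bounded by blast
  show "\<exists>d. D = Suc d" if "\<exists>a. smooth_point (conormal_limits Z1 z1) a D" for D
   using that dim_conormal_fibre(2)[OF Z1(4) b1] by blast
  show "\<exists>d. D = Suc d" if "\<exists>a. smooth_point (conormal_limits Z2 z2) a D" for D
   using that dim_conormal_fibre(2)[OF Z2(4) b2] by blast
  show "\<exists>D2. (\<exists>a. smooth_point (conormal_limits Z2 z2) a D2) \<and> D1 + CARD('n2) = D2 + CARD('n1)"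
   if "\<exists>a. smooth_point (conormal_limits Z1 z1) a D1" for D1 using that shift by blast
 qed (rule ne)
qed

lemma dim_conormal_space_equidimensional:
 fixes Z :: "(complex^'n) set"
 assumes Z: "analytic_variety Z" "equidimensional Z d" "d < CARD('n)" "z \<in> Z"
 shows "dim_proj (conormal_space Z) = CARD('n) - 1"
proof -
 obtain p m where p: "smooth_point Z p m" using analytic_variety_smooth_dense[OF Z(1,4) open_UNIV] by auto
 have "m < CARD('n)" using equidimensional_smooth[OF Z(2) p] Z(3) by simp
 then obtain a where "norm a = 1" "join p a \<in> conormal_cone Z" using ex_conormal[OF p] by blast
 then show ?thesis by (intro dim_conormal_space[of "join p a"]) auto
qed

theorem proposition8p4:
  fixes Z1 :: "(complex^'n1) set" and Z2 :: "(complex^'n2) set"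
    and z1 :: "complex^'n1" and z2 :: "complex^'n2"
    and \<phi> :: "complex^'n1 \<Rightarrow> complex^'n2" and d1 d2 :: nat
  assumes "analytic_variety Z1" and "equidimensional Z1 d1" and "0 < d1" and "d1 < CARD('n1)"
    and "analytic_variety Z2" and "equidimensional Z2 d2" and "0 < d2" and "d2 < CARD('n2)"
    and "z1 \<in> Z1" and "z2 \<in> Z2"
    and "analytic_germ_iso \<phi> Z1 z1 Z2 z2"
  shows "(\<forall>l::nat. 0 < l \<longrightarrow>
            (codim_proj (conormal_fibre Z1 z1) (conormal_space Z1) = int l \<longleftrightarrow>
             codim_proj (conormal_fibre Z2 z2) (conormal_space Z2) = int l)) \<and>
         (deficient_conormal_at Z1 z1 \<longleftrightarrow> deficient_conormal_at Z2 z2)"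
proof -
  note Z1 = assms(1,2,4,9) and Z2 = assms(5,6,8,10)
  have "dim_proj (conormal_fibre Z1 z1) + CARD('n2) \<le> dim_proj (conormal_fibre Z2 z2) + CARD('n1)"
    by (rule dim_fibre_le[OF Z1 Z2 germ_iso_smooth_conormal_limits(1)[OF assms(11,9,10)]])
  moreover have "dim_proj (conormal_fibre Z2 z2) + CARD('n1) \<le> dim_proj (conormal_fibre Z1 z1) + CARD('n2)"
    by (rule dim_fibre_le[OF Z2 Z1 germ_iso_smooth_conormal_limits(2)[OF assms(11,9,10)]])
  \<comment> \<open>The conormal spaces have dimensions \<open>CARD('n1) - 1\<close> and
    \<open>CARD('n2) - 1\<close> as truncated differences; these bounds turn them into differences
    of integers.\<close>
  moreover have "CARD('n1) \<ge> 1" "CARD('n2) \<ge> 1" by (simp_all add: Suc_leI)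
  ultimately have "codim_proj (conormal_fibre Z1 z1) (conormal_space Z1) =
      codim_proj (conormal_fibre Z2 z2) (conormal_space Z2)"
    unfolding codim_proj_def dim_conormal_space_equidimensional[OF Z1] dim_conormal_space_equidimensional[OF Z2]
    by (simp add: of_nat_diff)
  then show ?thesis by (simp add: deficient_conormal_at_def)
qed

end
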